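(* Let $S$ be a smooth surface, let $C(k)$ be a regularizable focal curve germ located at $p_k\in S(k)$, $k\geq 0$, let $C(j)$, $j\ge k$, be its iterated lifts, located at $p_j\in S(j)$, and let $m_k,m_{k+1},m_{k+2},\dots$ be its multiplicity sequence. Then for each $i\ge k$ the multiplicity $m_i$ is given by $$m_i=\sum m_j,$$ summing over all $j$ for which $p_j$ is proximate to $p_i$.
   Context: **Monster tower.** If $D$ is a distribution (subbundle of $TM$) on a manifold $M$, its prolongation is the distribution $\widetilde D$ on $\widetilde M=\mathbf P D$ (with projection $\pi:\widetilde M\to M$) consisting of the tangent vectors at $\widetilde p$ which $d\pi$ maps into the line in $D(\pi(\widetilde p))$ represented by $\widetilde p$. Put $S(0)=S$, $\Delta(0)=TS$, $S(k)=\mathbf P\Delta(k-1)$, and let $\Delta(k)$ (the rank 2 focal bundle) be the prolongation of $\Delta(k-1)$. **Divisors at infinity.** Let $j\ge2$. On $N_0=S(j-1)$ let $E_0\subset\Delta(j-1)$ be the line bundle of vectors vertical over $S(j-2)$. Iterating the prolongation construction on $(N_0,E_0)$ ($N_{i+1}=\mathbf P E_i$, $E_{i+1}$ the prolongation of $E_i$) gives submanifolds $N_i\subset S(j-1+i)$. Put $I_j=I_j[0]=N_1\subset S(j)$ (divisor at infinity) and $I_j[\ell]=N_{\ell+1}\subset S(j+\ell)$ (its $\ell$th prolongation). **Focal curve germs.** A focal curve germ on $S(k)$ located at $p\in S(k)$ is a locally irreducible germ at $p$ of a curve with nonconstant smooth parameterization that is tangent to $\Delta(k)$ at each nonsingular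 point. Its lift to $S(k+1)=\mathbf P\Delta(k)$ is the closure of the curve of tangent directions at nonsingular points; it is again a focal curve germ. A germ is critical if it projects to a single point of $S$; a tangent direction to a critical germ is also called critical. A focal curve germ is regular if it is nonsingular and its tangent direction at its location is not critical. $C(k)$ is regularizable if some iterated lift $C(r)$, $r\ge k$, is regular. **Multiplicity sequence.** For $j\ge k$, $m_j$ denotes the multiplicity of $C(j)$ at its location $p_j$ on $S(j)$. **Proximity.** For $j>i\ge k$, $p_j$ is proximate to $p_i$ if either $j=i+1$, or $j\ge i+2$ and $p_j\in I_{i+2}[j-i-2]\subset S(j)$. *)

theory Defs
  imports "HOL-Analysis.Analysis"
begin

section \<open>Smooth manifolds, curves and tangent vectors\<close>

text \<open>
  Everything is over the reals and in the \<open>C\<^sup>\<infinity>\<close> category.  Coordinates in dimension \<open>n\<close> are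
  points of \<^const>\<open>Euclidean_space\<close> \<open>n\<close>, i.e. functions \<open>nat \<Rightarrow> real\<close> vanishing at all \<open>i \<ge> n\<close>, so that
  manifolds of arbitrary dimension live in one type.
  An atlas is indexed by a type of chart names; only names in \<open>charts\<close> matter.
\<close>

record ('p, 'c) manifold =
  mdim :: nat
  charts :: "'c set"
  cdom :: "'c \<Rightarrow> 'p set"
  coord :: "'c \<Rightarrow> 'p \<Rightarrow> nat \<Rightarrow> real"

type_synonym 'c tvec = "'c \<Rightarrow> nat \<Rightarrow> real"

definition points :: "('p, 'c) manifold \<Rightarrow> 'p set" where
  "points M = (\<Union>c\<in>charts M. cdom M c)"

definition mtopology :: "('p, 'c) manifold \<Rightarrow> 'p topology" where
  "mtopology M = topology (\<lambda>U. U \<subseteq> points M \<and>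
     (\<forall>c\<in>charts M. openin (Euclidean_space (mdim M)) (coord M c ` (U \<inter> cdom M c))))"

definition partial_deriv :: "nat \<Rightarrow> ((nat \<Rightarrow> real) \<Rightarrow> real) \<Rightarrow> (nat \<Rightarrow> real) \<Rightarrow> real" where
  "partial_deriv i f x = deriv (\<lambda>s. f (x(i := s))) (x i)"

primrec Ck :: "nat \<Rightarrow> nat \<Rightarrow> (nat \<Rightarrow> real) set \<Rightarrow> ((nat \<Rightarrow> real) \<Rightarrow> real) \<Rightarrow> bool" where
  "Ck 0 n V f \<longleftrightarrow> continuous_on V f"
| "Ck (Suc k) n V f \<longleftrightarrow> continuous_on V f \<and>
     (\<forall>i<n. (\<forall>x\<in>V. (\<lambda>s. f (x(i := s))) differentiable (at (x i))) \<and> Ck k n V (partial_deriv i f))"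

definition smooth_manifold :: "('p, 'c) manifold \<Rightarrow> bool" where
  "smooth_manifold M \<longleftrightarrow>
     (\<forall>c\<in>charts M. inj_on (coord M c) (cdom M c) \<and>
        openin (Euclidean_space (mdim M)) (coord M c ` cdom M c)) \<and>
     (\<forall>c\<in>charts M. \<forall>c'\<in>charts M.
        openin (Euclidean_space (mdim M)) (coord M c ` (cdom M c \<inter> cdom M c')) \<and>
        (\<forall>i<mdim M. \<forall>k. Ck k (mdim M) (coord M c ` (cdom M c \<inter> cdom M c'))
           (\<lambda>x. coord M c' (the_inv_into (cdom M c) (coord M c) x) i))) \<and>
     Hausdorff_space (mtopology M) \<and> second_countable (mtopology M)"

definition smooth_surface :: "('p, 'c) manifold \<Rightarrow> bool" where
  "smooth_surface S \<longleftrightarrow> smooth_manifold S \<and> mdim S = 2"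

definition smooth_real_on :: "real set \<Rightarrow> (real \<Rightarrow> real) \<Rightarrow> bool" where
  "smooth_real_on T f \<longleftrightarrow> (\<forall>n. \<forall>t\<in>T. ((deriv ^^ n) f) differentiable (at t))"

text \<open>Smoothness in a neighbourhood of every parameter value in \<open>T\<close> (\<open>T\<close> need not be open).\<close>

definition smooth_curve :: "('p, 'c) manifold \<Rightarrow> real set \<Rightarrow> (real \<Rightarrow> 'p) \<Rightarrow> bool" where
  "smooth_curve M T \<gamma> \<longleftrightarrow> (\<forall>t\<in>T. \<exists>c\<in>charts M. \<exists>\<epsilon>>0.
     \<gamma> ` ball t \<epsilon> \<subseteq> cdom M c \<and> (\<forall>i<mdim M. smooth_real_on (ball t \<epsilon>) (\<lambda>s. coord M c (\<gamma> s) i)))"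

text \<open>
  A tangent vector at \<open>q\<close> is the velocity of a smooth curve through \<open>q\<close>, recorded by its components
  in all charts around \<open>q\<close> (and \<open>0\<close> for the other chart names and for indices beyond the dimension).
  \<open>tangents M N q\<close> is the tangent space at \<open>q\<close> of a submanifold \<open>N\<close> of \<open>M\<close>.
\<close>

definition velocity :: "('p, 'c) manifold \<Rightarrow> (real \<Rightarrow> 'p) \<Rightarrow> real \<Rightarrow> 'c tvec" where
  "velocity M \<gamma> t = (\<lambda>c i. if c \<in> charts M \<and> \<gamma> t \<in> cdom M c \<and> i < mdim M
     then deriv (\<lambda>s. coord M c (\<gamma> s) i) t else 0)"

definition tangents :: "('p, 'c) manifold \<Rightarrow> 'p set \<Rightarrow> 'p \<Rightarrow> 'c tvec set" where
  "tangents M N q = {velocity M \<gamma> 0 | \<gamma>. \<gamma> 0 = q \<and>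
     (\<exists>\<epsilon>>0. smooth_curve M {-\<epsilon><..<\<epsilon>} \<gamma> \<and> \<gamma> ` {-\<epsilon><..<\<epsilon>} \<subseteq> N)}"

definition differential ::
  "('p, 'c) manifold \<Rightarrow> ('q, 'd) manifold \<Rightarrow> ('p \<Rightarrow> 'q) \<Rightarrow> 'p \<Rightarrow> 'c tvec \<Rightarrow> 'd tvec" where
  "differential M M' h q v = (THE w. \<exists>\<gamma>. \<gamma> 0 = q \<and> (\<exists>\<epsilon>>0. smooth_curve M {-\<epsilon><..<\<epsilon>} \<gamma>) \<and>
     velocity M \<gamma> 0 = v \<and> velocity M' (h \<circ> \<gamma>) 0 = w)"

definition line_of :: "'c tvec \<Rightarrow> 'c tvec set" where
  "line_of v = {(\<lambda>c i. r * v c i) | r. True}"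

definition lines :: "'c tvec set \<Rightarrow> 'c tvec set set" where
  "lines V = {line_of v | v. v \<in> V \<and> v \<noteq> (\<lambda>_ _. 0)}"


section \<open>Projectivized tangent bundles and prolongation\<close>

text \<open>
  To iterate projectivization without changing types, all points of the tower live in one datatype:
  \<open>Pt x\<close> is a point of \<open>S\<close>, and \<open>Line q l\<close> is the point of a projectivized bundle given by the line
  \<open>l\<close> of tangent vectors at \<open>q\<close>.  If \<open>c\<close> is a chart of \<open>M\<close>, then \<open>Aff c i\<close> is the chart of \<open>P(TM)\<close>
  on the set of lines with nonvanishing \<open>i\<close>-th component in \<open>c\<close>; its coordinates are those of \<open>c\<close>
  followed by the ratios of the other components to the \<open>i\<close>-th one.
\<close>

datatype 'c tchart = Base 'c | Aff "'c tchart" nat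

datatype ('a, 'c) pt =
    Pt 'a
  | Line (foot: "('a, 'c) pt") (dir: "('c tchart \<Rightarrow> nat \<Rightarrow> real) set")

type_synonym ('a, 'c) tmanifold = "(('a, 'c) pt, 'c tchart) manifold"

primrec root :: "('a, 'c) pt \<Rightarrow> 'a" where
  "root (Pt x) = x"
| "root (Line q l) = root q"

definition base :: "('a, 'c) manifold \<Rightarrow> ('a, 'c) tmanifold" where
  "base S = \<lparr>mdim = mdim S,
     charts = Base ` charts S,
     cdom = (\<lambda>c. case c of Base b \<Rightarrow> Pt ` cdom S b | Aff _ _ \<Rightarrow> {}),
     coord = (\<lambda>c q. case c of Base b \<Rightarrow> coord S b (root q) | Aff _ _ \<Rightarrow> (\<lambda>_. 0))\<rparr>"

definition proj_dom :: "('a, 'c) tmanifold \<Rightarrow> 'c tchart \<Rightarrow> nat \<Rightarrow> ('a, 'c) pt set" where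
  "proj_dom M c i = {Line q l | q l. q \<in> cdom M c \<and> l \<in> lines (tangents M (points M) q) \<and>
     (\<exists>v\<in>l. v c i \<noteq> 0)}"

definition proj_coord ::
  "('a, 'c) tmanifold \<Rightarrow> 'c tchart \<Rightarrow> nat \<Rightarrow> ('a, 'c) pt \<Rightarrow> nat \<Rightarrow> real" where
  "proj_coord M c i p = (\<lambda>j.
     if j < mdim M then coord M c (foot p) j
     else if j < 2 * mdim M - 1 then
       (let v = (SOME v. v \<in> dir p \<and> v c i \<noteq> 0); m = j - mdim M
        in v c (if m < i then m else Suc m) / v c i)
     else 0)"

definition PT :: "('a, 'c) tmanifold \<Rightarrow> ('a, 'c) tmanifold" where
  "PT M = \<lparr>mdim = 2 * mdim M - 1,
     charts = {Aff c i | c i. c \<in> charts M \<and> i < mdim M},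
     cdom = (\<lambda>a. case a of Base _ \<Rightarrow> {} | Aff c i \<Rightarrow> proj_dom M c i),
     coord = (\<lambda>a. case a of Base _ \<Rightarrow> (\<lambda>_ _. 0) | Aff c i \<Rightarrow> proj_coord M c i)\<rparr>"

text \<open>
  A pair \<open>(N, D)\<close> consists of a submanifold \<open>N\<close> of an ambient manifold \<open>M\<close> and a distribution \<open>D\<close> on
  \<open>N\<close> (the fibre at \<open>q\<close> being \<open>D q\<close>).  Its prolongation is the submanifold \<open>P(D)\<close> of \<open>P(TM)\<close>,
  with the distribution of those vectors tangent to \<open>P(D)\<close> which the differential of the
  projection \<open>foot\<close> maps into the line represented by the point.
\<close>

type_synonym ('a, 'c) dist = "('a, 'c) pt set \<times> (('a, 'c) pt \<Rightarrow> 'c tchart tvec set)"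

definition proj_dist :: "('a, 'c) dist \<Rightarrow> ('a, 'c) pt set" where
  "proj_dist ND = {Line q l | q l. q \<in> fst ND \<and> l \<in> lines (snd ND q)}"

definition prolong :: "('a, 'c) tmanifold \<Rightarrow> ('a, 'c) dist \<Rightarrow> ('a, 'c) dist" where
  "prolong M ND = (proj_dist ND,
     (\<lambda>p. {v \<in> tangents (PT M) (proj_dist ND) p. differential (PT M) M foot p v \<in> dir p}))"


section \<open>The monster tower and the divisors at infinity\<close>

text \<open>
  \<open>S(k)\<close> is realized as a submanifold of \<open>ambient S k\<close>, where \<open>ambient S (k+1)\<close> is \<open>PT (ambient S k)\<close>.
\<close>

primrec ambient :: "('a, 'c) manifold \<Rightarrow> nat \<Rightarrow> ('a, 'c) tmanifold" where
  "ambient S 0 = base S"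
| "ambient S (Suc k) = PT (ambient S k)"

primrec tower :: "('a, 'c) manifold \<Rightarrow> nat \<Rightarrow> ('a, 'c) dist" where
  "tower S 0 = (points (base S), tangents (base S) (points (base S)))"
| "tower S (Suc k) = prolong (ambient S k) (tower S k)"

definition monster :: "('a, 'c) manifold \<Rightarrow> nat \<Rightarrow> ('a, 'c) pt set" where
  "monster S k = fst (tower S k)"

definition focal_bundle :: "('a, 'c) manifold \<Rightarrow> nat \<Rightarrow> ('a, 'c) pt \<Rightarrow> 'c tchart tvec set" where
  "focal_bundle S k = snd (tower S k)"

text \<open>Only meaningful for \<open>j \<ge> 2\<close>; the \<open>i\<close>-th pair \<open>(N\<^sub>i, E\<^sub>i)\<close> lives in \<open>S(j - 1 + i)\<close>.\<close>

primrec vert_tower :: "('a, 'c) manifold \<Rightarrow> nat \<Rightarrow> nat \<Rightarrow> ('a, 'c) dist" where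
  "vert_tower S j 0 = (monster S (j - 1),
     (\<lambda>q. {v \<in> focal_bundle S (j - 1) q.
        differential (ambient S (j - 1)) (ambient S (j - 2)) foot q v = (\<lambda>_ _. 0)}))"
| "vert_tower S j (Suc i) = prolong (ambient S (j - 1 + i)) (vert_tower S j i)"

text \<open>\<open>div_inf S j l\<close> is \<open>I\<^sub>j[l]\<close>, a subset of \<open>S(j + l)\<close>.\<close>

definition div_inf :: "('a, 'c) manifold \<Rightarrow> nat \<Rightarrow> nat \<Rightarrow> ('a, 'c) pt set" where
  "div_inf S j l = fst (vert_tower S j (Suc l))"


section \<open>Curve germs\<close>

text \<open>
  A curve germ at \<open>p\<close> is given by a representative \<open>C\<close>, a set of points of which only the part near
  \<open>p\<close> matters.  It is locally irreducible with a nonconstant smooth parameterization if near \<open>p\<close>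
  it is the image of an injective smooth curve.  The compact parameter interval prevents the
  ends of the curve from accumulating at \<open>p\<close>, which would create further branches.
\<close>

definition parametrizes ::
  "('p, 'c) manifold \<Rightarrow> (real \<Rightarrow> 'p) \<Rightarrow> 'p set \<Rightarrow> 'p \<Rightarrow> bool" where
  "parametrizes M \<gamma> C p \<longleftrightarrow> \<gamma> 0 = p \<and>
     (\<exists>\<epsilon>>0. smooth_curve M {-\<epsilon>..\<epsilon>} \<gamma> \<and> inj_on \<gamma> {-\<epsilon>..\<epsilon>} \<and>
        (\<exists>U. openin (mtopology M) U \<and> p \<in> U \<and> C \<inter> U = \<gamma> ` {-\<epsilon>..\<epsilon>} \<inter> U))"

text \<open>\<open>C\<close> is nonsingular at \<open>q\<close>, with tangent line \<open>l\<close>.\<close>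

definition nonsingular_tangent ::
  "('p, 'c) manifold \<Rightarrow> 'p set \<Rightarrow> 'p \<Rightarrow> 'c tvec set \<Rightarrow> bool" where
  "nonsingular_tangent M C q l \<longleftrightarrow> (\<exists>\<gamma>. parametrizes M \<gamma> C q \<and>
     velocity M \<gamma> 0 \<noteq> (\<lambda>_ _. 0) \<and> l = line_of (velocity M \<gamma> 0))"

definition vanishing_order :: "('p, 'c) manifold \<Rightarrow> (real \<Rightarrow> 'p) \<Rightarrow> nat \<Rightarrow> bool" where
  "vanishing_order M \<gamma> n \<longleftrightarrow> 0 < n \<and>
     (\<exists>c\<in>charts M. \<gamma> 0 \<in> cdom M c \<and>
        (\<exists>i<mdim M. (deriv ^^ n) (\<lambda>t. coord M c (\<gamma> t) i) 0 \<noteq> 0) \<and>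
        (\<forall>m. 0 < m \<and> m < n \<longrightarrow> (\<forall>i<mdim M. (deriv ^^ m) (\<lambda>t. coord M c (\<gamma> t) i) 0 = 0)))"

text \<open>
  The multiplicity is the order of a primitive parameterization.  Since a non-primitive
  parameterization such as \<open>t \<mapsto> (t\<^sup>3, 0)\<close> has larger order, it is the least order that occurs.
\<close>

definition multiplicity_at :: "('p, 'c) manifold \<Rightarrow> 'p set \<Rightarrow> 'p \<Rightarrow> nat" where
  "multiplicity_at M C p = (LEAST n. \<exists>\<gamma>. parametrizes M \<gamma> C p \<and> vanishing_order M \<gamma> n)"

definition focal_curve_germ ::
  "('a, 'c) manifold \<Rightarrow> nat \<Rightarrow> ('a, 'c) pt set \<Rightarrow> ('a, 'c) pt \<Rightarrow> bool" where
  "focal_curve_germ S k C p \<longleftrightarrow> (\<exists>\<gamma>. parametrizes (ambient S k) \<gamma> C p) \<and>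
     (\<exists>U. openin (mtopology (ambient S k)) U \<and> p \<in> U \<and> C \<inter> U \<subseteq> monster S k \<and>
        (\<forall>q\<in>C \<inter> U. \<forall>l. nonsingular_tangent (ambient S k) C q l \<longrightarrow> l \<subseteq> focal_bundle S k q))"

definition lift_curve ::
  "('a, 'c) manifold \<Rightarrow> nat \<Rightarrow> ('a, 'c) pt set \<Rightarrow> ('a, 'c) pt set" where
  "lift_curve S k C = mtopology (ambient S (Suc k)) closure_of
     {Line q l | q l. q \<in> C \<and> nonsingular_tangent (ambient S k) C q l}"

text \<open>The tangent direction of the (possibly singular) germ \<open>C\<close> at \<open>p\<close>: the location of its lift.\<close>

definition tangent_direction ::
  "('a, 'c) manifold \<Rightarrow> nat \<Rightarrow> ('a, 'c) pt set \<Rightarrow> ('a, 'c) pt \<Rightarrow> ('a, 'c) pt \<Rightarrow> bool" where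
  "tangent_direction S k C p p' \<longleftrightarrow> {q \<in> lift_curve S k C. foot q = p} = {p'}"

definition critical_germ ::
  "('a, 'c) manifold \<Rightarrow> nat \<Rightarrow> ('a, 'c) pt set \<Rightarrow> ('a, 'c) pt \<Rightarrow> bool" where
  "critical_germ S k C p \<longleftrightarrow> focal_curve_germ S k C p \<and>
     (\<exists>U. openin (mtopology (ambient S k)) U \<and> p \<in> U \<and> (\<exists>s. root ` (C \<inter> U) = {s}))"

definition critical_direction ::
  "('a, 'c) manifold \<Rightarrow> nat \<Rightarrow> ('a, 'c) pt \<Rightarrow> 'c tchart tvec set \<Rightarrow> bool" where
  "critical_direction S k p l \<longleftrightarrow>
     (\<exists>D. critical_germ S k D p \<and> tangent_direction S k D p (Line p l))"

definition regular_germ ::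
  "('a, 'c) manifold \<Rightarrow> nat \<Rightarrow> ('a, 'c) pt set \<Rightarrow> ('a, 'c) pt \<Rightarrow> bool" where
  "regular_germ S k C p \<longleftrightarrow> focal_curve_germ S k C p \<and>
     (\<exists>l. nonsingular_tangent (ambient S k) C p l \<and> \<not> critical_direction S k p l)"

text \<open>
  \<open>C j\<close>, located at \<open>p j\<close>, are the iterated lifts (\<open>j \<ge> k\<close>) of the focal curve germ \<open>C k\<close> at \<open>p k\<close>.
\<close>

definition iterated_lifts ::
  "('a, 'c) manifold \<Rightarrow> nat \<Rightarrow> (nat \<Rightarrow> ('a, 'c) pt set) \<Rightarrow> (nat \<Rightarrow> ('a, 'c) pt) \<Rightarrow> bool" where
  "iterated_lifts S k C p \<longleftrightarrow>
     (\<forall>j\<ge>k. focal_curve_germ S j (C j) (p j) \<and> C (Suc j) = lift_curve S j (C j) \<and>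
        tangent_direction S j (C j) (p j) (p (Suc j)))"

definition regularizable ::
  "('a, 'c) manifold \<Rightarrow> nat \<Rightarrow> ('a, 'c) pt set \<Rightarrow> ('a, 'c) pt \<Rightarrow> bool" where
  "regularizable S k C0 p0 \<longleftrightarrow> (\<exists>C p. C k = C0 \<and> p k = p0 \<and> iterated_lifts S k C p \<and>
     (\<exists>r\<ge>k. regular_germ S r (C r) (p r)))"

definition proximate ::
  "('a, 'c) manifold \<Rightarrow> (nat \<Rightarrow> ('a, 'c) pt) \<Rightarrow> nat \<Rightarrow> nat \<Rightarrow> bool" where
  "proximate S p j i \<longleftrightarrow> j = i + 1 \<or> (j \<ge> i + 2 \<and> p j \<in> div_inf S (i + 2) (j - i - 2))"

end

theory Submission
  imports Defs "HOL-Library.Extended_Nat"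
begin

text \<open>
  On \<open>S(k)\<close> there are local coordinates \<open>z 0, \<dots>, z (k + 1)\<close> in which, along a focal curve, the coordinate
  created at each step is the quotient of the derivatives of the two active coordinates of the stage
  below.  Hence the orders of the coordinates satisfy one additive relation for each step, and the multiplicity
  on \<open>S(i)\<close> is the smaller one of the orders of the two active coordinates.  If the multiplicity is \<open>a\<close> on \<open>S(i)\<close>
  and \<open>b\<close> on \<open>S(i + 1)\<close>, then either \<open>a = b\<close> and only \<open>p (i + 1)\<close> is proximate to \<open>p i\<close>, or a division of \<open>a\<close> by \<open>b\<close> with
  repeated subtraction takes place, each subtraction corresponding to a point that stays on the prolonged
  divisor at infinity: \<open>a\<close> is the sum of the multiplicities met on the way.

  A regular germ \<open>C(r)\<close> is immersed, and since its tangent is not critical the orders of its coordinates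
  at all lower stages are finite.  Therefore its parameterization projects to parameterizations of all \<open>C(i)\<close> with
  \<open>i \<le> r\<close>.  These have the least possible order, since any other parameterization of finite order lifts to \<open>C(r)\<close>,
  where it is obtained from the immersed one by substitution.
\<close>

section \<open>Smooth functions\<close>

text \<open>The germs are merely smooth, so a coordinate can be flat along the curve, of infinite
  order, without being constant. Regularity excludes this: an infinite order at a lower stage would
  make the velocity of \<open>C(r)\<close> a multiple of the direction of some \<open>z j\<close>
  with \<open>j \<ge> 2\<close>, and the straight line in that direction is a critical germ. The
  additive relations contain the order of a new coordinate as a function, but multiplicities see its
  order after its value at 0 is subtracted. The two agree if that value is 0. Therefore a quotient
  is inverted only in the vertical direction, where the inverted coordinate vanishes at the point.
  That a projected parameterization is again injective comes from the lift: values that coincide on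
  both sides of time 0 have equal tangent lines, hence equal points on the lift. That it fills the
  whole germ is invariance of domain in dimension one. Each subtraction removes at least 1, so for
  fixed \<open>i\<close> a single stage of height about \<open>i + m i\<close>, and at least
  \<open>r\<close>, shows the whole division.\<close>

text \<open>A plot \<open>(x, t, \<xi>)\<close> is a curve \<open>x\<close> with velocity \<open>\<xi>\<close> at time \<open>t\<close>.  A function is smooth if along all plots
  it obeys the chain rule with partial derivatives that are again smooth; compositions then need
  no topology on the domain.\<close>

definition has_diff ::
  "((real \<Rightarrow> 'x) \<times> real \<times> (nat \<Rightarrow> real)) set \<Rightarrow> nat \<Rightarrow> ('x \<Rightarrow> real) \<Rightarrow> (nat \<Rightarrow> 'x \<Rightarrow> real) \<Rightarrow> bool" where
  "has_diff P n f g \<longleftrightarrow> (\<forall>x t \<xi>. (x, t, \<xi>) \<in> P \<longrightarrow>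
     ((\<lambda>s. f (x s)) has_real_derivative (\<Sum>i<n. g i (x t) * \<xi> i)) (at t))"

coinductive smooth_along :: "((real \<Rightarrow> 'x) \<times> real \<times> (nat \<Rightarrow> real)) set \<Rightarrow> nat \<Rightarrow> ('x \<Rightarrow> real) \<Rightarrow> bool"
  for P n where
  smI: "has_diff P n f g \<Longrightarrow> \<forall>i<n. smooth_along P n (g i) \<Longrightarrow> smooth_along P n f"

lemma sm_diff:
  assumes "smooth_along P n f"
  obtains g where "has_diff P n f g" "\<And>i. i < n \<Longrightarrow> smooth_along P n (g i)"
  using assms by (cases rule: smooth_along.cases) blast

text \<open>Closure under arithmetic and composition is proved by coinduction up to these operations.\<close>

inductive sm_gen for P :: "((real \<Rightarrow> 'x) \<times> real \<times> (nat \<Rightarrow> real)) set" and n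
    and Q :: "((real \<Rightarrow> 'y) \<times> real \<times> (nat \<Rightarrow> real)) set" and m where
  base: "smooth_along P n f \<Longrightarrow> sm_gen P n Q m f"
| const: "sm_gen P n Q m (\<lambda>x. c)"
| add: "sm_gen P n Q m f \<Longrightarrow> sm_gen P n Q m g \<Longrightarrow> sm_gen P n Q m (\<lambda>x. f x + g x)"
| mult: "sm_gen P n Q m f \<Longrightarrow> sm_gen P n Q m g \<Longrightarrow> sm_gen P n Q m (\<lambda>x. f x * g x)"
| inv: "sm_gen P n Q m f \<Longrightarrow> (\<And>x t \<xi>. (x, t, \<xi>) \<in> P \<Longrightarrow> f (x t) \<noteq> 0) \<Longrightarrow> sm_gen P n Q m (\<lambda>x. inverse (f x))"
| comp: "smooth_along Q m f \<Longrightarrow> (\<And>x t \<xi>. (x, t, \<xi>) \<in> P \<Longrightarrow> (h \<circ> x, t, \<lambda>j. \<Sum>i<n. d j i (x t) * \<xi> i) \<in> Q) \<Longrightarrow>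
    (\<And>i j. i < n \<Longrightarrow> j < m \<Longrightarrow> smooth_along P n (d j i)) \<Longrightarrow> sm_gen P n Q m (\<lambda>x. f (h x))"

lemma sm_gen_sum:
  assumes "\<And>j. j < (k::nat) \<Longrightarrow> sm_gen P n Q m (f j)"
  shows "sm_gen P n Q m (\<lambda>x. \<Sum>j<k. f j x)"
  using assms by (induction k) (auto intro: sm_gen.intros)

text \<open>The generated functions are closed under taking partial derivatives, by the sum,
  product, reciprocal and chain rules. Case \<open>comp\<close> stays inside because the outer
  derivatives are smooth along \<open>Q\<close> and are composed with the same
  \<open>h\<close>.\<close>

lemma sm_gen_imp_sm:
  assumes "sm_gen P n Q m f"
  shows "smooth_along P n f"
proof -
  have step: "\<exists>g. has_diff P n f g \<and> (\<forall>i<n. sm_gen P n Q m (g i))" if "sm_gen P n Q m f" for f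
    using that
  proof induction
    case (base f)
    then show ?case by (metis sm_diff sm_gen.base)
  next
    case (const c)
    show ?case by (rule exI[of _ "\<lambda>i x. 0"]) (auto simp: has_diff_def intro: sm_gen.const)
  next
    case (add f g)
    then obtain f' g' where "has_diff P n f f'" "has_diff P n g g'"
      "\<forall>i<n. sm_gen P n Q m (f' i)" "\<forall>i<n. sm_gen P n Q m (g' i)" by blast
    then show ?case
      by (intro exI[of _ "\<lambda>i x. f' i x + g' i x"])
        (auto simp: has_diff_def distrib_right sum.distrib intro!: sm_gen.add DERIV_add)
  next
    case (mult f g)
    then obtain f' g' where *: "has_diff P n f f'" "has_diff P n g g'"
      "\<forall>i<n. sm_gen P n Q m (f' i)" "\<forall>i<n. sm_gen P n Q m (g' i)" by blast
    show ?case
    proof (intro exI[of _ "\<lambda>i x. f' i x * g x + f x * g' i x"] conjI allI impI)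
      show "has_diff P n (\<lambda>x. f x * g x) (\<lambda>i x. f' i x * g x + f x * g' i x)"
        unfolding has_diff_def
      proof (intro allI impI)
        fix x t \<xi> assume "(x, t, \<xi>) \<in> P"
        with * have "((\<lambda>s. f (x s)) has_real_derivative (\<Sum>i<n. f' i (x t) * \<xi> i)) (at t)"
          "((\<lambda>s. g (x s)) has_real_derivative (\<Sum>i<n. g' i (x t) * \<xi> i)) (at t)"
          by (auto simp: has_diff_def)
        from DERIV_mult[OF this]
        show "((\<lambda>s. f (x s) * g (x s)) has_real_derivative
            (\<Sum>i<n. (f' i (x t) * g (x t) + f (x t) * g' i (x t)) * \<xi> i)) (at t)"
          by (simp add: algebra_simps sum.distrib sum_distrib_left)
      qed
    qed (use * mult in \<open>auto intro!: sm_gen.add sm_gen.mult\<close>)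
  next
    case (inv f)
    then obtain f' where *: "has_diff P n f f'" "\<forall>i<n. sm_gen P n Q m (f' i)" by blast
    show ?case
    proof (intro exI[of _ "\<lambda>i x. (-1) * f' i x * (inverse (f x) * inverse (f x))"] conjI allI impI)
      show "has_diff P n (\<lambda>x. inverse (f x)) (\<lambda>i x. (-1) * f' i x * (inverse (f x) * inverse (f x)))"
        unfolding has_diff_def
      proof (intro allI impI)
        fix x t \<xi> assume P: "(x, t, \<xi>) \<in> P"
        with * have "((\<lambda>s. f (x s)) has_real_derivative (\<Sum>i<n. f' i (x t) * \<xi> i)) (at t)"
          by (auto simp: has_diff_def)
        from DERIV_inverse'[OF this] inv(2)[OF P]
        show "((\<lambda>s. inverse (f (x s))) has_real_derivative
            (\<Sum>i<n. (-1) * f' i (x t) * (inverse (f (x t)) * inverse (f (x t))) * \<xi> i)) (at t)"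
          by (simp add: algebra_simps sum.distrib sum_distrib_left sum_negf)
      qed
    qed (use * inv(1,2) in \<open>simp, intro sm_gen.const sm_gen.mult sm_gen.inv sm_gen.mult[OF sm_gen.const, of _ _ _ _ _ "-1", simplified], auto\<close>)
  next
    case (comp f h d)
    obtain f' where *: "has_diff Q m f f'" "\<And>i. i < m \<Longrightarrow> smooth_along Q m (f' i)"
      using sm_diff[OF comp(1)] by blast
    show ?case
    proof (intro exI[of _ "\<lambda>i x. \<Sum>j<m. f' j (h x) * d j i x"] conjI allI impI)
      show "has_diff P n (\<lambda>x. f (h x)) (\<lambda>i x. \<Sum>j<m. f' j (h x) * d j i x)"
        unfolding has_diff_def
      proof (intro allI impI)
        fix x t \<xi> assume P: "(x, t, \<xi>) \<in> P"
        have eq: "(\<Sum>j<m. f' j (h (x t)) * (\<Sum>i<n. d j i (x t) * \<xi> i))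
          = (\<Sum>i<n. (\<Sum>j<m. f' j (h (x t)) * d j i (x t)) * \<xi> i)"
          by (simp add: sum_distrib_left sum_distrib_right mult.assoc) (rule sum.swap)
        have "((\<lambda>s. f ((h \<circ> x) s)) has_real_derivative
            (\<Sum>j<m. f' j ((h \<circ> x) t) * (\<Sum>i<n. d j i (x t) * \<xi> i))) (at t)"
          using *(1) comp(2)[OF P] unfolding has_diff_def by blast
        then show "((\<lambda>s. f (h (x s))) has_real_derivative
            (\<Sum>i<n. (\<Sum>j<m. f' j (h (x t)) * d j i (x t)) * \<xi> i)) (at t)"
          using eq by (simp add: o_def)
      qed
    next
      fix i assume "i < n"
      then show "sm_gen P n Q m (\<lambda>x. \<Sum>j<m. f' j (h x) * d j i x)"
        using comp * by (intro sm_gen_sum sm_gen.mult sm_gen.base sm_gen.comp[of Q m _ P h]) auto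
    qed
  qed
  show ?thesis
    using assms
  proof (coinduction arbitrary: f)
    case smooth_along
    then show ?case using step by meson
  qed
qed

lemma sm_const: "smooth_along P n (\<lambda>x. c)"
  and sm_add: "smooth_along P n f \<Longrightarrow> smooth_along P n g \<Longrightarrow> smooth_along P n (\<lambda>x. f x + g x)"
  and sm_mult: "smooth_along P n f \<Longrightarrow> smooth_along P n g \<Longrightarrow> smooth_along P n (\<lambda>x. f x * g x)"
  and sm_inverse: "smooth_along P n f \<Longrightarrow> (\<And>x t \<xi>. (x, t, \<xi>) \<in> P \<Longrightarrow> f (x t) \<noteq> 0) \<Longrightarrow> smooth_along P n (\<lambda>x. inverse (f x))"
  by (auto intro!: sm_gen_imp_sm[where Q = P and m = n] intro: sm_gen.intros)

lemma sm_comp: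
  assumes "smooth_along Q m f" "\<And>x t \<xi>. (x, t, \<xi>) \<in> P \<Longrightarrow> (h \<circ> x, t, \<lambda>j. \<Sum>i<n. d j i (x t) * \<xi> i) \<in> Q"
    "\<And>i j. i < n \<Longrightarrow> j < m \<Longrightarrow> smooth_along P n (d j i)"
  shows "smooth_along P n (\<lambda>x. f (h x))"
  using sm_gen_imp_sm[OF sm_gen.comp[OF assms]] by simp

lemma sm_sum: "(\<And>j. j < (k::nat) \<Longrightarrow> smooth_along P n (f j)) \<Longrightarrow> smooth_along P n (\<lambda>x. \<Sum>j<k. f j x)"
  by (induction k) (auto intro: sm_const sm_add)

lemma sm_minus: "smooth_along P n f \<Longrightarrow> smooth_along P n (\<lambda>x. - f x)"
  using sm_mult[OF sm_const[of P n "-1"]] by simp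

lemma sm_diff2: "smooth_along P n f \<Longrightarrow> smooth_along P n g \<Longrightarrow> smooth_along P n (\<lambda>x. f x - g x)"
  using sm_add[OF _ sm_minus] by simp

lemma sm_divide: "smooth_along P n f \<Longrightarrow> smooth_along P n g \<Longrightarrow> (\<And>x t \<xi>. (x, t, \<xi>) \<in> P \<Longrightarrow> g (x t) \<noteq> 0) \<Longrightarrow>
    smooth_along P n (\<lambda>x. f x / g x)"
  unfolding divide_inverse by (intro sm_mult sm_inverse)

lemma sm_power: "smooth_along P n f \<Longrightarrow> smooth_along P n (\<lambda>x. f x ^ k)"
  by (induction k) (auto intro: sm_const sm_mult)

lemma sm_cong:
  assumes "smooth_along P n f" "\<And>x t \<xi>. (x, t, \<xi>) \<in> P \<Longrightarrow> \<forall>\<^sub>F s in nhds t. f' (x s) = f (x s)"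
  shows "smooth_along P n f'"
proof -
  obtain g where g: "has_diff P n f g" "\<And>i. i < n \<Longrightarrow> smooth_along P n (g i)" using sm_diff[OF assms(1)] by metis
  have "has_diff P n f' g"
    unfolding has_diff_def
  proof (intro allI impI)
    fix x t \<xi> assume P: "(x, t, \<xi>) \<in> P"
    show "((\<lambda>s. f' (x s)) has_real_derivative (\<Sum>i<n. g i (x t) * \<xi> i)) (at t)"
      using DERIV_cong_ev[OF refl assms(2)[OF P] refl] g(1) P by (auto simp: has_diff_def)
  qed
  then show ?thesis using g(2) by (intro smI) auto
qed


subsection \<open>Functions of one real variable\<close>

text \<open>Unlike in \<open>open_plots\<close> below, only the value at time \<open>t\<close> has
  to lie in \<open>T\<close>. The identity is then a plot at each single time in \<open>T\<close>,
  which is how \<open>has_diff_RP\<close> recovers the ordinary derivative.\<close>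

definition real_plots :: "real set \<Rightarrow> ((real \<Rightarrow> real) \<times> real \<times> (nat \<Rightarrow> real)) set" where
  "real_plots T = {(x, t, \<xi>). (x has_real_derivative \<xi> 0) (at t) \<and> x t \<in> T}"

definition real_smooth :: "real set \<Rightarrow> (real \<Rightarrow> real) \<Rightarrow> bool" where
  "real_smooth T f \<longleftrightarrow> smooth_along (real_plots T) 1 f"

lemma rs_const: "real_smooth T (\<lambda>x. c)"
  and rs_add: "real_smooth T f \<Longrightarrow> real_smooth T g \<Longrightarrow> real_smooth T (\<lambda>x. f x + g x)"
  and rs_diff: "real_smooth T f \<Longrightarrow> real_smooth T g \<Longrightarrow> real_smooth T (\<lambda>x. f x - g x)"
  and rs_mult: "real_smooth T f \<Longrightarrow> real_smooth T g \<Longrightarrow> real_smooth T (\<lambda>x. f x * g x)"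
  and rs_power: "real_smooth T f \<Longrightarrow> real_smooth T (\<lambda>x. f x ^ k)"
  unfolding real_smooth_def by (auto intro: sm_const sm_add sm_diff2 sm_mult sm_power)

lemma rs_divide:
  assumes "real_smooth T f" "real_smooth T g" "\<And>t. t \<in> T \<Longrightarrow> g t \<noteq> 0"
  shows "real_smooth T (\<lambda>x. f x / g x)"
  using assms unfolding real_smooth_def by (intro sm_divide) (auto simp: real_plots_def)

lemma has_diff_RP:
  "has_diff (real_plots T) 1 f g \<longleftrightarrow> (\<forall>t\<in>T. (f has_real_derivative g 0 t) (at t))" (is "?L \<longleftrightarrow> ?R")
proof
  assume g: ?L
  show ?R
  proof
    fix t assume "t \<in> T"
    then have "((\<lambda>s. s), t, (\<lambda>_. 1)) \<in> real_plots T" by (auto simp: real_plots_def)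
    with g have "((\<lambda>s. f s) has_real_derivative (\<Sum>i<1. g i t * 1)) (at t)" unfolding has_diff_def by fast
    then show "(f has_real_derivative g 0 t) (at t)" by simp
  qed
next
  assume R: ?R
  have "((\<lambda>s. f (x s)) has_real_derivative g 0 (x t) * \<xi> 0) (at t)" if "(x, t, \<xi>) \<in> real_plots T" for x t \<xi>
    using that R DERIV_chain2[of f "g 0 (x t)" x t "\<xi> 0" UNIV] by (auto simp: real_plots_def)
  then show ?L by (simp add: has_diff_def)
qed

lemma rs_iff: "real_smooth T f \<longleftrightarrow> (\<exists>g. (\<forall>t\<in>T. (f has_real_derivative g t) (at t)) \<and> real_smooth T g)"
proof
  assume "real_smooth T f"
  then obtain g where g: "has_diff (real_plots T) 1 f g" "real_smooth T (g 0)" unfolding real_smooth_def by (metis sm_diff less_one)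
  then show "\<exists>g. (\<forall>t\<in>T. (f has_real_derivative g t) (at t)) \<and> real_smooth T g" using has_diff_RP[of T f g] by auto
next
  assume "\<exists>g. (\<forall>t\<in>T. (f has_real_derivative g t) (at t)) \<and> real_smooth T g"
  then obtain g where g: "\<forall>t\<in>T. (f has_real_derivative g t) (at t)" "real_smooth T g" by blast
  show "real_smooth T f" unfolding real_smooth_def
    by (rule smI[where g = "\<lambda>_. g"], unfold has_diff_RP) (use g in \<open>auto simp: real_smooth_def\<close>)
qed

lemma rs_cong:
  assumes "real_smooth T f" "open T" "\<And>t. t \<in> T \<Longrightarrow> f' t = f t"
  shows "real_smooth T f'"
  unfolding real_smooth_def
proof (rule sm_cong[OF assms(1)[unfolded real_smooth_def]])
  fix x t \<xi> assume "(x, t, \<xi>) \<in> real_plots T"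
  then have "isCont x t" "x t \<in> T" by (auto simp: real_plots_def intro: DERIV_isCont)
  then have "\<forall>\<^sub>F s in nhds t. x s \<in> T"
    using assms(2) by (simp add: continuous_at_open eventually_nhds)
  then show "\<forall>\<^sub>F s in nhds t. f' (x s) = f (x s)"
    by eventually_elim (use assms(3) in auto)
qed

lemma sm_mono: "smooth_along P n f \<Longrightarrow> P' \<subseteq> P \<Longrightarrow> smooth_along P' n f"
proof (coinduction arbitrary: f)
  case smooth_along
  obtain g where "has_diff P n f g" "\<And>i. i < n \<Longrightarrow> smooth_along P n (g i)" using sm_diff[OF smooth_along(1)] by metis
  moreover from this have "has_diff P' n f g" using smooth_along(2) unfolding has_diff_def by blast
  ultimately show ?case using smooth_along(2) by blast
qed

lemma rs_mono: "real_smooth T f \<Longrightarrow> T' \<subseteq> T \<Longrightarrow> real_smooth T' f"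
  unfolding real_smooth_def by (erule sm_mono) (auto simp: real_plots_def)

lemma
  assumes "real_smooth T f"
  shows rs_has_deriv: "\<And>t. t \<in> T \<Longrightarrow> (f has_real_derivative deriv f t) (at t)"
    and rs_rs_deriv: "open T \<Longrightarrow> real_smooth T (deriv f)"
proof -
  obtain g where g: "\<forall>t\<in>T. (f has_real_derivative g t) (at t)" "real_smooth T g" using assms rs_iff by blast
  then have d: "deriv f t = g t" if "t \<in> T" for t using DERIV_imp_deriv that by blast
  show "\<And>t. t \<in> T \<Longrightarrow> (f has_real_derivative deriv f t) (at t)" using g d by auto
  show "open T \<Longrightarrow> real_smooth T (deriv f)" using rs_cong[OF g(2)] d by auto
qed

lemma rs_higher_deriv: "real_smooth T f \<Longrightarrow> open T \<Longrightarrow> real_smooth T ((deriv ^^ n) f)"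
  by (induction n) (auto intro: rs_rs_deriv[simplified])

text \<open>Translates between the smoothness used for curves and smoothness along plots. Openness
  of \<open>T\<close> serves the direction from left to right: a derivative witness agrees with
  \<open>deriv f\<close> near each point of \<open>T\<close>, so \<open>deriv f\<close> is smooth as
  well.\<close>

lemma rs_eq_smooth_real_on:
  assumes "open T"
  shows "real_smooth T f \<longleftrightarrow> smooth_real_on T f"
proof
  assume "real_smooth T f"
  then show "smooth_real_on T f"
    using rs_has_deriv[OF rs_higher_deriv[OF _ assms]] unfolding smooth_real_on_def
    by (auto simp: real_differentiable_def)
next
  assume "smooth_real_on T f"
  then show "real_smooth T f" unfolding real_smooth_def
  proof (coinduction arbitrary: f)
    case smooth_along
    have "(f has_real_derivative deriv f t) (at t)" if "t \<in> T" for t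
      using smooth_along that unfolding smooth_real_on_def
      by (metis DERIV_deriv_iff_real_differentiable eq_id_iff funpow.simps(1))
    then have "has_diff (real_plots T) 1 f (\<lambda>_. deriv f)" unfolding has_diff_RP by blast
    moreover have "smooth_real_on T (deriv f)"
      using smooth_along unfolding smooth_real_on_def by (metis comp_apply funpow_Suc_right)
    ultimately show ?case by blast
  qed
qed

lemma rs_id: "real_smooth T (\<lambda>t. t)"
  unfolding rs_iff[of T "\<lambda>t. t"] using rs_const[of T 1] by (intro exI[of _ "\<lambda>_. 1"]) auto

lemma rs_isCont: "real_smooth T f \<Longrightarrow> t \<in> T \<Longrightarrow> isCont f t"
  using rs_has_deriv DERIV_isCont by blast

lemma rs_comp:
  assumes "real_smooth T' f" "real_smooth T g" "g ` T \<subseteq> T'" "open T"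
  shows "real_smooth T (\<lambda>t. f (g t))"
  unfolding real_smooth_def
proof (rule sm_comp[OF assms(1)[unfolded real_smooth_def], where d = "\<lambda>_ _. deriv g"])
  fix x t \<xi> assume "(x, t, \<xi>) \<in> real_plots T"
  then show "(g \<circ> x, t, \<lambda>j. \<Sum>i<1. deriv g (x t) * \<xi> i) \<in> real_plots T'"
    using assms(3) rs_has_deriv[OF assms(2)] by (auto simp: real_plots_def intro!: DERIV_chain)
qed (use rs_rs_deriv[OF assms(2,4)] in \<open>simp add: real_smooth_def\<close>)


subsection \<open>Functions of several real variables\<close>

text \<open>Chart images consist of functions that vanish from index \<open>n\<close> on and have no
  interior among all functions \<open>nat \<Rightarrow> real\<close>. Asking the curve to stay in
  \<open>V\<close> near \<open>t\<close> takes the place of openness.\<close>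

definition open_plots :: "nat \<Rightarrow> (nat \<Rightarrow> real) set \<Rightarrow> ((real \<Rightarrow> nat \<Rightarrow> real) \<times> real \<times> (nat \<Rightarrow> real)) set" where
  "open_plots n V = {(x, t, \<xi>). (\<forall>i<n. ((\<lambda>s. x s i) has_real_derivative \<xi> i) (at t)) \<and> (\<forall>\<^sub>F s in nhds t. x s \<in> V)}"

lemma PW_mem: "(x, t, \<xi>) \<in> open_plots n V \<Longrightarrow> x t \<in> V"
  by (auto simp: open_plots_def dest: eventually_nhds_x_imp_x)

lemma sm_PW_cong:
  assumes "smooth_along (open_plots n V) n f" "\<And>x. x \<in> V \<Longrightarrow> f' x = f x"
  shows "smooth_along (open_plots n V) n f'"
  by (rule sm_cong[OF assms(1)]) (auto simp: open_plots_def elim!: eventually_mono intro: assms(2))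

lemma PW_mono: "V' \<subseteq> V \<Longrightarrow> open_plots n V' \<subseteq> open_plots n V"
  by (auto simp: open_plots_def elim!: eventually_mono)

lemma sm_coord: "i < n \<Longrightarrow> smooth_along (open_plots n V) n (\<lambda>x. x i)"
proof (rule smI[where g = "\<lambda>j x. if j = i then 1 else 0"])
  assume "i < n"
  then show "has_diff (open_plots n V) n (\<lambda>x. x i) (\<lambda>j x. if j = i then 1 else 0)"
    by (auto simp: has_diff_def open_plots_def if_distrib[of "\<lambda>u. u * _"] cong: if_cong)
  show "\<forall>j<n. smooth_along (open_plots n V) n (\<lambda>x. if j = i then 1 else 0)" by (auto intro: sm_const)
qed

text \<open>Coordinate lines through a point of \<open>V\<close> stay in \<open>V\<close> for a short time; enough for the
  partial derivatives of a smooth function on \<open>V\<close> to be determined by the function.\<close>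

definition line_open :: "nat \<Rightarrow> (nat \<Rightarrow> real) set \<Rightarrow> bool" where
  "line_open n V \<longleftrightarrow> (\<forall>x\<in>V. \<forall>i<n. \<forall>\<^sub>F s in nhds (x i). x(i := s) \<in> V)"

lemma
  assumes "smooth_along (open_plots n V) n f" "line_open n V"
  shows sm_has_diff: "has_diff (open_plots n V) n f (\<lambda>i. partial_deriv i f)"
    and sm_partial_deriv: "\<And>i. i < n \<Longrightarrow> smooth_along (open_plots n V) n (partial_deriv i f)"
proof -
  obtain g where g: "has_diff (open_plots n V) n f g" "\<And>i. i < n \<Longrightarrow> smooth_along (open_plots n V) n (g i)"
    using sm_diff[OF assms(1)] by metis
  have eq: "partial_deriv i f x = g i x" if "i < n" "x \<in> V" for i x
  proof -
    have "((\<lambda>s. (x(i := s)) j) has_real_derivative (if j = i then 1 else 0)) (at (x i))" for j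
      by (cases "j = i") auto
    then have "((\<lambda>s. x(i := s)), x i, (\<lambda>j. if j = i then 1 else 0)) \<in> open_plots n V"
      using assms(2) that unfolding open_plots_def line_open_def by auto
    then have "((\<lambda>s. f (x(i := s))) has_real_derivative (\<Sum>j<n. g j (x(i := x i)) * (if j = i then 1 else 0))) (at (x i))"
      using g(1) unfolding has_diff_def by fast
    then show ?thesis
      using \<open>i < n\<close> unfolding partial_deriv_def by (intro DERIV_imp_deriv) (simp add: if_distrib[of "\<lambda>u. _ * u"] cong: if_cong)
  qed
  show "has_diff (open_plots n V) n f (\<lambda>i. partial_deriv i f)"
    unfolding has_diff_def
  proof (intro allI impI)
    fix x t \<xi> assume P: "(x, t, \<xi>) \<in> open_plots n V"
    have "(\<Sum>i<n. partial_deriv i f (x t) * \<xi> i) = (\<Sum>i<n. g i (x t) * \<xi> i)"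
      using eq PW_mem[OF P] by (intro sum.cong) auto
    then show "((\<lambda>s. f (x s)) has_real_derivative (\<Sum>i<n. partial_deriv i f (x t) * \<xi> i)) (at t)"
      using g(1) P unfolding has_diff_def by auto
  qed
  show "\<And>i. i < n \<Longrightarrow> smooth_along (open_plots n V) n (partial_deriv i f)"
    using sm_PW_cong[OF g(2)] eq by blast
qed

lemma sm_chain:
  assumes "smooth_along (open_plots n V) n f" "line_open n V"
    and "\<And>i. i < n \<Longrightarrow> ((\<lambda>s. x s i) has_real_derivative \<xi> i) (at t)" "\<forall>\<^sub>F s in nhds t. x s \<in> V"
  shows "((\<lambda>s. f (x s)) has_real_derivative (\<Sum>i<n. partial_deriv i f (x t) * \<xi> i)) (at t)"
  using sm_has_diff[OF assms(1,2)] assms(3,4) unfolding has_diff_def open_plots_def by blast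

text \<open>The inner map appears twice because membership in \<open>V'\<close> also concerns the
  components from \<open>m\<close> on: \<open>h'\<close> is the full map, for instance padded with
  zeros, and \<open>h\<close> supplies its smooth components below \<open>m\<close>.\<close>

lemma sm_comp_PW:
  assumes "smooth_along (open_plots m V') m f" "\<And>j. j < m \<Longrightarrow> smooth_along (open_plots n V) n (h j)" "line_open n V"
    "\<And>x. x \<in> V \<Longrightarrow> (\<lambda>j. h' j x) \<in> V'" "\<And>x j. x \<in> V \<Longrightarrow> j < m \<Longrightarrow> h' j x = h j x"
  shows "smooth_along (open_plots n V) n (\<lambda>x. f (\<lambda>j. h' j x))"
proof (rule sm_comp[OF assms(1), where d = "\<lambda>j i. partial_deriv i (h j)"])
  fix x t \<xi> assume P: "(x, t, \<xi>) \<in> open_plots n V"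
  then have ev: "\<forall>\<^sub>F s in nhds t. x s \<in> V" by (auto simp: open_plots_def)
  have "((\<lambda>s. h' j (x s)) has_real_derivative (\<Sum>i<n. partial_deriv i (h j) (x t) * \<xi> i)) (at t)" if "j < m" for j
  proof -
    have "((\<lambda>s. h j (x s)) has_real_derivative (\<Sum>i<n. partial_deriv i (h j) (x t) * \<xi> i)) (at t)"
      using sm_has_diff[OF assms(2)[OF that] assms(3)] P unfolding has_diff_def by blast
    moreover have "\<forall>\<^sub>F s in nhds t. h' j (x s) = h j (x s)"
      using ev by eventually_elim (use assms(5) that in auto)
    ultimately show ?thesis by (subst DERIV_cong_ev[OF refl _ refl])
  qed
  moreover have "\<forall>\<^sub>F s in nhds t. (\<lambda>j. h' j (x s)) \<in> V'"
    using ev by eventually_elim (use assms(4) in auto)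
  ultimately show "((\<lambda>x j. h' j x) \<circ> x, t, \<lambda>j. \<Sum>i<n. partial_deriv i (h j) (x t) * \<xi> i) \<in> open_plots m V'"
    by (auto simp: open_plots_def)
qed (use sm_partial_deriv assms in auto)

lemma sm_comp_rs:
  assumes "smooth_along (open_plots m V') m f" "\<And>j. j < m \<Longrightarrow> real_smooth T (\<lambda>t. \<zeta> t j)" "open T" "\<And>t. t \<in> T \<Longrightarrow> \<zeta> t \<in> V'"
  shows "real_smooth T (\<lambda>t. f (\<zeta> t))"
  unfolding real_smooth_def
proof (rule sm_comp[OF assms(1), where d = "\<lambda>j i. deriv (\<lambda>t. \<zeta> t j)"])
  fix x t \<xi> assume P: "(x, t, \<xi>) \<in> real_plots T"
  then have x: "(x has_real_derivative \<xi> 0) (at t)" "x t \<in> T" by (auto simp: real_plots_def)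
  then have "\<forall>\<^sub>F s in nhds t. x s \<in> T"
    using assms(3) DERIV_isCont[OF x(1)] by (simp add: continuous_at_open eventually_nhds)
  then have "\<forall>\<^sub>F s in nhds t. \<zeta> (x s) \<in> V'" by eventually_elim (use assms(4) in auto)
  then show "(\<zeta> \<circ> x, t, \<lambda>j. \<Sum>i<1. deriv (\<lambda>t. \<zeta> t j) (x t) * \<xi> i) \<in> open_plots m V'"
    using x DERIV_chain2[OF rs_has_deriv[OF assms(2)] x(1)] by (auto simp: open_plots_def)
qed (use rs_rs_deriv[OF assms(2) assms(3)] in \<open>simp add: real_smooth_def\<close>)

section \<open>Open subsets of Euclidean space as unions of boxes\<close>

definition eball :: "nat \<Rightarrow> (nat \<Rightarrow> real) \<Rightarrow> real \<Rightarrow> (nat \<Rightarrow> real) set" where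
  "eball n x d = {y. (\<forall>i\<ge>n. y i = 0) \<and> (\<forall>i<n. \<bar>y i - x i\<bar> < d)}"

definition eopen :: "nat \<Rightarrow> (nat \<Rightarrow> real) set \<Rightarrow> bool" where
  "eopen n V \<longleftrightarrow> V \<subseteq> {y. \<forall>i\<ge>n. y i = 0} \<and> (\<forall>x\<in>V. \<exists>d>0. eball n x d \<subseteq> V)"

text \<open>From index \<open>n\<close> on both points are zero, so a basic neighbourhood of the
  product topology restricts only the first \<open>n\<close> coordinates and contains a box of
  uniform size.\<close>

lemma openin_Euclidean_iff: "openin (Euclidean_space n) V \<longleftrightarrow> eopen n V"
proof
  assume "openin (Euclidean_space n) V"
  then obtain W where W: "openin (powertop_real UNIV) W" "V = W \<inter> {x. \<forall>i\<ge>n. x i = 0}"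
    unfolding Euclidean_space_def openin_subtopology by blast
  have "\<exists>d>0. eball n x d \<subseteq> V" if x: "x \<in> V" for x
  proof -
    obtain X where X: "x \<in> (\<Pi>\<^sub>E i\<in>UNIV. X i)" "\<And>i. open (X i)" "(\<Pi>\<^sub>E i\<in>UNIV. X i) \<subseteq> W"
      using product_topology_open_contains_basis[OF W(1), of x] x W(2) by auto
    have "\<exists>d>0. \<forall>y. \<bar>y - x i\<bar> < d \<longrightarrow> y \<in> X i" for i
      using X(1,2) unfolding open_dist dist_real_def by (auto simp: PiE_def)
    then obtain d where d: "\<And>i. d i > 0" "\<And>i y. \<bar>y - x i\<bar> < d i \<Longrightarrow> y \<in> X i" by metis
    define e where "e = Min (insert 1 (d ` {..<n}))"
    have e: "e > 0" "\<And>i. i < n \<Longrightarrow> e \<le> d i" unfolding e_def using d(1) by (auto simp: Min_le_iff)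
    have "y \<in> V" if y: "y \<in> eball n x e" for y
    proof -
      have "y i \<in> X i" for i
      proof (cases "i < n")
        case True
        then show ?thesis using y d(2)[of "y i" i] e(2)[OF True] by (force simp: eball_def)
      next
        case False
        then have "y i = x i" using y x W(2) by (auto simp: eball_def)
        then show ?thesis using X(1) by (auto simp: PiE_def)
      qed
      then have "y \<in> W" using X(3) by (auto simp: PiE_def)
      then show ?thesis using y W(2) by (auto simp: eball_def)
    qed
    then show ?thesis using e(1) by blast
  qed
  then show "eopen n V" using W(2) unfolding eopen_def by blast
next
  assume V: "eopen n V"
  then obtain d where d: "\<And>x. x \<in> V \<Longrightarrow> d x > 0" "\<And>x. x \<in> V \<Longrightarrow> eball n x (d x) \<subseteq> V"
    unfolding eopen_def by metis
  define B where "B x = (\<Inter>i\<in>{..<n}. {y. \<bar>y i - x i\<bar> < d x})" for x :: "nat \<Rightarrow> real"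
  have "open (B x)" for x unfolding B_def
    by (intro open_INT) (auto intro!: open_Collect_less continuous_intros)
  then have "open (\<Union>x\<in>V. B x)" by blast
  then have "openin (powertop_real UNIV) (\<Union>x\<in>V. B x)"
    by (simp add: euclidean_product_topology)
  moreover have "V = (\<Union>x\<in>V. B x) \<inter> {x. \<forall>i\<ge>n. x i = 0}"
  proof
    show "V \<subseteq> (\<Union>x\<in>V. B x) \<inter> {x. \<forall>i\<ge>n. x i = 0}"
      using V d(1) by (auto simp: eopen_def B_def)
    show "(\<Union>x\<in>V. B x) \<inter> {x. \<forall>i\<ge>n. x i = 0} \<subseteq> V"
      using d(2) by (fastforce simp: B_def eball_def)
  qed
  ultimately show "openin (Euclidean_space n) V"
    unfolding Euclidean_space_def openin_subtopology by blast
qed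

lemma eopen_Int: "eopen n U \<Longrightarrow> eopen n V \<Longrightarrow> eopen n (U \<inter> V)"
  and eopen_Union: "(\<And>U. U \<in> K \<Longrightarrow> eopen n U) \<Longrightarrow> eopen n (\<Union>K)"
  by (auto simp flip: openin_Euclidean_iff)

lemma eopen_line_open:
  assumes "eopen n V" shows "line_open n V"
  unfolding line_open_def
proof (intro ballI allI impI)
  fix x i assume x: "x \<in> V" "i < n"
  then obtain d where d: "d > 0" "eball n x d \<subseteq> V" using assms by (auto simp: eopen_def)
  have "x(i := s) \<in> V" if "dist s (x i) < d" for s
  proof -
    have "x(i := s) \<in> eball n x d" using x assms that d(1) by (auto simp: eball_def eopen_def dist_real_def)
    then show ?thesis using d(2) by blast
  qed
  then show "\<forall>\<^sub>F s in nhds (x i). x(i := s) \<in> V"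
    using d(1) by (auto simp: eventually_nhds_metric)
qed

lemma isCont_nhds: "isCont f a \<Longrightarrow> filterlim f (nhds (f a)) (nhds a)"
  by (simp add: isCont_def tendsto_at_iff_tendsto_nhds)

lemma eopen_ev:
  assumes "eopen n V" "x t \<in> V" "\<And>i. i < n \<Longrightarrow> isCont (\<lambda>s. x s i) t" "\<And>s i. i \<ge> n \<Longrightarrow> x s i = 0"
  shows "\<forall>\<^sub>F s in nhds t. x s \<in> V"
proof -
  obtain d where d: "d > 0" "eball n (x t) d \<subseteq> V" using assms by (auto simp: eopen_def)
  have "\<forall>\<^sub>F s in nhds t. \<bar>x s i - x t i\<bar> < d" if "i < n" for i
    using tendstoD[OF isCont_nhds[OF assms(3)[OF that]] d(1)] by (simp add: dist_real_def)
  then have "\<forall>\<^sub>F s in nhds t. \<forall>i\<in>{..<n}. \<bar>x s i - x t i\<bar> < d"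
    by (intro eventually_ball_finite) auto
  then show ?thesis by eventually_elim (use d(2) assms(4) in \<open>auto simp: eball_def\<close>)
qed

subsection \<open>Iterated partial derivatives\<close>

text \<open>If no box works, counterexamples in boxes of size \<open>inverse (Suc k)\<close>
  converge componentwise, hence in the product topology, to \<open>x\<close>.\<close>

lemma continuous_on_box:
  fixes x :: "nat \<Rightarrow> real" and g :: "(nat \<Rightarrow> real) \<Rightarrow> real"
  assumes "continuous_on V g" "V \<subseteq> {y. \<forall>i\<ge>n. y i = 0}" "x \<in> V" "e > (0::real)"
  shows "\<exists>d>0. \<forall>y\<in>V. (\<forall>i<n. \<bar>y i - x i\<bar> < d) \<longrightarrow> \<bar>g y - g x\<bar> < e"
proof (rule ccontr)
  assume "\<not> ?thesis"
  then have "\<forall>k. \<exists>y\<in>V. (\<forall>i<n. \<bar>y i - x i\<bar> < inverse (real (Suc k))) \<and> \<not> \<bar>g y - g x\<bar> < e"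
    by (metis inverse_positive_iff_positive of_nat_0_less_iff zero_less_Suc)
  then obtain y where y: "\<And>k. y k \<in> V" "\<And>k i. i < n \<Longrightarrow> \<bar>y k i - x i\<bar> < inverse (real (Suc k))"
    "\<And>k. \<not> \<bar>g (y k) - g x\<bar> < e" by metis
  have "(\<lambda>k. y k i) \<longlonglongrightarrow> x i" for i
  proof (cases "i < n")
    case True
    have "(\<lambda>k. y k i - x i) \<longlonglongrightarrow> 0"
      by (rule tendsto_rabs_zero_cancel[OF tendsto_sandwich[OF _ _ tendsto_const LIMSEQ_inverse_real_of_nat]])
        (use y(2)[OF True] in \<open>auto intro!: always_eventually less_imp_le\<close>)
    then show ?thesis using Lim_null by blast
  next
    case False
    then have "y k i = 0" "x i = 0" for k using y(1)[of k] assms(2,3) by auto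
    then show ?thesis by simp
  qed
  then have "limitin (powertop_real UNIV) y x sequentially"
    unfolding limitin_componentwise by simp
  then have "y \<longlonglongrightarrow> x" by (simp add: euclidean_product_topology)
  then have "(\<lambda>k. g (y k)) \<longlonglongrightarrow> g x"
    by (rule continuous_on_tendsto_compose[OF assms(1) _ assms(3)]) (simp add: y(1))
  then have "\<forall>\<^sub>F k in sequentially. \<bar>g (y k) - g x\<bar> < e"
    using assms(4) by (auto simp: tendsto_iff dist_real_def)
  then show False using y(3) by (auto dest: eventually_happens)
qed

lemma MVT_segment:
  assumes "\<And>s. s \<in> closed_segment a b \<Longrightarrow> (h has_real_derivative h' s) (at s)"
  shows "\<exists>z\<in>closed_segment a b. h b - h a = (b - a) * h' (z::real)"
proof -
  consider "a < b" | "a = b" | "b < a" by linarith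
  then show ?thesis
  proof cases
    case 1
    then show ?thesis using MVT2[OF 1, of h h'] assms by (fastforce simp: closed_segment_eq_real_ivl)
  next
    case 3
    then obtain z where "b < z" "z < a" "h a - h b = (a - b) * h' z"
      using MVT2[OF 3, of h h'] assms by (fastforce simp: closed_segment_eq_real_ivl)
    then show ?thesis by (intro bexI[of _ z]) (auto simp: closed_segment_eq_real_ivl algebra_simps)
  qed auto
qed

text \<open>The path from \<open>x\<close> to \<open>y\<close> changes one coordinate at a time
  through the corners \<open>h k\<close>. The mean value theorem on each edge compares the increment
  with the partial derivative at \<open>x\<close>, up to \<open>e\<close>.\<close>

lemma C1_increment:
  assumes V: "eopen n V" "x \<in> V" and e: "e > 0"
    and df: "\<And>i y. i < n \<Longrightarrow> y \<in> V \<Longrightarrow> (\<lambda>s. f (y(i := s))) differentiable (at (y i))"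
    and cf: "\<And>i. i < n \<Longrightarrow> continuous_on V (partial_deriv i f)"
  shows "\<exists>d>0. \<forall>y\<in>eball n x d. \<bar>f y - f x - (\<Sum>k<n. partial_deriv k f x * (y k - x k))\<bar> \<le> e * (\<Sum>k<n. \<bar>y k - x k\<bar>)"
proof -
  have Vz: "V \<subseteq> {y. \<forall>i\<ge>n. y i = 0}" using V by (auto simp: eopen_def)
  obtain d0 where d0: "d0 > 0" "eball n x d0 \<subseteq> V" using V by (auto simp: eopen_def)
  have "\<forall>i\<in>{..<n}. \<exists>d>0. \<forall>y\<in>V. (\<forall>j<n. \<bar>y j - x j\<bar> < d) \<longrightarrow> \<bar>partial_deriv i f y - partial_deriv i f x\<bar> < e"
    using continuous_on_box[OF cf Vz V(2) e] by auto
  then obtain dd where dd: "\<And>i. i < n \<Longrightarrow> dd i > 0"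
    "\<And>i y. i < n \<Longrightarrow> y \<in> V \<Longrightarrow> (\<forall>j<n. \<bar>y j - x j\<bar> < dd i) \<Longrightarrow> \<bar>partial_deriv i f y - partial_deriv i f x\<bar> < e"
    by (metis lessThan_iff)
  define d where "d = Min (insert d0 (dd ` {..<n}))"
  have d: "d > 0" "d \<le> d0" "\<And>i. i < n \<Longrightarrow> d \<le> dd i" unfolding d_def using dd(1) d0(1) by (auto simp: Min_le_iff)
  have near: "\<bar>partial_deriv i f y - partial_deriv i f x\<bar> < e \<and> y \<in> V" if "i < n" "y \<in> eball n x d" for i y
  proof -
    have "y \<in> eball n x d0" using that d(2) by (fastforce simp: eball_def)
    then have "y \<in> V" using d0(2) by blast
    then show ?thesis using dd(2)[OF that(1)] that d(3)[OF that(1)] by (fastforce simp: eball_def)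
  qed
  have main: "\<bar>f y - f x - (\<Sum>k<n. partial_deriv k f x * (y k - x k))\<bar> \<le> e * (\<Sum>k<n. \<bar>y k - x k\<bar>)"
    if y: "y \<in> eball n x d" for y
  proof -
    define h where "h k = (\<lambda>i. if i < k then y i else x i)" for k :: nat
    have h0: "h 0 = x" and hn: "h n = y"
      using y V(2) Vz by (auto simp: h_def eball_def fun_eq_iff)
    have hS: "h (Suc k) = (h k)(k := y k)" "(h k)(k := x k) = h k" for k by (auto simp: h_def fun_eq_iff)
    have step: "\<bar>f (h (Suc k)) - f (h k) - partial_deriv k f x * (y k - x k)\<bar> \<le> e * \<bar>y k - x k\<bar>" if k: "k < n" for k
    proof -
      have seg: "(h k)(k := s) \<in> eball n x d" if "s \<in> closed_segment (x k) (y k)" for s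
      proof -
        have "\<bar>s - x k\<bar> \<le> \<bar>y k - x k\<bar>" using that by (auto simp: closed_segment_eq_real_ivl split: if_splits)
        then show ?thesis using y k V(2) Vz d(1) by (auto simp: eball_def h_def)
      qed
      have "((\<lambda>s. f ((h k)(k := s))) has_real_derivative partial_deriv k f ((h k)(k := s))) (at s)"
        if "s \<in> closed_segment (x k) (y k)" for s
        using df[OF k, of "(h k)(k := s)"] near[OF k seg[OF that]]
        by (simp add: partial_deriv_def DERIV_deriv_iff_real_differentiable)
      from MVT_segment[of "x k" "y k" "\<lambda>s. f ((h k)(k := s))", OF this]
      obtain z where z: "z \<in> closed_segment (x k) (y k)"
        "f (h (Suc k)) - f (h k) = (y k - x k) * partial_deriv k f ((h k)(k := z))"
        using hS by auto
      then have "f (h (Suc k)) - f (h k) - partial_deriv k f x * (y k - x k)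
        = (partial_deriv k f ((h k)(k := z)) - partial_deriv k f x) * (y k - x k)"
        by (simp add: algebra_simps)
      then show ?thesis using near[OF k seg[OF z(1)]] by (simp add: abs_mult mult_right_mono)
    qed
    have "f y - f x - (\<Sum>k<n. partial_deriv k f x * (y k - x k))
      = (\<Sum>k<n. f (h (Suc k)) - f (h k) - partial_deriv k f x * (y k - x k))"
      using sum_lessThan_telescope[of "\<lambda>k. f (h k)" n] h0 hn by (simp add: sum_subtractf)
    also have "\<bar>\<dots>\<bar> \<le> (\<Sum>k<n. e * \<bar>y k - x k\<bar>)"
      by (rule order_trans[OF sum_abs sum_mono]) (use step in auto)
    finally show ?thesis by (simp add: sum_distrib_left)
  qed
  show ?thesis using d(1) main by blast
qed

text \<open>The curve is only known to be differentiable at the one time \<open>t\<close>, so the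
  chain rule needs total differentiability: the remainder \<open>R\<close> is small compared with
  the displacement of the curve, which in turn is bounded by a multiple of
  \<open>s - t\<close>.\<close>

lemma C1_has_diff:
  assumes V: "eopen n V"
    and df: "\<And>i y. i < n \<Longrightarrow> y \<in> V \<Longrightarrow> (\<lambda>s. f (y(i := s))) differentiable (at (y i))"
    and cf: "\<And>i. i < n \<Longrightarrow> continuous_on V (partial_deriv i f)"
  shows "has_diff (open_plots n V) n f (\<lambda>i. partial_deriv i f)"
  unfolding has_diff_def
proof (intro allI impI)
  fix x t \<xi> assume P: "(x, t, \<xi>) \<in> open_plots n V"
  define R where "R s = f (x s) - f (x t) - (\<Sum>k<n. partial_deriv k f (x t) * (x s k - x t k))" for s
  have xt: "x t \<in> V" by (rule PW_mem[OF P])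
  have dx: "((\<lambda>s. x s i) has_real_derivative \<xi> i) (at t)" if "i < n" for i using P that by (auto simp: open_plots_def)
  have q: "((\<lambda>s. (x s i - x t i) / (s - t)) \<longlongrightarrow> \<xi> i) (at t)" if "i < n" for i
    using dx[OF that] by (simp add: has_field_derivative_iff)
  have Vz: "V \<subseteq> {y. \<forall>i\<ge>n. y i = 0}" using V by (auto simp: eopen_def)
  have R0: "((\<lambda>s. R s / (s - t)) \<longlongrightarrow> 0) (at t)"
  proof (rule tendstoI)
    fix e :: real assume e: "e > 0"
    \<comment> \<open>A bound for the sum of the difference quotients of the curve near
      \<open>t\<close>. The extra 1 makes the limit stay strictly below it and keeps
      \<open>K\<close> positive.\<close>
    define K where "K = (\<Sum>k<n. \<bar>\<xi> k\<bar>) + 1"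
    have K: "K > 0" unfolding K_def by (simp add: add_nonneg_pos sum_nonneg)
    obtain d where d: "d > 0" and dR: "\<And>y. y \<in> eball n (x t) d \<Longrightarrow>
      \<bar>f y - f (x t) - (\<Sum>k<n. partial_deriv k f (x t) * (y k - x t k))\<bar> \<le> (e / K) * (\<Sum>k<n. \<bar>y k - x t k\<bar>)"
      using C1_increment[OF V xt _ df cf, of "e / K"] e K by auto
    have "\<forall>\<^sub>F s in at t. (\<Sum>k<n. \<bar>(x s k - x t k) / (s - t)\<bar>) < K"
      by (rule order_tendstoD(2)[of _ "\<Sum>k<n. \<bar>\<xi> k\<bar>"]) (use q in \<open>auto simp: K_def simp del: abs_divide intro!: tendsto_sum tendsto_rabs\<close>)
    moreover have "\<forall>\<^sub>F s in at t. \<forall>i\<in>{..<n}. \<bar>x s i - x t i\<bar> < d"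
    proof (intro eventually_ball_finite ballI)
      fix i assume "i \<in> {..<n}"
      then have "((\<lambda>s. x s i) \<longlongrightarrow> x t i) (at t)" using DERIV_isCont[OF dx] by (simp add: isCont_def)
      then show "\<forall>\<^sub>F s in at t. \<bar>x s i - x t i\<bar> < d" using d by (auto simp: tendsto_iff dist_real_def)
    qed simp
    moreover have "\<forall>\<^sub>F s in at t. x s \<in> V"
      using P by (auto simp: open_plots_def eventually_nhds_conv_at)
    moreover have "\<forall>\<^sub>F s in at t. s \<noteq> t" by (simp add: eventually_at_filter)
    ultimately show "\<forall>\<^sub>F s in at t. dist (R s / (s - t)) 0 < e"
    proof eventually_elim
      case (elim s)
      then have "x s \<in> eball n (x t) d" using Vz by (auto simp: eball_def)
      from dR[OF this] have "\<bar>R s\<bar> \<le> (e / K) * (\<Sum>k<n. \<bar>x s k - x t k\<bar>)" by (simp add: R_def)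
      then have "\<bar>R s\<bar> / \<bar>s - t\<bar> \<le> (e / K) * (\<Sum>k<n. \<bar>x s k - x t k\<bar>) / \<bar>s - t\<bar>"
        by (rule divide_right_mono) simp
      also have "\<dots> = (e / K) * (\<Sum>k<n. \<bar>(x s k - x t k) / (s - t)\<bar>)"
        by (simp add: sum_divide_distrib[symmetric])
      also have "\<dots> < (e / K) * K" using elim(1) e K by (intro mult_strict_left_mono) auto
      finally show ?case using K by (simp add: dist_real_def)
    qed
  qed
  have "((\<lambda>s. R s / (s - t) + (\<Sum>k<n. partial_deriv k f (x t) * ((x s k - x t k) / (s - t))))
      \<longlongrightarrow> 0 + (\<Sum>k<n. partial_deriv k f (x t) * \<xi> k)) (at t)"
    using R0 q by (intro tendsto_add tendsto_sum tendsto_mult tendsto_const) auto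
  moreover have "R s / (s - t) + (\<Sum>k<n. partial_deriv k f (x t) * ((x s k - x t k) / (s - t)))
     = (f (x s) - f (x t)) / (s - t)" for s
  proof -
    have "(\<Sum>k<n. partial_deriv k f (x t) * ((x s k - x t k) / (s - t)))
      = (\<Sum>k<n. partial_deriv k f (x t) * (x s k - x t k)) / (s - t)"
      by (simp add: sum_divide_distrib)
    then show ?thesis by (simp add: R_def add_divide_distrib[symmetric])
  qed
  ultimately show "((\<lambda>s. f (x s)) has_real_derivative (\<Sum>i<n. partial_deriv i f (x t) * \<xi> i)) (at t)"
    by (simp add: has_field_derivative_iff)
qed

text \<open>The passage from \<open>Ck\<close> to plots is made only for the transition maps of the
  surface; those of the higher stages are smooth by the closure properties above.\<close>

lemma Ck_imp_sm:
  assumes "eopen n V" "\<forall>k. Ck k n V f"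
  shows "smooth_along (open_plots n V) n f"
  using assms(2)
proof (coinduction arbitrary: f)
  case smooth_along
  have 1: "Ck (Suc k) n V f" for k using smooth_along by blast
  have c: "Ck k n V (partial_deriv i f)" if "i < n" for i k using 1[of k] that by simp
  have "continuous_on V (partial_deriv i f)" if "i < n" for i using c[OF that, of 0] by simp
  then have "has_diff (open_plots n V) n f (\<lambda>i. partial_deriv i f)"
    using 1[of 0] by (intro C1_has_diff[OF assms(1)]) auto
  then show ?case using c by blast
qed


subsection \<open>Orders of vanishing at 0\<close>

text \<open>\<open>f t\<close> is \<open>t\<close> times the integral of
  \<open>deriv f (t * s)\<close> over \<open>s\<close> in \<open>{0..1}\<close>. Differentiating
  under the integral turns the weighted integral \<open>G n\<close> into \<open>G (Suc n)\<close>,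
  so smoothness of \<open>G 0\<close> follows by coinduction on the range of
  \<open>G\<close>.\<close>

lemma hadamard:
  fixes e :: real
  assumes "e > 0" "real_smooth (ball 0 e) f" "f 0 = 0"
  shows "\<exists>g. real_smooth (ball 0 e) g \<and> (\<forall>t\<in>ball 0 e. f t = t * g t)"
proof -
  define D where "D n = (deriv ^^ n) f" for n
  define G where "G n t = integral {0..1} (\<lambda>s. s ^ n * D (Suc n) (t * s))" for n t
  have rsD: "real_smooth (ball 0 e) (D n)" for n unfolding D_def using rs_higher_deriv[OF assms(2)] by simp
  have dD: "(D n has_real_derivative D (Suc n) t) (at t)" if "t \<in> ball 0 e" for n t
    using rs_has_deriv[OF rsD that] by (simp add: D_def)
  have inb: "t * s \<in> ball 0 e" if "t \<in> ball 0 e" "s \<in> {0..1}" for t s :: real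
  proof -
    have "\<bar>t\<bar> * \<bar>s\<bar> \<le> \<bar>t\<bar> * 1" using that by (intro mult_left_mono) auto
    then show ?thesis using that by (auto simp: abs_mult)
  qed
  have contD: "continuous_on (ball 0 e) (D n)" for n
    using DERIV_isCont[OF dD] by (intro continuous_at_imp_continuous_on) blast
  have dG: "(G n has_real_derivative G (Suc n) t) (at t)" if t: "t \<in> ball 0 e" for n t
  proof -
    have "((\<lambda>x. integral (cbox 0 1) (\<lambda>s. s ^ n * D (Suc n) (x * s)))
       has_field_derivative integral (cbox 0 1) (\<lambda>s. s ^ Suc n * D (Suc (Suc n)) (t * s))) (at t within ball 0 e)"
    proof (rule leibniz_rule_field_derivative[where fx = "\<lambda>t s. s ^ Suc n * D (Suc (Suc n)) (t * s)"])
      fix x s :: real assume xs: "x \<in> ball 0 e" "s \<in> cbox 0 1"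
      have "((\<lambda>x. D (Suc n) (x * s)) has_real_derivative D (Suc (Suc n)) (x * s) * s) (at x)"
        using xs inb[of x s] by (intro DERIV_chain2[OF dD]) (auto intro!: derivative_eq_intros)
      from DERIV_cmult[OF this, of "s ^ n"]
      show "((\<lambda>x. s ^ n * D (Suc n) (x * s)) has_real_derivative s ^ Suc n * D (Suc (Suc n)) (x * s)) (at x within ball 0 e)"
        by (auto intro: DERIV_subset simp: algebra_simps)
    next
      fix x :: real assume "x \<in> ball 0 e"
      then have "continuous_on {0..1} (\<lambda>s. s ^ n * D (Suc n) (x * s))"
        using inb by (intro continuous_intros continuous_on_compose2[OF contD]) auto
      then show "(\<lambda>s. s ^ n * D (Suc n) (x * s)) integrable_on cbox 0 1"
        by (simp add: integrable_continuous_real)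
    next
      have "continuous_on (ball 0 e \<times> cbox 0 1) (\<lambda>p. snd p ^ Suc n * D (Suc (Suc n)) (fst p * snd p))"
        using inb by (intro continuous_intros continuous_on_compose2[OF contD]) auto
      then show "continuous_on (ball 0 e \<times> cbox 0 1) (\<lambda>(x, s). s ^ Suc n * D (Suc (Suc n)) (x * s))"
        by (simp add: case_prod_beta)
    qed (use t in auto)
    then show ?thesis using t by (simp add: G_def[abs_def] at_within_open[of t "ball 0 e"])
  qed
  have "smooth_along (real_plots (ball 0 e)) 1 g" if "g \<in> range G" for g
    using that
  proof (coinduction arbitrary: g)
    case smooth_along
    then obtain n where n: "g = G n" by blast
    have "has_diff (real_plots (ball 0 e)) 1 g (\<lambda>_. G (Suc n))" unfolding n has_diff_RP using dG by blast
    then show ?case by blast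
  qed
  then have "real_smooth (ball 0 e) (G 0)" unfolding real_smooth_def by blast
  moreover have "f t = t * G 0 t" if t: "t \<in> ball 0 e" for t
  proof -
    have "((\<lambda>s. t * D 1 (t * s)) has_integral (f (t * 1) - f (t * 0))) {0..1}"
    proof (rule fundamental_theorem_of_calculus)
      fix s :: real assume s: "s \<in> {0..1}"
      have "((\<lambda>s. D 0 (t * s)) has_real_derivative D 1 (t * s) * t) (at s)"
        using inb[OF t s] dD[of "t * s" 0] by (intro DERIV_chain2[of "D 0"]) (auto intro!: derivative_eq_intros)
      then show "((\<lambda>s. f (t * s)) has_vector_derivative t * D 1 (t * s)) (at s within {0..1})"
        by (auto simp: D_def has_real_derivative_iff_has_vector_derivative mult.commute intro: has_vector_derivative_at_within)
    qed simp
    then have "integral {0..1} (\<lambda>s. t * D 1 (t * s)) = f t" using assms(3) by (simp add: integral_unique del: integral_mult_right)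
    then show ?thesis by (simp add: G_def)
  qed
  ultimately show ?thesis by blast
qed

lemma ev_ball: "(\<forall>\<^sub>F t in nhds (a::real). P t) \<longleftrightarrow> (\<exists>e>0. \<forall>t\<in>ball a e. P t)"
  unfolding eventually_nhds_metric by (simp add: dist_commute Ball_def)

definition smooth_near_0 :: "(real \<Rightarrow> real) \<Rightarrow> bool" where
  "smooth_near_0 f \<longleftrightarrow> (\<exists>e>0. real_smooth (ball 0 e) f)"

lemma rsn_both: "smooth_near_0 f \<Longrightarrow> smooth_near_0 g \<Longrightarrow> \<exists>e>0. real_smooth (ball 0 e) f \<and> real_smooth (ball 0 e) g"
  unfolding smooth_near_0_def
proof safe
  fix d e :: real assume "d > 0" "e > 0" "real_smooth (ball 0 d) f" "real_smooth (ball 0 e) g"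
  then show "\<exists>e>0. real_smooth (ball 0 e) f \<and> real_smooth (ball 0 e) g"
    by (intro exI[of _ "min d e"]) (auto intro: rs_mono)
qed

lemma rsn_const: "smooth_near_0 (\<lambda>_. c)" and rsn_id: "smooth_near_0 (\<lambda>t. t)"
  and rsn_deriv: "smooth_near_0 f \<Longrightarrow> smooth_near_0 (deriv f)"
  unfolding smooth_near_0_def using rs_const rs_id rs_rs_deriv zero_less_one by blast+

lemma rsn_add: "smooth_near_0 f \<Longrightarrow> smooth_near_0 g \<Longrightarrow> smooth_near_0 (\<lambda>t. f t + g t)"
  and rsn_diff: "smooth_near_0 f \<Longrightarrow> smooth_near_0 g \<Longrightarrow> smooth_near_0 (\<lambda>t. f t - g t)"
  and rsn_mult: "smooth_near_0 f \<Longrightarrow> smooth_near_0 g \<Longrightarrow> smooth_near_0 (\<lambda>t. f t * g t)"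
  by (metis rsn_both smooth_near_0_def rs_add rs_diff rs_mult)+

lemma rsn_power: "smooth_near_0 f \<Longrightarrow> smooth_near_0 (\<lambda>t. f t ^ k)"
  unfolding smooth_near_0_def using rs_power by blast

lemma rsn_isCont: "smooth_near_0 f \<Longrightarrow> isCont f 0"
  unfolding smooth_near_0_def using rs_isCont by force

lemma rsn_ev: "smooth_near_0 f \<Longrightarrow> \<forall>\<^sub>F t in nhds 0. (f has_real_derivative deriv f t) (at t)"
  unfolding smooth_near_0_def ev_ball using rs_has_deriv by blast

lemma rsn_comp:
  assumes "smooth_near_0 f" "smooth_near_0 g" "g 0 = 0"
  shows "smooth_near_0 (\<lambda>t. f (g t))"
proof -
  obtain d e where de: "d > 0" "e > 0" "real_smooth (ball 0 d) f" "real_smooth (ball 0 e) g" using assms by (auto simp: smooth_near_0_def)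
  have "\<forall>\<^sub>F t in nhds 0. g t \<in> ball 0 d"
    using tendstoD[OF isCont_nhds[OF rsn_isCont[OF assms(2)]] de(1)] assms(3) by (simp add: dist_commute)
  then obtain r where r: "r > 0" "\<forall>t\<in>ball 0 r. g t \<in> ball 0 d" unfolding ev_ball by blast
  have "real_smooth (ball 0 (min e r)) (\<lambda>t. f (g t))"
    by (rule rs_comp[OF de(3) rs_mono[OF de(4)]]) (use r in auto)
  then show ?thesis unfolding smooth_near_0_def using de(2) r(1) by (intro exI[of _ "min e r"]) simp
qed

lemma rsn_divide:
  assumes "smooth_near_0 f" "smooth_near_0 g" "g 0 \<noteq> 0"
  shows "smooth_near_0 (\<lambda>t. f t / g t)"
proof -
  obtain d where d: "d > 0" "real_smooth (ball 0 d) f" "real_smooth (ball 0 d) g" using rsn_both[OF assms(1,2)] by auto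
  have "\<forall>\<^sub>F t in nhds 0. g t \<noteq> 0"
    by (rule tendsto_imp_eventually_ne[OF isCont_nhds[OF rsn_isCont[OF assms(2)]] assms(3)])
  then obtain r where r: "r > 0" "\<forall>t\<in>ball 0 r. g t \<noteq> 0" unfolding ev_ball by blast
  have "real_smooth (ball 0 (min d r)) (\<lambda>t. f t / g t)"
    by (rule rs_divide[OF rs_mono[OF d(2)] rs_mono[OF d(3)]]) (use r in auto)
  then show ?thesis unfolding smooth_near_0_def using d(1) r(1) by (intro exI[of _ "min d r"]) simp
qed

text \<open>The infimum of the empty set is \<open>\<infinity>\<close>: this is the order of every
  flat function, even of one that does not vanish near 0.\<close>

definition order_at_0 :: "(real \<Rightarrow> real) \<Rightarrow> enat" where
  "order_at_0 f = (INF n\<in>{n. (deriv ^^ n) f 0 \<noteq> 0}. enat n)"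

lemma ordz_ge_iff: "enat n \<le> order_at_0 f \<longleftrightarrow> (\<forall>m<n. (deriv ^^ m) f 0 = 0)"
  unfolding order_at_0_def le_INF_iff by (auto simp: not_le[symmetric])

lemma ordz_eq_iff: "order_at_0 f = enat n \<longleftrightarrow> (deriv ^^ n) f 0 \<noteq> 0 \<and> (\<forall>m<n. (deriv ^^ m) f 0 = 0)"
proof -
  have "order_at_0 f = enat n \<longleftrightarrow> enat n \<le> order_at_0 f \<and> \<not> enat (Suc n) \<le> order_at_0 f"
    by (auto simp: Suc_ile_eq)
  then show ?thesis unfolding ordz_ge_iff by (auto simp: less_Suc_eq)
qed

lemma enat_leI:
  assumes "\<And>n. enat n \<le> a \<Longrightarrow> enat n \<le> b"
  shows "a \<le> b"
proof (cases a)
  case infinity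
  show ?thesis
  proof (cases b)
    case (enat m)
    then show ?thesis using assms[of "Suc m"] infinity by simp
  qed simp
qed (use assms in auto)

lemma enat_eqI: "(\<And>n. enat n \<le> a \<longleftrightarrow> enat n \<le> b) \<Longrightarrow> a = b"
  by (rule order_antisym; rule enat_leI; simp)

lemma ordz_cong: "\<forall>\<^sub>F t in nhds 0. f t = g t \<Longrightarrow> order_at_0 f = order_at_0 g"
  using higher_deriv_cong_ev[of f g 0 0] unfolding order_at_0_def by simp

lemma factor_derivs:
  assumes "smooth_near_0 h" "\<forall>\<^sub>F t in nhds 0. f t = t ^ n * h t"
  shows "(\<forall>m<n. (deriv ^^ m) f 0 = 0) \<and> (deriv ^^ n) f 0 = fact n * h 0"
  using assms
proof (induction n arbitrary: f h)
  case 0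
  then show ?case by (auto dest: eventually_nhds_x_imp_x)
next
  case (Suc n)
  \<comment> \<open>The cofactor of \<open>t ^ n\<close> in the derivative of
    \<open>t ^ Suc n * h t\<close>. Its value at 0 is \<open>Suc n\<close> times \<open>h 0\<close>,
    which builds up the factorial.\<close>
  define k where "k t = real (Suc n) * h t + t * deriv h t" for t
  have k: "smooth_near_0 k" unfolding k_def using Suc.prems(1) by (intro rsn_add rsn_mult rsn_const rsn_id rsn_deriv)
  have "\<forall>\<^sub>F t in nhds 0. \<forall>\<^sub>F s in nhds t. f s = s ^ Suc n * h s"
    using Suc.prems(2) eventually_eventually by blast
  then have "\<forall>\<^sub>F t in nhds 0. deriv f t = t ^ n * k t"
    using rsn_ev[OF Suc.prems(1)]
  proof eventually_elim
    case (elim t)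
    have "((\<lambda>s. s ^ Suc n * h s) has_real_derivative (real (Suc n) * t ^ n) * h t + deriv h t * t ^ Suc n) (at t)"
      using DERIV_mult[OF DERIV_pow[of "Suc n"] elim(2)] by simp
    then have "(f has_real_derivative (real (Suc n) * t ^ n) * h t + deriv h t * t ^ Suc n) (at t)"
      using DERIV_cong_ev[OF refl elim(1) refl] by blast
    then show ?case by (auto dest!: DERIV_imp_deriv simp: k_def algebra_simps)
  qed
  from Suc.IH[OF k this] have IH: "\<forall>m<n. (deriv ^^ m) (deriv f) 0 = 0" "(deriv ^^ n) (deriv f) 0 = fact n * k 0"
    by auto
  have "f 0 = 0" using eventually_nhds_x_imp_x[OF Suc.prems(2)] by simp
  then have "(deriv ^^ m) f 0 = 0" if "m < Suc n" for m
    using IH(1) that by (cases m) (auto simp: funpow_Suc_right simp del: funpow.simps)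
  moreover have "(deriv ^^ Suc n) f 0 = fact (Suc n) * h 0"
    using IH(2) by (simp add: funpow_Suc_right k_def algebra_simps del: funpow.simps)
  ultimately show ?case by blast
qed

text \<open>Each further vanishing derivative forces the cofactor found so far to vanish at 0, and
  \<open>hadamard\<close> splits off one more factor \<open>t\<close>. Orders are afterwards
  computed with such factorizations instead of Leibniz formulas.\<close>

lemma ordz_ge_factor:
  assumes "smooth_near_0 f"
  shows "enat n \<le> order_at_0 f \<longleftrightarrow> (\<exists>h. smooth_near_0 h \<and> (\<forall>\<^sub>F t in nhds 0. f t = t ^ n * h t))"
proof
  show "\<exists>h. smooth_near_0 h \<and> (\<forall>\<^sub>F t in nhds 0. f t = t ^ n * h t) \<Longrightarrow> enat n \<le> order_at_0 f"
    using factor_derivs unfolding ordz_ge_iff by blast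
  show "enat n \<le> order_at_0 f \<Longrightarrow> \<exists>h. smooth_near_0 h \<and> (\<forall>\<^sub>F t in nhds 0. f t = t ^ n * h t)"
  proof (induction n)
    case 0
    then show ?case using assms by auto
  next
    case (Suc n)
    then have "enat n \<le> order_at_0 f" by (simp add: ordz_ge_iff)
    then obtain h where h: "smooth_near_0 h" "\<forall>\<^sub>F t in nhds 0. f t = t ^ n * h t" using Suc.IH by blast
    then have "h 0 = 0" using factor_derivs[OF h] Suc.prems by (auto simp: ordz_ge_iff)
    then obtain d g where "d > 0" "real_smooth (ball 0 d) g" "\<forall>t\<in>ball 0 d. h t = t * g t"
      using h(1) hadamard unfolding smooth_near_0_def by blast
    then have g: "smooth_near_0 g" "\<forall>\<^sub>F t in nhds 0. h t = t * g t"
      unfolding smooth_near_0_def ev_ball by blast+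
    from h(2) g(2) have "\<forall>\<^sub>F t in nhds 0. f t = t ^ Suc n * g t"
      by eventually_elim (auto simp: algebra_simps)
    then show ?case using g(1) by blast
  qed
qed

lemma ordz_factor:
  assumes "smooth_near_0 f" "order_at_0 f = enat n"
  obtains h where "smooth_near_0 h" "h 0 \<noteq> 0" "\<forall>\<^sub>F t in nhds 0. f t = t ^ n * h t"
proof -
  obtain h where h: "smooth_near_0 h" "\<forall>\<^sub>F t in nhds 0. f t = t ^ n * h t"
    using ordz_ge_factor[OF assms(1), of n] assms(2) by auto
  moreover have "h 0 \<noteq> 0" using factor_derivs[OF h] assms(2) by (simp add: ordz_eq_iff)
  ultimately show ?thesis using that by blast
qed

lemma ordz_eqI:
  assumes "smooth_near_0 h" "h 0 \<noteq> 0" "\<forall>\<^sub>F t in nhds 0. f t = t ^ n * h t"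
  shows "order_at_0 f = enat n"
  using factor_derivs[OF assms(1,3)] assms(2) by (simp add: ordz_eq_iff)

lemma ordz_0_iff: "order_at_0 f = 0 \<longleftrightarrow> f 0 \<noteq> 0"
  using ordz_eq_iff[of f 0] by (simp add: zero_enat_def)

lemma ordz_add_ge: "smooth_near_0 f \<Longrightarrow> smooth_near_0 g \<Longrightarrow> enat n \<le> order_at_0 f \<Longrightarrow> enat n \<le> order_at_0 g \<Longrightarrow> enat n \<le> order_at_0 (\<lambda>t. f t + g t)"
proof -
  assume *: "smooth_near_0 f" "smooth_near_0 g" "enat n \<le> order_at_0 f" "enat n \<le> order_at_0 g"
  then obtain h k where hk: "smooth_near_0 h" "\<forall>\<^sub>F t in nhds 0. f t = t ^ n * h t" "smooth_near_0 k" "\<forall>\<^sub>F t in nhds 0. g t = t ^ n * k t"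
    by (metis ordz_ge_factor)
  have "\<forall>\<^sub>F t in nhds 0. f t + g t = t ^ n * (h t + k t)"
    using hk(2,4) by eventually_elim (simp add: algebra_simps)
  then show ?thesis using rsn_add[OF hk(1,3)] ordz_ge_factor[OF rsn_add[OF *(1,2)]] by blast
qed

lemma ordz_mult_ge: "smooth_near_0 f \<Longrightarrow> smooth_near_0 g \<Longrightarrow> enat n \<le> order_at_0 f \<Longrightarrow> enat n \<le> order_at_0 (\<lambda>t. f t * g t)"
proof -
  assume *: "smooth_near_0 f" "smooth_near_0 g" "enat n \<le> order_at_0 f"
  then obtain h where h: "smooth_near_0 h" "\<forall>\<^sub>F t in nhds 0. f t = t ^ n * h t" by (metis ordz_ge_factor)
  have "\<forall>\<^sub>F t in nhds 0. f t * g t = t ^ n * (h t * g t)"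
    using h(2) by eventually_elim (simp add: algebra_simps)
  then show ?thesis using rsn_mult[OF h(1) *(2)] ordz_ge_factor[OF rsn_mult[OF *(1,2)]] by blast
qed

lemma ordz_mult:
  assumes "smooth_near_0 f" "smooth_near_0 g"
  shows "order_at_0 (\<lambda>t. f t * g t) = order_at_0 f + order_at_0 g"
proof -
  have inf: "order_at_0 (\<lambda>t. f t * g t) = \<infinity>" if "order_at_0 f = \<infinity>" "smooth_near_0 f" "smooth_near_0 g" for f g
  proof -
    have "enat n \<le> order_at_0 (\<lambda>t. f t * g t)" for n using ordz_mult_ge[OF that(2,3), of n] that(1) by simp
    then show ?thesis using enat_leI[of \<infinity>] by simp
  qed
  show ?thesis
  proof (cases "order_at_0 f = \<infinity> \<or> order_at_0 g = \<infinity>")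
    case True
    then show ?thesis using inf[of f g] inf[of g f] assms by (auto simp: mult.commute)
  next
    case False
    then obtain n m where nm: "order_at_0 f = enat n" "order_at_0 g = enat m" by auto
    obtain h where h: "smooth_near_0 h" "h 0 \<noteq> 0" "\<forall>\<^sub>F t in nhds 0. f t = t ^ n * h t" by (rule ordz_factor[OF assms(1) nm(1)])
    obtain k where k: "smooth_near_0 k" "k 0 \<noteq> 0" "\<forall>\<^sub>F t in nhds 0. g t = t ^ m * k t" by (rule ordz_factor[OF assms(2) nm(2)])
    have "\<forall>\<^sub>F t in nhds 0. f t * g t = t ^ (n + m) * (h t * k t)"
      using h(3) k(3) by eventually_elim (simp add: power_add algebra_simps)
    then have "order_at_0 (\<lambda>t. f t * g t) = enat (n + m)"
      using h k by (intro ordz_eqI[where h = "\<lambda>t. h t * k t"] rsn_mult) auto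
    then show ?thesis using nm by simp
  qed
qed

text \<open>The order of \<open>f - f 0\<close> (see \<open>vord_eq_ordz\<close>). Going through the
  derivative makes it positive by construction and lets relations between derivatives become sums of
  orders.\<close>

definition order_of_change :: "(real \<Rightarrow> real) \<Rightarrow> enat" where
  "order_of_change f = eSuc (order_at_0 (deriv f))"

lemma vord_ge_iff: "enat n \<le> order_of_change f \<longleftrightarrow> (\<forall>m. 0 < m \<and> m < n \<longrightarrow> (deriv ^^ m) f 0 = 0)"
proof (cases n)
  case (Suc k)
  then have "enat n \<le> order_of_change f \<longleftrightarrow> enat k \<le> order_at_0 (deriv f)" by (simp add: order_of_change_def flip: eSuc_enat)
  also have "\<dots> \<longleftrightarrow> (\<forall>m<k. (deriv ^^ Suc m) f 0 = 0)"
    by (simp add: ordz_ge_iff funpow_Suc_right del: funpow.simps)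
  also have "\<dots> \<longleftrightarrow> (\<forall>m. 0 < m \<and> m < n \<longrightarrow> (deriv ^^ m) f 0 = 0)"
    using Suc by (metis Suc_less_eq gr0_implies_Suc zero_less_Suc)
  finally show ?thesis .
qed (simp add: zero_enat_def[symmetric])

lemma deriv_power_diff_const: "(deriv ^^ Suc m) (\<lambda>t. f t - c) 0 = (deriv ^^ Suc m) f (0::real)" if "smooth_near_0 f"
proof -
  have "\<forall>\<^sub>F t in nhds 0. deriv (\<lambda>t. f t - c) t = deriv f t"
    using rsn_ev[OF that] by eventually_elim (auto intro!: DERIV_imp_deriv derivative_eq_intros)
  from higher_deriv_cong_ev[OF this refl, of m] show ?thesis
    by (simp add: funpow_Suc_right del: funpow.simps)
qed

lemma vord_eq_ordz: "smooth_near_0 f \<Longrightarrow> order_of_change f = order_at_0 (\<lambda>t. f t - f 0)"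
proof (rule enat_eqI)
  fix n assume f: "smooth_near_0 f"
  have "(deriv ^^ m) (\<lambda>t. f t - f 0) 0 = (if m = 0 then 0 else (deriv ^^ m) f 0)" for m
    using deriv_power_diff_const[OF f, of "m - 1" "f 0"] by (cases m) auto
  then have "(\<forall>m. 0 < m \<and> m < n \<longrightarrow> (deriv ^^ m) f 0 = 0) \<longleftrightarrow> (\<forall>m<n. (deriv ^^ m) (\<lambda>t. f t - f 0) 0 = 0)"
    by auto
  then show "enat n \<le> order_of_change f \<longleftrightarrow> enat n \<le> order_at_0 (\<lambda>t. f t - f 0)" unfolding vord_ge_iff ordz_ge_iff .
qed

lemma vord_eq_ordz0: "smooth_near_0 f \<Longrightarrow> f 0 = 0 \<Longrightarrow> order_of_change f = order_at_0 f"
  using vord_eq_ordz by fastforce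

lemma vord_cong: "\<forall>\<^sub>F t in nhds 0. f t = g t \<Longrightarrow> order_of_change f = order_of_change g"
  by (rule enat_eqI) (simp add: vord_ge_iff higher_deriv_cong_ev[of f g 0 0])

text \<open>Since \<open>\<phi>\<close> is divisible by \<open>t\<close>, substituting it into
  \<open>t ^ n * h t\<close> leaves a factor \<open>t ^ n\<close>.\<close>

lemma vord_le_comp:
  assumes "smooth_near_0 f" "smooth_near_0 \<phi>" "\<phi> 0 = 0"
  shows "order_of_change f \<le> order_of_change (\<lambda>t. f (\<phi> t))"
proof -
  have fp: "smooth_near_0 (\<lambda>t. f (\<phi> t))" by (rule rsn_comp[OF assms])
  have "enat n \<le> order_of_change (\<lambda>t. f (\<phi> t))" if n: "enat n \<le> order_of_change f" for n
  proof -
    have r: "smooth_near_0 (\<lambda>t. f t - f 0)" using assms(1) by (intro rsn_diff rsn_const)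
    then obtain h where h: "smooth_near_0 h" "\<forall>\<^sub>F t in nhds 0. f t - f 0 = t ^ n * h t"
      using n vord_eq_ordz[OF assms(1)] ordz_ge_factor[OF r] by auto
    have "enat 1 \<le> order_at_0 \<phi>" using assms(3) by (simp add: ordz_ge_iff)
    then obtain k where k: "smooth_near_0 k" "\<forall>\<^sub>F t in nhds 0. \<phi> t = t ^ 1 * k t"
      using ordz_ge_factor[OF assms(2)] by blast
    have "filterlim \<phi> (nhds 0) (nhds 0)"
      using isCont_nhds[OF rsn_isCont[OF assms(2)]] assms(3) by simp
    from eventually_compose_filterlim[OF h(2) this] k(2)
    have "\<forall>\<^sub>F t in nhds 0. f (\<phi> t) - f (\<phi> 0) = t ^ n * (k t ^ n * h (\<phi> t))"
      by eventually_elim (simp add: assms(3) power_mult_distrib)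
    moreover have "smooth_near_0 (\<lambda>t. k t ^ n * h (\<phi> t))"
      using k(1) rsn_comp[OF h(1) assms(2,3)] by (intro rsn_mult rsn_power)
    ultimately show ?thesis
      using ordz_ge_factor[OF rsn_diff[OF fp rsn_const]] vord_eq_ordz[OF fp] by auto
  qed
  then show ?thesis by (rule enat_leI)
qed

text \<open>The origin of all additive relations between orders. The quotient \<open>h\<close> of
  the derivatives enters with \<open>order_at_0\<close>, not with \<open>order_of_change\<close>:
  the shift by one belongs to \<open>f\<close> and \<open>g\<close> and cancels.\<close>

lemma vord_rel:
  assumes "smooth_near_0 f" "smooth_near_0 g" "smooth_near_0 h" "\<forall>\<^sub>F t in nhds 0. deriv f t = h t * deriv g t"
  shows "order_of_change f = order_at_0 h + order_of_change g"
  unfolding order_of_change_def using ordz_cong[OF assms(4)] ordz_mult[OF assms(3) rsn_deriv[OF assms(2)]]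
  by (simp add: iadd_Suc_right)

text \<open>Plots are differentiable at one time only and may be wild elsewhere. Hence a sequence
  that converges fast enough to \<open>x\<close> and violates continuity lies on a single plot,
  along which \<open>f\<close> would still be continuous at time 0.\<close>

lemma sm_imp_continuous:
  assumes V: "eopen n V" and f: "smooth_along (open_plots n V) n f" and x: "x \<in> V" and e: "e > 0"
  shows "\<exists>d>0. \<forall>y\<in>eball n x d. y \<in> V \<and> \<bar>f y - f x\<bar> < e"
proof (rule ccontr)
  assume neg: "\<not> ?thesis"
  obtain d0 where d0: "d0 > 0" "eball n x d0 \<subseteq> V" using V x by (auto simp: eopen_def)
  define r where "r k = inverse (real (Suc k))" for k
  have r: "r k > 0" for k by (simp add: r_def)
  have "\<exists>y. y \<in> eball n x (min d0 ((r k)\<^sup>2)) \<and> \<not> \<bar>f y - f x\<bar> < e" for k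
  proof -
    have "min d0 ((r k)\<^sup>2) > 0" using d0 zero_less_power[OF r, of k 2] by simp
    then obtain y where "y \<in> eball n x (min d0 ((r k)\<^sup>2))" "\<not> (y \<in> V \<and> \<bar>f y - f x\<bar> < e)"
      using neg by blast
    moreover from this(1) have "y \<in> V" using d0(2) by (auto simp: eball_def)
    ultimately show ?thesis by blast
  qed
  then obtain y where y: "\<And>k. y k \<in> eball n x (min d0 ((r k)\<^sup>2))" "\<And>k. \<not> \<bar>f (y k) - f x\<bar> < e" by metis
  have yV: "y k \<in> V" for k using y(1)[of k] d0(2) by (auto simp: eball_def)
  \<comment> \<open>At time \<open>r k\<close> the curve sits at \<open>y k\<close>, at all other
    times at \<open>x\<close>. The distance to \<open>x\<close> is at most the square of the time,
    so all components have derivative 0 at 0.\<close>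
  define \<gamma> where "\<gamma> s = (if \<exists>k. s = r k then y (THE k. s = r k) else x)" for s
  have inj: "r k = r l \<Longrightarrow> k = l" for k l by (simp add: r_def)
  have \<gamma>r: "\<gamma> (r k) = y k" for k
  proof -
    have "(THE j. r k = r j) = k" using inj by (intro the_equality) auto
    then show ?thesis by (auto simp: \<gamma>_def)
  qed
  have \<gamma>0: "\<gamma> 0 = x" using r by (auto simp: \<gamma>_def less_le)
  have \<gamma>V: "\<gamma> s \<in> V" for s
  proof (cases "\<exists>k. s = r k")
    case True then show ?thesis using yV \<gamma>r by auto
  next
    case False then show ?thesis using x by (simp add: \<gamma>_def)
  qed
  have bd: "\<bar>\<gamma> s i - x i\<bar> \<le> s\<^sup>2" if "i < n" for i s
  proof (cases "\<exists>k. s = r k")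
    case True
    then obtain k where k: "s = r k" by blast
    show ?thesis using y(1)[of k] that \<gamma>r k by (force simp: eball_def)
  next
    case False then show ?thesis by (simp add: \<gamma>_def)
  qed
  have "((\<lambda>s. \<gamma> s i) has_real_derivative 0) (at 0)" if i: "i < n" for i
    unfolding has_field_derivative_iff
  proof (rule tendsto_rabs_zero_cancel, rule tendsto_sandwich[OF _ _ tendsto_const tendsto_rabs_zero[OF tendsto_ident_at]])
    show "\<forall>\<^sub>F s in at 0. \<bar>(\<gamma> s i - \<gamma> 0 i) / (s - 0)\<bar> \<le> \<bar>s\<bar>"
    proof (rule eventually_at_filter[THEN iffD2], rule always_eventually, intro allI impI)
      fix s :: real assume "s \<noteq> 0"
      then show "\<bar>(\<gamma> s i - \<gamma> 0 i) / (s - 0)\<bar> \<le> \<bar>s\<bar>"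
        using bd[OF i, of s] by (simp add: \<gamma>0 divide_le_eq power2_eq_square abs_mult[symmetric])
    qed
  qed auto
  then have "(\<gamma>, 0, \<lambda>_. 0) \<in> open_plots n V" using \<gamma>V by (simp add: open_plots_def)
  then have "((\<lambda>s. f (\<gamma> s)) has_real_derivative (\<Sum>i<n. partial_deriv i f (\<gamma> 0) * 0)) (at 0)"
    using sm_has_diff[OF f eopen_line_open[OF V]] unfolding has_diff_def by fast
  then have "isCont (\<lambda>s. f (\<gamma> s)) 0" using DERIV_isCont by blast
  moreover have "r \<longlonglongrightarrow> 0" unfolding r_def[abs_def] by (rule LIMSEQ_inverse_real_of_nat)
  ultimately have "(\<lambda>k. f (\<gamma> (r k))) \<longlonglongrightarrow> f (\<gamma> 0)" by (rule isCont_tendsto_compose)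
  then have "\<forall>\<^sub>F k in sequentially. \<bar>f (y k) - f x\<bar> < e"
    using e by (simp add: \<gamma>r \<gamma>0 tendsto_iff dist_real_def)
  then show False using y(2) by (auto dest: eventually_happens)
qed

lemma eopen_vimage1:
  assumes "eopen n V" "smooth_along (open_plots n V) n f" "open S"
  shows "eopen n {x \<in> V. f x \<in> S}"
  unfolding eopen_def
proof (intro conjI ballI)
  show "{x \<in> V. f x \<in> S} \<subseteq> {y. \<forall>i\<ge>n. y i = 0}" using assms(1) by (auto simp: eopen_def)
  fix x assume x: "x \<in> {x \<in> V. f x \<in> S}"
  then obtain e where e: "e > 0" "\<And>y. \<bar>y - f x\<bar> < e \<Longrightarrow> y \<in> S"
    using assms(3) unfolding open_dist dist_real_def by blast
  then show "\<exists>d>0. eball n x d \<subseteq> {x \<in> V. f x \<in> S}"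
    using sm_imp_continuous[OF assms(1,2), of x e] x by blast
qed

lemma eopen_vimage:
  assumes "eopen n V" "\<And>i. i < m \<Longrightarrow> smooth_along (open_plots n V) n (h i)" "eopen m W"
  shows "eopen n {x \<in> V. (\<lambda>i. if i < m then h i x else 0) \<in> W}"
  unfolding eopen_def
proof (intro conjI ballI)
  show "{x \<in> V. (\<lambda>i. if i < m then h i x else 0) \<in> W} \<subseteq> {y. \<forall>i\<ge>n. y i = 0}"
    using assms(1) by (auto simp: eopen_def)
  fix x assume x: "x \<in> {x \<in> V. (\<lambda>i. if i < m then h i x else 0) \<in> W}"
  then obtain d where d: "d > 0" "eball m (\<lambda>i. if i < m then h i x else 0) d \<subseteq> W"
    using assms(3) by (auto simp: eopen_def)
  obtain d0 where d0: "d0 > 0" "eball n x d0 \<subseteq> V" using assms(1) x by (auto simp: eopen_def)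
  have "\<exists>r>0. \<forall>y\<in>eball n x r. \<bar>h i y - h i x\<bar> < d" if "i < m" for i
    using sm_imp_continuous[OF assms(1) assms(2)[OF that] _ d(1), of x] x by blast
  then obtain r where r: "\<And>i. i < m \<Longrightarrow> r i > 0"
    "\<And>i y. i < m \<Longrightarrow> y \<in> eball n x (r i) \<Longrightarrow> \<bar>h i y - h i x\<bar> < d" by metis
  define R where "R = Min (insert d0 (r ` {..<m}))"
  have R: "R > 0" "R \<le> d0" "\<And>i. i < m \<Longrightarrow> R \<le> r i" unfolding R_def using r(1) d0(1) by (auto simp: Min_le_iff)
  have mono: "y \<in> eball n x R \<Longrightarrow> R \<le> R' \<Longrightarrow> y \<in> eball n x R'" for y R' by (force simp: eball_def)
  have "eball n x R \<subseteq> {x \<in> V. (\<lambda>i. if i < m then h i x else 0) \<in> W}"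
  proof
    fix y assume y: "y \<in> eball n x R"
    have "(\<lambda>i. if i < m then h i y else 0) \<in> eball m (\<lambda>i. if i < m then h i x else 0) d"
      using r(2) mono[OF y R(3)] by (auto simp: eball_def)
    then show "y \<in> {x \<in> V. (\<lambda>i. if i < m then h i x else 0) \<in> W}"
      using d(2) d0(2) mono[OF y R(2)] by blast
  qed
  then show "\<exists>d>0. eball n x d \<subseteq> {x \<in> V. (\<lambda>i. if i < m then h i x else 0) \<in> W}" using R(1) by blast
qed


section \<open>Manifolds\<close>

definition cinv :: "('p, 'c) manifold \<Rightarrow> 'c \<Rightarrow> (nat \<Rightarrow> real) \<Rightarrow> 'p" where
  "cinv M c = the_inv_into (cdom M c) (coord M c)"

definition transit :: "('p, 'c) manifold \<Rightarrow> 'c \<Rightarrow> 'c \<Rightarrow> nat \<Rightarrow> (nat \<Rightarrow> real) \<Rightarrow> real" where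
  "transit M c c' i x = coord M c' (cinv M c x) i"

text \<open>With the Hausdorff axiom split off, the chart calculus of \<open>PT M\<close> is already
  available while the Hausdorff property of \<open>PT M\<close> is being proved.\<close>

definition sman0 :: "('p, 'c) manifold \<Rightarrow> bool" where
  "sman0 M \<longleftrightarrow> (\<forall>c\<in>charts M. inj_on (coord M c) (cdom M c) \<and> eopen (mdim M) (coord M c ` cdom M c)) \<and>
     (\<forall>c\<in>charts M. \<forall>c'\<in>charts M. eopen (mdim M) (coord M c ` (cdom M c \<inter> cdom M c')) \<and>
        (\<forall>i<mdim M. smooth_along (open_plots (mdim M) (coord M c ` (cdom M c \<inter> cdom M c'))) (mdim M) (transit M c c' i)))"

definition sman :: "('p, 'c) manifold \<Rightarrow> bool" where
  "sman M \<longleftrightarrow> sman0 M \<and> Hausdorff_space (mtopology M)"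

text \<open>Injectivity of the charts makes images commute with intersections; so the predicate
  inside \<open>mtopology\<close> is a topology and can be recovered from the abstract type.\<close>

lemma openin_mtopology:
  assumes "\<And>c. c \<in> charts M \<Longrightarrow> inj_on (coord M c) (cdom M c)"
  shows "openin (mtopology M) U \<longleftrightarrow>
    U \<subseteq> points M \<and> (\<forall>c\<in>charts M. eopen (mdim M) (coord M c ` (U \<inter> cdom M c)))"
proof -
  have "istopology (\<lambda>U. U \<subseteq> points M \<and> (\<forall>c\<in>charts M. eopen (mdim M) (coord M c ` (U \<inter> cdom M c))))"
    unfolding istopology_def
  proof (intro conjI allI impI ballI)
    fix S T c
    assume *: "S \<subseteq> points M \<and> (\<forall>c\<in>charts M. eopen (mdim M) (coord M c ` (S \<inter> cdom M c)))"
      "T \<subseteq> points M \<and> (\<forall>c\<in>charts M. eopen (mdim M) (coord M c ` (T \<inter> cdom M c)))"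
    then show "S \<inter> T \<subseteq> points M" by blast
    assume c: "c \<in> charts M"
    have "coord M c ` (S \<inter> T \<inter> cdom M c) = coord M c ` (S \<inter> cdom M c) \<inter> coord M c ` (T \<inter> cdom M c)"
      using assms[OF c] by (auto dest: inj_onD)
    then show "eopen (mdim M) (coord M c ` (S \<inter> T \<inter> cdom M c))" using * c eopen_Int by fastforce
  next
    fix K
    assume *: "\<forall>U\<in>K. U \<subseteq> points M \<and> (\<forall>c\<in>charts M. eopen (mdim M) (coord M c ` (U \<inter> cdom M c)))"
    then show "\<Union>K \<subseteq> points M" by blast
    fix c assume c: "c \<in> charts M"
    have "coord M c ` (\<Union>K \<inter> cdom M c) = \<Union>((\<lambda>U. coord M c ` (U \<inter> cdom M c)) ` K)" by blast
    then show "eopen (mdim M) (coord M c ` (\<Union>K \<inter> cdom M c))" using * c by (auto intro!: eopen_Union)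
  qed
  from topology_inverse'[OF this] show ?thesis
    unfolding mtopology_def openin_Euclidean_iff by simp
qed

lemma ball_real: "ball (0::real) e = {-e<..<e}" by (auto simp: dist_real_def)

definition curve_in_chart :: "('p, 'c) manifold \<Rightarrow> 'c \<Rightarrow> (real \<Rightarrow> 'p) \<Rightarrow> real set \<Rightarrow> bool" where
  "curve_in_chart M c \<gamma> T \<longleftrightarrow> \<gamma> ` T \<subseteq> cdom M c \<and> (\<forall>i<mdim M. real_smooth T (\<lambda>s. coord M c (\<gamma> s) i))"

definition smooth_at :: "('p, 'c) manifold \<Rightarrow> (real \<Rightarrow> 'p) \<Rightarrow> real \<Rightarrow> bool" where
  "smooth_at M \<gamma> t \<longleftrightarrow> (\<exists>c\<in>charts M. \<exists>e>0. curve_in_chart M c \<gamma> (ball t e))"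

lemma smooth_curve_iff: "smooth_curve M T \<gamma> \<longleftrightarrow> (\<forall>t\<in>T. smooth_at M \<gamma> t)"
  unfolding smooth_curve_def smooth_at_def curve_in_chart_def by (simp add: rs_eq_smooth_real_on)

lemma scurve_mono: "curve_in_chart M c \<gamma> T \<Longrightarrow> T' \<subseteq> T \<Longrightarrow> curve_in_chart M c \<gamma> T'"
  unfolding curve_in_chart_def using rs_mono by blast

lemma scurve_csm: "curve_in_chart M c \<gamma> T \<Longrightarrow> open T \<Longrightarrow> t \<in> T \<Longrightarrow> c \<in> charts M \<Longrightarrow> smooth_at M \<gamma> t"
  unfolding smooth_at_def by (meson openE scurve_mono)

lemma scurve_cong: "curve_in_chart M c \<gamma> T \<Longrightarrow> open T \<Longrightarrow> (\<And>t. t \<in> T \<Longrightarrow> \<gamma>' t = \<gamma> t) \<Longrightarrow> curve_in_chart M c \<gamma>' T"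
  unfolding curve_in_chart_def by (auto intro: rs_cong)

text \<open>The tangent vector at \<open>q\<close> with components \<open>\<xi>\<close> in the chart
  \<open>c\<close>, carried to all other charts by the Jacobian matrices of the transition maps. The
  zero entries follow the convention of \<open>velocity\<close>.\<close>

definition tv :: "('p, 'c) manifold \<Rightarrow> 'p \<Rightarrow> 'c \<Rightarrow> (nat \<Rightarrow> real) \<Rightarrow> 'c tvec" where
  "tv M q c \<xi> = (\<lambda>c' i. if c' \<in> charts M \<and> q \<in> cdom M c' \<and> i < mdim M
     then \<Sum>j<mdim M. partial_deriv j (transit M c c' i) (coord M c q) * \<xi> j else 0)"

lemma tv_cong: "(\<And>j. j < mdim M \<Longrightarrow> \<xi> j = \<xi>' j) \<Longrightarrow> tv M q c \<xi> = tv M q c \<xi>'"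
  unfolding tv_def by (intro ext) (auto intro: sum.cong)

lemma tv_scale: "tv M q c (\<lambda>j. r * \<xi> j) = (\<lambda>c' i. r * tv M q c \<xi> c' i)"
  unfolding tv_def by (intro ext) (auto simp: sum_distrib_left algebra_simps)

locale chartM =
  fixes M :: "('p, 'c) manifold"
  assumes M: "sman0 M"
begin

abbreviation "n \<equiv> mdim M"

lemma inj: "c \<in> charts M \<Longrightarrow> inj_on (coord M c) (cdom M c)"
  and op: "c \<in> charts M \<Longrightarrow> eopen n (coord M c ` cdom M c)"
  and op2: "c \<in> charts M \<Longrightarrow> c' \<in> charts M \<Longrightarrow> eopen n (coord M c ` (cdom M c \<inter> cdom M c'))"
  and tr: "c \<in> charts M \<Longrightarrow> c' \<in> charts M \<Longrightarrow> i < n \<Longrightarrow>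
      smooth_along (open_plots n (coord M c ` (cdom M c \<inter> cdom M c'))) n (transit M c c' i)"
  using M by (auto simp: sman0_def)

lemma openin_iff: "openin (mtopology M) U \<longleftrightarrow>
    U \<subseteq> points M \<and> (\<forall>c\<in>charts M. eopen n (coord M c ` (U \<inter> cdom M c)))"
  by (rule openin_mtopology) (rule inj)

lemma cdom_points: "c \<in> charts M \<Longrightarrow> cdom M c \<subseteq> points M"
  by (auto simp: points_def)

lemma topspace_mt: "topspace (mtopology M) = points M"
proof
  show "topspace (mtopology M) \<subseteq> points M" using openin_iff openin_topspace by blast
  have "openin (mtopology M) (points M)"
    unfolding openin_iff using op cdom_points by (auto simp: Int_absorb1)
  then show "points M \<subseteq> topspace (mtopology M)" using openin_subset by blast
qed

lemma openin_cdom: "c \<in> charts M \<Longrightarrow> openin (mtopology M) (cdom M c)"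
  unfolding openin_iff using op2 cdom_points by (auto simp: Int_commute)

lemma cinv_coord: "c \<in> charts M \<Longrightarrow> q \<in> cdom M c \<Longrightarrow> cinv M c (coord M c q) = q"
  unfolding cinv_def by (simp add: the_inv_into_f_f inj)

lemma coord_cinv: "c \<in> charts M \<Longrightarrow> x \<in> coord M c ` cdom M c \<Longrightarrow> coord M c (cinv M c x) = x"
  and cinv_cdom: "c \<in> charts M \<Longrightarrow> x \<in> coord M c ` cdom M c \<Longrightarrow> cinv M c x \<in> cdom M c"
  using cinv_coord by auto

lemma coord_0: "c \<in> charts M \<Longrightarrow> q \<in> cdom M c \<Longrightarrow> i \<ge> n \<Longrightarrow> coord M c q i = 0"
  using op unfolding eopen_def by fastforce

lemma transit_coord: "c \<in> charts M \<Longrightarrow> q \<in> cdom M c \<Longrightarrow> transit M c c' i (coord M c q) = coord M c' q i"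
  by (simp add: transit_def cinv_coord)

lemma openin_chart:
  assumes c: "c \<in> charts M" and W: "eopen n W"
  shows "openin (mtopology M) {p \<in> cdom M c. coord M c p \<in> W}"
  unfolding openin_iff
proof (intro conjI ballI)
  show "{p \<in> cdom M c. coord M c p \<in> W} \<subseteq> points M" using cdom_points[OF c] by blast
  fix c' assume c': "c' \<in> charts M"
  let ?V = "coord M c' ` (cdom M c' \<inter> cdom M c)"
  have "coord M c' ` ({p \<in> cdom M c. coord M c p \<in> W} \<inter> cdom M c')
     = {x \<in> ?V. (\<lambda>i. if i < n then transit M c' c i x else 0) \<in> W}" (is "?A = ?B")
  proof -
    have eq: "(\<lambda>i. if i < n then transit M c' c i (coord M c' p) else 0) = coord M c p"
      if "p \<in> cdom M c" "p \<in> cdom M c'" for p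
      using that transit_coord[OF c'] coord_0[OF c] by fastforce
    show ?thesis
    proof (intro set_eqI iffI)
      fix x assume "x \<in> ?A" then show "x \<in> ?B" using eq by auto
    next
      fix x assume "x \<in> ?B"
      then obtain p where "x = coord M c' p" "p \<in> cdom M c" "p \<in> cdom M c'" "coord M c p \<in> W"
        using eq by auto
      then show "x \<in> ?A" by blast
    qed
  qed
  then show "eopen n (coord M c' ` ({p \<in> cdom M c. coord M c p \<in> W} \<inter> cdom M c'))"
    using eopen_vimage[OF op2[OF c' c] tr[OF c' c] W] by simp
qed

lemma scurve_isCont: "curve_in_chart M c \<gamma> T \<Longrightarrow> t \<in> T \<Longrightarrow> i < n \<Longrightarrow> isCont (\<lambda>s. coord M c (\<gamma> s) i) t"
  unfolding curve_in_chart_def using rs_isCont by fastforce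

lemma csm_open_ev:
  assumes "smooth_at M \<gamma> t" "openin (mtopology M) U" "\<gamma> t \<in> U"
  shows "\<forall>\<^sub>F s in nhds t. \<gamma> s \<in> U"
proof -
  obtain c e where c: "c \<in> charts M" "e > 0" "curve_in_chart M c \<gamma> (ball t e)" using assms(1) by (auto simp: smooth_at_def)
  \<comment> \<open>Clipping outside the ball provides the vanishing from index \<open>n\<close> on
    that \<open>eopen_ev\<close> asks for at all times.\<close>
  define x where "x s = (if s \<in> ball t e then coord M c (\<gamma> s) else (\<lambda>_. 0))" for s
  have ins: "\<gamma> s \<in> cdom M c" if "s \<in> ball t e" for s using c(3) that by (auto simp: curve_in_chart_def)
  have evb: "\<forall>\<^sub>F s in nhds t. s \<in> ball t e" using eventually_nhds_in_open[of "ball t e" t] c(2) by simp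
  have "\<forall>\<^sub>F s in nhds t. x s \<in> coord M c ` (U \<inter> cdom M c)"
  proof (rule eopen_ev)
    show "eopen n (coord M c ` (U \<inter> cdom M c))" using assms(2) c(1) by (simp add: openin_iff)
    show "x t \<in> coord M c ` (U \<inter> cdom M c)" using assms(3) ins c(2) by (simp add: x_def)
    fix i assume "i < n"
    then have "isCont (\<lambda>s. coord M c (\<gamma> s) i) t" using scurve_isCont[OF c(3)] c(2) by simp
    moreover have "\<forall>\<^sub>F s in nhds t. x s i = coord M c (\<gamma> s) i"
      using evb by eventually_elim (simp add: x_def)
    ultimately show "isCont (\<lambda>s. x s i) t" by (subst isCont_cong)
  next
    show "\<And>s i. n \<le> i \<Longrightarrow> x s i = 0" using coord_0[OF c(1) ins] by (simp add: x_def)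
  qed
  then show ?thesis using evb
  proof eventually_elim
    case (elim s)
    then obtain q where "q \<in> U" "q \<in> cdom M c" "coord M c (\<gamma> s) = coord M c q" by (auto simp: x_def)
    then show ?case using inj[OF c(1)] ins[OF elim(2)] by (auto dest: inj_onD)
  qed
qed

lemma scurve_change:
  assumes "c \<in> charts M" "c' \<in> charts M" "curve_in_chart M c \<gamma> T" "open T" "\<gamma> ` T \<subseteq> cdom M c'"
  shows "curve_in_chart M c' \<gamma> T"
    and "t \<in> T \<Longrightarrow> i < n \<Longrightarrow> ((\<lambda>s. coord M c' (\<gamma> s) i) has_real_derivative
      (\<Sum>j<n. partial_deriv j (transit M c c' i) (coord M c (\<gamma> t)) * deriv (\<lambda>s. coord M c (\<gamma> s) j) t)) (at t)"
proof -
  let ?V = "coord M c ` (cdom M c \<inter> cdom M c')"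
  have V: "coord M c (\<gamma> s) \<in> ?V" if "s \<in> T" for s using assms(3,5) that by (auto simp: curve_in_chart_def)
  have eq: "coord M c' (\<gamma> s) i = transit M c c' i (coord M c (\<gamma> s))" if "s \<in> T" for s i
    using that assms(3) transit_coord[OF assms(1)] by (auto simp: curve_in_chart_def)
  show "curve_in_chart M c' \<gamma> T"
    unfolding curve_in_chart_def
  proof (intro conjI allI impI)
    fix i assume i: "i < n"
    have "real_smooth T (\<lambda>s. transit M c c' i (coord M c (\<gamma> s)))"
      using sm_comp_rs[OF tr[OF assms(1,2) i] _ assms(4)] V assms(3) by (auto simp: curve_in_chart_def)
    then show "real_smooth T (\<lambda>s. coord M c' (\<gamma> s) i)" by (rule rs_cong[OF _ assms(4) eq])
  qed (rule assms(5))
  assume t: "t \<in> T" and i: "i < n"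
  have evT: "\<forall>\<^sub>F s in nhds t. s \<in> T" using assms(4) t by (simp add: eventually_nhds_in_open)
  have "((\<lambda>s. transit M c c' i (coord M c (\<gamma> s))) has_real_derivative
      (\<Sum>j<n. partial_deriv j (transit M c c' i) (coord M c (\<gamma> t)) * deriv (\<lambda>s. coord M c (\<gamma> s) j) t)) (at t)"
  proof (rule sm_chain[OF tr[OF assms(1,2) i] eopen_line_open[OF op2[OF assms(1,2)]]])
    show "\<forall>\<^sub>F s in nhds t. coord M c (\<gamma> s) \<in> ?V" using evT by eventually_elim (rule V)
    show "\<And>j. j < n \<Longrightarrow> ((\<lambda>s. coord M c (\<gamma> s) j) has_real_derivative deriv (\<lambda>s. coord M c (\<gamma> s) j) t) (at t)"
      using assms(3) t rs_has_deriv unfolding curve_in_chart_def by blast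
  qed
  moreover have "\<forall>\<^sub>F s in nhds t. coord M c' (\<gamma> s) i = transit M c c' i (coord M c (\<gamma> s))"
    using evT by eventually_elim (rule eq)
  ultimately show "((\<lambda>s. coord M c' (\<gamma> s) i) has_real_derivative
      (\<Sum>j<n. partial_deriv j (transit M c c' i) (coord M c (\<gamma> t)) * deriv (\<lambda>s. coord M c (\<gamma> s) j) t)) (at t)"
    by (subst DERIV_cong_ev[OF refl _ refl])
qed

lemma csm_chart:
  assumes "smooth_at M \<gamma> t" "c \<in> charts M" "\<gamma> t \<in> cdom M c"
  obtains e where "e > 0" "curve_in_chart M c \<gamma> (ball t e)"
proof -
  obtain c0 d where c0: "c0 \<in> charts M" "d > 0" "curve_in_chart M c0 \<gamma> (ball t d)" using assms(1) by (auto simp: smooth_at_def)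
  obtain e where e: "e > 0" "\<forall>s\<in>ball t e. \<gamma> s \<in> cdom M c"
    using csm_open_ev[OF assms(1) openin_cdom[OF assms(2)] assms(3)] unfolding ev_ball by blast
  have "curve_in_chart M c \<gamma> (ball t (min d e))"
    by (rule scurve_change(1)[OF c0(1) assms(2) scurve_mono[OF c0(3)]]) (use e in auto)
  then show ?thesis using that[of "min d e"] c0(2) e(1) by simp
qed

lemma csm_deriv:
  assumes "smooth_at M \<gamma> t" "c \<in> charts M" "\<gamma> t \<in> cdom M c" "i < n"
  shows "((\<lambda>s. coord M c (\<gamma> s) i) has_real_derivative velocity M \<gamma> t c i) (at t)"
proof -
  obtain e where e: "e > 0" "curve_in_chart M c \<gamma> (ball t e)" by (rule csm_chart[OF assms(1-3)])
  then show ?thesis using assms rs_has_deriv[of "ball t e"] unfolding curve_in_chart_def by (simp add: velocity_def)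
qed

lemma velocity_tv:
  assumes "smooth_at M \<gamma> t" "c \<in> charts M" "\<gamma> t \<in> cdom M c"
  shows "velocity M \<gamma> t = tv M (\<gamma> t) c (velocity M \<gamma> t c)"
proof (intro ext)
  fix c' i
  show "velocity M \<gamma> t c' i = tv M (\<gamma> t) c (velocity M \<gamma> t c) c' i"
  proof (cases "c' \<in> charts M \<and> \<gamma> t \<in> cdom M c' \<and> i < n")
    case True
    obtain e where e: "e > 0" "curve_in_chart M c \<gamma> (ball t e)" by (rule csm_chart[OF assms])
    obtain d where d: "d > 0" "curve_in_chart M c' \<gamma> (ball t d)" using csm_chart[OF assms(1)] True by blast
    have "((\<lambda>s. coord M c' (\<gamma> s) i) has_real_derivative
      (\<Sum>j<n. partial_deriv j (transit M c c' i) (coord M c (\<gamma> t)) * deriv (\<lambda>s. coord M c (\<gamma> s) j) t)) (at t)"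
      by (rule scurve_change(2)[OF assms(2) _ scurve_mono[OF e(2)], of _ "ball t (min e d)"])
        (use True d e in \<open>auto simp: curve_in_chart_def\<close>)
    then show ?thesis using True assms(2,3) by (auto simp: velocity_def tv_def dest!: DERIV_imp_deriv intro!: sum.cong)
  qed (auto simp: velocity_def tv_def)
qed

lemma chart_curve:
  assumes "c \<in> charts M" "open T" "\<And>i. i < n \<Longrightarrow> real_smooth T (\<lambda>s. \<zeta> s i)" "\<And>s. s \<in> T \<Longrightarrow> \<zeta> s \<in> coord M c ` cdom M c"
  shows "curve_in_chart M c (\<lambda>s. cinv M c (\<zeta> s)) T"
  unfolding curve_in_chart_def
proof (intro conjI allI impI)
  show "(\<lambda>s. cinv M c (\<zeta> s)) ` T \<subseteq> cdom M c" using cinv_cdom[OF assms(1)] assms(4) by blast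
  fix i assume "i < n"
  from assms(3)[OF this] show "real_smooth T (\<lambda>s. coord M c (cinv M c (\<zeta> s)) i)"
    by (rule rs_cong[OF _ assms(2)]) (simp add: coord_cinv assms)
qed

text \<open>Straight segments in a chart realize every component vector. They also yield
  \<open>tv_nth\<close> and \<open>tv_change\<close> without any computation with Jacobian matrices,
  because a velocity obeys these rules.\<close>

lemma line_curve:
  assumes "c \<in> charts M" "q \<in> cdom M c"
  obtains \<gamma> e where "e > 0" "curve_in_chart M c \<gamma> (ball 0 e)" "\<gamma> 0 = q" "velocity M \<gamma> 0 = tv M q c \<xi>"
    "\<And>i. i < n \<Longrightarrow> velocity M \<gamma> 0 c i = \<xi> i"
proof -
  define \<zeta> where "\<zeta> s = (\<lambda>i. if i < n then coord M c q i + s * \<xi> i else 0)" for s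
  have \<zeta>0: "\<zeta> 0 = coord M c q" using coord_0[OF assms] by (auto simp: \<zeta>_def)
  have "\<forall>\<^sub>F s in nhds 0. \<zeta> s \<in> coord M c ` cdom M c"
    by (rule eopen_ev[OF op[OF assms(1)]]) (use \<zeta>0 assms in \<open>auto simp: \<zeta>_def\<close>)
  then obtain e where e: "e > 0" "\<forall>s\<in>ball 0 e. \<zeta> s \<in> coord M c ` cdom M c" unfolding ev_ball by blast
  define \<gamma> where "\<gamma> s = cinv M c (\<zeta> s)" for s
  have 1: "curve_in_chart M c \<gamma> (ball 0 e)"
    unfolding \<gamma>_def by (rule chart_curve[OF assms(1)]) (use e in \<open>auto simp: \<zeta>_def intro!: rs_add rs_mult rs_const rs_id\<close>)
  have 2: "\<gamma> 0 = q" using cinv_coord[OF assms] by (simp add: \<gamma>_def \<zeta>0)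
  have smooth_at: "smooth_at M \<gamma> 0" using 1 e assms by (auto simp: smooth_at_def)
  have 3: "velocity M \<gamma> 0 c i = \<xi> i" if i: "i < n" for i
  proof -
    have "((\<lambda>s. \<zeta> s i) has_real_derivative \<xi> i) (at 0)"
      using i by (auto simp: \<zeta>_def intro!: derivative_eq_intros)
    moreover have "\<forall>\<^sub>F s in nhds 0. coord M c (\<gamma> s) i = \<zeta> s i"
      unfolding ev_ball using e coord_cinv[OF assms(1)] by (auto simp: \<gamma>_def)
    ultimately have "((\<lambda>s. coord M c (\<gamma> s) i) has_real_derivative \<xi> i) (at 0)"
      by (subst DERIV_cong_ev[OF refl _ refl])
    then show ?thesis using csm_deriv[OF smooth_at assms(1) _ i] 2 assms(2) DERIV_unique by blast
  qed
  have "velocity M \<gamma> 0 = tv M q c \<xi>"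
    using velocity_tv[OF smooth_at assms(1)] 2 assms(2) tv_cong[of M "velocity M \<gamma> 0 c" \<xi>] 3 by simp
  then show ?thesis using that e(1) 1 2 3 by blast
qed

lemma tv_nth: "c \<in> charts M \<Longrightarrow> q \<in> cdom M c \<Longrightarrow> i < n \<Longrightarrow> tv M q c \<xi> c i = \<xi> i"
  by (metis line_curve)

lemma tv_eq_iff: "c \<in> charts M \<Longrightarrow> q \<in> cdom M c \<Longrightarrow> tv M q c \<xi> = tv M q c \<xi>' \<longleftrightarrow> (\<forall>i<n. \<xi> i = \<xi>' i)"
  by (metis tv_cong tv_nth)

lemma tv_change:
  assumes "c \<in> charts M" "q \<in> cdom M c" "c' \<in> charts M" "q \<in> cdom M c'"
  shows "tv M q c \<xi> = tv M q c' (tv M q c \<xi> c')"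
proof -
  obtain \<gamma> e where g: "e > 0" "curve_in_chart M c \<gamma> (ball 0 e)" "\<gamma> 0 = q" "velocity M \<gamma> 0 = tv M q c \<xi>"
    using line_curve[OF assms(1,2)] by metis
  then have "smooth_at M \<gamma> 0" using assms by (auto simp: smooth_at_def)
  from velocity_tv[OF this assms(3)] show ?thesis using g assms by simp
qed

lemma tv_zero_iff: "c \<in> charts M \<Longrightarrow> q \<in> cdom M c \<Longrightarrow> tv M q c \<xi> = (\<lambda>_ _. 0) \<longleftrightarrow> (\<forall>i<n. \<xi> i = 0)"
proof -
  assume c: "c \<in> charts M" "q \<in> cdom M c"
  have "(\<lambda>_ _. 0) = tv M q c (\<lambda>_. 0)" by (intro ext) (simp add: tv_def)
  then show ?thesis using tv_eq_iff[OF c] by metis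
qed

lemma tangents_iff: "v \<in> tangents M N q \<longleftrightarrow> (\<exists>\<gamma> e. e > 0 \<and> \<gamma> 0 = q \<and> v = velocity M \<gamma> 0 \<and>
    (\<forall>t\<in>ball 0 e. smooth_at M \<gamma> t \<and> \<gamma> t \<in> N))"
  unfolding tangents_def smooth_curve_iff ball_real by blast

lemma tangents_tv:
  assumes "c \<in> charts M" "q \<in> cdom M c"
  shows "tangents M (points M) q = {tv M q c \<xi> | \<xi>. True}"
proof (intro set_eqI iffI)
  fix v assume "v \<in> tangents M (points M) q"
  then obtain \<gamma> e where g: "e > 0" "\<gamma> 0 = q" "v = velocity M \<gamma> 0" "\<forall>t\<in>ball 0 e. smooth_at M \<gamma> t"
    unfolding tangents_iff by blast
  then have "smooth_at M \<gamma> 0" by simp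
  then show "v \<in> {tv M q c \<xi> | \<xi>. True}" using velocity_tv[OF _ assms(1)] g assms(2) by blast
next
  fix v assume "v \<in> {tv M q c \<xi> | \<xi>. True}"
  then obtain \<xi> where v: "v = tv M q c \<xi>" by blast
  obtain \<gamma> e where g: "e > 0" "curve_in_chart M c \<gamma> (ball 0 e)" "\<gamma> 0 = q" "velocity M \<gamma> 0 = tv M q c \<xi>"
    using line_curve[OF assms(1,2)] by metis
  then show "v \<in> tangents M (points M) q"
    unfolding tangents_iff using v scurve_csm[OF g(2) _ _ assms(1)] cdom_points[OF assms(1)]
    by (intro exI[of _ \<gamma>] exI[of _ e]) (auto simp: curve_in_chart_def)
qed

lemma csm_points: "smooth_at M \<gamma> t \<Longrightarrow> \<gamma> t \<in> points M"
  unfolding smooth_at_def curve_in_chart_def using cdom_points by fastforce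

end

subsection \<open>Projectivized tangent bundles\<close>

lemma line_of_scale: "r \<noteq> 0 \<Longrightarrow> line_of (\<lambda>c i. r * v c i) = line_of v"
proof -
  assume r: "r \<noteq> 0"
  show ?thesis unfolding line_of_def
  proof (intro set_eqI iffI)
    fix w assume "w \<in> {\<lambda>c i. ra * (r * v c i) |ra. True}"
    then obtain a where "w = (\<lambda>c i. a * (r * v c i))" by blast
    then have "w = (\<lambda>c i. (a * r) * v c i)" by (simp add: mult.assoc)
    then show "w \<in> {\<lambda>c i. r * v c i |r. True}" by blast
  next
    fix w assume "w \<in> {\<lambda>c i. r * v c i |r. True}"
    then obtain a where "w = (\<lambda>c i. a * v c i)" by blast
    then have "w = (\<lambda>c i. (a / r) * (r * v c i))" using r by simp
    then show "w \<in> {\<lambda>c i. ra * (r * v c i) |ra. True}" by blast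
  qed
qed

lemma line_of_self: "v \<in> line_of v"
  unfolding line_of_def by (auto intro!: exI[of _ 1])

lemma line_of_eqI:
  assumes "w \<in> line_of v" "w \<noteq> (\<lambda>_ _. 0)"
  shows "line_of w = line_of v"
proof -
  obtain r where r: "w = (\<lambda>c i. r * v c i)" using assms(1) by (auto simp: line_of_def)
  then have "r \<noteq> 0" using assms(2) by (auto simp: fun_eq_iff)
  then show ?thesis using line_of_scale r by simp
qed

text \<open>\<open>skip i\<close> enumerates the indices other than \<open>i\<close>, in the order
  in which \<open>proj_coord\<close> lists the ratios; \<open>unskip i\<close> is its
  inverse.\<close>

definition skip :: "nat \<Rightarrow> nat \<Rightarrow> nat" where "skip i m = (if m < i then m else Suc m)"
definition unskip :: "nat \<Rightarrow> nat \<Rightarrow> nat" where "unskip i m = (if m < i then m else m - 1)"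

lemma unskip_skip: "m \<noteq> i \<Longrightarrow> skip i (unskip i m) = m"
  by (auto simp: skip_def unskip_def)

lemma skip_bounds: "i < n \<Longrightarrow> m < n - 1 \<Longrightarrow> skip i m < n \<and> skip i m \<noteq> i"
  by (auto simp: skip_def)

lemma unskip_less: "i < n \<Longrightarrow> m < n \<Longrightarrow> m \<noteq> i \<Longrightarrow> unskip i m < n - 1"
  by (auto simp: unskip_def)

text \<open>For affine coordinates \<open>X\<close> of a line, \<open>ins n i X\<close> is the
  spanning vector with \<open>i\<close>-th component 1 and \<open>restr n X\<close> the coordinates
  of the foot. \<open>pcoord\<close> below goes back, for \<open>\<xi>\<close> normalized by
  \<open>\<xi> i = 1\<close>.\<close>

definition ins :: "nat \<Rightarrow> nat \<Rightarrow> (nat \<Rightarrow> real) \<Rightarrow> nat \<Rightarrow> real" where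
  "ins n i X = (\<lambda>m. if m = i then 1 else X (n + unskip i m))"

definition restr :: "nat \<Rightarrow> (nat \<Rightarrow> real) \<Rightarrow> nat \<Rightarrow> real" where
  "restr n X = (\<lambda>j. if j < n then X j else 0)"

definition pcoord :: "nat \<Rightarrow> nat \<Rightarrow> (nat \<Rightarrow> real) \<Rightarrow> (nat \<Rightarrow> real) \<Rightarrow> nat \<Rightarrow> real" where
  "pcoord n i x \<xi> = (\<lambda>j. if j < n then x j else if j < 2 * n - 1 then \<xi> (skip i (j - n)) else 0)"

lemma PT_simps [simp]:
  "mdim (PT M) = 2 * mdim M - 1" "charts (PT M) = {Aff c i | c i. c \<in> charts M \<and> i < mdim M}"
  "cdom (PT M) (Aff c i) = proj_dom M c i" "coord (PT M) (Aff c i) = proj_coord M c i"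
  by (simp_all add: PT_def)

locale tchartM = chartM M for M :: "('a, 'c) tmanifold"
begin

lemma lines_tangents:
  assumes "c \<in> charts M" "q \<in> cdom M c"
  shows "l \<in> lines (tangents M (points M) q) \<longleftrightarrow> (\<exists>\<xi>. l = line_of (tv M q c \<xi>) \<and> (\<exists>i<n. \<xi> i \<noteq> 0))"
  unfolding lines_def tangents_tv[OF assms] using tv_zero_iff[OF assms] by auto

lemma proj_domI:
  assumes "c \<in> charts M" "q \<in> cdom M c" "i < n" "\<xi> i \<noteq> 0"
  shows "Line q (line_of (tv M q c \<xi>)) \<in> proj_dom M c i"
proof -
  have "line_of (tv M q c \<xi>) \<in> lines (tangents M (points M) q)"
    using lines_tangents[OF assms(1,2)] assms(3,4) by blast
  moreover have "tv M q c \<xi> c i \<noteq> 0" using tv_nth[OF assms(1-3)] assms(4) by simp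
  ultimately show ?thesis unfolding proj_dom_def using assms(2) line_of_self by blast
qed

lemma proj_dom_eq:
  assumes "c \<in> charts M" "i < n"
  shows "proj_dom M c i = {Line q (line_of (tv M q c \<xi>)) | q \<xi>. q \<in> cdom M c \<and> \<xi> i = 1}"
proof (intro set_eqI iffI)
  fix P assume "P \<in> proj_dom M c i"
  then obtain q l v where P: "P = Line q l" "q \<in> cdom M c" "l \<in> lines (tangents M (points M) q)" "v \<in> l" "v c i \<noteq> 0"
    unfolding proj_dom_def by blast
  then obtain \<xi> where \<xi>: "l = line_of (tv M q c \<xi>)" using lines_tangents[OF assms(1)] by blast
  then obtain r where "v = (\<lambda>c' i. r * tv M q c \<xi> c' i)" using P(4) by (auto simp: line_of_def)
  then have i0: "\<xi> i \<noteq> 0" using P(5) tv_nth[OF assms(1) P(2) assms(2)] by auto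
  then have "line_of (tv M q c (\<lambda>j. inverse (\<xi> i) * \<xi> j)) = l"
    unfolding tv_scale \<xi> by (intro line_of_scale) simp
  moreover have "(\<lambda>j. inverse (\<xi> i) * \<xi> j) i = 1" using i0 by simp
  ultimately show "P \<in> {Line q (line_of (tv M q c \<xi>)) | q \<xi>. q \<in> cdom M c \<and> \<xi> i = 1}"
    using P(1,2) by blast
next
  fix P assume "P \<in> {Line q (line_of (tv M q c \<xi>)) | q \<xi>. q \<in> cdom M c \<and> \<xi> i = 1}"
  then obtain q \<xi> where P: "P = Line q (line_of (tv M q c \<xi>))" "q \<in> cdom M c" "\<xi> i = 1" by blast
  show "P \<in> proj_dom M c i" unfolding P(1) by (rule proj_domI) (use assms P in auto)
qed

lemma proj_coord_eq:
  assumes "c \<in> charts M" "i < n" "q \<in> cdom M c" "\<xi> i \<noteq> 0"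
  shows "proj_coord M c i (Line q (line_of (tv M q c \<xi>))) = pcoord n i (coord M c q) (\<lambda>j. \<xi> j / \<xi> i)"
proof
  fix j
  define v where "v = (SOME v. v \<in> line_of (tv M q c \<xi>) \<and> v c i \<noteq> 0)"
  have "tv M q c \<xi> \<in> line_of (tv M q c \<xi>) \<and> tv M q c \<xi> c i \<noteq> 0"
    using tv_nth[OF assms(1,3,2)] assms(4) line_of_self by simp
  then have "v \<in> line_of (tv M q c \<xi>) \<and> v c i \<noteq> 0" unfolding v_def by (rule someI[where P = "\<lambda>v. v \<in> line_of (tv M q c \<xi>) \<and> v c i \<noteq> 0"])
  then obtain r where r: "v = (\<lambda>c' j. r * tv M q c \<xi> c' j)" "r \<noteq> 0" by (auto simp: line_of_def)
  then have v: "v c m / v c i = \<xi> m / \<xi> i" if "m < n" for m using tv_nth[OF assms(1,3)] that assms(2) by simp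
  show "proj_coord M c i (Line q (line_of (tv M q c \<xi>))) j = pcoord n i (coord M c q) (\<lambda>j. \<xi> j / \<xi> i) j"
    using v[of "skip i (j - n)"] skip_bounds[OF assms(2), of "j - n"]
    unfolding proj_coord_def pcoord_def by (auto simp: Let_def skip_def v_def[symmetric])
qed

lemma pcoord_inverse:
  assumes "i < n" "\<xi> i = 1"
  shows "m < n \<Longrightarrow> ins n i (pcoord n i x \<xi>) m = \<xi> m"
proof -
  assume m: "m < n"
  have "m \<noteq> i \<Longrightarrow> n + unskip i m < 2 * n - 1" using unskip_less[OF assms(1) m] by linarith
  then show ?thesis using assms by (auto simp: ins_def pcoord_def unskip_skip)
qed

lemma restr_pcoord:
  assumes "c \<in> charts M" "q \<in> cdom M c"
  shows "restr n (pcoord n i (coord M c q) \<xi>) = coord M c q"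
  using coord_0[OF assms] by (auto simp: restr_def pcoord_def)

lemma pcoord_ins:
  assumes "i < n" "\<forall>j\<ge>2 * n - 1. X j = 0"
  shows "pcoord n i (restr n X) (ins n i X) = X"
proof
  fix j
  have "ins n i X (skip i (j - n)) = X j" if "\<not> j < n" "j < 2 * n - 1"
    using that assms(1) by (auto simp: ins_def skip_def unskip_def)
  then show "pcoord n i (restr n X) (ins n i X) j = X j" using assms(2) by (auto simp: pcoord_def restr_def)
qed

lemma proj_image:
  assumes "c \<in> charts M" "i < n"
  shows "proj_coord M c i ` proj_dom M c i = {X. (\<forall>j\<ge>2 * n - 1. X j = 0) \<and> restr n X \<in> coord M c ` cdom M c}"
proof (intro set_eqI iffI)
  fix X assume "X \<in> proj_coord M c i ` proj_dom M c i"
  then obtain q \<xi> where q: "q \<in> cdom M c" "\<xi> i = 1" "X = pcoord n i (coord M c q) \<xi>"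
    unfolding proj_dom_eq[OF assms] using proj_coord_eq[OF assms] by auto
  then show "X \<in> {X. (\<forall>j\<ge>2 * n - 1. X j = 0) \<and> restr n X \<in> coord M c ` cdom M c}"
    using restr_pcoord[OF assms(1) q(1)] assms(2) by (auto simp: pcoord_def)
next
  fix X assume "X \<in> {X. (\<forall>j\<ge>2 * n - 1. X j = 0) \<and> restr n X \<in> coord M c ` cdom M c}"
  then obtain q where q: "\<forall>j\<ge>2 * n - 1. X j = 0" "q \<in> cdom M c" "restr n X = coord M c q" by blast
  have i1: "ins n i X i = 1" by (simp add: ins_def)
  have "proj_coord M c i (Line q (line_of (tv M q c (ins n i X)))) = X"
    using proj_coord_eq[OF assms q(2), of "ins n i X"] i1 pcoord_ins[OF assms(2) q(1)] q(3) by simp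
  moreover have "Line q (line_of (tv M q c (ins n i X))) \<in> proj_dom M c i"
    unfolding proj_dom_eq[OF assms] using q(2) i1 by blast
  ultimately show "X \<in> proj_coord M c i ` proj_dom M c i" by (metis image_eqI)
qed

lemma proj_inj:
  assumes "c \<in> charts M" "i < n"
  shows "inj_on (proj_coord M c i) (proj_dom M c i)"
proof (rule inj_onI)
  fix P P' assume "P \<in> proj_dom M c i" "P' \<in> proj_dom M c i" and eq: "proj_coord M c i P = proj_coord M c i P'"
  then obtain q \<xi> q' \<xi>' where P: "P = Line q (line_of (tv M q c \<xi>))" "q \<in> cdom M c" "\<xi> i = 1"
    "P' = Line q' (line_of (tv M q' c \<xi>'))" "q' \<in> cdom M c" "\<xi>' i = 1"
    unfolding proj_dom_eq[OF assms] by blast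
  have e: "pcoord n i (coord M c q) \<xi> = pcoord n i (coord M c q') \<xi>'"
    using eq P proj_coord_eq[OF assms] by simp
  have "coord M c q = coord M c q'"
    using e restr_pcoord[OF assms(1) P(2)] restr_pcoord[OF assms(1) P(5)] by metis
  then have "q = q'" using inj[OF assms(1)] P by (auto dest: inj_onD)
  moreover have "\<forall>m<n. \<xi> m = \<xi>' m"
    using e pcoord_inverse[of i \<xi> _ "coord M c q"] pcoord_inverse[of i \<xi>' _ "coord M c q'"] assms(2) P(3,6) by metis
  ultimately show "P = P'" using P tv_cong by metis
qed

lemma eopen_restr: "eopen n V \<Longrightarrow> n \<ge> 1 \<Longrightarrow> eopen (2 * n - 1) {X. (\<forall>j\<ge>2 * n - 1. X j = 0) \<and> restr n X \<in> V}"
  unfolding eopen_def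
proof (intro conjI ballI)
  fix X assume V: "V \<subseteq> {y. \<forall>i\<ge>n. y i = 0} \<and> (\<forall>x\<in>V. \<exists>d>0. eball n x d \<subseteq> V)" and n1: "n \<ge> 1"
    and X: "X \<in> {X. (\<forall>j\<ge>2 * n - 1. X j = 0) \<and> restr n X \<in> V}"
  then obtain d where d: "d > 0" "eball n (restr n X) d \<subseteq> V" by blast
  have "eball (2 * n - 1) X d \<subseteq> {X. (\<forall>j\<ge>2 * n - 1. X j = 0) \<and> restr n X \<in> V}"
  proof
    fix Y assume Y: "Y \<in> eball (2 * n - 1) X d"
    then have "restr n Y \<in> eball n (restr n X) d" using n1 by (auto simp: eball_def restr_def)
    then show "Y \<in> {X. (\<forall>j\<ge>2 * n - 1. X j = 0) \<and> restr n X \<in> V}" using Y d(2) by (auto simp: eball_def)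
  qed
  then show "\<exists>d>0. eball (2 * n - 1) X d \<subseteq> {X. (\<forall>j\<ge>2 * n - 1. X j = 0) \<and> restr n X \<in> V}" using d(1) by blast
qed auto

text \<open>\<open>W m X\<close> is the \<open>m\<close>-th component, in the chart
  \<open>c'\<close>, of the normalized vector that spans the line with coordinates \<open>X\<close>.
  New affine coordinates are therefore quotients by \<open>W i'\<close>, and the two charts overlap
  exactly where \<open>W i'\<close> is nonzero.\<close>

lemma proj_change:
  fixes c c' i i'
  assumes c: "c \<in> charts M" "i < n" "c' \<in> charts M" "i' < n"
  defines "V \<equiv> {X. (\<forall>j\<ge>2 * n - 1. X j = 0) \<and> restr n X \<in> coord M c ` (cdom M c \<inter> cdom M c')}"
    and "W \<equiv> \<lambda>m X. \<Sum>j<n. partial_deriv j (transit M c c' m) (restr n X) * ins n i X j"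
  shows "eopen (2 * n - 1) V" "\<And>m. m < n \<Longrightarrow> smooth_along (open_plots (2 * n - 1) V) (2 * n - 1) (W m)"
    "proj_coord M c i ` (proj_dom M c i \<inter> proj_dom M c' i') = {X \<in> V. W i' X \<noteq> 0}"
    "\<And>X j. X \<in> V \<Longrightarrow> W i' X \<noteq> 0 \<Longrightarrow> j < 2 * n - 1 \<Longrightarrow> transit (PT M) (Aff c i) (Aff c' i') j X =
      (if j < n then transit M c c' j (restr n X) else W (skip i' (j - n)) X / W i' X)"
proof -
  let ?N = "2 * n - 1"
  have n1: "n \<ge> 1" using c by simp
  show V: "eopen ?N V" unfolding V_def by (rule eopen_restr[OF op2 n1]) (use c in auto)
  have sV: "smooth_along (open_plots ?N V) ?N (\<lambda>X. partial_deriv j (transit M c c' m) (restr n X))" if "m < n" "j < n" for j m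
    unfolding restr_def
  proof (rule sm_comp_PW[where h = "\<lambda>j X. X j" and f = "partial_deriv j (transit M c c' m)" and m = n
      and h' = "\<lambda>k X. if k < n then X k else 0" and V' = "coord M c ` (cdom M c \<inter> cdom M c')"])
    show "smooth_along (open_plots n (coord M c ` (cdom M c \<inter> cdom M c'))) n (partial_deriv j (transit M c c' m))"
      using sm_partial_deriv[OF tr eopen_line_open[OF op2]] c that by blast
    show "\<And>X. X \<in> V \<Longrightarrow> (\<lambda>j. if j < n then X j else 0) \<in> coord M c ` (cdom M c \<inter> cdom M c')"
      by (simp add: V_def restr_def)
  qed (use eopen_line_open[OF V] n1 in \<open>auto intro!: sm_coord\<close>)
  have si: "smooth_along (open_plots ?N V) ?N (\<lambda>X. ins n i X j)" if "j < n" for j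
    using unskip_less[OF c(2) that] by (cases "j = i") (auto simp: ins_def intro!: sm_const sm_coord)
  show sW: "smooth_along (open_plots ?N V) ?N (W m)" if "m < n" for m
    unfolding W_def using sV[OF that] si by (intro sm_sum sm_mult) auto
  have WV: "Line q (line_of (tv M q c (ins n i X))) = Line q (line_of (tv M q c' (\<lambda>m. W m X)))"
    if "restr n X = coord M c q" "q \<in> cdom M c \<inter> cdom M c'" for q X
  proof -
    have "tv M q c (ins n i X) = tv M q c' (tv M q c (ins n i X) c')" using tv_change c that by blast
    also have "\<dots> = tv M q c' (\<lambda>m. W m X)"
      by (rule tv_cong) (use c that in \<open>auto simp: tv_def W_def\<close>)
    finally show ?thesis by simp
  qed
  have form: "\<exists>q. q \<in> cdom M c \<inter> cdom M c' \<and> restr n X = coord M c q \<and>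
     cinv (PT M) (Aff c i) X = Line q (line_of (tv M q c (ins n i X)))" if X: "X \<in> V" for X
  proof -
    obtain q where q: "q \<in> cdom M c \<inter> cdom M c'" "restr n X = coord M c q" using X by (auto simp: V_def)
    have "ins n i X i = 1" by (simp add: ins_def)
    then have "Line q (line_of (tv M q c (ins n i X))) \<in> proj_dom M c i"
      "proj_coord M c i (Line q (line_of (tv M q c (ins n i X)))) = X"
      using proj_dom_eq[OF c(1,2)] proj_coord_eq[OF c(1,2), of q "ins n i X"] q pcoord_ins[OF c(2), of X] X
      by (auto simp: V_def)
    then have "cinv (PT M) (Aff c i) X = Line q (line_of (tv M q c (ins n i X)))"
      using the_inv_into_f_eq[OF proj_inj[OF c(1,2)], of "Line q (line_of (tv M q c (ins n i X)))" X]
      by (simp add: cinv_def)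
    then show ?thesis using q by blast
  qed
  show "proj_coord M c i ` (proj_dom M c i \<inter> proj_dom M c' i') = {X \<in> V. W i' X \<noteq> 0}"
  proof (intro set_eqI iffI)
    fix X assume "X \<in> proj_coord M c i ` (proj_dom M c i \<inter> proj_dom M c' i')"
    then obtain P where P: "P \<in> proj_dom M c i" "P \<in> proj_dom M c' i'" "X = proj_coord M c i P" by blast
    then obtain q \<xi> where q: "P = Line q (line_of (tv M q c \<xi>))" "q \<in> cdom M c" "\<xi> i = 1"
      unfolding proj_dom_eq[OF c(1,2)] by blast
    have qc': "q \<in> cdom M c'" using P(2) q(1) unfolding proj_dom_def by blast
    have X: "X = pcoord n i (coord M c q) \<xi>" using P(3) q proj_coord_eq[OF c(1,2)] by simp
    have XV: "X \<in> V" using restr_pcoord[OF c(1) q(2)] X q qc' n1 by (auto simp: V_def pcoord_def)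
    have \<xi>: "\<And>m. m < n \<Longrightarrow> ins n i X m = \<xi> m" using X pcoord_inverse[of i \<xi>] c(2) q(3) by simp
    have "P = Line q (line_of (tv M q c (ins n i X)))" using q(1) tv_cong[of M] \<xi> by metis
    also have "\<dots> = Line q (line_of (tv M q c' (\<lambda>m. W m X)))"
      by (rule WV) (use X q qc' restr_pcoord[OF c(1) q(2)] in auto)
    finally have "\<exists>v\<in>line_of (tv M q c' (\<lambda>m. W m X)). v c' i' \<noteq> 0" using P(2) unfolding proj_dom_def by blast
    then have "W i' X \<noteq> 0" using tv_nth[OF c(3) qc' c(4)] by (auto simp: line_of_def)
    then show "X \<in> {X \<in> V. W i' X \<noteq> 0}" using XV by blast
  next
    fix X assume X: "X \<in> {X \<in> V. W i' X \<noteq> 0}"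
    then obtain q where q: "q \<in> cdom M c \<inter> cdom M c'" "restr n X = coord M c q" by (auto simp: V_def)
    define P where "P = Line q (line_of (tv M q c (ins n i X)))"
    have i1: "ins n i X i = 1" by (simp add: ins_def)
    then have Pi: "P \<in> proj_dom M c i" unfolding P_def proj_dom_eq[OF c(1,2)] using q by blast
    have "tv M q c' (\<lambda>m. W m X) \<in> line_of (tv M q c' (\<lambda>m. W m X))" by (rule line_of_self)
    moreover have "tv M q c' (\<lambda>m. W m X) c' i' \<noteq> 0" using tv_nth[of c' q i'] c q X by simp
    moreover have "line_of (tv M q c' (\<lambda>m. W m X)) \<in> lines (tangents M (points M) q)"
      using lines_tangents[of c' q] c q X by blast
    ultimately have "P \<in> proj_dom M c' i'" unfolding P_def WV[OF q(2,1)] proj_dom_def using q(1) by blast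
    moreover have "proj_coord M c i P = X"
      using proj_coord_eq[OF c(1,2), of q "ins n i X"] q i1 pcoord_ins[OF c(2), of X] X by (auto simp: P_def V_def)
    ultimately show "X \<in> proj_coord M c i ` (proj_dom M c i \<inter> proj_dom M c' i')" using Pi by blast
  qed
  fix X j assume X: "X \<in> V" "W i' X \<noteq> 0" and j: "j < ?N"
  obtain q where q: "q \<in> cdom M c \<inter> cdom M c'" "restr n X = coord M c q"
     "cinv (PT M) (Aff c i) X = Line q (line_of (tv M q c (ins n i X)))" using form[OF X(1)] by blast
  have "coord (PT M) (Aff c' i') (cinv (PT M) (Aff c i) X) = pcoord n i' (coord M c' q) (\<lambda>m. W m X / W i' X)"
    unfolding q(3) WV[OF q(2,1)] using proj_coord_eq[OF c(3,4), of q "\<lambda>m. W m X"] q(1) X(2) by simp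
  then show "transit (PT M) (Aff c i) (Aff c' i') j X =
      (if j < n then transit M c c' j (restr n X) else W (skip i' (j - n)) X / W i' X)"
    using j q transit_coord[OF c(1)] by (auto simp: transit_def[of "PT M"] pcoord_def)
qed

lemma PT_sman0: "sman0 (PT M)"
  unfolding sman0_def
proof (intro conjI ballI allI impI)
  fix C assume "C \<in> charts (PT M)"
  then obtain c i where C: "C = Aff c i" "c \<in> charts M" "i < n" by auto
  show "inj_on (coord (PT M) C) (cdom (PT M) C)" using proj_inj C by simp
  show "eopen (mdim (PT M)) (coord (PT M) C ` cdom (PT M) C)"
    using proj_image[OF C(2,3)] eopen_restr[OF op[OF C(2)]] C by simp
  fix C' assume "C' \<in> charts (PT M)"
  then obtain c' i' where C': "C' = Aff c' i'" "c' \<in> charts M" "i' < n" by auto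
  let ?N = "2 * n - 1"
  define V where "V = {X. (\<forall>j\<ge>2 * n - 1. X j = 0) \<and> restr n X \<in> coord M c ` (cdom M c \<inter> cdom M c')}"
  define W where "W m X = (\<Sum>j<n. partial_deriv j (transit M c c' m) (restr n X) * ins n i X j)" for m X
  note * = proj_change[OF C(2,3) C'(2,3), folded V_def W_def]
  note V = *(1)
  have W: "smooth_along (open_plots ?N V) ?N (W m)" if "m < n" for m
    using *(2)[OF that] by (simp add: W_def[abs_def])
  have eq: "coord (PT M) C ` (cdom (PT M) C \<inter> cdom (PT M) C') = {X \<in> V. W i' X \<in> - {0}}"
    using *(3) C C' by auto
  have o0: "open (- {0::real})" by auto
  show op: "eopen (mdim (PT M)) (coord (PT M) C ` (cdom (PT M) C \<inter> cdom (PT M) C'))"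
    unfolding eq using o0 eopen_vimage1[OF V W[OF C'(3)], of "- {0}"] by simp
  fix j assume j: "j < mdim (PT M)"
  have lV: "line_open ?N {X \<in> V. W i' X \<in> - {0}}" using eopen_line_open[OF op] eq by simp
  have sub: "open_plots ?N {X \<in> V. W i' X \<in> - {0}} \<subseteq> open_plots ?N V" by (rule PW_mono) blast
  have "smooth_along (open_plots ?N {X \<in> V. W i' X \<in> - {0}}) ?N
     (\<lambda>X. if j < n then transit M c c' j (restr n X) else W (skip i' (j - n)) X / W i' X)"
  proof (cases "j < n")
    case True
    have "smooth_along (open_plots ?N V) ?N (\<lambda>X. transit M c c' j (restr n X))"
      unfolding restr_def
    proof (rule sm_comp_PW[where h = "\<lambda>j X. X j" and f = "transit M c c' j" and m = n
        and h' = "\<lambda>k X. if k < n then X k else 0" and V' = "coord M c ` (cdom M c \<inter> cdom M c')"])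
      show "smooth_along (open_plots n (coord M c ` (cdom M c \<inter> cdom M c'))) n (transit M c c' j)"
        using tr[OF C(2) C'(2) True] .
      show "\<And>X. X \<in> V \<Longrightarrow> (\<lambda>j. if j < n then X j else 0) \<in> coord M c ` (cdom M c \<inter> cdom M c')"
        by (simp add: V_def restr_def)
    qed (use eopen_line_open[OF V] C in \<open>auto intro!: sm_coord\<close>)
    then show ?thesis using True sm_mono[OF _ sub] by simp
  next
    case False
    then have "skip i' (j - n) < n" using skip_bounds[OF C'(3), of "j - n"] j by auto
    note sk = this
    have ne: "W i' (x t) \<noteq> 0" if "(x, t, \<xi>) \<in> open_plots ?N {X \<in> V. W i' X \<in> - {0}}" for x t \<xi>
      using PW_mem[OF that] by simp
    have "smooth_along (open_plots ?N {X \<in> V. W i' X \<in> - {0}}) ?N (\<lambda>X. W (skip i' (j - n)) X / W i' X)"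
    proof (rule sm_divide)
      show "smooth_along (open_plots ?N {X \<in> V. W i' X \<in> - {0}}) ?N (W (skip i' (j - n)))" by (rule sm_mono[OF W[OF sk] sub])
      show "smooth_along (open_plots ?N {X \<in> V. W i' X \<in> - {0}}) ?N (W i')" by (rule sm_mono[OF W[OF C'(3)] sub])
    qed (rule ne)
    then show ?thesis using False by simp
  qed
  then have "smooth_along (open_plots ?N {X \<in> V. W i' X \<in> - {0}}) ?N (transit (PT M) C C' j)"
  proof (rule sm_PW_cong)
    fix X assume "X \<in> {X \<in> V. W i' X \<in> - {0}}"
    then show "transit (PT M) C C' j X =
        (if j < n then transit M c c' j (restr n X) else W (skip i' (j - n)) X / W i' X)"
      using *(4)[of X j] j C(1) C'(1) by simp
  qed
  then show "smooth_along (open_plots (mdim (PT M)) (coord (PT M) C ` (cdom (PT M) C \<inter> cdom (PT M) C'))) (mdim (PT M)) (transit (PT M) C C' j)"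
    unfolding eq by simp
qed

end

lemma PT_chartM: "chartM M \<Longrightarrow> chartM (PT M)"
  using tchartM.PT_sman0[unfolded tchartM_def] by (simp add: chartM_def)

context tchartM begin

interpretation PT: chartM "PT M"
  by (rule PT_chartM) unfold_locales

lemma points_PT: "P \<in> points (PT M) \<longleftrightarrow>
    (\<exists>c\<in>charts M. \<exists>q\<in>cdom M c. \<exists>\<xi>. \<exists>i<n. \<xi> i \<noteq> 0 \<and> P = Line q (line_of (tv M q c \<xi>)))"
proof
  assume "P \<in> points (PT M)"
  then show "\<exists>c\<in>charts M. \<exists>q\<in>cdom M c. \<exists>\<xi>. \<exists>i<n. \<xi> i \<noteq> 0 \<and> P = Line q (line_of (tv M q c \<xi>))"
  proof -
    obtain c i where c: "c \<in> charts M" "i < n" "P \<in> proj_dom M c i"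
      using \<open>P \<in> points (PT M)\<close> by (auto simp: points_def)
    then obtain q \<xi> where "q \<in> cdom M c" "\<xi> i = 1" "P = Line q (line_of (tv M q c \<xi>))"
      unfolding proj_dom_eq[OF c(1,2)] by blast
    then show ?thesis using c(1,2) by (metis zero_neq_one)
  qed
next
  assume "\<exists>c\<in>charts M. \<exists>q\<in>cdom M c. \<exists>\<xi>. \<exists>i<n. \<xi> i \<noteq> 0 \<and> P = Line q (line_of (tv M q c \<xi>))"
  then obtain c q \<xi> i where P: "c \<in> charts M" "q \<in> cdom M c" "i < n" "\<xi> i \<noteq> 0" "P = Line q (line_of (tv M q c \<xi>))"
    by blast
  have "P \<in> proj_dom M c i" unfolding P(5) by (rule proj_domI) (use P in auto)
  then show "P \<in> points (PT M)" using PT.cdom_points[of "Aff c i"] P by auto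
qed

lemma foot_coord: "c \<in> charts M \<Longrightarrow> i < n \<Longrightarrow> P \<in> proj_dom M c i \<Longrightarrow>
    foot P \<in> cdom M c \<and> (\<forall>j<n. proj_coord M c i P j = coord M c (foot P) j)"
  by (auto simp: proj_dom_def proj_coord_def)

lemma foot_csm:
  assumes "smooth_at (PT M) \<gamma> t"
  shows "smooth_at M (foot \<circ> \<gamma>) t"
proof -
  obtain c i e where c: "c \<in> charts M" "i < n" "e > 0" "curve_in_chart (PT M) (Aff c i) \<gamma> (ball t e)"
    using assms by (auto simp: smooth_at_def)
  then have d: "\<gamma> s \<in> proj_dom M c i" if "s \<in> ball t e" for s using that by (auto simp: curve_in_chart_def)
  have "curve_in_chart M c (foot \<circ> \<gamma>) (ball t e)"
    unfolding curve_in_chart_def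
  proof (intro conjI allI impI)
    show "(foot \<circ> \<gamma>) ` ball t e \<subseteq> cdom M c" using foot_coord[OF c(1,2)] d by auto
    fix j assume j: "j < n"
    then have "real_smooth (ball t e) (\<lambda>s. coord (PT M) (Aff c i) (\<gamma> s) j)" using c(2,4) by (auto simp: curve_in_chart_def)
    then show "real_smooth (ball t e) (\<lambda>s. coord M c ((foot \<circ> \<gamma>) s) j)"
      by (rule rs_cong) (use foot_coord[OF c(1,2)] d j in auto)
  qed
  then show ?thesis using c by (auto simp: smooth_at_def)
qed

lemma foot_velocity:
  assumes "smooth_at (PT M) \<gamma> t" "c \<in> charts M" "i < n" "\<gamma> t \<in> proj_dom M c i"
  shows "velocity M (foot \<circ> \<gamma>) t = tv M (foot (\<gamma> t)) c (velocity (PT M) \<gamma> t (Aff c i))"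
proof -
  have "Aff c i \<in> charts (PT M)" "\<gamma> t \<in> cdom (PT M) (Aff c i)" using assms by auto
  from PT.csm_chart[OF assms(1) this] obtain e where e: "e > 0" "curve_in_chart (PT M) (Aff c i) \<gamma> (ball t e)" .
  have d: "\<gamma> s \<in> proj_dom M c i" if "s \<in> ball t e" for s using that e by (auto simp: curve_in_chart_def)
  have focal_param: "(foot \<circ> \<gamma>) t \<in> cdom M c" using foot_coord[OF assms(2-4)] by simp
  have "velocity M (foot \<circ> \<gamma>) t c j = velocity (PT M) \<gamma> t (Aff c i) j" if j: "j < n" for j
  proof -
    have "\<forall>\<^sub>F s in nhds t. coord M c ((foot \<circ> \<gamma>) s) j = coord (PT M) (Aff c i) (\<gamma> s) j"
      unfolding ev_ball using e(1) d foot_coord[OF assms(2,3)] j by (intro exI[of _ e]) auto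
    then have "deriv (\<lambda>s. coord M c ((foot \<circ> \<gamma>) s) j) t = deriv (\<lambda>s. coord (PT M) (Aff c i) (\<gamma> s) j) t"
      by (intro deriv_cong_ev) auto
    then show ?thesis using j focal_param assms by (auto simp: velocity_def)
  qed
  then have "tv M ((foot \<circ> \<gamma>) t) c (velocity M (foot \<circ> \<gamma>) t c) = tv M ((foot \<circ> \<gamma>) t) c (velocity (PT M) \<gamma> t (Aff c i))"
    by (rule tv_cong)
  then show ?thesis
    using velocity_tv[OF foot_csm[OF assms(1)] assms(2) focal_param] by (simp add: o_def)
qed

text \<open>By the chart formula of \<open>foot_velocity\<close>, the velocity of
  \<open>foot \<circ> \<gamma>\<close> depends only on the velocity of \<open>\<gamma>\<close>; this
  is the uniqueness behind the \<open>THE\<close> in \<open>differential\<close>.\<close>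

lemma differential_foot:
  assumes "e > 0" "\<And>t. t \<in> ball 0 e \<Longrightarrow> smooth_at (PT M) \<gamma> t"
  shows "differential (PT M) M foot (\<gamma> 0) (velocity (PT M) \<gamma> 0) = velocity M (foot \<circ> \<gamma>) 0"
  unfolding differential_def
proof (rule the_equality)
  show "\<exists>\<gamma>'. \<gamma>' 0 = \<gamma> 0 \<and> (\<exists>\<epsilon>>0. smooth_curve (PT M) {- \<epsilon><..<\<epsilon>} \<gamma>') \<and>
      velocity (PT M) \<gamma>' 0 = velocity (PT M) \<gamma> 0 \<and> velocity M (foot \<circ> \<gamma>') 0 = velocity M (foot \<circ> \<gamma>) 0"
    using assms unfolding smooth_curve_iff ball_real by (intro exI[of _ \<gamma>]) auto
  have 0: "smooth_at (PT M) \<gamma> 0" using assms by simp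
  then obtain c i where c: "c \<in> charts M" "i < n" "\<gamma> 0 \<in> proj_dom M c i"
    using PT.csm_points[OF 0] by (auto simp: points_def)
  fix w assume "\<exists>\<gamma>'. \<gamma>' 0 = \<gamma> 0 \<and> (\<exists>\<epsilon>>0. smooth_curve (PT M) {- \<epsilon><..<\<epsilon>} \<gamma>') \<and>
      velocity (PT M) \<gamma>' 0 = velocity (PT M) \<gamma> 0 \<and> velocity M (foot \<circ> \<gamma>') 0 = w"
  then obtain \<gamma>' \<epsilon> where g: "\<gamma>' 0 = \<gamma> 0" "\<epsilon> > 0" "smooth_curve (PT M) {- \<epsilon><..<\<epsilon>} \<gamma>'"
    "velocity (PT M) \<gamma>' 0 = velocity (PT M) \<gamma> 0" "velocity M (foot \<circ> \<gamma>') 0 = w" by blast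
  then have "smooth_at (PT M) \<gamma>' 0" by (simp add: smooth_curve_iff)
  from foot_velocity[OF this c(1,2)] foot_velocity[OF 0 c] c(3) g
  show "w = velocity M (foot \<circ> \<gamma>) 0" by simp
qed

lemma openin_foot:
  assumes "openin (mtopology M) U"
  shows "openin (mtopology (PT M)) {P \<in> points (PT M). foot P \<in> U}"
  unfolding PT.openin_iff
proof (intro conjI ballI)
  fix C assume "C \<in> charts (PT M)"
  then obtain c i where C: "C = Aff c i" "c \<in> charts M" "i < n" by auto
  have sub: "U \<subseteq> points M" "eopen n (coord M c ` (U \<inter> cdom M c))" using assms C by (auto simp: openin_iff)
  have "coord (PT M) C ` ({P \<in> points (PT M). foot P \<in> U} \<inter> cdom (PT M) C)
     = {X. (\<forall>j\<ge>2 * n - 1. X j = 0) \<and> restr n X \<in> coord M c ` (U \<inter> cdom M c)}" (is "?A = ?B")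
  proof (intro set_eqI iffI)
    fix X assume "X \<in> ?A"
    then obtain P where P: "P \<in> proj_dom M c i" "foot P \<in> U" "X = proj_coord M c i P" using C by auto
    then have "restr n X = coord M c (foot P)"
      using foot_coord[OF C(2,3) P(1)] coord_0[OF C(2)] by (auto simp: restr_def)
    moreover have "\<forall>j\<ge>2 * n - 1. X j = 0" using proj_image[OF C(2,3)] P by blast
    ultimately show "X \<in> ?B" using foot_coord[OF C(2,3) P(1)] P(2) by blast
  next
    fix X assume X: "X \<in> ?B"
    then obtain q where q: "q \<in> U" "q \<in> cdom M c" "restr n X = coord M c q" by blast
    then obtain P where P: "P \<in> proj_dom M c i" "X = proj_coord M c i P"
      using X proj_image[OF C(2,3)] by blast
    then have "restr n X = coord M c (foot P)"
      using foot_coord[OF C(2,3) P(1)] coord_0[OF C(2)] by (auto simp: restr_def)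
    then have "foot P = q" using inj[OF C(2)] q foot_coord[OF C(2,3) P(1)] by (auto dest: inj_onD)
    moreover have "P \<in> points (PT M)" using PT.cdom_points[of "Aff c i"] P(1) C by auto
    ultimately show "X \<in> ?A" using P C q(1) by auto
  qed
  then show "eopen (mdim (PT M)) (coord (PT M) C ` ({P \<in> points (PT M). foot P \<in> U} \<inter> cdom (PT M) C))"
    using eopen_restr[OF sub(2)] C(3) by simp
qed auto

lemma openin_coord_vimage:
  assumes "c \<in> charts M" "i < n" "j < 2 * n - 1" "open S"
  shows "openin (mtopology (PT M)) {P \<in> proj_dom M c i. proj_coord M c i P j \<in> S}"
proof -
  have C: "Aff c i \<in> charts (PT M)" using assms by auto
  have "eopen (mdim (PT M)) {X \<in> coord (PT M) (Aff c i) ` cdom (PT M) (Aff c i). X j \<in> S}"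
    by (rule eopen_vimage1[OF PT.op[OF C] sm_coord assms(4)]) (use assms in simp)
  from PT.openin_chart[OF C this]
  have "openin (mtopology (PT M)) {P \<in> proj_dom M c i. proj_coord M c i P \<in> {X \<in> proj_coord M c i ` proj_dom M c i. X j \<in> S}}"
    by simp
  moreover have "{P \<in> proj_dom M c i. proj_coord M c i P \<in> {X \<in> proj_coord M c i ` proj_dom M c i. X j \<in> S}}
    = {P \<in> proj_dom M c i. proj_coord M c i P j \<in> S}" by blast
  ultimately show ?thesis by simp
qed

text \<open>Points with different feet are separated on \<open>M\<close>. Over the same foot, two
  lines in a common affine chart are separated by one of its coordinates; lines without a common
  affine chart are the case that needs an argument.\<close>

lemma PT_Hausdorff:
  assumes "Hausdorff_space (mtopology M)"
  shows "Hausdorff_space (mtopology (PT M))"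
  unfolding Hausdorff_space_def PT.topspace_mt disjnt_def
proof (intro allI impI, elim conjE)
  fix P P' assume PP: "P \<in> points (PT M)" "P' \<in> points (PT M)" "P \<noteq> P'"
  let ?goal = "\<exists>U V. openin (mtopology (PT M)) U \<and> openin (mtopology (PT M)) V \<and> P \<in> U \<and> P' \<in> V \<and> U \<inter> V = {}"
  obtain c q \<xi> i where P: "c \<in> charts M" "q \<in> cdom M c" "i < n" "\<xi> i \<noteq> 0" "P = Line q (line_of (tv M q c \<xi>))"
    using PP(1) unfolding points_PT by blast
  obtain c' q' \<xi>' i' where P': "c' \<in> charts M" "q' \<in> cdom M c'" "i' < n" "\<xi>' i' \<noteq> 0" "P' = Line q' (line_of (tv M q' c' \<xi>'))"
    using PP(2) unfolding points_PT by blast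
  show ?goal
  proof (cases "q = q'")
    case False
    moreover have "q \<in> points M" "q' \<in> points M" using P(1,2) P'(1,2) cdom_points by blast+
    ultimately obtain U V where "openin (mtopology M) U" "openin (mtopology M) V" "q \<in> U" "q' \<in> V" "U \<inter> V = {}"
      using assms[unfolded Hausdorff_space_def topspace_mt disjnt_def, rule_format, of q q'] by auto
    then show ?thesis using openin_foot PP P(5) P'(5)
      by (intro exI[of _ "{P \<in> points (PT M). foot P \<in> U}"] exI[of _ "{P \<in> points (PT M). foot P \<in> V}"]) auto
  next
    case True
    define \<eta> where "\<eta> = tv M q' c' \<xi>' c"
    have P'\<eta>: "P' = Line q (line_of (tv M q c \<eta>))"
      unfolding P'(5) \<eta>_def True[symmetric] using tv_change[of c' q c] P P' True by simp
    have ne: "\<exists>j<n. \<eta> j \<noteq> 0"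
    proof (rule ccontr)
      assume "\<not> ?thesis"
      then have "tv M q c \<eta> = (\<lambda>_ _. 0)" using tv_zero_iff[OF P(1,2)] by blast
      then have "tv M q' c' \<xi>' = (\<lambda>_ _. 0)" using tv_change[of c' q c] P P' True by (simp add: \<eta>_def)
      then show False using tv_zero_iff[OF P'(1,2)] P'(3,4) by blast
    qed
    have dom: "Line q (line_of (tv M q c \<zeta>)) \<in> proj_dom M c j" if "\<zeta> j \<noteq> 0" "j < n" for \<zeta> j
      by (rule proj_domI) (use P that in auto)
    show ?thesis
    proof (cases "\<exists>j<n. \<xi> j \<noteq> 0 \<and> \<eta> j \<noteq> 0")
      case True
      then obtain j where j: "j < n" "\<xi> j \<noteq> 0" "\<eta> j \<noteq> 0" by blast
      have d: "P \<in> proj_dom M c j" "P' \<in> proj_dom M c j" using dom j P(5) P'\<eta> by auto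
      then have "proj_coord M c j P \<noteq> proj_coord M c j P'"
        using proj_inj[OF P(1) j(1)] PP(3) by (auto dest: inj_onD)
      then obtain k where k: "proj_coord M c j P k \<noteq> proj_coord M c j P' k" by blast
      have "k < 2 * n - 1" using proj_image[OF P(1) j(1)] d k by (metis (mono_tags, lifting) image_eqI linorder_not_le mem_Collect_eq)
      obtain S T where ST: "open S" "open T" "proj_coord M c j P k \<in> S" "proj_coord M c j P' k \<in> T" "S \<inter> T = {}"
        using hausdorff[OF k] by blast
      show ?thesis
        using openin_coord_vimage[OF P(1) j(1) \<open>k < 2 * n - 1\<close>] ST d
        by (intro exI[of _ "{P \<in> proj_dom M c j. proj_coord M c j P k \<in> S}"] exI[of _ "{P \<in> proj_dom M c j. proj_coord M c j P k \<in> T}"]) auto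
    next
      case False
      \<comment> \<open>Here \<open>\<xi> j = 0\<close> and \<open>\<eta> i = 0\<close>. The
        neighbourhoods require the ratio of component \<open>j\<close> to component
        \<open>i\<close>, respectively the inverse ratio, to be smaller than 1 in absolute value,
        which excludes each other.\<close>
      obtain j where j: "j < n" "\<eta> j \<noteq> 0" using ne by blast
      have z: "\<xi> j = 0" "\<eta> i = 0" "i \<noteq> j" using False j P(3,4) by auto
      have bnd: "n + unskip a b < 2 * n - 1" if "a < n" "b < n" "b \<noteq> a" for a b using unskip_less[OF that] that by linarith
      have val: "proj_coord M c a (Line r (line_of (tv M r c \<zeta>))) (n + unskip a b) = \<zeta> b / \<zeta> a"
        if "a < n" "b < n" "b \<noteq> a" "\<zeta> a \<noteq> 0" "r \<in> cdom M c" for a b \<zeta> r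
        using proj_coord_eq[OF P(1) that(1,5), of \<zeta>] bnd[OF that(1-3)] that by (simp add: pcoord_def unskip_skip)
      let ?U = "{Q \<in> proj_dom M c i. proj_coord M c i Q (n + unskip i j) \<in> {-1<..<1}}"
      let ?V = "{Q \<in> proj_dom M c j. proj_coord M c j Q (n + unskip j i) \<in> {-1<..<1}}"
      have "openin (mtopology (PT M)) ?U" "openin (mtopology (PT M)) ?V"
        using openin_coord_vimage[OF P(1,3) bnd[OF P(3) j(1) z(3)[symmetric]], of "{-1<..<1}"]
          openin_coord_vimage[OF P(1) j(1) bnd[OF j(1) P(3) z(3)], of "{-1<..<1}"] by auto
      moreover have "P \<in> ?U" using dom[of \<xi> i] val[of i j \<xi> q] z P j by simp
      moreover have "P' \<in> ?V" using dom[of \<eta> j] val[of j i \<eta> q] z P j P'\<eta> by simp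
      moreover have "?U \<inter> ?V = {}"
      proof (rule ccontr)
        assume "\<not> ?thesis"
        then obtain Q where Q: "Q \<in> ?U" "Q \<in> ?V" by blast
        then obtain r \<zeta> where r: "Q = Line r (line_of (tv M r c \<zeta>))" "r \<in> cdom M c" "\<zeta> i = 1"
          unfolding proj_dom_eq[OF P(1,3)] by blast
        have "Q \<in> proj_dom M c j" using Q by blast
        then have "\<exists>v\<in>line_of (tv M r c \<zeta>). v c j \<noteq> 0" unfolding proj_dom_def r(1) by blast
        then have "\<zeta> j \<noteq> 0" using tv_nth[OF P(1) r(2) j(1)] by (auto simp: line_of_def)
        then have "-1 < \<zeta> j" "\<zeta> j < 1" "-1 < 1 / \<zeta> j" "1 / \<zeta> j < 1"
          using Q val[of i j \<zeta> r] val[of j i \<zeta> r] z(3) r P(3) j(1) by auto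
        then show False using \<open>\<zeta> j \<noteq> 0\<close> by (cases "\<zeta> j > 0") (auto simp: divide_less_eq less_divide_eq)
      qed
      ultimately show ?thesis by blast
    qed
  qed
qed

end

lemma PT_sman: "sman M \<Longrightarrow> sman (PT M)"
  using tchartM.PT_sman0 tchartM.PT_Hausdorff unfolding sman_def tchartM_def chartM_def by blast


subsection \<open>The ambient manifolds of the tower\<close>

lemma base_simps [simp]:
  "mdim (base S) = mdim S" "charts (base S) = Base ` charts S"
  "cdom (base S) (Base b) = Pt ` cdom S b" "coord (base S) (Base b) = (\<lambda>q. coord S b (root q))"
  by (simp_all add: base_def)

lemma base_sman:
  fixes S :: "('a, 'b) manifold"
  assumes "smooth_manifold S"
  shows "sman (base S)"
proof -
  let ?n = "mdim S"
  have inj: "inj_on (coord S b) (cdom S b)" if "b \<in> charts S" for b using assms that by (auto simp: smooth_manifold_def)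
  have injB: "inj_on (\<lambda>q :: ('a, 'b) pt. coord S b (root q)) (Pt ` cdom S b)" if "b \<in> charts S" for b
    using inj[OF that] by (auto intro!: inj_onI dest: inj_onD)
  have img: "(\<lambda>q. coord S b (root q)) ` (Pt ` A) = coord S b ` A" for b A by (auto simp: image_image)
  have int: "Pt ` A \<inter> Pt ` B = Pt ` (A \<inter> B)" for A B :: "'a set" by blast
  have inv: "the_inv_into (Pt ` cdom S b) (\<lambda>q :: ('a, 'b) pt. coord S b (root q)) x = Pt (the_inv_into (cdom S b) (coord S b) x)"
    if b: "b \<in> charts S" and x: "x \<in> coord S b ` cdom S b" for b x
  proof -
    obtain q where q: "q \<in> cdom S b" "x = coord S b q" using x by blast
    show ?thesis
      using the_inv_into_f_eq[OF injB[OF b], of "Pt q" x] the_inv_into_f_f[OF inj[OF b] q(1)] q by simp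
  qed
  have "sman0 (base S)"
    unfolding sman0_def
  proof (intro conjI ballI allI impI)
    fix C assume "C \<in> charts (base S)"
    then obtain b where b: "C = Base b" "b \<in> charts S" by auto
    show "inj_on (coord (base S) C) (cdom (base S) C)" using injB b by simp
    show "eopen (mdim (base S)) (coord (base S) C ` cdom (base S) C)"
      using assms b by (auto simp: img smooth_manifold_def openin_Euclidean_iff)
    fix C' assume "C' \<in> charts (base S)"
    then obtain b' where b': "C' = Base b'" "b' \<in> charts S" by auto
    show op: "eopen (mdim (base S)) (coord (base S) C ` (cdom (base S) C \<inter> cdom (base S) C'))"
      using assms b b' by (auto simp: img int smooth_manifold_def openin_Euclidean_iff)
    fix i assume i: "i < mdim (base S)"
    let ?V = "coord S b ` (cdom S b \<inter> cdom S b')"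
    have "smooth_along (open_plots ?n ?V) ?n (\<lambda>x. coord S b' (the_inv_into (cdom S b) (coord S b) x) i)"
      using assms b b' i by (intro Ck_imp_sm) (auto simp: smooth_manifold_def openin_Euclidean_iff)
    moreover have "transit (base S) C C' i x = coord S b' (the_inv_into (cdom S b) (coord S b) x) i" if "x \<in> ?V" for x
    proof -
      have "x \<in> coord S b ` cdom S b" using that by blast
      from inv[OF b(2) this] show ?thesis using b b' by (simp add: transit_def cinv_def)
    qed
    ultimately have "smooth_along (open_plots ?n ?V) ?n (transit (base S) C C' i)"
      by (rule sm_PW_cong)
    then show "smooth_along (open_plots (mdim (base S)) (coord (base S) C ` (cdom (base S) C \<inter> cdom (base S) C'))) (mdim (base S)) (transit (base S) C C' i)"
      using b b' by (simp add: int img)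
  qed
  moreover have "Hausdorff_space (mtopology (base S))"
    unfolding Hausdorff_space_def
  proof (intro allI impI, elim conjE)
    interpret B: chartM "base S" by unfold_locales fact
    have pts: "points (base S) = Pt ` points S" by (auto simp: points_def)
    have iffS: "openin (mtopology S) U \<longleftrightarrow>
        U \<subseteq> points S \<and> (\<forall>c\<in>charts S. eopen (mdim S) (coord S c ` (U \<inter> cdom S c)))" for U
      by (rule openin_mtopology) (rule inj)
    have op: "openin (mtopology (base S)) (Pt ` U)" if "openin (mtopology S) U" for U
      using that unfolding iffS B.openin_iff by (auto simp: pts int img)
    fix P P' assume "P \<in> topspace (mtopology (base S))" "P' \<in> topspace (mtopology (base S))" "P \<noteq> P'"
    then obtain x y where xy: "P = Pt x" "P' = Pt y" "x \<in> points S" "y \<in> points S" "x \<noteq> y"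
      unfolding B.topspace_mt pts by auto
    have "points S \<inter> cdom S c = cdom S c" if "c \<in> charts S" for c using that by (auto simp: points_def)
    then have "openin (mtopology S) (points S)"
      unfolding iffS using assms by (simp add: smooth_manifold_def openin_Euclidean_iff)
    then have "x \<in> topspace (mtopology S)" "y \<in> topspace (mtopology S)" using xy openin_subset by blast+
    then obtain U V where UV: "openin (mtopology S) U" "openin (mtopology S) V" "x \<in> U" "y \<in> V" "disjnt U V"
      using assms xy(5) unfolding smooth_manifold_def Hausdorff_space_def by meson
    then show "\<exists>U V. openin (mtopology (base S)) U \<and> openin (mtopology (base S)) V \<and> P \<in> U \<and> P' \<in> V \<and> disjnt U V"
      using op xy by (intro exI[of _ "Pt ` U"] exI[of _ "Pt ` V"]) (auto simp: disjnt_def)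
  qed
  ultimately show ?thesis by (simp add: sman_def)
qed

lemma ambient_sman: "smooth_manifold S \<Longrightarrow> sman (ambient S k)"
  by (induction k) (auto intro: base_sman PT_sman)

section \<open>Curve germs\<close>

lemma ivl_sub: "{-e<..<e} \<subseteq> {-e..(e::real)}"
  by (simp add: subset_iff)

lemma deriv_nonzero_inj:
  fixes f :: "real \<Rightarrow> real"
  assumes "\<And>t. a < t \<Longrightarrow> t < b \<Longrightarrow> (f has_real_derivative f' t) (at t) \<and> f' t \<noteq> 0" "continuous_on {a..b} f"
  shows "inj_on f {a..b}"
proof (rule linorder_inj_onI')
  fix x y assume xy: "x \<in> {a..b}" "y \<in> {a..b}" "x < y"
  show "f x \<noteq> f y"
  proof
    assume "f x = f y"
    moreover have "continuous_on {x..y} f" by (rule continuous_on_subset[OF assms(2)]) (use xy in auto)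
    moreover have "f differentiable (at z)" if "x < z" "z < y" for z
      using assms(1)[of z] that xy by (auto simp: real_differentiable_def)
    ultimately obtain z where z: "x < z" "z < y" "(f has_real_derivative 0) (at z)"
      using Rolle[OF xy(3)] by blast
    then show False using assms(1)[of z] xy DERIV_unique by fastforce
  qed
qed

text \<open>The inverse function theorem in one variable. Smoothness of \<open>\<psi>\<close> is a
  coinduction on all functions \<open>h \<circ> \<psi>\<close>, a class closed under differentiation
  because the derivative of \<open>h \<circ> \<psi>\<close> is
  \<open>(deriv h / deriv f) \<circ> \<psi>\<close>.\<close>

lemma rs_inverse:
  assumes "smooth_near_0 f" "deriv f 0 \<noteq> 0"
  shows "\<exists>d>0. \<exists>\<psi>. (\<forall>s\<in>ball 0 d. \<psi> (f s) = s) \<and> smooth_near_0 (\<lambda>y. \<psi> (f 0 + y))"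
proof -
  obtain e where e: "e > 0" "real_smooth (ball 0 e) f" using assms(1) by (auto simp: smooth_near_0_def)
  have "\<forall>\<^sub>F t in nhds 0. deriv f t \<noteq> 0"
    by (rule tendsto_imp_eventually_ne[OF isCont_nhds[OF rsn_isCont[OF rsn_deriv[OF assms(1)]]] assms(2)])
  then obtain d0 where d0: "d0 > 0" "\<forall>t\<in>ball 0 d0. deriv f t \<noteq> 0" unfolding ev_ball by blast
  define d where "d = min e d0 / 2"
  have d: "d > 0" "d < e" "d < d0" using e d0 by (auto simp: d_def)
  have df: "(f has_real_derivative deriv f t) (at t)" "deriv f t \<noteq> 0" if "t \<in> {-d..d}" for t
    using rs_has_deriv[OF e(2), of t] d0(2) that d by auto
  have cont: "continuous_on {-d..d} f"
    using DERIV_isCont[OF df(1)] by (intro continuous_at_imp_continuous_on) blast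
  have inj: "inj_on f {-d..d}" by (rule deriv_nonzero_inj[OF _ cont, of "deriv f"]) (use df in auto)
  define \<psi> where "\<psi> = the_inv_into {-d..d} f"
  have \<psi>: "\<psi> (f s) = s" if "s \<in> {-d..d}" for s unfolding \<psi>_def by (rule the_inv_into_f_f[OF inj that])
  define Y where "Y = f ` {-d<..<d}"
  have oY: "open Y" unfolding Y_def
    by (rule invariance_of_domain) (auto intro: continuous_on_subset[OF cont] inj_on_subset[OF inj])
  have \<psi>Y: "\<psi> y \<in> {-d<..<d}" "f (\<psi> y) = y" if "y \<in> Y" for y using that \<psi> by (auto simp: Y_def)
  have d\<psi>: "(\<psi> has_real_derivative inverse (deriv f (\<psi> y))) (at y)" if y: "y \<in> Y" for y
  proof -
    obtain r where r: "r > 0" "ball y r \<subseteq> Y" using oY y open_contains_ball by blast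
    have s: "\<psi> y \<in> {-d<..<d}" "f (\<psi> y) = y" using \<psi>Y y by auto
    show ?thesis
    proof (rule DERIV_inverse_function[where a = "y - r" and b = "y + r"])
      show "(f has_real_derivative deriv f (\<psi> y)) (at (\<psi> y))" "deriv f (\<psi> y) \<noteq> 0" using df s(1) by auto
      show "\<And>z. y - r < z \<Longrightarrow> z < y + r \<Longrightarrow> f (\<psi> z) = z" using \<psi>Y(2) r(2) by (auto simp: subset_iff dist_real_def)
      have "isCont \<psi> (f (\<psi> y))"
        by (rule isCont_inverse_function2[of "-d" _ d]) (use s \<psi> DERIV_isCont[OF df(1)] in auto)
      then show "isCont \<psi> y" using s by simp
    qed (use r in auto)
  qed
  have smooth_along: "smooth_along (real_plots Y) 1 g" if "\<exists>h. real_smooth {-d<..<d} h \<and> g = (\<lambda>y. h (\<psi> y))" for g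
    using that
  proof (coinduction arbitrary: g)
    case smooth_along
    then obtain h where h: "real_smooth {-d<..<d} h" "g = (\<lambda>y. h (\<psi> y))" by blast
    define k where "k s = deriv h s / deriv f s" for s
    have sub: "{-d<..<d} \<subseteq> ball 0 e" using d by auto
    have "real_smooth {-d<..<d} k" unfolding k_def
      by (rule rs_divide) (use rs_rs_deriv[OF h(1)] rs_rs_deriv[OF rs_mono[OF e(2) sub]] df in auto)
    moreover have "has_diff (real_plots Y) 1 g (\<lambda>_ y. k (\<psi> y))"
      unfolding has_diff_RP h(2)
    proof
      fix y assume y: "y \<in> Y"
      have "((\<lambda>y. h (\<psi> y)) has_real_derivative deriv h (\<psi> y) * inverse (deriv f (\<psi> y))) (at y)"
        by (rule DERIV_chain2[OF rs_has_deriv[OF h(1)] d\<psi>]) (use \<psi>Y y in auto)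
      then show "((\<lambda>y. h (\<psi> y)) has_real_derivative k (\<psi> y)) (at y)" by (simp add: k_def divide_inverse)
    qed
    ultimately show ?case by blast
  qed
  have rsY: "real_smooth Y \<psi>" unfolding real_smooth_def by (rule smooth_along) (intro exI[of _ "\<lambda>s. s"], simp add: rs_id)
  have "f 0 \<in> Y" using d by (auto simp: Y_def)
  then obtain r where r: "r > 0" "ball (f 0) r \<subseteq> Y" using oY open_contains_ball by blast
  have "real_smooth (ball 0 r) (\<lambda>y. \<psi> (f 0 + y))"
    by (rule rs_comp[OF rsY]) (use r in \<open>auto intro!: rs_add rs_const rs_id simp: subset_iff dist_real_def\<close>)
  then have "smooth_near_0 (\<lambda>y. \<psi> (f 0 + y))" using r(1) by (auto simp: smooth_near_0_def)
  moreover have "\<forall>s\<in>ball 0 d. \<psi> (f s) = s"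
  proof
    fix s :: real assume "s \<in> ball 0 d"
    then show "\<psi> (f s) = s" by (intro \<psi>) auto
  qed
  ultimately show ?thesis using d(1) by blast
qed

text \<open>Near 0 the derivative of \<open>F \<circ> \<zeta>\<close> is a combination, with smooth
  coefficients, of the derivatives of the components; so a smooth map cannot lower orders.\<close>

lemma vord_multi:
  assumes "smooth_along (open_plots n V) n F" "line_open n V" "\<And>i. i < n \<Longrightarrow> smooth_near_0 (\<lambda>t. \<zeta> t i)" "\<forall>\<^sub>F t in nhds 0. \<zeta> t \<in> V"
  shows "smooth_near_0 (\<lambda>t. F (\<zeta> t))" "(\<And>i. i < n \<Longrightarrow> enat k \<le> order_of_change (\<lambda>t. \<zeta> t i)) \<Longrightarrow> enat k \<le> order_of_change (\<lambda>t. F (\<zeta> t))"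
proof -
  have "\<forall>i\<in>{..<n}. \<exists>e>0. real_smooth (ball 0 e) (\<lambda>t. \<zeta> t i)" using assms(3) by (auto simp: smooth_near_0_def)
  then obtain ee where ee: "\<And>i. i < n \<Longrightarrow> ee i > 0" "\<And>i. i < n \<Longrightarrow> real_smooth (ball 0 (ee i)) (\<lambda>t. \<zeta> t i)"
    by (metis lessThan_iff)
  obtain e0 where e0: "e0 > 0" "\<forall>t\<in>ball 0 e0. \<zeta> t \<in> V" using assms(4) unfolding ev_ball by blast
  define e where "e = Min (insert e0 (ee ` {..<n}))"
  have e: "e > 0" "e \<le> e0" "\<And>i. i < n \<Longrightarrow> e \<le> ee i" unfolding e_def using ee(1) e0(1) by (auto simp: Min_le_iff)
  have r\<zeta>: "real_smooth (ball 0 e) (\<lambda>t. \<zeta> t i)" if "i < n" for i by (rule rs_mono[OF ee(2)[OF that]]) (use e(3)[OF that] in auto)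
  have rcomp: "smooth_near_0 (\<lambda>t. F (\<zeta> t))" if "smooth_along (open_plots n V) n F" for F
    unfolding smooth_near_0_def using sm_comp_rs[OF that r\<zeta>, of "\<lambda>j. j"] e0 e by (intro exI[of _ e]) (auto intro!: sm_comp_rs[OF that] r\<zeta>)
  show "smooth_near_0 (\<lambda>t. F (\<zeta> t))" by (rule rcomp[OF assms(1)])
  assume k: "\<And>i. i < n \<Longrightarrow> enat k \<le> order_of_change (\<lambda>t. \<zeta> t i)"
  show "enat k \<le> order_of_change (\<lambda>t. F (\<zeta> t))"
  proof (cases k)
    case (Suc m)
    have "deriv (\<lambda>t. F (\<zeta> t)) t = (\<Sum>i<n. partial_deriv i F (\<zeta> t) * deriv (\<lambda>t. \<zeta> t i) t)" if t: "t \<in> ball 0 e" for t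
    proof (rule DERIV_imp_deriv, rule sm_chain[OF assms(1,2)])
      show "\<And>i. i < n \<Longrightarrow> ((\<lambda>s. \<zeta> s i) has_real_derivative deriv (\<lambda>t. \<zeta> t i) t) (at t)"
        using rs_has_deriv[OF r\<zeta> t] by blast
      show "\<forall>\<^sub>F s in nhds t. \<zeta> s \<in> V"
        using eventually_nhds_in_open[of "ball 0 e" t] t by (auto elim!: eventually_mono) (use e0 e in auto)
    qed
    then have ev: "\<forall>\<^sub>F t in nhds 0. deriv (\<lambda>t. F (\<zeta> t)) t = (\<Sum>i<n. partial_deriv i F (\<zeta> t) * deriv (\<lambda>t. \<zeta> t i) t)"
      unfolding ev_ball using e(1) by blast
    have "smooth_near_0 (\<lambda>t. \<Sum>i<j. partial_deriv i F (\<zeta> t) * deriv (\<lambda>t. \<zeta> t i) t) \<and>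
        enat m \<le> order_at_0 (\<lambda>t. \<Sum>i<j. partial_deriv i F (\<zeta> t) * deriv (\<lambda>t. \<zeta> t i) t)" if "j \<le> n" for j
      using that
    proof (induction j)
      case 0
      then show ?case using rsn_const[of 0] factor_derivs[OF rsn_const[of 0], of "\<lambda>_. 0" m] by (simp add: ordz_ge_iff)
    next
      case (Suc j)
      have 1: "smooth_near_0 (partial_deriv j F \<circ> \<zeta>)" using rcomp[OF sm_partial_deriv[OF assms(1,2)]] Suc.prems by (simp add: o_def)
      have 2: "smooth_near_0 (deriv (\<lambda>t. \<zeta> t j))" using rsn_deriv assms(3) Suc.prems by simp
      have "eSuc (enat m) \<le> eSuc (order_at_0 (deriv (\<lambda>t. \<zeta> t j)))"
        using k[of j] Suc.prems \<open>k = Suc m\<close> by (simp add: order_of_change_def eSuc_enat)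
      then have "enat m \<le> order_at_0 (\<lambda>t. deriv (\<lambda>t. \<zeta> t j) t * partial_deriv j F (\<zeta> t))"
        using ordz_mult_ge[OF 2 1, of m] by (simp add: o_def)
      then have 3: "enat m \<le> order_at_0 (\<lambda>t. partial_deriv j F (\<zeta> t) * deriv (\<lambda>t. \<zeta> t j) t)" by (simp add: mult.commute)
      have 4: "smooth_near_0 (\<lambda>t. partial_deriv j F (\<zeta> t) * deriv (\<lambda>t. \<zeta> t j) t)" using rsn_mult[OF 1 2] by (simp add: o_def)
      show ?case using Suc rsn_add[OF _ 4] ordz_add_ge[OF _ 4 _ 3] by simp
    qed
    then have "enat m \<le> order_at_0 (deriv (\<lambda>t. F (\<zeta> t)))" unfolding ordz_cong[OF ev] by blast
    then show ?thesis unfolding order_of_change_def Suc eSuc_enat[symmetric] by simp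
  qed (simp add: zero_enat_def[symmetric])
qed

definition curve_order :: "('p, 'c) manifold \<Rightarrow> 'c \<Rightarrow> (real \<Rightarrow> 'p) \<Rightarrow> enat" where
  "curve_order M c \<gamma> = (INF i\<in>{..<mdim M}. order_of_change (\<lambda>t. coord M c (\<gamma> t) i))"

lemma mord_ge_iff: "a \<le> curve_order M c \<gamma> \<longleftrightarrow> (\<forall>i<mdim M. a \<le> order_of_change (\<lambda>t. coord M c (\<gamma> t) i))"
  unfolding curve_order_def le_INF_iff by auto

lemma mord_eq_iff: "0 < k \<Longrightarrow> curve_order M c \<gamma> = enat k \<longleftrightarrow>
    (\<exists>i<mdim M. (deriv ^^ k) (\<lambda>t. coord M c (\<gamma> t) i) 0 \<noteq> 0) \<and>
    (\<forall>m. 0 < m \<and> m < k \<longrightarrow> (\<forall>i<mdim M. (deriv ^^ m) (\<lambda>t. coord M c (\<gamma> t) i) 0 = 0))"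
proof -
  assume k: "0 < k"
  have "curve_order M c \<gamma> = enat k \<longleftrightarrow> enat k \<le> curve_order M c \<gamma> \<and> \<not> enat (Suc k) \<le> curve_order M c \<gamma>"
    by (auto simp: Suc_ile_eq)
  then show ?thesis unfolding mord_ge_iff vord_ge_iff using k by (auto simp: less_Suc_eq)
qed

lemma mord_attained: "curve_order M c \<gamma> = enat k \<Longrightarrow> \<exists>i<mdim M. order_of_change (\<lambda>t. coord M c (\<gamma> t) i) = enat k"
proof (rule ccontr)
  assume *: "curve_order M c \<gamma> = enat k" "\<not> (\<exists>i<mdim M. order_of_change (\<lambda>t. coord M c (\<gamma> t) i) = enat k)"
  have "enat k \<le> order_of_change (\<lambda>t. coord M c (\<gamma> t) i)" if "i < mdim M" for i
    using mord_ge_iff[of "enat k" M c \<gamma>] *(1) that by simp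
  then have "enat (Suc k) \<le> curve_order M c \<gamma>" unfolding mord_ge_iff Suc_ile_eq using *(2) by (metis order_less_le)
  then show False using *(1) by simp
qed

lemma vord_pos: "order_of_change f \<noteq> 0" by (simp add: order_of_change_def)

context chartM begin

lemma rsn_coord: "smooth_at M \<gamma> 0 \<Longrightarrow> c \<in> charts M \<Longrightarrow> \<gamma> 0 \<in> cdom M c \<Longrightarrow> i < n \<Longrightarrow> smooth_near_0 (\<lambda>t. coord M c (\<gamma> t) i)"
proof -
  assume *: "smooth_at M \<gamma> 0" "c \<in> charts M" "\<gamma> 0 \<in> cdom M c" and i: "i < n"
  from csm_chart[OF *] obtain e where "e > 0" "curve_in_chart M c \<gamma> (ball 0 e)" .
  then show ?thesis using i unfolding curve_in_chart_def smooth_near_0_def by (intro exI[of _ e]) simp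
qed

text \<open>Transition maps cannot lower orders, in either direction.\<close>

lemma mord_chart:
  assumes "smooth_at M \<gamma> 0" "c \<in> charts M" "\<gamma> 0 \<in> cdom M c" "c' \<in> charts M" "\<gamma> 0 \<in> cdom M c'"
  shows "curve_order M c \<gamma> = curve_order M c' \<gamma>"
proof -
  have le: "enat k \<le> curve_order M c' \<gamma>" if "enat k \<le> curve_order M c \<gamma>" "c \<in> charts M" "\<gamma> 0 \<in> cdom M c" "c' \<in> charts M" "\<gamma> 0 \<in> cdom M c'"
    for k c c'
    unfolding mord_ge_iff
  proof (intro allI impI)
    fix i assume i: "i < n"
    let ?V = "coord M c ` (cdom M c \<inter> cdom M c')"
    have ev: "\<forall>\<^sub>F t in nhds 0. \<gamma> t \<in> cdom M c \<inter> cdom M c'"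
      using eventually_conj[OF csm_open_ev[OF assms(1) openin_cdom[OF that(2)] that(3)]
          csm_open_ev[OF assms(1) openin_cdom[OF that(4)] that(5)]] by simp
    have "enat k \<le> order_of_change (\<lambda>t. transit M c c' i (coord M c (\<gamma> t)))"
    proof (rule vord_multi(2)[OF tr[OF that(2,4) i] eopen_line_open[OF op2[OF that(2,4)]]])
      show "\<forall>\<^sub>F t in nhds 0. coord M c (\<gamma> t) \<in> ?V" using ev by eventually_elim blast
    qed (use that(1) rsn_coord[OF assms(1) that(2,3)] in \<open>auto simp: mord_ge_iff\<close>)
    moreover have "\<forall>\<^sub>F t in nhds 0. transit M c c' i (coord M c (\<gamma> t)) = coord M c' (\<gamma> t) i"
      using ev by eventually_elim (use transit_coord[OF that(2)] in auto)
    ultimately show "enat k \<le> order_of_change (\<lambda>t. coord M c' (\<gamma> t) i)" using vord_cong by metis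
  qed
  show ?thesis by (rule enat_eqI) (use le assms in blast)
qed

lemma vanishing_order_iff:
  assumes "smooth_at M \<gamma> 0" "c \<in> charts M" "\<gamma> 0 \<in> cdom M c"
  shows "vanishing_order M \<gamma> k \<longleftrightarrow> curve_order M c \<gamma> = enat k"
proof -
  have k0: "0 < k" if "curve_order M c \<gamma> = enat k"
  proof -
    note m = mord_attained[OF that]
    obtain i where "order_of_change (\<lambda>t. coord M c (\<gamma> t) i) = enat k" using m by blast
    then have "enat k \<noteq> 0" using vord_pos[of "\<lambda>t. coord M c (\<gamma> t) i"] by simp
    then show ?thesis by (cases k) (simp_all add: enat_0)
  qed
  show ?thesis
  proof (cases "0 < k")
    case True
    have "vanishing_order M \<gamma> k \<longleftrightarrow> (\<exists>c\<in>charts M. \<gamma> 0 \<in> cdom M c \<and> curve_order M c \<gamma> = enat k)"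
      unfolding vanishing_order_def mord_eq_iff[OF True] using True by simp
    also have "\<dots> \<longleftrightarrow> curve_order M c \<gamma> = enat k"
    proof
      assume "\<exists>c\<in>charts M. \<gamma> 0 \<in> cdom M c \<and> curve_order M c \<gamma> = enat k"
      then obtain c' where c': "c' \<in> charts M" "\<gamma> 0 \<in> cdom M c'" "curve_order M c' \<gamma> = enat k" by blast
      show "curve_order M c \<gamma> = enat k" unfolding mord_chart[OF assms c'(1,2)] by (rule c'(3))
    qed (use assms(2,3) in blast)
    finally show ?thesis .
  next
    case False
    then show ?thesis using k0 by (auto simp: vanishing_order_def)
  qed
qed

end

locale hman = tchartM M for M :: "('a, 'c) tmanifold" +
  assumes H: "Hausdorff_space (mtopology M)"

lemma hman_iff: "hman M \<longleftrightarrow> sman M"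
  by (auto simp: hman_def tchartM_def chartM_def hman_axioms_def sman_def)

definition tangent_lines :: "('a, 'c) tmanifold \<Rightarrow> ('a, 'c) pt set \<Rightarrow> ('a, 'c) pt set" where
  "tangent_lines M C = {Line q l | q l. q \<in> C \<and> nonsingular_tangent M C q l}"

section \<open>Arcs, reparameterizations and tangent lines of germs\<close>

context hman begin

text \<open>A compact set in a Hausdorff space is closed. This allows unwanted pieces of an arc to
  be removed from a neighbourhood.\<close>

lemma curve_closedin:
  assumes "compact K" "\<And>t. t \<in> K \<Longrightarrow> smooth_at M \<gamma> t"
  shows "closedin (mtopology M) (\<gamma> ` K)"
proof -
  have "continuous_map (top_of_set K) (mtopology M) \<gamma>"
    unfolding continuous_map_def
  proof (intro conjI allI impI)
    show "\<gamma> \<in> topspace (top_of_set K) \<rightarrow> topspace (mtopology M)"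
      using csm_points[OF assms(2)] by (auto simp: topspace_mt)
    fix U assume U: "openin (mtopology M) U"
    show "openin (top_of_set K) {x \<in> topspace (top_of_set K). \<gamma> x \<in> U}"
      unfolding openin_euclidean_subtopology_iff
    proof (intro conjI ballI)
      fix x assume "x \<in> {x \<in> topspace (top_of_set K). \<gamma> x \<in> U}"
      then have x: "x \<in> K" "\<gamma> x \<in> U" by auto
      obtain e where "e > 0" "\<forall>s\<in>ball x e. \<gamma> s \<in> U"
        using csm_open_ev[OF assms(2)[OF x(1)] U x(2)] unfolding ev_ball by blast
      then show "\<exists>e>0. \<forall>x'\<in>K. dist x' x < e \<longrightarrow> x' \<in> {x \<in> topspace (top_of_set K). \<gamma> x \<in> U}"
        by (intro exI[of _ e]) (auto simp: dist_commute)
    qed auto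
  qed
  then have "compactin (mtopology M) (\<gamma> ` K)"
    by (rule image_compactin[rotated]) (simp add: compactin_subtopology assms(1))
  then show ?thesis by (rule compactin_imp_closedin[OF H])
qed

text \<open>Removing from \<open>U\<close> the compact images of the two outer intervals leaves an
  open set, which still contains \<open>\<delta> s\<close> by injectivity. The interval
  \<open>J\<close> is left open at its ends so that both closed and open parameter intervals
  fit.\<close>

lemma sub_arc:
  assumes "\<And>t. t \<in> {-e..e} \<Longrightarrow> smooth_at M \<delta> t" "inj_on \<delta> {-e..e}" "openin (mtopology M) U"
    "C \<inter> U = \<delta> ` J \<inter> U" "{-e<..<e} \<subseteq> J" "J \<subseteq> {-e..e}" "-e \<le> A" "A < s" "s < B" "B \<le> e" "\<delta> s \<in> U"
  shows "\<exists>U'. openin (mtopology M) U' \<and> \<delta> s \<in> U' \<and> U' \<subseteq> U \<and> C \<inter> U' = \<delta> ` {A<..<B} \<inter> U'"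
proof -
  let ?K = "{-e..A} \<union> {B..e}"
  define U' where "U' = U - \<delta> ` ?K"
  have "closedin (mtopology M) (\<delta> ` ?K)"
    by (rule curve_closedin) (use assms in auto)
  then have "openin (mtopology M) U'" unfolding U'_def using assms(3) by blast
  moreover have "\<delta> s \<in> U'"
  proof -
    have "\<delta> s \<notin> \<delta> ` ?K"
    proof
      assume "\<delta> s \<in> \<delta> ` ?K"
      then obtain u where "u \<in> ?K" "\<delta> s = \<delta> u" by blast
      then have "s = u" using inj_onD[OF assms(2), of s u] assms by auto
      then show False using \<open>u \<in> ?K\<close> assms by auto
    qed
    then show ?thesis using assms(11) by (simp add: U'_def)
  qed
  moreover have "C \<inter> U' = \<delta> ` {A<..<B} \<inter> U'"
  proof (intro set_eqI iffI)
    fix q assume q: "q \<in> C \<inter> U'"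
    then have "q \<in> C \<inter> U" by (auto simp: U'_def)
    then obtain u where u: "u \<in> J" "q = \<delta> u" using assms(4) by blast
    then have "u \<notin> ?K" using q by (auto simp: U'_def)
    then show "q \<in> \<delta> ` {A<..<B} \<inter> U'" using u q assms(6) by force
  next
    fix q assume q: "q \<in> \<delta> ` {A<..<B} \<inter> U'"
    then obtain u where u: "u \<in> {A<..<B}" "q = \<delta> u" by blast
    then have "u \<in> J" using assms(5,7,10) by auto
    then show "q \<in> C \<inter> U'" using u q assms(4) by (auto simp: U'_def)
  qed
  ultimately show ?thesis by (intro exI[of _ U']) (auto simp: U'_def)
qed

text \<open>Turns the one closed interval of the definition into open intervals of any smaller
  radius, inside any given neighbourhood of \<open>p\<close>.\<close>

lemma parametrizesE:
  assumes "parametrizes M \<gamma> C p"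
  obtains e where "e > 0" "\<gamma> 0 = p" "\<And>t. t \<in> {-e..e} \<Longrightarrow> smooth_at M \<gamma> t" "inj_on \<gamma> {-e..e}"
    "\<And>d W. 0 < d \<Longrightarrow> d \<le> e \<Longrightarrow> openin (mtopology M) W \<Longrightarrow> p \<in> W \<Longrightarrow>
      \<exists>U. openin (mtopology M) U \<and> p \<in> U \<and> U \<subseteq> W \<and> C \<inter> U = \<gamma> ` {-d<..<d} \<inter> U"
proof -
  obtain e U where e: "e > 0" "\<gamma> 0 = p" "\<And>t. t \<in> {-e..e} \<Longrightarrow> smooth_at M \<gamma> t" "inj_on \<gamma> {-e..e}"
    "openin (mtopology M) U" "p \<in> U" "C \<inter> U = \<gamma> ` {-e..e} \<inter> U"
    using assms unfolding parametrizes_def smooth_curve_iff by blast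
  have "\<exists>U. openin (mtopology M) U \<and> p \<in> U \<and> U \<subseteq> W \<and> C \<inter> U = \<gamma> ` {-d<..<d} \<inter> U"
    if d: "0 < d" "d \<le> e" "openin (mtopology M) W" "p \<in> W" for d W
  proof -
    have "openin (mtopology M) (U \<inter> W)" "C \<inter> (U \<inter> W) = \<gamma> ` {-e..e} \<inter> (U \<inter> W)"
      using e(5,7) d(3) by auto
    from sub_arc[OF e(3,4) this ivl_sub order_refl, of "-d" 0 d] e(1,2,6) d
    show ?thesis by auto
  qed
  then show ?thesis using that e by blast
qed

text \<open>Closed and open intervals have the same image inside a neighbourhood from which the two
  end points are removed; halving \<open>e\<close> keeps these end points within reach of
  injectivity.\<close>

lemma parametrizesI:
  assumes "\<gamma> 0 = p" "e > 0" "\<And>t. t \<in> {-e..e} \<Longrightarrow> smooth_at M \<gamma> t" "inj_on \<gamma> {-e..e}"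
    "openin (mtopology M) U" "p \<in> U" "C \<inter> U = \<gamma> ` {-e<..<e} \<inter> U"
  shows "parametrizes M \<gamma> C p"
proof -
  let ?d = "e / 2"
  from sub_arc[OF assms(3,4,5,7) order_refl ivl_sub, of "-?d" 0 ?d] assms(1,2,6)
  obtain U' where U': "openin (mtopology M) U'" "p \<in> U'" "C \<inter> U' = \<gamma> ` {-?d<..<?d} \<inter> U'" by auto
  define U2 where "U2 = U' - \<gamma> ` {-?d, ?d}"
  have "closedin (mtopology M) (\<gamma> ` {-?d, ?d})" by (rule curve_closedin) (use assms(2,3) in auto)
  then have "openin (mtopology M) U2" unfolding U2_def using U'(1) by blast
  moreover have "p \<in> U2"
    using inj_onD[OF assms(4), of 0 "?d"] inj_onD[OF assms(4), of 0 "-?d"] U'(2) assms(1,2) by (auto simp: U2_def)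
  moreover have "C \<inter> U2 = \<gamma> ` {-?d..?d} \<inter> U2"
  proof (intro set_eqI iffI)
    fix q assume q: "q \<in> C \<inter> U2"
    then have "q \<in> C \<inter> U'" by (auto simp: U2_def)
    then show "q \<in> \<gamma> ` {-?d..?d} \<inter> U2" using q U'(3) by auto
  next
    fix q assume q: "q \<in> \<gamma> ` {-?d..?d} \<inter> U2"
    then obtain u where u: "u \<in> {-?d..?d}" "q = \<gamma> u" by blast
    have q': "q \<notin> \<gamma> ` {-?d, ?d}" "q \<in> U'" using q by (auto simp: U2_def)
    then have "u \<noteq> ?d" "u \<noteq> -?d" using u(2) by blast+
    then have "u \<in> {-?d<..<?d}" using u(1) by simp
    then have "q \<in> C \<inter> U'" unfolding U'(3) using u(2) q'(2) by blast
    then show "q \<in> C \<inter> U2" using q by blast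
  qed
  moreover have "inj_on \<gamma> {-?d..?d}" by (rule inj_on_subset[OF assms(4)]) (use assms(2) in auto)
  ultimately show ?thesis unfolding parametrizes_def smooth_curve_iff using assms(1,2,3)
    by (intro conjI exI[of _ ?d] exI[of _ U2]) auto
qed

lemma csm_shift: "smooth_at M (\<lambda>t. \<gamma> (t + s)) t \<longleftrightarrow> smooth_at M \<gamma> (t + s)"
proof -
  have im: "smooth_at M (\<lambda>t. \<gamma> (t + s)) t" if g: "smooth_at M \<gamma> (t + s)" for \<gamma> s t
  proof -
    obtain c e where c: "c \<in> charts M" "e > 0" "curve_in_chart M c \<gamma> (ball (t + s) e)" using g by (auto simp: smooth_at_def)
    have "curve_in_chart M c (\<lambda>t. \<gamma> (t + s)) (ball t e)"
      unfolding curve_in_chart_def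
    proof (intro conjI allI impI)
      show "(\<lambda>t. \<gamma> (t + s)) ` ball t e \<subseteq> cdom M c" using c(3) by (auto simp: curve_in_chart_def dist_real_def)
      fix i assume "i < n"
      then have "real_smooth (ball (t + s) e) (\<lambda>u. coord M c (\<gamma> u) i)" using c(3) by (auto simp: curve_in_chart_def)
      then show "real_smooth (ball t e) (\<lambda>t. coord M c (\<gamma> (t + s)) i)"
        by (rule rs_comp[of _ _ _ "\<lambda>u. u + s"]) (auto intro!: rs_add rs_id rs_const simp: dist_real_def)
    qed
    then show ?thesis using c by (auto simp: smooth_at_def)
  qed
  show ?thesis using im[of \<gamma> t s] im[of "\<lambda>t. \<gamma> (t + s)" "t + s" "-s"] by auto
qed

lemma velocity_shift: "velocity M (\<lambda>t. \<gamma> (t + s)) t = velocity M \<gamma> (t + s)"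
proof -
  have d: "deriv (\<lambda>u. f (u + s)) t = deriv f (t + s)" for f :: "real \<Rightarrow> real"
    unfolding deriv_def by (subst DERIV_shift) simp
  show ?thesis unfolding velocity_def
    by (intro ext) (simp add: d[of "\<lambda>u. coord M c (\<gamma> u) i" for c i])
qed

text \<open>Gives access to the tangent lines at the points near the location of the germ, which are
  the ones that enter the lift.\<close>

lemma recenter:
  assumes "e > 0" "\<And>t. t \<in> {-e..e} \<Longrightarrow> smooth_at M \<delta> t" "inj_on \<delta> {-e..e}" "openin (mtopology M) U"
    "C \<inter> U = \<delta> ` {-e<..<e} \<inter> U" "s \<in> {-e<..<e}" "\<delta> s \<in> U"
  shows "parametrizes M (\<lambda>t. \<delta> (t + s)) C (\<delta> s)"
proof -
  define d where "d = (e - \<bar>s\<bar>) / 2"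
  have d: "d > 0" "-e \<le> s - d" "s + d \<le> e" using assms(1,6) by (auto simp: d_def field_simps)
  from sub_arc[OF assms(2,3,4,5) order_refl ivl_sub, of "s - d" s "s + d"] d assms(7)
  obtain U' where U': "openin (mtopology M) U'" "\<delta> s \<in> U'" "C \<inter> U' = \<delta> ` {s - d<..<s + d} \<inter> U'" by auto
  have "\<delta> ` {s - d<..<s + d} = (\<lambda>t. \<delta> (t + s)) ` {-d<..<d}"
  proof -
    have "{s - d<..<s + d} = (\<lambda>t. t + s) ` {-d<..<d}" by (auto intro!: image_eqI[where x = "_ - s"])
    then show ?thesis by (simp add: image_image)
  qed
  then show ?thesis
    using U' d assms(2) csm_shift
    by (intro parametrizesI[where e = d and U = U']) (auto intro!: inj_onI dest!: inj_onD[OF assms(3)])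
qed

lemma velocity_comp:
  assumes "smooth_at M \<gamma> (\<phi> t)" "c \<in> charts M" "\<gamma> (\<phi> t) \<in> cdom M c" "(\<phi> has_real_derivative r) (at t)"
    "smooth_at M \<eta> t" "\<forall>\<^sub>F s in nhds t. \<eta> s = \<gamma> (\<phi> s)" "i < n"
  shows "velocity M \<eta> t c i = r * velocity M \<gamma> (\<phi> t) c i"
proof -
  have e: "\<eta> t = \<gamma> (\<phi> t)" using eventually_nhds_x_imp_x[OF assms(6)] .
  have "((\<lambda>s. coord M c (\<gamma> (\<phi> s)) i) has_real_derivative velocity M \<gamma> (\<phi> t) c i * r) (at t)"
    by (rule DERIV_chain2[OF csm_deriv[OF assms(1-3,7)] assms(4)])
  moreover have "\<forall>\<^sub>F s in nhds t. coord M c (\<eta> s) i = coord M c (\<gamma> (\<phi> s)) i" using assms(6) by eventually_elim simp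
  ultimately have "((\<lambda>s. coord M c (\<eta> s) i) has_real_derivative velocity M \<gamma> (\<phi> t) c i * r) (at t)"
    by (subst DERIV_cong_ev[OF refl _ refl])
  then show ?thesis using csm_deriv[OF assms(5,2) _ assms(7)] e assms(3) DERIV_unique by (simp add: mult.commute) blast
qed

lemma velocity_nonzero:
  assumes "smooth_at M \<gamma> t" "velocity M \<gamma> t \<noteq> (\<lambda>_ _. 0)" "c \<in> charts M" "\<gamma> t \<in> cdom M c"
  shows "\<exists>i<n. velocity M \<gamma> t c i \<noteq> 0"
  using velocity_tv[OF assms(1,3,4)] tv_zero_iff[OF assms(3,4)] assms(2) by metis

text \<open>Some coordinate \<open>u\<close> of the immersed curve has nonzero derivative and hence
  a smooth local inverse \<open>\<psi>\<close>. Applying \<open>\<psi>\<close> to the same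
  coordinate of \<open>\<eta>\<close> gives \<open>\<phi>\<close>, as both curves run in the same
  set near \<open>p\<close>.\<close>

lemma reparam:
  assumes "parametrizes M \<gamma> C p" "velocity M \<gamma> 0 \<noteq> (\<lambda>_ _. 0)" "parametrizes M \<eta> C p"
  obtains \<phi> where "smooth_near_0 \<phi>" "\<phi> 0 = 0" "\<forall>\<^sub>F t in nhds 0. \<eta> t = \<gamma> (\<phi> t)"
proof -
  obtain e where e: "e > 0" "\<gamma> 0 = p" "\<And>t. t \<in> {-e..e} \<Longrightarrow> smooth_at M \<gamma> t" "inj_on \<gamma> {-e..e}"
    "\<And>d W. 0 < d \<Longrightarrow> d \<le> e \<Longrightarrow> openin (mtopology M) W \<Longrightarrow> p \<in> W \<Longrightarrow>
      \<exists>U. openin (mtopology M) U \<and> p \<in> U \<and> U \<subseteq> W \<and> C \<inter> U = \<gamma> ` {-d<..<d} \<inter> U"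
    using parametrizesE[OF assms(1)] by metis
  obtain e' where e': "e' > 0" "\<eta> 0 = p" "\<And>t. t \<in> {-e'..e'} \<Longrightarrow> smooth_at M \<eta> t"
    "\<And>d W. 0 < d \<Longrightarrow> d \<le> e' \<Longrightarrow> openin (mtopology M) W \<Longrightarrow> p \<in> W \<Longrightarrow>
      \<exists>U. openin (mtopology M) U \<and> p \<in> U \<and> U \<subseteq> W \<and> C \<inter> U = \<eta> ` {-d<..<d} \<inter> U"
    using parametrizesE[OF assms(3)] by metis
  have csm0: "smooth_at M \<gamma> 0" "smooth_at M \<eta> 0" using e e' by auto
  obtain c where c: "c \<in> charts M" "p \<in> cdom M c" using csm_points[OF csm0(1)] e(2) by (auto simp: points_def)
  obtain i where i: "i < n" "velocity M \<gamma> 0 c i \<noteq> 0"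
    using velocity_nonzero[OF csm0(1) assms(2) c(1)] c(2) e(2) by blast
  define u where "u t = coord M c (\<gamma> t) i" for t
  have u: "smooth_near_0 u" "deriv u 0 \<noteq> 0"
    using rsn_coord[OF csm0(1) c(1) _ i(1)] c(2) e(2) i c by (auto simp: u_def[abs_def] velocity_def)
  obtain d \<psi> where d: "d > 0" "\<forall>s\<in>ball 0 d. \<psi> (u s) = s" "smooth_near_0 (\<lambda>y. \<psi> (u 0 + y))"
    using rs_inverse[OF u] by blast
  define \<phi> where "\<phi> t = \<psi> (coord M c (\<eta> t) i)" for t
  have e\<eta>: "coord M c (\<eta> t) i = u 0 + (coord M c (\<eta> t) i - u 0)" for t by simp
  have "smooth_near_0 (\<lambda>t. \<psi> (u 0 + (coord M c (\<eta> t) i - u 0)))"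
    by (rule rsn_comp[OF d(3)])
      (use rsn_coord[OF csm0(2) c(1) _ i(1)] c(2) e(2) e'(2) in \<open>auto intro!: rsn_diff rsn_const simp: u_def\<close>)
  then have r\<phi>: "smooth_near_0 \<phi>" unfolding \<phi>_def by simp
  have \<phi>0: "\<phi> 0 = 0" using d(1,2) e(2) e'(2) by (simp add: \<phi>_def u_def[symmetric] flip: e(2))
  let ?d = "min d e"
  obtain U where U: "openin (mtopology M) U" "p \<in> U" "C \<inter> U = \<gamma> ` {-?d<..<?d} \<inter> U"
    using e(5)[of ?d "topspace (mtopology M)"] d(1) e(1) csm_points[OF csm0(1)] e(2) openin_topspace[of "mtopology M"] by (auto simp: topspace_mt)
  obtain U' where U': "openin (mtopology M) U'" "p \<in> U'" "U' \<subseteq> U" "C \<inter> U' = \<eta> ` {-e'<..<e'} \<inter> U'"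
    using e'(4)[of e' U] e'(1) U by auto
  have "\<forall>\<^sub>F t in nhds 0. \<eta> t \<in> U'" using csm_open_ev[OF csm0(2) U'(1)] U'(2) e'(2) by simp
  moreover have "\<forall>\<^sub>F t in nhds 0. t \<in> {-e'<..<e'}" using e'(1) by (intro eventually_nhds_in_open) auto
  ultimately have "\<forall>\<^sub>F t in nhds 0. \<eta> t = \<gamma> (\<phi> t)"
  proof eventually_elim
    case (elim t)
    then have "\<eta> t \<in> C \<inter> U" using U' by blast
    then obtain s where s: "s \<in> {-?d<..<?d}" "\<eta> t = \<gamma> s" using U(3) by blast
    then have "\<psi> (u s) = s" using d(2) by auto
    then show ?case using s(2) by (simp add: \<phi>_def u_def)
  qed
  then show ?thesis using that r\<phi> \<phi>0 by blast
qed

lemma velocity_reparam: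
  assumes "smooth_at M \<gamma> 0" "smooth_at M \<eta> 0" "smooth_near_0 \<phi>" "\<phi> 0 = 0" "\<forall>\<^sub>F t in nhds 0. \<eta> t = \<gamma> (\<phi> t)"
  shows "velocity M \<eta> 0 = (\<lambda>c i. deriv \<phi> 0 * velocity M \<gamma> 0 c i)"
proof -
  have e: "\<eta> 0 = \<gamma> 0" using eventually_nhds_x_imp_x[OF assms(5)] assms(4) by simp
  obtain c where c: "c \<in> charts M" "\<gamma> 0 \<in> cdom M c" using csm_points[OF assms(1)] by (auto simp: points_def)
  have d\<phi>: "(\<phi> has_real_derivative deriv \<phi> 0) (at 0)" using eventually_nhds_x_imp_x[OF rsn_ev[OF assms(3)]] .
  have "velocity M \<eta> 0 c i = deriv \<phi> 0 * velocity M \<gamma> 0 c i" if "i < n" for i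
    using velocity_comp[of \<gamma> \<phi> 0 c "deriv \<phi> 0" \<eta> i] assms(1,2,4,5) c d\<phi> that by simp
  then have "tv M (\<gamma> 0) c (velocity M \<eta> 0 c) = tv M (\<gamma> 0) c (\<lambda>i. deriv \<phi> 0 * velocity M \<gamma> 0 c i)" by (rule tv_cong)
  also have "\<dots> = (\<lambda>c' i. deriv \<phi> 0 * tv M (\<gamma> 0) c (velocity M \<gamma> 0 c) c' i)" by (rule tv_scale)
  finally show ?thesis
    unfolding velocity_tv[OF assms(1) c, symmetric]
    using velocity_tv[OF assms(2) c(1)] c(2) e by argo
qed

text \<open>By \<open>reparam\<close> any other immersed parameterization is
  \<open>\<gamma> \<circ> \<phi>\<close> near 0, with velocity scaled by
  \<open>deriv \<phi> 0\<close>.\<close>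

lemma nonsingular_tangent_iff:
  assumes "parametrizes M \<gamma> C p" "velocity M \<gamma> 0 \<noteq> (\<lambda>_ _. 0)"
  shows "nonsingular_tangent M C p l \<longleftrightarrow> l = line_of (velocity M \<gamma> 0)"
proof
  assume "nonsingular_tangent M C p l"
  then obtain \<eta> where \<eta>: "parametrizes M \<eta> C p" "velocity M \<eta> 0 \<noteq> (\<lambda>_ _. 0)" "l = line_of (velocity M \<eta> 0)"
    unfolding nonsingular_tangent_def by blast
  obtain \<phi> where \<phi>: "smooth_near_0 \<phi>" "\<phi> 0 = 0" "\<forall>\<^sub>F t in nhds 0. \<eta> t = \<gamma> (\<phi> t)" by (rule reparam[OF assms \<eta>(1)])
  have "smooth_at M \<gamma> 0" "smooth_at M \<eta> 0"
    using assms(1) \<eta>(1) unfolding parametrizes_def smooth_curve_iff by auto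
  from velocity_reparam[OF this \<phi>] have v: "velocity M \<eta> 0 = (\<lambda>c i. deriv \<phi> 0 * velocity M \<gamma> 0 c i)" .
  then have "deriv \<phi> 0 \<noteq> 0" using \<eta>(2) by auto
  then show "l = line_of (velocity M \<gamma> 0)" using v \<eta>(3) line_of_scale by simp
qed (use assms in \<open>auto simp: nonsingular_tangent_def\<close>)

end

section \<open>Lifting and projecting parameterizations\<close>

lemma rsn_common:
  assumes "\<And>m. m < (k::nat) \<Longrightarrow> smooth_near_0 (f m)"
  shows "\<exists>e>0. \<forall>m<k. real_smooth (ball 0 e) (f m)"
  using assms
proof (induction k)
  case 0
  show ?case by (intro exI[of _ 1]) simp
next
  case (Suc k)
  then obtain e where e: "e > 0" "\<forall>m<k. real_smooth (ball 0 e) (f m)" by auto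
  obtain d where d: "d > 0" "real_smooth (ball 0 d) (f k)" using Suc.prems[of k] by (auto simp: smooth_near_0_def)
  have "real_smooth (ball 0 (min d e)) (f m)" if "m < Suc k" for m
  proof (cases "m = k")
    case True
    then show ?thesis using rs_mono[OF d(2), of "ball 0 (min d e)"] by (simp add: subset_iff)
  next
    case False
    then have "real_smooth (ball 0 e) (f m)" using e(2) that by simp
    then show ?thesis by (rule rs_mono) auto
  qed
  then show ?case using d(1) e(1) by (intro exI[of _ "min d e"]) simp
qed

lemma rsn_eq_at_0:
  assumes "smooth_near_0 f" "smooth_near_0 g" "\<forall>\<^sub>F t in at 0. f t = g t"
  shows "f 0 = g 0"
proof -
  have "(f \<longlongrightarrow> f 0) (at 0)" "(g \<longlongrightarrow> g 0) (at 0)" using rsn_isCont assms(1,2) by (auto simp: isCont_def)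
  moreover from this(1) have "(g \<longlongrightarrow> f 0) (at 0)" using assms(3) by (rule Lim_transform_eventually)
  ultimately show ?thesis using tendsto_unique[OF at_neq_bot] by blast
qed

lemma ordz_deriv: "order_of_change f = enat k \<Longrightarrow> \<exists>k'. k = Suc k' \<and> order_at_0 (deriv f) = enat k'"
  unfolding order_of_change_def eSuc_enat_iff .

lemma closure_ofE: "q \<in> X closure_of S \<Longrightarrow> q \<in> T \<Longrightarrow> openin X T \<Longrightarrow> \<exists>y\<in>S. y \<in> T"
  unfolding in_closure_of by blast

lemma hman_PT: "hman M \<Longrightarrow> hman (PT M)"
  unfolding hman_iff by (rule PT_sman)

context hman begin

lemma param_csm: "parametrizes M \<gamma> C p \<Longrightarrow> smooth_at M \<gamma> 0"
  unfolding parametrizes_def smooth_curve_iff by auto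

lemma param_0: "parametrizes M \<gamma> C p \<Longrightarrow> \<gamma> 0 = p"
  unfolding parametrizes_def by auto

lemma openin_topsp: "openin (mtopology M) (points M)"
  using openin_topspace[of "mtopology M"] by (simp add: topspace_mt)

text \<open>Excluding the end points makes the part of \<open>\<delta> ` {-d..d}\<close> inside \<open>U\<close> relatively closed.\<close>

lemma param_nbhd:
  assumes "parametrizes M \<delta> C p" "e > 0"
  shows "\<exists>d U. 0 < d \<and> d < e \<and> (\<forall>t\<in>{-d..d}. smooth_at M \<delta> t) \<and> inj_on \<delta> {-d..d} \<and>
    openin (mtopology M) U \<and> p \<in> U \<and> C \<inter> U = \<delta> ` {-d<..<d} \<inter> U \<and> \<delta> (-d) \<notin> U \<and> \<delta> d \<notin> U \<and>
    mtopology M closure_of C \<inter> U \<subseteq> \<delta> ` {-d<..<d}"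
proof -
  obtain e0 where e0: "e0 > 0" "\<delta> 0 = p" "\<And>t. t \<in> {-e0..e0} \<Longrightarrow> smooth_at M \<delta> t" "inj_on \<delta> {-e0..e0}"
    "\<And>d W. 0 < d \<Longrightarrow> d \<le> e0 \<Longrightarrow> openin (mtopology M) W \<Longrightarrow> p \<in> W \<Longrightarrow>
      \<exists>U. openin (mtopology M) U \<and> p \<in> U \<and> U \<subseteq> W \<and> C \<inter> U = \<delta> ` {-d<..<d} \<inter> U"
    using parametrizesE[OF assms(1)] by metis
  define d where "d = min e e0 / 2"
  have d: "0 < d" "d < e" "d < e0" using assms(2) e0(1) by (auto simp: d_def)
  have p: "p \<in> points M" using csm_points[OF e0(3)[of 0]] e0(1,2) by simp
  obtain U where U: "openin (mtopology M) U" "p \<in> U" "C \<inter> U = \<delta> ` {-d<..<d} \<inter> U"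
    using e0(5)[OF d(1) _ openin_topsp p] d(3) by auto
  have cs: "\<And>t. t \<in> {-d..d} \<Longrightarrow> smooth_at M \<delta> t" using e0(3) d by simp
  have inj: "inj_on \<delta> {-d..d}" by (rule inj_on_subset[OF e0(4)]) (use d in auto)
  define U' where "U' = U - \<delta> ` {-d, d}"
  have "closedin (mtopology M) (\<delta> ` {-d, d})" by (rule curve_closedin) (use cs d in auto)
  then have oU': "openin (mtopology M) U'" unfolding U'_def using U(1) by blast
  have pU': "p \<in> U'"
    using inj_onD[OF inj, of 0 d] inj_onD[OF inj, of 0 "-d"] U(2) d e0(2) by (auto simp: U'_def)
  have CU': "C \<inter> U' = \<delta> ` {-d<..<d} \<inter> U'" using U(3) unfolding U'_def by blast
  have ends: "\<delta> (-d) \<notin> U'" "\<delta> d \<notin> U'" by (auto simp: U'_def)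
  have "mtopology M closure_of C \<inter> U' \<subseteq> \<delta> ` {-d<..<d}"
  proof
    fix q assume q: "q \<in> mtopology M closure_of C \<inter> U'"
    have "closedin (mtopology M) (\<delta> ` {-d..d})" by (rule curve_closedin) (use cs in auto)
    then have o: "openin (mtopology M) (U' - \<delta> ` {-d..d})" using oU' by blast
    have "q \<in> \<delta> ` {-d..d}"
    proof (rule ccontr)
      assume "q \<notin> \<delta> ` {-d..d}"
      then have "q \<in> U' - \<delta> ` {-d..d}" using q by blast
      from closure_ofE[OF _ this o] obtain y where "y \<in> C" "y \<in> U' - \<delta> ` {-d..d}" using q by blast
      then have "y \<in> \<delta> ` {-d<..<d}" using CU' by blast
      then show False using \<open>y \<in> U' - \<delta> ` {-d..d}\<close> ivl_sub[of d] by blast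
    qed
    then obtain s where s: "s \<in> {-d..d}" "q = \<delta> s" by blast
    then have "s \<noteq> d" "s \<noteq> -d" using q ends by auto
    then have "s \<in> {-d<..<d}" using s(1) by simp
    then show "q \<in> \<delta> ` {-d<..<d}" using s(2) by blast
  qed
  then show ?thesis using d(1,2) cs inj oU' pU' CU' ends by blast
qed

text \<open>Splits the common power of \<open>t\<close> off the velocity. The remaining vector
  \<open>h\<close> is nonzero at 0 and spans the limit of the tangent lines, also where the curve is
  singular.\<close>

lemma order_factor:
  assumes "smooth_at M \<gamma> 0" "vanishing_order M \<gamma> k" "c \<in> charts M" "\<gamma> 0 \<in> cdom M c"
  shows "\<exists>i h k1. i < n \<and> (\<forall>m<n. smooth_near_0 (h m)) \<and> h i 0 \<noteq> 0 \<and> k = Suc k1 \<and>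
    order_of_change (\<lambda>t. coord M c (\<gamma> t) i) = enat k \<and>
    (\<forall>m<n. \<forall>\<^sub>F t in nhds 0. deriv (\<lambda>t. coord M c (\<gamma> t) m) t = t ^ k1 * h m t)"
proof -
  have mk: "curve_order M c \<gamma> = enat k" using assms(2) unfolding vanishing_order_iff[OF assms(1,3,4)] .
  from mord_attained[OF mk] obtain i where i: "i < n" "order_of_change (\<lambda>t. coord M c (\<gamma> t) i) = enat k" by blast
  from ordz_deriv[OF i(2)] obtain k1 where k1: "k = Suc k1" "order_at_0 (deriv (\<lambda>t. coord M c (\<gamma> t) i)) = enat k1" by blast
  have r: "smooth_near_0 (\<lambda>t. coord M c (\<gamma> t) m)" if "m < n" for m by (rule rsn_coord[OF assms(1,3,4) that])
  have "\<exists>h. smooth_near_0 h \<and> (\<forall>\<^sub>F t in nhds 0. deriv (\<lambda>t. coord M c (\<gamma> t) m) t = t ^ k1 * h t)" if m: "m < n" for m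
  proof -
    have "enat k \<le> order_of_change (\<lambda>t. coord M c (\<gamma> t) m)" using mk m mord_ge_iff[of "enat k" M c \<gamma>] by simp
    then have "enat k1 \<le> order_at_0 (deriv (\<lambda>t. coord M c (\<gamma> t) m))"
      unfolding order_of_change_def k1(1) eSuc_enat[symmetric] by simp
    then show ?thesis unfolding ordz_ge_factor[OF rsn_deriv[OF r[OF m]]] .
  qed
  then obtain h where h: "\<And>m. m < n \<Longrightarrow> smooth_near_0 (h m)"
    "\<And>m. m < n \<Longrightarrow> \<forall>\<^sub>F t in nhds 0. deriv (\<lambda>t. coord M c (\<gamma> t) m) t = t ^ k1 * h m t" by metis
  have "h i 0 \<noteq> 0" using factor_derivs[OF h[OF i(1)]] k1(2) unfolding ordz_eq_iff by simp
  then show ?thesis using i(1) h k1(1) i(2) by blast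
qed

end

context hman begin

interpretation PT: hman "PT M"
  by (rule hman_PT) unfold_locales

lemma dir_line:
  assumes "P \<in> points (PT M)" "v \<in> dir P" "v \<noteq> (\<lambda>_ _. 0)"
  shows "P = Line (foot P) (line_of v)"
proof -
  obtain c q \<xi> where "P = Line q (line_of (tv M q c \<xi>))" using assms(1) unfolding points_PT by blast
  then show ?thesis using line_of_eqI[OF _ assms(3)] assms(2) by simp
qed

lemma closure_nst_foot:
  assumes "P \<in> mtopology (PT M) closure_of tangent_lines M C"
  shows "foot P \<in> mtopology M closure_of C"
  unfolding in_closure_of
proof (intro conjI allI impI)
  have P: "P \<in> points (PT M)" using assms unfolding in_closure_of PT.topspace_mt by blast
  then obtain c q \<xi> where "c \<in> charts M" "q \<in> cdom M c" "P = Line q (line_of (tv M q c \<xi>))" unfolding points_PT by blast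
  then show "foot P \<in> topspace (mtopology M)" using cdom_points by (auto simp: topspace_mt)
  fix T assume T: "foot P \<in> T \<and> openin (mtopology M) T"
  then have "openin (mtopology (PT M)) {P \<in> points (PT M). foot P \<in> T}" by (intro openin_foot) blast
  from closure_ofE[OF assms _ this] obtain y where "y \<in> tangent_lines M C" "foot y \<in> T" using T P by blast
  then show "\<exists>y. y \<in> C \<and> y \<in> T" by (auto simp: tangent_lines_def)
qed

text \<open>A germ can be nonsingular at \<open>p\<close> although the given parameterization
  \<open>\<delta>\<close> is singular at 0, as for \<open>t ^ 3\<close> on a line. Writing
  \<open>\<delta>\<close> as \<open>\<gamma>' \<circ> \<phi>\<close> shows that the actual tangent
  line is the limit of those of \<open>\<delta>\<close>.\<close>

lemma tangent_limit:
  assumes \<gamma>': "parametrizes M \<gamma>' C p" "velocity M \<gamma>' 0 \<noteq> (\<lambda>_ _. 0)" and \<delta>: "parametrizes M \<delta> C p"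
    and c: "c \<in> charts M" "p \<in> cdom M c" and i: "i < n" and h: "\<And>m. m < n \<Longrightarrow> smooth_near_0 (h m)" "h i 0 \<noteq> 0"
    and dh: "\<And>m. m < n \<Longrightarrow> \<forall>\<^sub>F t in nhds 0. deriv (\<lambda>t. coord M c (\<delta> t) m) t = t ^ k1 * h m t"
  shows "line_of (velocity M \<gamma>' 0) = line_of (tv M p c (\<lambda>m. h m 0 / h i 0))"
proof -
  obtain \<phi> where \<phi>: "smooth_near_0 \<phi>" "\<phi> 0 = 0" "\<forall>\<^sub>F t in nhds 0. \<delta> t = \<gamma>' (\<phi> t)" by (rule reparam[OF \<gamma>' \<delta>])
  have cs: "smooth_at M \<gamma>' 0" "\<gamma>' 0 = p" using param_csm[OF \<gamma>'(1)] param_0[OF \<gamma>'(1)] by auto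
  define w where "w m s = coord M c (\<gamma>' s) m" for m s
  have rw: "smooth_near_0 (w m)" if "m < n" for m unfolding w_def using rsn_coord[OF cs(1) c(1)] cs(2) c(2) that by simp
  have fl: "filterlim \<phi> (nhds 0) (nhds 0)" using isCont_nhds[OF rsn_isCont[OF \<phi>(1)]] \<phi>(2) by simp
  have dw: "\<forall>\<^sub>F t in nhds 0. t ^ k1 * h m t = deriv \<phi> t * deriv (w m) (\<phi> t)" if m: "m < n" for m
  proof -
    have "\<forall>\<^sub>F t in nhds 0. \<forall>\<^sub>F s in nhds t. \<delta> s = \<gamma>' (\<phi> s)" using \<phi>(3) eventually_eventually by blast
    then show ?thesis
      using dh[OF m] rsn_ev[OF \<phi>(1)] eventually_compose_filterlim[OF rsn_ev[OF rw[OF m]] fl]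
    proof eventually_elim
      case (elim t)
      have "((\<lambda>s. w m (\<phi> s)) has_real_derivative deriv (w m) (\<phi> t) * deriv \<phi> t) (at t)"
        by (rule DERIV_chain2[OF elim(4,3)])
      moreover have "\<forall>\<^sub>F s in nhds t. coord M c (\<delta> s) m = w m (\<phi> s)"
        using elim(1) by eventually_elim (simp add: w_def)
      ultimately have "((\<lambda>s. coord M c (\<delta> s) m) has_real_derivative deriv (w m) (\<phi> t) * deriv \<phi> t) (at t)"
        by (subst DERIV_cong_ev[OF refl _ refl])
      then show ?case using elim(2) by (auto dest!: DERIV_imp_deriv simp: mult.commute)
    qed
  qed
  have rdw: "smooth_near_0 (\<lambda>t. deriv (w m) (\<phi> t))" if "m < n" for m
    by (rule rsn_comp[OF rsn_deriv[OF rw[OF that]] \<phi>(1,2)])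
  have par: "h m 0 * deriv (w i) 0 = h i 0 * deriv (w m) 0" if m: "m < n" for m
  proof -
    have ne: "\<forall>\<^sub>F t in at (0::real). t \<noteq> 0" by (simp add: eventually_at_filter)
    have "\<forall>\<^sub>F t in at 0. h m t * deriv (w i) (\<phi> t) = h i t * deriv (w m) (\<phi> t)"
      using eventually_nhds_conv_at[THEN iffD1, OF dw[OF m], THEN conjunct1]
        eventually_nhds_conv_at[THEN iffD1, OF dw[OF i], THEN conjunct1] ne
    proof eventually_elim
      case (elim t)
      have "t ^ k1 * (h m t * deriv (w i) (\<phi> t)) = (t ^ k1 * h m t) * deriv (w i) (\<phi> t)" by simp
      also have "\<dots> = (t ^ k1 * h i t) * deriv (w m) (\<phi> t)" unfolding elim(1,2) by simp
      finally show ?case using elim(3) by simp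
    qed
    from rsn_eq_at_0[OF rsn_mult[OF h(1)[OF m] rdw[OF i]] rsn_mult[OF h(1)[OF i] rdw[OF m]] this] \<phi>(2)
    show ?thesis by simp
  qed
  have "tv M p c (velocity M \<gamma>' 0 c) = tv M p c (\<lambda>m. deriv (w i) 0 * (h m 0 / h i 0))"
  proof (rule tv_cong)
    fix m assume m: "m < n"
    have "velocity M \<gamma>' 0 c m = deriv (w m) 0" using m c cs(2) by (simp add: velocity_def w_def[abs_def])
    then show "velocity M \<gamma>' 0 c m = deriv (w i) 0 * (h m 0 / h i 0)"
      using par[OF m] h(2) by (simp add: field_simps)
  qed
  then have v: "velocity M \<gamma>' 0 = (\<lambda>c' j. deriv (w i) 0 * tv M p c (\<lambda>m. h m 0 / h i 0) c' j)"
    unfolding tv_scale by (rule trans[OF velocity_tv[OF cs(1) c(1), unfolded cs(2), OF c(2)]])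
  then have "deriv (w i) 0 \<noteq> 0" using \<gamma>'(2) by auto
  then show ?thesis unfolding v by (rule line_of_scale)
qed

text \<open>Division of the velocity by a power of \<open>t\<close> extends the tangent line
  smoothly through time 0. The old coordinates are among those of the lift, so the order cannot
  increase.\<close>

lemma lift_germ:
  assumes \<delta>: "parametrizes M \<delta> C p" and vo: "vanishing_order M \<delta> k"
  defines "L \<equiv> mtopology (PT M) closure_of tangent_lines M C"
  shows "\<exists>\<delta>'. (\<forall>t. foot (\<delta>' t) = \<delta> t) \<and> parametrizes (PT M) \<delta>' L (\<delta>' 0) \<and> {P \<in> L. foot P = p} = {\<delta>' 0} \<and>
    (\<exists>k'\<le>k. vanishing_order (PT M) \<delta>' k')"
proof -
  have cs0: "smooth_at M \<delta> 0" and \<delta>0: "\<delta> 0 = p" using param_csm[OF \<delta>] param_0[OF \<delta>] by auto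
  obtain c where c: "c \<in> charts M" "p \<in> cdom M c" using csm_points[OF cs0] \<delta>0 by (auto simp: points_def)
  from order_factor[OF cs0 vo c(1) c(2)[folded \<delta>0]] obtain i h k1 where i: "i < n"
    and hh: "\<forall>m<n. smooth_near_0 (h m)" "h i 0 \<noteq> 0" and k: "k = Suc k1"
    and vi: "order_of_change (\<lambda>t. coord M c (\<delta> t) i) = enat k"
    and dhh: "\<forall>m<n. \<forall>\<^sub>F t in nhds 0. deriv (\<lambda>t. coord M c (\<delta> t) m) t = t ^ k1 * h m t" by blast
  have h: "\<And>m. m < n \<Longrightarrow> smooth_near_0 (h m)" "h i 0 \<noteq> 0" using hh by auto
  have dh: "\<And>m. m < n \<Longrightarrow> \<forall>\<^sub>F t in nhds 0. deriv (\<lambda>t. coord M c (\<delta> t) m) t = t ^ k1 * h m t" using dhh by blast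
  define \<xi> where "\<xi> t m = h m t / h i t" for t m
  have "\<exists>e>0. \<forall>m<n. real_smooth (ball 0 e) (\<lambda>t. \<xi> t m)"
    by (rule rsn_common) (use rsn_divide[OF h(1) h(1)[OF i] h(2)] in \<open>simp add: \<xi>_def\<close>)
  then obtain ea where ea: "ea > 0" "\<forall>m<n. real_smooth (ball 0 ea) (\<lambda>t. \<xi> t m)" by blast
  have "\<delta> 0 \<in> cdom M c" using c \<delta>0 by simp
  from csm_chart[OF cs0 c(1) this] obtain eb where eb: "eb > 0" "curve_in_chart M c \<delta> (ball 0 eb)" .
  have "\<forall>\<^sub>F t in nhds 0. \<forall>m\<in>{..<n}. deriv (\<lambda>t. coord M c (\<delta> t) m) t = t ^ k1 * h m t"
    by (rule eventually_ball_finite) (use dh in auto)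
  moreover have "\<forall>\<^sub>F t in nhds 0. h i t \<noteq> 0"
    by (rule tendsto_imp_eventually_ne[OF isCont_nhds[OF rsn_isCont[OF h(1)[OF i]]] h(2)])
  ultimately have "\<forall>\<^sub>F t in nhds 0. (\<forall>m\<in>{..<n}. deriv (\<lambda>t. coord M c (\<delta> t) m) t = t ^ k1 * h m t) \<and> h i t \<noteq> 0"
    by (rule eventually_conj)
  then obtain ec where ec: "ec > 0" "\<And>t m. t \<in> ball 0 ec \<Longrightarrow> m < n \<Longrightarrow> deriv (\<lambda>t. coord M c (\<delta> t) m) t = t ^ k1 * h m t"
    "\<And>t. t \<in> ball 0 ec \<Longrightarrow> h i t \<noteq> 0" unfolding ev_ball by (auto 0 4)
  define e where "e = min ea (min eb ec)"
  have e: "e > 0" "ball 0 e \<subseteq> ball 0 ea" "ball 0 e \<subseteq> ball 0 eb" "ball 0 e \<subseteq> ball (0::real) ec"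
    using ea eb ec by (auto simp: e_def)
  have \<xi>i: "\<xi> t i = 1" if "t \<in> ball 0 e" for t using ec(3)[of t] that e by (auto simp: \<xi>_def)
  have dc: "\<delta> t \<in> cdom M c" if "t \<in> ball 0 e" for t
    using eb(2) subsetD[OF e(3) that] unfolding curve_in_chart_def by blast
  \<comment> \<open>The value far from 0 is arbitrary; this one keeps
    \<open>foot (\<delta>' t) = \<delta> t\<close> true for all \<open>t\<close>.\<close>
  define \<delta>' where "\<delta>' t = (if t \<in> ball 0 e then Line (\<delta> t) (line_of (tv M (\<delta> t) c (\<xi> t))) else Line (\<delta> t) {})" for t
  have foot: "foot (\<delta>' t) = \<delta> t" for t by (simp add: \<delta>'_def)
  have co: "proj_coord M c i (\<delta>' t) = pcoord n i (coord M c (\<delta> t)) (\<xi> t)" and dom: "\<delta>' t \<in> proj_dom M c i"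
    if t: "t \<in> ball 0 e" for t
    using proj_coord_eq[OF c(1) i dc[OF t], of "\<xi> t"] proj_domI[OF c(1) dc[OF t] i, of "\<xi> t"] \<xi>i[OF t] t
    by (auto simp: \<delta>'_def)
  have sc': "curve_in_chart (PT M) (Aff c i) \<delta>' (ball 0 e)"
    unfolding curve_in_chart_def
  proof (intro conjI allI impI)
    show "\<delta>' ` ball 0 e \<subseteq> cdom (PT M) (Aff c i)" using dom by auto
    fix j assume j: "j < mdim (PT M)"
    have "real_smooth (ball 0 e) (\<lambda>t. if j < n then coord M c (\<delta> t) j else \<xi> t (skip i (j - n)))"
    proof (cases "j < n")
      case True
      then show ?thesis using rs_mono[OF _ e(3)] eb(2) by (auto simp: curve_in_chart_def)
    next
      case False
      then have "skip i (j - n) < n" using skip_bounds[OF i, of "j - n"] j by auto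
      then show ?thesis using rs_mono[OF _ e(2)] ea(2) False by auto
    qed
    then show "real_smooth (ball 0 e) (\<lambda>s. coord (PT M) (Aff c i) (\<delta>' s) j)"
      by (rule rs_cong) (use co j in \<open>auto simp: pcoord_def\<close>)
  qed
  have Ch: "Aff c i \<in> charts (PT M)" using c i by auto
  have cs': "smooth_at (PT M) \<delta>' t" if "t \<in> ball 0 e" for t 
    by (rule scurve_csm[OF sc' open_ball that Ch])
  have vel: "velocity M \<delta> t \<noteq> (\<lambda>_ _. 0)" "line_of (velocity M \<delta> t) = line_of (tv M (\<delta> t) c (\<xi> t))"
    if t: "t \<in> ball 0 e" "t \<noteq> 0" for t
  proof -
    have cst: "smooth_at M \<delta> t" by (rule scurve_csm[OF scurve_mono[OF eb(2) e(3)] open_ball t(1) c(1)])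
    have tc: "t \<in> ball 0 ec" using subsetD[OF e(4) t(1)] .
    have ht: "h i t \<noteq> 0" using ec(3)[OF tc] .
    have "tv M (\<delta> t) c (velocity M \<delta> t c) = tv M (\<delta> t) c (\<lambda>m. (t ^ k1 * h i t) * \<xi> t m)"
    proof (rule tv_cong)
      fix m assume m: "m < n"
      then show "velocity M \<delta> t c m = (t ^ k1 * h i t) * \<xi> t m"
        using ec(2)[OF tc m] dc[OF t(1)] c ht by (simp add: velocity_def \<xi>_def)
    qed
    then have v: "velocity M \<delta> t = (\<lambda>c' j. (t ^ k1 * h i t) * tv M (\<delta> t) c (\<xi> t) c' j)"
      unfolding tv_scale by (rule trans[OF velocity_tv[OF cst c(1) dc[OF t(1)]]])
    show "line_of (velocity M \<delta> t) = line_of (tv M (\<delta> t) c (\<xi> t))"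
      unfolding v by (rule line_of_scale) (use ht t in simp)
    have "velocity M \<delta> t c i = (t ^ k1 * h i t) * \<xi> t i" unfolding v using tv_nth[OF c(1) dc[OF t(1)] i] by simp
    then have "velocity M \<delta> t c i \<noteq> 0" using ht t \<xi>i[OF t(1)] by simp
    then show "velocity M \<delta> t \<noteq> (\<lambda>_ _. 0)" by auto
  qed
  from param_nbhd[OF \<delta> e(1)] obtain d U where d: "0 < d" "d < e" and css: "\<forall>t\<in>{-d..d}. smooth_at M \<delta> t"
    and inj: "inj_on \<delta> {-d..d}"
    and U: "openin (mtopology M) U" "p \<in> U" "C \<inter> U = \<delta> ` {-d<..<d} \<inter> U" "\<delta> (-d) \<notin> U" "\<delta> d \<notin> U" by blast
  have cs: "\<And>t. t \<in> {-d..d} \<Longrightarrow> smooth_at M \<delta> t" using css by blast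
  have inb: "t \<in> ball 0 e" if "t \<in> {-d..d}" for t using that d by auto
  define Uh where "Uh = {P \<in> points (PT M). foot P \<in> U}"
  have oUh: "openin (mtopology (PT M)) Uh" unfolding Uh_def by (rule openin_foot[OF U(1)])
  have A: "nonsingular_tangent M C (\<delta> s) l \<longleftrightarrow> l = dir (\<delta>' s)"
    if s: "s \<in> {-d<..<d}" "s \<noteq> 0" "\<delta> s \<in> U" for s l
  proof -
    have pr: "parametrizes M (\<lambda>t. \<delta> (t + s)) C (\<delta> s)" by (rule recenter[OF d(1) cs inj U(1,3) s(1,3)])
    have b: "s \<in> ball 0 e" using inb s by simp
    have "velocity M (\<lambda>t. \<delta> (t + s)) 0 = velocity M \<delta> s" using velocity_shift[of \<delta> s 0] by simp
    then show ?thesis using nonsingular_tangent_iff[OF pr] vel[OF b s(2)] b by (simp add: \<delta>'_def)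
  qed
  \<comment> \<open>The location itself may be a nonsingular point of the germ; then its tangent
    line must be the limit line and adds no second point over \<open>p\<close>.\<close>
  have B: "Line p l = \<delta>' 0" if "nonsingular_tangent M C p l" for l
  proof -
    obtain \<gamma>' where \<gamma>': "parametrizes M \<gamma>' C p" "velocity M \<gamma>' 0 \<noteq> (\<lambda>_ _. 0)" "l = line_of (velocity M \<gamma>' 0)"
      using \<open>nonsingular_tangent M C p l\<close> unfolding nonsingular_tangent_def by blast
    have "line_of (velocity M \<gamma>' 0) = line_of (tv M p c (\<lambda>m. h m 0 / h i 0))"
      by (rule tangent_limit[OF \<gamma>'(1,2) \<delta> c i]) (use h dh in auto)
    then show ?thesis using \<gamma>'(3) e(1) \<delta>0 by (simp add: \<delta>'_def \<xi>_def[abs_def])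
  qed
  have Cc: "Uh \<inter> tangent_lines M C \<subseteq> \<delta>' ` {-d<..<d}"
  proof
    fix Q assume "Q \<in> Uh \<inter> tangent_lines M C"
    then obtain q l where Q: "Q = Line q l" "q \<in> C" "q \<in> U" "nonsingular_tangent M C q l" by (auto simp: tangent_lines_def Uh_def)
    then obtain s where s: "s \<in> {-d<..<d}" "q = \<delta> s" using U(3) by blast
    show "Q \<in> \<delta>' ` {-d<..<d}"
    proof (cases "s = 0")
      case True
      then have "Q = \<delta>' s" using B[of l] Q s \<delta>0 by simp
      then show ?thesis using s by blast
    next
      case False
      then have "l = dir (\<delta>' s)" using A[of s l] s Q by simp
      then have "Q = \<delta>' s" using Q(1) s(2) inb[of s] s(1) by (simp add: \<delta>'_def)
      then show ?thesis using s by blast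
    qed
  qed
  have D: "\<delta>' s \<in> tangent_lines M C" if s: "s \<in> {-d<..<d}" "s \<noteq> 0" "\<delta> s \<in> U" for s
  proof -
    have "\<delta> s \<in> C" using U(3) s by blast
    moreover have "\<delta>' s = Line (\<delta> s) (dir (\<delta>' s))" by (simp add: \<delta>'_def)
    ultimately show ?thesis using A[OF s, of "dir (\<delta>' s)"] unfolding tangent_lines_def by blast
  qed
  have pts: "\<delta>' s \<in> points (PT M)" if "s \<in> {-d..d}" for s
    using PT.cdom_points[OF Ch] dom[OF inb[OF that]] by auto
  have p0: "\<delta>' 0 \<in> Uh" using pts[of 0] d U(2) \<delta>0 foot by (simp add: Uh_def)
  have E: "L \<inter> Uh = \<delta>' ` {-d<..<d} \<inter> Uh"
  proof (intro set_eqI iffI)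
    fix P assume P: "P \<in> L \<inter> Uh"
    have "closedin (mtopology (PT M)) (\<delta>' ` {-d..d})"
      by (rule PT.curve_closedin) (use cs' inb in auto)
    then have o: "openin (mtopology (PT M)) (Uh - \<delta>' ` {-d..d})" using oUh by blast
    have "P \<in> \<delta>' ` {-d..d}"
    proof (rule ccontr)
      assume "P \<notin> \<delta>' ` {-d..d}"
      then have "P \<in> Uh - \<delta>' ` {-d..d}" using P by blast
      from closure_ofE[OF _ this o] obtain y where "y \<in> tangent_lines M C" "y \<in> Uh - \<delta>' ` {-d..d}"
        using P unfolding L_def by blast
      then show False using Cc ivl_sub[of d] by blast
    qed
    then obtain s where s: "s \<in> {-d..d}" "P = \<delta>' s" by blast
    then have "\<delta> s \<in> U" using P foot by (auto simp: Uh_def)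
    then have "s \<noteq> d" "s \<noteq> -d" using U(4,5) by auto
    then have "s \<in> {-d<..<d}" using s(1) by simp
    then show "P \<in> \<delta>' ` {-d<..<d} \<inter> Uh" using s(2) P by blast
  next
    fix P assume P: "P \<in> \<delta>' ` {-d<..<d} \<inter> Uh"
    then obtain s where s: "s \<in> {-d<..<d}" "P = \<delta>' s" by blast
    have sU: "\<delta> s \<in> U" using P s foot by (auto simp: Uh_def)
    have "P \<in> L" unfolding L_def in_closure_of
    proof (intro conjI allI impI)
      show "P \<in> topspace (mtopology (PT M))" unfolding PT.topspace_mt using pts s by simp
      fix T assume T: "P \<in> T \<and> openin (mtopology (PT M)) T"
      show "\<exists>y. y \<in> tangent_lines M C \<and> y \<in> T"
      proof (cases "s = 0")
        \<comment> \<open>If the germ is singular at \<open>p\<close>, the point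
          \<open>\<delta>' 0\<close> is not itself a tangent line of the germ. It belongs to the
          closure as the limit of \<open>\<delta>' t\<close> with
          \<open>t \<noteq> 0\<close>.\<close>
        case True
        have o: "openin (mtopology (PT M)) (T \<inter> Uh)" using T oUh by blast
        have "\<delta>' 0 \<in> T \<inter> Uh" using T True s P by blast
        from PT.csm_open_ev[OF cs' o this] e(1)
        have 1: "\<forall>\<^sub>F t in nhds 0. \<delta>' t \<in> T \<inter> Uh" by simp
        have 2: "\<forall>\<^sub>F t in nhds 0. t \<in> {-d<..<d}" using d(1) by (intro eventually_nhds_in_open) auto
        have "\<forall>\<^sub>F t in at 0. \<delta>' t \<in> T \<inter> Uh \<and> t \<in> {-d<..<d} \<and> t \<noteq> 0"
          using eventually_conj[OF 1 2] unfolding eventually_at_filter by eventually_elim auto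
        then obtain t where t: "\<delta>' t \<in> T \<inter> Uh" "t \<in> {-d<..<d}" "t \<noteq> 0"
          using eventually_happens[of _ "at (0::real)"] by auto
        then have "\<delta> t \<in> U" using foot[of t] by (auto simp: Uh_def)
        then show ?thesis using D[OF t(2,3)] t(1) by blast
      next
        case False
        then show ?thesis using D[OF s(1) _ sU] T s(2) by blast
      qed
    qed
    then show "P \<in> L \<inter> Uh" using P by blast
  qed
  have inj': "inj_on \<delta>' {-d..d}"
  proof (rule inj_onI)
    fix s t assume st: "s \<in> {-d..d}" "t \<in> {-d..d}" "\<delta>' s = \<delta>' t"
    then have "\<delta> s = \<delta> t" using foot[of s] foot[of t] by simp
    then show "s = t" using inj_onD[OF inj] st(1,2) by blast
  qed
  have 1: "parametrizes (PT M) \<delta>' L (\<delta>' 0)"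
    by (rule PT.parametrizesI[OF refl d(1) _ inj' oUh p0 E]) (use cs' inb in auto)
  have 2: "{P \<in> L. foot P = p} = {\<delta>' 0}"
  proof (intro set_eqI iffI)
    fix P assume "P \<in> {P \<in> L. foot P = p}"
    then have P: "P \<in> L" "foot P = p" by auto
    then have "P \<in> points (PT M)" unfolding L_def in_closure_of PT.topspace_mt by blast
    then have "P \<in> L \<inter> Uh" using P U(2) by (simp add: Uh_def)
    then obtain s where s: "s \<in> {-d<..<d}" "P = \<delta>' s" unfolding E by blast
    then have "\<delta> s = \<delta> 0" using P(2) foot \<delta>0 by simp
    then have s0: "s = 0" by (rule inj_onD[OF inj]) (use s(1) d(1) in auto)
    show "P \<in> {\<delta>' 0}" unfolding s(2) s0 by (rule singletonI)
  next
    fix P assume P: "P \<in> {\<delta>' 0}"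
    have "\<delta>' 0 \<in> \<delta>' ` {-d<..<d} \<inter> Uh" using d(1) p0 by (intro IntI imageI) simp_all
    then have "\<delta>' 0 \<in> L" unfolding E[symmetric] by (rule IntD1)
    moreover have "P = \<delta>' 0" using P by (rule singletonD)
    moreover have "foot (\<delta>' 0) = p" unfolding foot by (rule \<delta>0)
    ultimately show "P \<in> {P \<in> L. foot P = p}" by simp
  qed
  have 0: "0 \<in> ball 0 e" using e(1) by simp
  have 3: "\<exists>k'\<le>k. vanishing_order (PT M) \<delta>' k'"
  proof -
    have "\<forall>\<^sub>F t in nhds 0. coord (PT M) (Aff c i) (\<delta>' t) i = coord M c (\<delta> t) i"
      unfolding ev_ball using e(1) co i by (intro exI[of _ e]) (auto simp: pcoord_def)
    from vord_cong[OF this] have "order_of_change (\<lambda>t. coord (PT M) (Aff c i) (\<delta>' t) i) = enat k" using vi by simp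
    moreover have "curve_order (PT M) (Aff c i) \<delta>' \<le> order_of_change (\<lambda>t. coord (PT M) (Aff c i) (\<delta>' t) i)"
      using mord_ge_iff[of "curve_order (PT M) (Aff c i) \<delta>'" "PT M" "Aff c i" \<delta>'] i by auto
    ultimately obtain k' where k': "curve_order (PT M) (Aff c i) \<delta>' = enat k'" "k' \<le> k"
      using enat_ile[of "curve_order (PT M) (Aff c i) \<delta>'" k] by auto
    have "\<delta>' 0 \<in> cdom (PT M) (Aff c i)" using dom[OF 0] by simp
    from PT.vanishing_order_iff[OF cs'[OF 0] Ch this] k' show ?thesis by blast
  qed
  show ?thesis using foot 1 2 3 by blast
qed

text \<open>The projected curve is compared with an arbitrary parameterization
  \<open>\<delta>\<close> of the germ through \<open>\<phi>\<close>, for which only continuity and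
  injectivity are established; in dimension one these already make its image a neighbourhood.
  Injectivity itself has to be derived from the lift.\<close>

lemma project_germ:
  assumes \<delta>: "parametrizes M \<delta> C p"
    and \<gamma>': "parametrizes (PT M) \<gamma>' (mtopology (PT M) closure_of tangent_lines M C) P" and footP: "foot P = p"
    and vo: "vanishing_order M (foot \<circ> \<gamma>') k"
    and vel: "\<forall>\<^sub>F t in at 0. velocity M (foot \<circ> \<gamma>') t \<in> dir (\<gamma>' t)"
  shows "parametrizes M (foot \<circ> \<gamma>') C p"
proof -
  define \<gamma> where "\<gamma> = foot \<circ> \<gamma>'"
  have cs'0: "smooth_at (PT M) \<gamma>' 0" and \<gamma>'0: "\<gamma>' 0 = P" using PT.param_csm[OF \<gamma>'] PT.param_0[OF \<gamma>'] by auto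
  have cs0: "smooth_at M \<gamma> 0" unfolding \<gamma>_def by (rule foot_csm[OF cs'0])
  have \<gamma>0: "\<gamma> 0 = p" using \<gamma>'0 footP by (simp add: \<gamma>_def)
  obtain c where c: "c \<in> charts M" "\<gamma> 0 \<in> cdom M c" using csm_points[OF cs0] by (auto simp: points_def)
  from order_factor[OF cs0 vo[folded \<gamma>_def] c] obtain i h k1 where i: "i < n"
    and h: "smooth_near_0 (h i)" "h i 0 \<noteq> 0" and dh: "\<forall>\<^sub>F t in nhds 0. deriv (\<lambda>t. coord M c (\<gamma> t) i) t = t ^ k1 * h i t" by blast
  define u where "u t = coord M c (\<gamma> t) i" for t
  have ru: "smooth_near_0 u" unfolding u_def by (rule rsn_coord[OF cs0 c i])
  have ev_u: "\<forall>\<^sub>F t in nhds 0. (u has_real_derivative t ^ k1 * h i t) (at t)"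
    using rsn_ev[OF ru] dh by eventually_elim (simp add: u_def[abs_def])
  have ev_h: "\<forall>\<^sub>F t in nhds 0. h i t \<noteq> 0"
    by (rule tendsto_imp_eventually_ne[OF isCont_nhds[OF rsn_isCont[OF h(1)]] h(2)])
  from param_nbhd[OF \<delta> zero_less_one] obtain d U where d: "0 < d" and cs\<delta>: "\<forall>t\<in>{-d..d}. smooth_at M \<delta> t"
    and inj\<delta>: "inj_on \<delta> {-d..d}"
    and U: "openin (mtopology M) U" "p \<in> U" "C \<inter> U = \<delta> ` {-d<..<d} \<inter> U"
      "mtopology M closure_of C \<inter> U \<subseteq> \<delta> ` {-d<..<d}" by blast
  from PT.param_nbhd[OF \<gamma>' zero_less_one] obtain d' U' where d': "0 < d'" and cs\<gamma>: "\<forall>t\<in>{-d'..d'}. smooth_at (PT M) \<gamma>' t"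
    and inj\<gamma>: "inj_on \<gamma>' {-d'..d'}"
    and U': "openin (mtopology (PT M)) U'" "P \<in> U'"
      "(mtopology (PT M) closure_of tangent_lines M C) \<inter> U' = \<gamma>' ` {-d'<..<d'} \<inter> U'" by blast
  have evd': "\<forall>\<^sub>F t in nhds 0. t \<in> {-d'<..<d'}" using d' by (intro eventually_nhds_in_open) auto
  have evU': "\<forall>\<^sub>F t in nhds 0. \<gamma>' t \<in> U'" using PT.csm_open_ev[OF cs'0 U'(1)] \<gamma>'0 U'(2) by simp
  have evU: "\<forall>\<^sub>F t in nhds 0. \<gamma> t \<in> U" using csm_open_ev[OF cs0 U(1)] \<gamma>0 U(2) by simp
  have evv: "\<forall>\<^sub>F t in nhds 0. t \<noteq> 0 \<longrightarrow> velocity M \<gamma> t \<in> dir (\<gamma>' t)"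
    using vel unfolding \<gamma>_def eventually_at_filter by simp
  have evc: "\<forall>\<^sub>F t in nhds 0. \<gamma> t \<in> cdom M c" by (rule csm_open_ev[OF cs0 openin_cdom[OF c(1)] c(2)])
  have "\<forall>\<^sub>F t in nhds 0. (u has_real_derivative t ^ k1 * h i t) (at t) \<and> h i t \<noteq> 0 \<and> t \<in> {-d'<..<d'} \<and> \<gamma>' t \<in> U' \<and> \<gamma> t \<in> U \<and>
    (t \<noteq> 0 \<longrightarrow> velocity M \<gamma> t \<in> dir (\<gamma>' t)) \<and> \<gamma> t \<in> cdom M c"
    using ev_u ev_h evd' evU' evU evv evc by eventually_elim simp
  then obtain \<eta> where \<eta>: "\<eta> > 0" and all: "\<forall>t\<in>ball 0 \<eta>. (u has_real_derivative t ^ k1 * h i t) (at t) \<and> h i t \<noteq> 0 \<and> t \<in> {-d'<..<d'} \<and>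
    \<gamma>' t \<in> U' \<and> \<gamma> t \<in> U \<and> (t \<noteq> 0 \<longrightarrow> velocity M \<gamma> t \<in> dir (\<gamma>' t)) \<and> \<gamma> t \<in> cdom M c" unfolding ev_ball by blast
  let ?J = "ball (0::real) \<eta>"
  have du: "(u has_real_derivative t ^ k1 * h i t) (at t)" and hne: "h i t \<noteq> 0" and td: "t \<in> {-d'<..<d'}"
    and tU': "\<gamma>' t \<in> U'" and tU: "\<gamma> t \<in> U" and tv: "t \<noteq> 0 \<Longrightarrow> velocity M \<gamma> t \<in> dir (\<gamma>' t)" and tc: "\<gamma> t \<in> cdom M c"
    if "t \<in> ?J" for t using all that by blast+
  have csJ: "smooth_at (PT M) \<gamma>' t" "smooth_at M \<gamma> t" if "t \<in> ?J" for t
  proof -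
    show "smooth_at (PT M) \<gamma>' t" using cs\<gamma> td[OF that] by auto
    then show "smooth_at M \<gamma> t" unfolding \<gamma>_def by (rule foot_csm)
  qed
  have inC: "\<gamma> t \<in> C \<inter> U" "\<gamma> t \<in> \<delta> ` {-d<..<d}" if t: "t \<in> ?J" for t
  proof -
    have "\<gamma>' t \<in> mtopology (PT M) closure_of tangent_lines M C" using U'(3) td[OF t] tU'[OF t] by blast
    from closure_nst_foot[OF this] have "\<gamma> t \<in> mtopology M closure_of C" by (simp add: \<gamma>_def)
    then show 1: "\<gamma> t \<in> \<delta> ` {-d<..<d}" using U(4) tU[OF t] by blast
    show "\<gamma> t \<in> C \<inter> U" using 1 tU[OF t] U(3) by blast
  qed
  define \<phi> where "\<phi> t = the_inv_into {-d..d} \<delta> (\<gamma> t)" for t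
  have \<phi>: "\<phi> t \<in> {-d<..<d}" "\<delta> (\<phi> t) = \<gamma> t" if t: "t \<in> ?J" for t
  proof -
    obtain s where s: "s \<in> {-d<..<d}" "\<gamma> t = \<delta> s" using inC(2)[OF t] by blast
    then have "\<phi> t = s" unfolding \<phi>_def s(2) by (intro the_inv_into_f_f[OF inj\<delta>]) auto
    then show "\<phi> t \<in> {-d<..<d}" "\<delta> (\<phi> t) = \<gamma> t" using s by auto
  qed
  have inj_eq: "s = t" if "s \<in> {-d<..<d}" "t \<in> {-d<..<d}" "\<delta> s = \<delta> t" for s t
    using inj_onD[OF inj\<delta> that(3)] that(1,2) by auto
  have cs\<delta>': "\<And>t. t \<in> {-d..d} \<Longrightarrow> smooth_at M \<delta> t" using cs\<delta> by blast
  \<comment> \<open>The curve stays in a neighbourhood in which the germ consists only of the values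
    of \<open>\<delta>\<close> at parameters close to \<open>\<phi> t\<close>.\<close>
  have cont\<phi>: "isCont \<phi> t" if t: "t \<in> ?J" for t
    unfolding isCont_def tendsto_iff
  proof (intro allI impI)
    fix e :: real assume e: "e > 0"
    define A B where "A = max (-d) (\<phi> t - e)" and "B = min d (\<phi> t + e)"
    have AB: "-d \<le> A" "A < \<phi> t" "\<phi> t < B" "B \<le> d" using \<phi>(1)[OF t] e by (auto simp: A_def B_def)
    have "\<delta> (\<phi> t) \<in> U" using \<phi>(2)[OF t] tU[OF t] by simp
    from sub_arc[OF cs\<delta>' inj\<delta> U(1,3) order_refl ivl_sub AB this] obtain W where W: "openin (mtopology M) W"
      "\<delta> (\<phi> t) \<in> W" "W \<subseteq> U" "C \<inter> W = \<delta> ` {A<..<B} \<inter> W" by blast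
    have "\<forall>\<^sub>F s in nhds t. \<gamma> s \<in> W" using csm_open_ev[OF csJ(2)[OF t] W(1)] W(2) \<phi>(2)[OF t] by simp
    moreover have "\<forall>\<^sub>F s in nhds t. s \<in> ?J" using t by (intro eventually_nhds_in_open) auto
    ultimately have "\<forall>\<^sub>F s in nhds t. dist (\<phi> s) (\<phi> t) < e"
    proof eventually_elim
      case (elim s)
      then have "\<gamma> s \<in> C \<inter> W" using inC(1) by blast
      then obtain r where r: "r \<in> {A<..<B}" "\<gamma> s = \<delta> r" using W(4) by blast
      have "\<phi> s = r" by (rule inj_eq) (use \<phi>[OF elim(2)] r AB in auto)
      then show ?case using r(1) by (auto simp: A_def B_def dist_real_def)
    qed
    then show "\<forall>\<^sub>F s in at t. dist (\<phi> s) (\<phi> t) < e" unfolding eventually_at_filter by eventually_elim simp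
  qed
  \<comment> \<open>A continuous injective \<open>\<phi>\<close> maps an open interval onto an open
    set, so near \<open>\<gamma> s\<close> the germ is filled by \<open>\<gamma>\<close>. This is
    applied to every time \<open>s \<noteq> 0\<close> and, once injectivity across 0 is known, to
    \<open>s = 0\<close>.\<close>
  have arc: "parametrizes M (\<lambda>t. \<gamma> (t + s)) C (\<gamma> s)"
    if \<kappa>: "\<kappa> > 0" "{s - \<kappa>..s + \<kappa>} \<subseteq> ?J" and inj: "inj_on \<gamma> {s - \<kappa>..s + \<kappa>}" for s \<kappa>
  proof -
    let ?I = "{s - \<kappa><..<s + \<kappa>}"
    have IJ: "?I \<subseteq> ?J" and sJ: "s \<in> ?J" using \<kappa> by (auto simp: subset_iff)
    have inj\<phi>: "inj_on \<phi> ?I"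
    proof (rule inj_onI)
      fix a b assume ab: "a \<in> ?I" "b \<in> ?I" "\<phi> a = \<phi> b"
      then have "\<gamma> a = \<gamma> b" using \<phi>(2)[of a] \<phi>(2)[of b] IJ by (metis subsetD)
      then show "a = b" using inj_onD[OF inj] ab by auto
    qed
    have "continuous_on ?I \<phi>" using cont\<phi> IJ by (intro continuous_at_imp_continuous_on) blast
    then have "open (\<phi> ` ?I)" by (rule invariance_of_domain) (use inj\<phi> in auto)
    moreover have "\<phi> s \<in> \<phi> ` ?I" using \<kappa>(1) by auto
    ultimately obtain r where r: "r > 0" "ball (\<phi> s) r \<subseteq> \<phi> ` ?I" using open_contains_ball by blast
    define A B where "A = max (-d) (\<phi> s - r)" and "B = min d (\<phi> s + r)"
    have AB: "-d \<le> A" "A < \<phi> s" "\<phi> s < B" "B \<le> d" using \<phi>(1)[OF sJ] r(1) by (auto simp: A_def B_def)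
    have "\<delta> (\<phi> s) \<in> U" using \<phi>(2)[OF sJ] tU[OF sJ] by simp
    from sub_arc[OF cs\<delta>' inj\<delta> U(1,3) order_refl ivl_sub AB this] obtain W where W: "openin (mtopology M) W"
      "\<delta> (\<phi> s) \<in> W" "W \<subseteq> U" "C \<inter> W = \<delta> ` {A<..<B} \<inter> W" by blast
    have CW: "C \<inter> W = \<gamma> ` ?I \<inter> W"
    proof (intro set_eqI iffI)
      fix q assume q: "q \<in> C \<inter> W"
      then obtain x where x: "x \<in> {A<..<B}" "q = \<delta> x" using W(4) by blast
      then have "x \<in> ball (\<phi> s) r" by (auto simp: A_def B_def dist_real_def)
      then obtain t where t: "t \<in> ?I" "x = \<phi> t" using r(2) by blast
      then have "q = \<gamma> t" using \<phi>(2)[OF subsetD[OF IJ t(1)]] x(2) by simp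
      then show "q \<in> \<gamma> ` ?I \<inter> W" using t(1) q by blast
    next
      fix q assume "q \<in> \<gamma> ` ?I \<inter> W"
      then show "q \<in> C \<inter> W" using inC(1) IJ by blast
    qed
    have im: "\<gamma> ` ?I = (\<lambda>t. \<gamma> (t + s)) ` {-\<kappa><..<\<kappa>}"
    proof -
      have "?I = (\<lambda>t. t + s) ` {-\<kappa><..<\<kappa>}" by (auto intro!: image_eqI[where x = "_ - s"])
      then show ?thesis by (simp add: image_image)
    qed
    show ?thesis
    proof (rule parametrizesI[OF _ \<kappa>(1) _ _ W(1)])
      show "\<And>t. t \<in> {-\<kappa>..\<kappa>} \<Longrightarrow> smooth_at M (\<lambda>t. \<gamma> (t + s)) t"
      proof -
        fix t assume "t \<in> {-\<kappa>..\<kappa>}"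
        then have "t + s \<in> {s - \<kappa>..s + \<kappa>}" by auto
        then show "smooth_at M (\<lambda>t. \<gamma> (t + s)) t" unfolding csm_shift using csJ(2) \<kappa>(2) by blast
      qed
      show "inj_on (\<lambda>t. \<gamma> (t + s)) {-\<kappa>..\<kappa>}" by (rule inj_onI) (auto dest!: inj_onD[OF inj])
      show "\<gamma> s \<in> W" using W(2) \<phi>(2)[OF sJ] by simp
      show "C \<inter> W = (\<lambda>t. \<gamma> (t + s)) ` {-\<kappa><..<\<kappa>} \<inter> W" using CW unfolding im .
    qed simp
  qed
  \<comment> \<open>On one side of 0 the coordinate \<open>u\<close> has nonvanishing derivative, so
    Rolle's theorem excludes equal values.\<close>
  have inj1: "a = b" if "{min a b..max a b} \<subseteq> ?J" "0 \<le> a \<and> 0 \<le> b \<or> a \<le> 0 \<and> b \<le> 0" "\<gamma> a = \<gamma> b" for a b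
  proof -
    have "inj_on u {min a b..max a b}"
    proof (rule deriv_nonzero_inj[where f' = "\<lambda>t. t ^ k1 * h i t"])
      fix t assume "min a b < t" "t < max a b"
      then have "t \<in> ?J" "t \<noteq> 0" using that(1,2) by (auto simp: subset_iff)
      then show "(u has_real_derivative t ^ k1 * h i t) (at t) \<and> t ^ k1 * h i t \<noteq> 0" using du hne by simp
    next
      show "continuous_on {min a b..max a b} u"
        using DERIV_isCont[OF du] that(1) by (intro continuous_at_imp_continuous_on) blast
    qed
    moreover have "u a = u b" using that(3) by (simp add: u_def)
    ultimately show ?thesis by (auto dest: inj_onD)
  qed
  have line: "\<gamma>' t = Line (\<gamma> t) (line_of (velocity M \<gamma> t)) \<and> velocity M \<gamma> t \<noteq> (\<lambda>_ _. 0)" if t: "t \<in> ?J" "t \<noteq> 0" for t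
  proof -
    have "deriv u t = t ^ k1 * h i t" by (rule DERIV_imp_deriv[OF du[OF t(1)]])
    then have "velocity M \<gamma> t c i \<noteq> 0" using hne[OF t(1)] t(2) tc[OF t(1)] c(1) i by (simp add: velocity_def u_def[abs_def])
    then have nz: "velocity M \<gamma> t \<noteq> (\<lambda>_ _. 0)" by auto
    show ?thesis using dir_line[OF PT.csm_points[OF csJ(1)[OF t(1)]] tv[OF t] nz] nz by (simp add: \<gamma>_def)
  qed
  have germ: "nonsingular_tangent M C (\<gamma> s) l \<longleftrightarrow> l = line_of (velocity M \<gamma> s)" if s: "s \<in> ?J" "s \<noteq> 0" for s l
  proof -
    \<comment> \<open>Small enough for the interval around \<open>s\<close> to avoid 0 and to stay
      within radius \<open>\<eta>\<close>.\<close>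
    define \<kappa> where "\<kappa> = min \<bar>s\<bar> (\<eta> - \<bar>s\<bar>) / 2"
    have \<kappa>: "\<kappa> > 0" using s by (auto simp: \<kappa>_def)
    have \<kappa>le: "2 * \<kappa> \<le> \<bar>s\<bar>" "2 * \<kappa> \<le> \<eta> - \<bar>s\<bar>" by (auto simp: \<kappa>_def)
    have s\<eta>: "\<bar>s\<bar> < \<eta>" using s(1) by simp
    have sub: "{s - \<kappa>..s + \<kappa>} \<subseteq> ?J"
    proof
      fix x assume "x \<in> {s - \<kappa>..s + \<kappa>}"
      then have "s - \<kappa> \<le> x" "x \<le> s + \<kappa>" by auto
      then have "\<bar>x\<bar> < \<eta>" using \<kappa>le s\<eta> \<kappa> by linarith
      then show "x \<in> ?J" by simp
    qed
    have sg: "0 \<le> a \<and> 0 \<le> b \<or> a \<le> 0 \<and> b \<le> 0" if "a \<in> {s - \<kappa>..s + \<kappa>}" "b \<in> {s - \<kappa>..s + \<kappa>}" for a b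
    proof -
      have "s - \<kappa> \<le> a" "a \<le> s + \<kappa>" "s - \<kappa> \<le> b" "b \<le> s + \<kappa>" using that by auto
      then show ?thesis using \<kappa>le(1) \<kappa> by linarith
    qed
    have "inj_on \<gamma> {s - \<kappa>..s + \<kappa>}"
    proof (rule inj_onI)
      fix a b assume ab: "a \<in> {s - \<kappa>..s + \<kappa>}" "b \<in> {s - \<kappa>..s + \<kappa>}" "\<gamma> a = \<gamma> b"
      have "{min a b..max a b} \<subseteq> {s - \<kappa>..s + \<kappa>}" using ab(1,2) by auto
      then show "a = b" using inj1[OF _ sg[OF ab(1,2)] ab(3)] sub by blast
    qed
    from arc[OF \<kappa> sub this] have pr: "parametrizes M (\<lambda>t. \<gamma> (t + s)) C (\<gamma> s)" .
    have "velocity M (\<lambda>t. \<gamma> (t + s)) 0 = velocity M \<gamma> s" using velocity_shift[of \<gamma> s 0] by simp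
    then show ?thesis using nonsingular_tangent_iff[OF pr] line[OF s] by simp
  qed
  define \<kappa> where "\<kappa> = \<eta> / 2"
  have \<kappa>: "\<kappa> > 0" "{0 - \<kappa>..0 + \<kappa>} \<subseteq> ?J" using \<eta> by (auto simp: \<kappa>_def)
  have "inj_on \<gamma> {0 - \<kappa>..0 + \<kappa>}"
  proof (rule inj_onI)
    fix a b assume ab: "a \<in> {0 - \<kappa>..0 + \<kappa>}" "b \<in> {0 - \<kappa>..0 + \<kappa>}" "\<gamma> a = \<gamma> b"
    have J: "a \<in> ?J" "b \<in> ?J" using ab \<kappa>(2) by blast+
    have mm: "{min a b..max a b} \<subseteq> ?J" using ab(1,2) \<eta> by (auto simp: \<kappa>_def)
    show "a = b"
    proof (cases "0 \<le> a \<and> 0 \<le> b \<or> a \<le> 0 \<and> b \<le> 0")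
      case True
      show ?thesis by (rule inj1[OF mm True ab(3)])
    next
      \<comment> \<open>Now \<open>a\<close> and \<open>b\<close> lie on opposite sides of 0. The
        common value has only one tangent line, so the lifted points agree and injectivity of
        \<open>\<gamma>'\<close> applies.\<close>
      case False
      then have "a \<noteq> 0" "b \<noteq> 0" by auto
      then have "line_of (velocity M \<gamma> a) = line_of (velocity M \<gamma> b)"
        using germ[OF J(1), of "line_of (velocity M \<gamma> a)"] germ[OF J(2), of "line_of (velocity M \<gamma> a)"] ab(3) by simp
      then have "\<gamma>' a = \<gamma>' b" using line J ab(3) \<open>a \<noteq> 0\<close> \<open>b \<noteq> 0\<close> by simp
      moreover have "a \<in> {-d'..d'}" "b \<in> {-d'..d'}" using td J by (auto simp: less_imp_le)
      ultimately show ?thesis using inj_onD[OF inj\<gamma>] by blast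
    qed
  qed
  from arc[OF \<kappa> this] show ?thesis using \<gamma>0 by (simp add: \<gamma>_def o_def)
qed

end

section \<open>Coordinates on the monster tower\<close>

text \<open>The \<open>k\<close>-th stage has coordinates \<open>z 0, \<dots>, z (k + 1)\<close>: first those of a chart of the surface, then one
  new coordinate \<open>z (s + 1)\<close> for each step \<open>s = 1, \<dots>, k\<close>.  A word \<open>w\<close> records whether step \<open>s\<close> is inverted:
  the new coordinate is the derivative of the coordinate introduced last by the retained one \<open>z (rho w k)\<close>,
  or the other way round.  The focal bundle is spanned by the field \<open>ev w k\<close> and by the partial derivative in
  the last coordinate.\<close>

primrec rho :: "(nat \<Rightarrow> bool) \<Rightarrow> nat \<Rightarrow> nat" where
  "rho w 0 = 0"
| "rho w (Suc k) = (if w (Suc k) then Suc k else rho w k)"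

text \<open>The two active coordinates of stage \<open>k\<close> are \<open>rho w k\<close> and
  \<open>Suc k\<close>. In the quotient that becomes \<open>z (k + 2)\<close>, index
  \<open>other w k\<close> is the numerator and \<open>rho w (Suc k)\<close> the
  denominator.\<close>

definition other :: "(nat \<Rightarrow> bool) \<Rightarrow> nat \<Rightarrow> nat" where
  "other w k = (if w (Suc k) then rho w k else Suc k)"

definition unitv :: "nat \<Rightarrow> nat \<Rightarrow> real" where "unitv b a = (if a = b then 1 else 0)"

primrec ev :: "(nat \<Rightarrow> bool) \<Rightarrow> nat \<Rightarrow> (nat \<Rightarrow> real) \<Rightarrow> nat \<Rightarrow> real" where
  "ev w 0 z = unitv 0"
| "ev w (Suc k) z = (\<lambda>a. if w (Suc k) then z (k + 2) * ev w k z a + unitv (Suc k) a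
     else ev w k z a + z (k + 2) * unitv (Suc k) a)"

lemma rho_le: "rho w k \<le> k"
  by (induction k) (auto intro: le_SucI)

lemma ev_support: "k < a \<Longrightarrow> ev w k z a = 0"
  by (induction k) (auto simp: unitv_def)

lemma ev_rho: "ev w k z (rho w k) = 1"
proof (induction k)
  case (Suc k)
  have "rho w k \<noteq> Suc k" using rho_le[of w k] by simp
  then show ?case using Suc ev_support[of k "Suc k" w z] by (auto simp: unitv_def)
qed (simp add: unitv_def)

lemma ev_other: "ev w (Suc k) z (other w k) = z (k + 2)"
proof -
  have "rho w k \<noteq> Suc k" using rho_le[of w k] by simp
  then show ?thesis using ev_rho[of w k z] ev_support[of k "Suc k" w z] by (auto simp: other_def unitv_def)
qed

lemma ev_cong: "(\<And>a. a < k + 2 \<Longrightarrow> z a = z' a) \<Longrightarrow> ev w k z = ev w k z'"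
proof (induction k)
  case (Suc k)
  then have "ev w k z = ev w k z'" "z (k + 2) = z' (k + 2)" by auto
  then show ?case by (simp only: ev.simps)
qed simp

definition dir_deriv :: "((nat \<Rightarrow> real) \<Rightarrow> nat \<Rightarrow> real) \<Rightarrow> nat \<Rightarrow> (nat \<Rightarrow> real) \<Rightarrow> (nat \<Rightarrow> real) \<Rightarrow> nat \<Rightarrow> real" where
  "dir_deriv F n z v = (\<lambda>m. \<Sum>a<n. partial_deriv a (\<lambda>z. F z m) z * v a)"

text \<open>The position of the tower coordinate \<open>z a\<close> among the coordinates of the
  ambient chart \<open>ch S b w k\<close>; the new coordinate is one of the ratios that follow the
  old coordinates.\<close>

primrec sg :: "('a, 'c) manifold \<Rightarrow> (nat \<Rightarrow> bool) \<Rightarrow> nat \<Rightarrow> nat \<Rightarrow> nat" where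
  "sg S w 0 = (\<lambda>a. a)"
| "sg S w (Suc k) = (\<lambda>a. if a < k + 2 then sg S w k a
     else mdim (ambient S k) + unskip (sg S w k (rho w (Suc k))) (sg S w k (other w k)))"

primrec ch :: "('a, 'c) manifold \<Rightarrow> 'c \<Rightarrow> (nat \<Rightarrow> bool) \<Rightarrow> nat \<Rightarrow> 'c tchart" where
  "ch S b w 0 = Base b"
| "ch S b w (Suc k) = Aff (ch S b w k) (sg S w k (rho w (Suc k)))"

text \<open>The inverse of the coordinate system, defined for every \<open>z\<close> although only
  the components below \<open>k + 2\<close> matter (\<open>Phi_cong\<close>). One and the same
  \<open>z\<close> thus describes a point and all its images on lower stages.\<close>

primrec Phi :: "('a, 'c) manifold \<Rightarrow> 'c \<Rightarrow> (nat \<Rightarrow> bool) \<Rightarrow> nat \<Rightarrow> (nat \<Rightarrow> real) \<Rightarrow> ('a, 'c) pt" where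
  "Phi S b w 0 = (\<lambda>z. cinv (ambient S 0) (Base b) (restr 2 z))"
| "Phi S b w (Suc k) = (\<lambda>z. Line (Phi S b w k z) (line_of (tv (ambient S k) (Phi S b w k z) (ch S b w k)
     (dir_deriv (\<lambda>z. coord (ambient S k) (ch S b w k) (Phi S b w k z)) (k + 2) z (ev w (Suc k) z)))))"

definition FF :: "('a, 'c) manifold \<Rightarrow> 'c \<Rightarrow> (nat \<Rightarrow> bool) \<Rightarrow> nat \<Rightarrow> (nat \<Rightarrow> real) \<Rightarrow> nat \<Rightarrow> real" where
  "FF S b w k z = coord (ambient S k) (ch S b w k) (Phi S b w k z)"

text \<open>The push-forward under \<open>Phi\<close> of the vector \<open>v\<close> at
  \<open>z\<close>.\<close>

definition tvP :: "('a, 'c) manifold \<Rightarrow> 'c \<Rightarrow> (nat \<Rightarrow> bool) \<Rightarrow> nat \<Rightarrow> (nat \<Rightarrow> real) \<Rightarrow> (nat \<Rightarrow> real) \<Rightarrow> 'c tchart tvec" where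
  "tvP S b w k z v = tv (ambient S k) (Phi S b w k z) (ch S b w k) (dir_deriv (FF S b w k) (k + 2) z v)"

lemma Phi_Suc: "Phi S b w (Suc k) z = Line (Phi S b w k z) (line_of (tvP S b w k z (ev w (Suc k) z)))"
  by (simp add: tvP_def FF_def[abs_def])

declare Phi.simps(2) [simp del]

text \<open>Only the two surface coordinates are confined to a chart image; the coordinates of the
  fibres range over all reals.\<close>

definition VV :: "('a, 'c) manifold \<Rightarrow> 'c \<Rightarrow> (nat \<Rightarrow> real) set" where
  "VV S b = {z. restr 2 z \<in> coord (ambient S 0) (Base b) ` cdom (ambient S 0) (Base b)}"

lemma VV_cong: "z \<in> VV S b \<Longrightarrow> z 0 = z' 0 \<Longrightarrow> z 1 = z' 1 \<Longrightarrow> z' \<in> VV S b"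
proof -
  assume "z \<in> VV S b" "z 0 = z' 0" "z 1 = z' 1"
  moreover from this have "restr 2 z = restr 2 z'" by (auto simp: restr_def less_2_cases_iff)
  ultimately show ?thesis by (simp add: VV_def)
qed

text \<open>Lets the entry of the word for the next step be chosen after a point of stage
  \<open>k\<close> is already described.\<close>

lemma Phi_cong_word:
  assumes "\<And>s. s \<le> k \<Longrightarrow> w s = w' s"
  shows "Phi S b w k = Phi S b w' k" "ch S b w k = ch S b w' k" "sg S w k = sg S w' k" "rho w k = rho w' k" "ev w k = ev w' k"
proof -
  have "Phi S b w k = Phi S b w' k \<and> ch S b w k = ch S b w' k \<and> sg S w k = sg S w' k \<and> rho w k = rho w' k \<and> ev w k = ev w' k"
    using assms
  proof (induction k)
    case (Suc k)
    then have IH: "Phi S b w k = Phi S b w' k" "ch S b w k = ch S b w' k" "sg S w k = sg S w' k" "rho w k = rho w' k" "ev w k = ev w' k"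
      and w: "w (Suc k) = w' (Suc k)" by auto
    show ?case unfolding Phi.simps ch.simps sg.simps rho.simps ev.simps other_def IH w by blast
  qed (simp add: fun_eq_iff)
  then show "Phi S b w k = Phi S b w' k" "ch S b w k = ch S b w' k" "sg S w k = sg S w' k" "rho w k = rho w' k" "ev w k = ev w' k"
    by auto
qed

lemma Phi_cong: "(\<And>a. a < k + 2 \<Longrightarrow> z a = z' a) \<Longrightarrow> Phi S b w k z = Phi S b w k z'"
proof (induction k arbitrary: z z')
  case 0
  then have "restr 2 z = restr 2 z'" by (intro ext) (simp add: restr_def)
  then show ?case by (simp only: Phi.simps)
next
  case (Suc k)
  have 1: "Phi S b w k z = Phi S b w k z'" by (rule Suc.IH) (use Suc.prems in simp)
  have 2: "ev w (Suc k) z = ev w (Suc k) z'" by (rule ev_cong) (use Suc.prems in simp)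
  have "partial_deriv a (\<lambda>z. FF S b w k z m) z = partial_deriv a (\<lambda>z. FF S b w k z m) z'" if "a < k + 2" for a m
  proof -
    have "Phi S b w k (z(a := s)) = Phi S b w k (z'(a := s))" for s by (rule Suc.IH) (use Suc.prems in simp)
    moreover have "z a = z' a" using Suc.prems that by simp
    ultimately show ?thesis by (simp add: partial_deriv_def FF_def)
  qed
  then have "dir_deriv (FF S b w k) (k + 2) z v = dir_deriv (FF S b w k) (k + 2) z' v" for v
    unfolding dir_deriv_def by (intro ext sum.cong) auto
  then show ?case unfolding Phi_Suc tvP_def 1 2 by simp
qed

lemma tvP_cong:
  assumes "\<And>a. a < k + 2 \<Longrightarrow> z a = z' a" "\<And>a. a < k + 2 \<Longrightarrow> v a = v' a"
  shows "tvP S b w k z v = tvP S b w k z' v'"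
proof -
  have "partial_deriv a (\<lambda>z. FF S b w k z m) z = partial_deriv a (\<lambda>z. FF S b w k z m) z'" if "a < k + 2" for a m
  proof -
    have "Phi S b w k (z(a := s)) = Phi S b w k (z'(a := s))" for s by (rule Phi_cong) (use assms in simp)
    moreover have "z a = z' a" using assms that by simp
    ultimately show ?thesis by (simp add: partial_deriv_def FF_def)
  qed
  then have "dir_deriv (FF S b w k) (k + 2) z v = dir_deriv (FF S b w k) (k + 2) z' v'"
    unfolding dir_deriv_def using assms(2) by (intro ext sum.cong) auto
  then show ?thesis unfolding tvP_def using Phi_cong[of k z z' S b w] assms(1) by simp
qed

lemma tvP_scale: "tvP S b w k z (\<lambda>a. r * v a) = (\<lambda>c i. r * tvP S b w k z v c i)"
proof -
  have "dir_deriv (FF S b w k) (k + 2) z (\<lambda>a. r * v a) = (\<lambda>m. r * dir_deriv (FF S b w k) (k + 2) z v m)"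
    unfolding dir_deriv_def by (auto simp: sum_distrib_left algebra_simps)
  then show ?thesis unfolding tvP_def by (simp add: tv_scale)
qed

lemma sm_ev: "k + 2 \<le> n \<Longrightarrow> smooth_along (open_plots n V) n (\<lambda>z. ev w k z a)"
proof (induction k arbitrary: a)
  case (Suc k)
  then have "smooth_along (open_plots n V) n (\<lambda>z. ev w k z a)" "smooth_along (open_plots n V) n (\<lambda>z. z (k + 2))" by (auto intro: sm_coord)
  then show ?case by (cases "w (Suc k)") (simp_all del: add_2_eq_Suc' add: sm_add sm_mult sm_const)
qed (auto intro: sm_const)

lemma mdim_pos: "2 \<le> mdim S \<Longrightarrow> 2 \<le> mdim (ambient S k)"
  by (induction k) auto

lemma
  assumes "mdim S = 2"
  shows sg_less: "a < k + 2 \<Longrightarrow> sg S w k a < mdim (ambient S k)"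
    and sg_inj: "inj_on (sg S w k) {..<k + 2}"
proof -
  have "(\<forall>a<k + 2. sg S w k a < mdim (ambient S k)) \<and> inj_on (sg S w k) {..<k + 2}"
  proof (induction k)
    case 0
    then show ?case using assms by simp
  next
    case (Suc k)
    let ?N = "mdim (ambient S k)"
    have N2: "2 \<le> ?N" by (rule mdim_pos) (simp add: assms)
    have ro: "rho w (Suc k) < k + 2" "other w k < k + 2" "rho w (Suc k) \<noteq> other w k"
      using rho_le[of w k] by (auto simp: other_def)
    then have ne: "sg S w k (rho w (Suc k)) \<noteq> sg S w k (other w k)" using Suc by (auto dest: inj_onD)
    have u: "unskip (sg S w k (rho w (Suc k))) (sg S w k (other w k)) < ?N - 1"
      by (rule unskip_less) (use Suc ro ne in auto)
    have 1: "sg S w (Suc k) a < mdim (ambient S (Suc k))" if "a < Suc k + 2" for a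
    proof (cases "a < k + 2")
      case True
      then have "sg S w k a < ?N" using Suc by blast
      then show ?thesis using True N2 by simp
    next
      case False
      then show ?thesis using u N2 by simp
    qed
    moreover have "inj_on (sg S w (Suc k)) {..<Suc k + 2}"
    proof (rule inj_onI)
      fix a a' assume aa: "a \<in> {..<Suc k + 2}" "a' \<in> {..<Suc k + 2}" "sg S w (Suc k) a = sg S w (Suc k) a'"
      have lt: "x < k + 2 \<Longrightarrow> sg S w k x < ?N" for x using Suc by blast
      show "a = a'"
        using aa lt[of a] lt[of a'] inj_onD[OF conjunct2[OF Suc], of a a'] by (auto split: if_splits)
    qed
    ultimately show ?case by blast
  qed
  then show "a < k + 2 \<Longrightarrow> sg S w k a < mdim (ambient S k)" "inj_on (sg S w k) {..<k + 2}" by auto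
qed

definition Eframe :: "(nat \<Rightarrow> bool) \<Rightarrow> nat \<Rightarrow> (nat \<Rightarrow> real) \<Rightarrow> real \<Rightarrow> real \<Rightarrow> nat \<Rightarrow> real" where
  "Eframe w k z \<alpha> \<beta> = (\<lambda>a. \<alpha> * ev w k z a + \<beta> * unitv (Suc k) a)"

lemma Eframe_rho: "Eframe w k z \<alpha> \<beta> (rho w k) = \<alpha>"
  using ev_rho[of w k z] rho_le[of w k] by (auto simp: Eframe_def unitv_def)

lemma Eframe_last: "Eframe w k z \<alpha> \<beta> (Suc k) = \<beta>"
  using ev_support[of k "Suc k" w z] by (simp add: Eframe_def unitv_def)

lemma ev_Suc_Eframe: "ev w (Suc k) z = (if w (Suc k) then Eframe w k z (z (k + 2)) 1 else Eframe w k z 1 (z (k + 2)))"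
  by (auto simp: Eframe_def fun_eq_iff)

section \<open>The coordinates describe the stages and their focal bundles\<close>

locale surf =
  fixes S :: "('a, 'c) manifold"
  assumes S: "smooth_surface S"
begin

lemma dimS: "mdim S = 2" and smS: "smooth_manifold S"
  using S by (auto simp: smooth_surface_def)

lemma hA: "hman (ambient S k)"
  unfolding hman_iff by (rule ambient_sman[OF smS])

sublocale A: hman "ambient S k" for k
  by (rule hA)

lemmas PTf = ambient.simps(2)[symmetric]
declare ambient.simps(2) [simp del]

lemma charts_Suc: "Aff c i \<in> charts (ambient S (Suc k)) \<longleftrightarrow> c \<in> charts (ambient S k) \<and> i < mdim (ambient S k)"
  by (simp add: ambient.simps(2))

lemma cdom_Suc: "cdom (ambient S (Suc k)) (Aff c i) = proj_dom (ambient S k) c i"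
  and coord_Suc: "coord (ambient S (Suc k)) (Aff c i) = proj_coord (ambient S k) c i"
  and mdim_Suc: "mdim (ambient S (Suc k)) = 2 * mdim (ambient S k) - 1"
  by (simp_all add: ambient.simps(2))

lemma ch_charts: "b \<in> charts S \<Longrightarrow> ch S b w k \<in> charts (ambient S k)"
proof (induction k)
  case (Suc k)
  have "rho w (Suc k) < k + 2" using rho_le[of w "Suc k"] by simp
  then show ?case using Suc sg_less[OF dimS] by (simp add: charts_Suc del: rho.simps)
qed simp

lemma VV_line_open: "b \<in> charts S \<Longrightarrow> line_open n (VV S b)"
  unfolding line_open_def
proof (intro ballI allI impI)
  fix z i assume b: "b \<in> charts S" and z: "z \<in> VV S b"
  show "\<forall>\<^sub>F s in nhds (z i). z(i := s) \<in> VV S b"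
  proof (cases "i < 2")
    case True
    have "line_open 2 (coord (ambient S 0) (Base b) ` cdom (ambient S 0) (Base b))"
      using eopen_line_open[OF A.op[of "Base b" 0]] b dimS by simp
    then have "\<forall>\<^sub>F s in nhds (restr 2 z i). (restr 2 z)(i := s) \<in> coord (ambient S 0) (Base b) ` cdom (ambient S 0) (Base b)"
      using True z unfolding line_open_def VV_def by blast
    moreover have "restr 2 z i = z i" "(restr 2 z)(i := s) = restr 2 (z(i := s))" for s
      using True by (auto simp: restr_def)
    ultimately show ?thesis by (simp add: VV_def)
  next
    case False
    then have "z(i := s) \<in> VV S b" for s by (intro VV_cong[OF z]) auto
    then show ?thesis by simp
  qed
qed

lemma VV_ev:
  assumes "b \<in> charts S" "\<zeta> t \<in> VV S b" "isCont (\<lambda>s. \<zeta> s 0) t" "isCont (\<lambda>s. \<zeta> s 1) t"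
  shows "\<forall>\<^sub>F s in nhds t. \<zeta> s \<in> VV S b"
proof -
  have "\<forall>\<^sub>F s in nhds t. restr 2 (\<zeta> s) \<in> coord (ambient S 0) (Base b) ` cdom (ambient S 0) (Base b)"
  proof (rule eopen_ev)
    show "eopen 2 (coord (ambient S 0) (Base b) ` cdom (ambient S 0) (Base b))"
      using A.op[of "Base b" 0] assms(1) dimS by simp
    show "restr 2 (\<zeta> t) \<in> coord (ambient S 0) (Base b) ` cdom (ambient S 0) (Base b)" using assms(2) by (simp add: VV_def)
    fix i :: nat assume "i < 2"
    then show "isCont (\<lambda>s. restr 2 (\<zeta> s) i) t" using assms(3,4) by (auto simp: restr_def less_2_cases_iff)
  qed (simp add: restr_def)
  then show ?thesis by (simp add: VV_def)
qed

text \<open>The third clause says that \<open>Phi\<close> is a graph over the coordinates at the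
  positions \<open>sg S w k a\<close>, which makes it injective with injective differential. The
  last one says that this graph is all of \<open>S(k)\<close> inside one ambient chart.\<close>

definition stage_coords :: "'c \<Rightarrow> (nat \<Rightarrow> bool) \<Rightarrow> nat \<Rightarrow> bool" where
  "stage_coords b w k \<longleftrightarrow> (\<forall>z\<in>VV S b. Phi S b w k z \<in> cdom (ambient S k) (ch S b w k)) \<and>
     (\<forall>m<mdim (ambient S k). smooth_along (open_plots (k + 2) (VV S b)) (k + 2) (\<lambda>z. FF S b w k z m)) \<and>
     (\<forall>a<k + 2. \<forall>z\<in>VV S b. FF S b w k z (sg S w k a) = z a) \<and>
     monster S k \<inter> cdom (ambient S k) (ch S b w k) = Phi S b w k ` VV S b"

definition stage_focal :: "'c \<Rightarrow> (nat \<Rightarrow> bool) \<Rightarrow> nat \<Rightarrow> bool" where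
  "stage_focal b w k \<longleftrightarrow> (\<forall>z\<in>VV S b. focal_bundle S k (Phi S b w k z) = {tvP S b w k z (Eframe w k z \<alpha> \<beta>) | \<alpha> \<beta>. True})"

lemma DF_nth:
  assumes "b \<in> charts S" "stage_coords b w k" "z \<in> VV S b" "a < k + 2"
  shows "dir_deriv (FF S b w k) (k + 2) z v (sg S w k a) = v a"
proof -
  have "partial_deriv i (\<lambda>z. FF S b w k z (sg S w k a)) z = (if i = a then 1 else 0)" if "i < k + 2" for i
  proof -
    have "\<forall>\<^sub>F s in nhds (z i). z(i := s) \<in> VV S b" using VV_line_open[OF assms(1)] assms(3) that unfolding line_open_def by blast
    then have "\<forall>\<^sub>F s in nhds (z i). FF S b w k (z(i := s)) (sg S w k a) = (z(i := s)) a"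
      by eventually_elim (use assms(2,4) in \<open>auto simp: stage_coords_def\<close>)
    then have "partial_deriv i (\<lambda>z. FF S b w k z (sg S w k a)) z = deriv (\<lambda>s. (z(i := s)) a) (z i)"
      unfolding partial_deriv_def by (intro deriv_cong_ev) auto
    also have "\<dots> = (if i = a then 1 else 0)" by (cases "i = a") auto
    finally show ?thesis .
  qed
  then have "dir_deriv (FF S b w k) (k + 2) z v (sg S w k a) = (\<Sum>i<k + 2. (if i = a then 1 else 0) * v i)"
    unfolding dir_deriv_def by (intro sum.cong) auto
  then show ?thesis using assms(4) by (simp add: if_distrib[of "\<lambda>u. u * _"] cong: if_cong)
qed

lemma tvP_nth:
  assumes "b \<in> charts S" "stage_coords b w k" "z \<in> VV S b" "a < k + 2"
  shows "tvP S b w k z v (ch S b w k) (sg S w k a) = v a"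
  unfolding tvP_def
  using A.tv_nth[OF ch_charts[OF assms(1)] _ sg_less[OF dimS assms(4)]] assms(2,3) DF_nth[OF assms] by (simp add: stage_coords_def)

lemma tvP_eq_iff:
  assumes "b \<in> charts S" "stage_coords b w k" "z \<in> VV S b"
  shows "tvP S b w k z v = tvP S b w k z v' \<longleftrightarrow> (\<forall>a<k + 2. v a = v' a)"
  using tvP_nth[OF assms, of _ v] tvP_nth[OF assms, of _ v'] tvP_cong[of k z z v v' S b w] by auto

lemma Phi_curve:
  assumes "b \<in> charts S" "stage_coords b w k" "open T" "\<And>a. a < k + 2 \<Longrightarrow> real_smooth T (\<lambda>t. \<zeta> t a)" "\<And>t. t \<in> T \<Longrightarrow> \<zeta> t \<in> VV S b"
  shows "curve_in_chart (ambient S k) (ch S b w k) (\<lambda>t. Phi S b w k (\<zeta> t)) T"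
    and "t \<in> T \<Longrightarrow> smooth_at (ambient S k) (\<lambda>t. Phi S b w k (\<zeta> t)) t"
    and "t \<in> T \<Longrightarrow> velocity (ambient S k) (\<lambda>t. Phi S b w k (\<zeta> t)) t
      = tvP S b w k (\<zeta> t) (\<lambda>a. deriv (\<lambda>s. \<zeta> s a) t)"
proof -
  note stage_coords = assms(2)[unfolded stage_coords_def]
  have sF: "smooth_along (open_plots (k + 2) (VV S b)) (k + 2) (\<lambda>z. FF S b w k z m)" if "m < mdim (ambient S k)" for m using stage_coords that by blast
  show sc: "curve_in_chart (ambient S k) (ch S b w k) (\<lambda>t. Phi S b w k (\<zeta> t)) T"
    unfolding curve_in_chart_def
  proof (intro conjI allI impI)
    show "(\<lambda>t. Phi S b w k (\<zeta> t)) ` T \<subseteq> cdom (ambient S k) (ch S b w k)" using stage_coords assms(5) by blast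
    fix m assume "m < mdim (ambient S k)"
    from sm_comp_rs[OF sF[OF this] assms(4,3,5)]
    show "real_smooth T (\<lambda>s. coord (ambient S k) (ch S b w k) (Phi S b w k (\<zeta> s)) m)" by (simp add: FF_def)
  qed
  assume t: "t \<in> T"
  show cs: "smooth_at (ambient S k) (\<lambda>t. Phi S b w k (\<zeta> t)) t"
    by (rule scurve_csm[OF sc assms(3) t ch_charts[OF assms(1)]])
  have in': "Phi S b w k (\<zeta> t) \<in> cdom (ambient S k) (ch S b w k)" using stage_coords assms(5)[OF t] by blast
  have evT: "\<forall>\<^sub>F s in nhds t. \<zeta> s \<in> VV S b"
    using eventually_nhds_in_open[OF assms(3) t] by eventually_elim (rule assms(5))
  have "tv (ambient S k) (Phi S b w k (\<zeta> t)) (ch S b w k) (velocity (ambient S k) (\<lambda>t. Phi S b w k (\<zeta> t)) t (ch S b w k))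
    = tvP S b w k (\<zeta> t) (\<lambda>a. deriv (\<lambda>s. \<zeta> s a) t)"
    unfolding tvP_def
  proof (rule tv_cong)
    fix m assume m: "m < mdim (ambient S k)"
    have "((\<lambda>s. FF S b w k (\<zeta> s) m) has_real_derivative (\<Sum>a<k + 2. partial_deriv a (\<lambda>z. FF S b w k z m) (\<zeta> t) * deriv (\<lambda>s. \<zeta> s a) t)) (at t)"
      by (rule sm_chain[OF sF[OF m] VV_line_open[OF assms(1)] rs_has_deriv[OF assms(4) t] evT])
    moreover have "((\<lambda>s. coord (ambient S k) (ch S b w k) (Phi S b w k (\<zeta> s)) m) has_real_derivative
        velocity (ambient S k) (\<lambda>t. Phi S b w k (\<zeta> t)) t (ch S b w k) m) (at t)"
      by (rule A.csm_deriv[OF cs ch_charts[OF assms(1)] in' m])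
    ultimately show "velocity (ambient S k) (\<lambda>t. Phi S b w k (\<zeta> t)) t (ch S b w k) m
       = dir_deriv (FF S b w k) (k + 2) (\<zeta> t) (\<lambda>a. deriv (\<lambda>s. \<zeta> s a) t) m"
      unfolding dir_deriv_def FF_def by (rule DERIV_unique[symmetric])
  qed
  then show "velocity (ambient S k) (\<lambda>t. Phi S b w k (\<zeta> t)) t = tvP S b w k (\<zeta> t) (\<lambda>a. deriv (\<lambda>s. \<zeta> s a) t)"
    using A.velocity_tv[OF cs ch_charts[OF assms(1)] in'] by simp
qed

text \<open>The tower coordinates are some of the ambient coordinates, so they are smooth along
  every smooth ambient curve; the last clause of \<open>stage_coords\<close> recovers the curve from
  them.\<close>

lemma monster_coords:
  assumes "b \<in> charts S" "stage_coords b w k" "smooth_at (ambient S k) \<gamma> t0" "\<forall>\<^sub>F s in nhds t0. \<gamma> s \<in> monster S k"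
    "\<gamma> t0 \<in> cdom (ambient S k) (ch S b w k)"
  shows "\<exists>e>0. \<exists>\<zeta>. (\<forall>a. real_smooth (ball t0 e) (\<lambda>s. \<zeta> s a)) \<and> (\<forall>s\<in>ball t0 e. \<zeta> s \<in> VV S b \<and> \<gamma> s = Phi S b w k (\<zeta> s))"
proof -
  note stage_coords = assms(2)[unfolded stage_coords_def]
  note c = ch_charts[OF assms(1), of w k]
  from A.csm_chart[OF assms(3) c assms(5)] obtain e1 where e1: "e1 > 0" "curve_in_chart (ambient S k) (ch S b w k) \<gamma> (ball t0 e1)" .
  obtain e2 where e2: "e2 > 0" "\<forall>s\<in>ball t0 e2. \<gamma> s \<in> monster S k" using assms(4) unfolding ev_ball by blast
  define e where "e = min e1 e2"
  define \<zeta> where "\<zeta> s a = (if a < k + 2 then coord (ambient S k) (ch S b w k) (\<gamma> s) (sg S w k a) else 0)" for s a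
  have sub: "ball t0 e \<subseteq> ball t0 e1" "ball t0 e \<subseteq> ball t0 e2" by (auto simp: e_def)
  have "real_smooth (ball t0 e) (\<lambda>s. \<zeta> s a)" for a
  proof (cases "a < k + 2")
    case True
    then have "real_smooth (ball t0 e1) (\<lambda>s. \<zeta> s a)" using e1(2) sg_less[OF dimS True] by (simp add: \<zeta>_def curve_in_chart_def)
    then show ?thesis by (rule rs_mono[OF _ sub(1)])
  next
    case False
    then show ?thesis by (simp add: \<zeta>_def rs_const)
  qed
  moreover have "\<zeta> s \<in> VV S b \<and> \<gamma> s = Phi S b w k (\<zeta> s)" if s: "s \<in> ball t0 e" for s
  proof -
    have "\<gamma> s \<in> monster S k \<inter> cdom (ambient S k) (ch S b w k)"
      using e1(2) e2(2) subsetD[OF sub(1) s] subsetD[OF sub(2) s] by (auto simp: curve_in_chart_def)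
    then obtain z where z: "z \<in> VV S b" "\<gamma> s = Phi S b w k z" using stage_coords by auto
    have eq: "\<zeta> s a = z a" if "a < k + 2" for a using stage_coords z that by (auto simp: \<zeta>_def FF_def)
    have "\<zeta> s \<in> VV S b" by (rule VV_cong[OF z(1)]) (use eq in auto)
    moreover have "Phi S b w k (\<zeta> s) = Phi S b w k z" by (rule Phi_cong) (rule eq)
    ultimately show ?thesis using z(2) by simp
  qed
  moreover have "e > 0" using e1(1) e2(1) by (simp add: e_def)
  ultimately show ?thesis by blast
qed

end

lemma velocity_cong:
  assumes "\<forall>\<^sub>F s in nhds t. \<gamma> s = \<gamma>' s"
  shows "velocity M \<gamma> t = velocity M \<gamma>' t"
proof -
  have e: "\<gamma> t = \<gamma>' t" using eventually_nhds_x_imp_x[OF assms] .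
  have d: "deriv (\<lambda>s. coord M c (\<gamma> s) i) t = deriv (\<lambda>s. coord M c (\<gamma>' s) i) t" for c i
    by (rule deriv_cong_ev[OF _ refl]) (use assms in \<open>eventually_elim, simp\<close>)
  show ?thesis unfolding velocity_def e by (intro ext if_cong refl d)
qed

lemma sm_more_vars:
  assumes "smooth_along (open_plots n V) n f" "n \<le> n'" "line_open n' V"
  shows "smooth_along (open_plots n' V) n' f"
  using sm_comp_PW[OF assms(1), of n' V "\<lambda>j z. z j" "\<lambda>j z. z j"] assms(2,3) sm_coord by simp

context surf begin

lemma monster_0: "monster S 0 = points (ambient S 0)"
  and focal_0: "focal_bundle S 0 = tangents (ambient S 0) (points (ambient S 0))"
  by (simp_all add: monster_def focal_bundle_def)

lemma monster_Suc: "monster S (Suc k) = {Line q l | q l. q \<in> monster S k \<and> l \<in> lines (focal_bundle S k q)}"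
  by (simp add: monster_def focal_bundle_def prolong_def proj_dist_def)

lemma focal_Suc: "focal_bundle S (Suc k) P = {v \<in> tangents (ambient S (Suc k)) (monster S (Suc k)) P.
    differential (ambient S (Suc k)) (ambient S k) foot P v \<in> dir P}"
  by (simp add: monster_def focal_bundle_def prolong_def PTf)

lemma stage_coords_0: "b \<in> charts S \<Longrightarrow> stage_coords b w 0"
proof -
  assume b: "b \<in> charts S"
  have c: "Base b \<in> charts (ambient S 0)" and m2: "mdim (ambient S 0) = 2" using b dimS by auto
  have F: "FF S b w 0 z m = restr 2 z m" if "z \<in> VV S b" for z m
    using A.coord_cinv[OF c, of "restr 2 z"] that by (simp add: FF_def VV_def del: ambient.simps)
  have "Phi S b w 0 ` VV S b = cdom (ambient S 0) (Base b)"
  proof (intro set_eqI iffI)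
    fix q assume "q \<in> Phi S b w 0 ` VV S b"
    then show "q \<in> cdom (ambient S 0) (Base b)"
      using A.cinv_cdom[OF c] by (auto simp: VV_def simp del: ambient.simps)
  next
    fix q assume q: "q \<in> cdom (ambient S 0) (Base b)"
    have r: "restr 2 (coord (ambient S 0) (Base b) q) = coord (ambient S 0) (Base b) q"
      using A.coord_0[OF c q] unfolding m2 restr_def by (intro ext) simp
    then have "coord (ambient S 0) (Base b) q \<in> VV S b" using q unfolding VV_def by simp
    moreover have "Phi S b w 0 (coord (ambient S 0) (Base b) q) = q"
      unfolding Phi.simps r by (rule A.cinv_coord[OF c q])
    ultimately show "q \<in> Phi S b w 0 ` VV S b" by (metis imageI)
  qed
  moreover have "smooth_along (open_plots 2 (VV S b)) 2 (\<lambda>z. FF S b w 0 z m)" if "m < 2" for m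
    by (rule sm_PW_cong[OF sm_coord[OF that]]) (use F that in \<open>simp add: restr_def\<close>)
  moreover have "monster S 0 \<inter> cdom (ambient S 0) (Base b) = cdom (ambient S 0) (Base b)"
    unfolding monster_0 using A.cdom_points[OF c] by blast
  ultimately show ?thesis unfolding stage_coords_def using F m2
    by (auto simp: restr_def numeral_2_eq_2 simp del: ambient.simps Phi.simps)
qed

lemma stage_focal_0: "b \<in> charts S \<Longrightarrow> stage_focal b w 0"
  unfolding stage_focal_def
proof
  fix z assume b: "b \<in> charts S" and z: "z \<in> VV S b"
  note stage_coords = stage_coords_0[OF b, of w]
  have c: "Base b \<in> charts (ambient S 0)" and m2: "mdim (ambient S 0) = 2" using b dimS by auto
  have q: "Phi S b w 0 z \<in> cdom (ambient S 0) (Base b)" using stage_coords z unfolding stage_coords_def by simp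
  have nth: "dir_deriv (FF S b w 0) (0 + 2) z v m = v m" if "m < 2" for v m
    using DF_nth[OF b stage_coords z, of m v] that by simp
  have eq: "tvP S b w 0 z v = tv (ambient S 0) (Phi S b w 0 z) (Base b) v" for v
    unfolding tvP_def ch.simps by (rule tv_cong) (use nth m2 in simp)
  have E0: "Eframe w 0 z \<alpha> \<beta> 0 = \<alpha>" "Eframe w 0 z \<alpha> \<beta> 1 = \<beta>" for \<alpha> \<beta> by (auto simp: Eframe_def unitv_def)
  show "focal_bundle S 0 (Phi S b w 0 z) = {tvP S b w 0 z (Eframe w 0 z \<alpha> \<beta>) | \<alpha> \<beta>. True}"
    unfolding focal_0 A.tangents_tv[OF c q]
  proof (intro set_eqI iffI)
    fix v assume "v \<in> {tv (ambient S 0) (Phi S b w 0 z) (Base b) \<xi> | \<xi>. True}"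
    then obtain \<xi> where v: "v = tvP S b w 0 z \<xi>" unfolding eq by blast
    have "tvP S b w 0 z \<xi> = tvP S b w 0 z (Eframe w 0 z (\<xi> 0) (\<xi> 1))"
      by (rule tvP_cong) (use E0 in \<open>auto simp: less_Suc_eq\<close>)
    then show "v \<in> {tvP S b w 0 z (Eframe w 0 z \<alpha> \<beta>) | \<alpha> \<beta>. True}" using v by blast
  next
    fix v assume "v \<in> {tvP S b w 0 z (Eframe w 0 z \<alpha> \<beta>) | \<alpha> \<beta>. True}"
    then show "v \<in> {tv (ambient S 0) (Phi S b w 0 z) (Base b) \<xi> | \<xi>. True}" unfolding eq by blast
  qed
qed

lemma tvP_in_line:
  assumes "b \<in> charts S" "stage_coords b w k" "z \<in> VV S b"
  shows "tvP S b w k z v \<in> line_of (tvP S b w k z v') \<longleftrightarrow> (\<exists>r. \<forall>a<k + 2. v a = r * v' a)"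
proof -
  have "tvP S b w k z v \<in> line_of (tvP S b w k z v') \<longleftrightarrow> (\<exists>r. tvP S b w k z v = tvP S b w k z (\<lambda>a. r * v' a))"
    unfolding line_of_def tvP_scale by blast
  then show ?thesis unfolding tvP_eq_iff[OF assms] .
qed

lemma tvP_zero_iff:
  assumes "b \<in> charts S" "stage_coords b w k" "z \<in> VV S b"
  shows "tvP S b w k z v = (\<lambda>_ _. 0) \<longleftrightarrow> (\<forall>a<k + 2. v a = 0)"
proof -
  have "(\<lambda>_ _. 0) = tvP S b w k z (\<lambda>a. 0 * v a)" unfolding tvP_scale by simp
  then show ?thesis using tvP_eq_iff[OF assms, of v "\<lambda>a. 0 * v a"] by simp
qed

lemma dir_Phi: "dir (Phi S b w (Suc k) z) = line_of (tvP S b w k z (ev w (Suc k) z))"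
  and foot_Phi: "foot (Phi S b w (Suc k) z) = Phi S b w k z"
  unfolding Phi_Suc by simp_all

text \<open>Test curves, used both to compute differentials and to exhibit tangent vectors of the
  stages and of the divisors.\<close>

lemma straight:
  fixes v :: "nat \<Rightarrow> real"
  assumes "b \<in> charts S" "stage_coords b w k" "z \<in> VV S b"
  defines "\<gamma> \<equiv> \<lambda>t. Phi S b w k (\<lambda>a. z a + t * v a)"
  shows "\<exists>e>0. \<forall>t\<in>ball 0 e. (\<lambda>a. z a + t * v a) \<in> VV S b \<and> smooth_at (ambient S k) \<gamma> t"
    and "velocity (ambient S k) \<gamma> 0 = tvP S b w k z v"
proof -
  have "\<forall>\<^sub>F t in nhds 0. (\<lambda>a. z a + t * v a) \<in> VV S b"
    by (rule VV_ev[OF assms(1)]) (use assms(3) in \<open>auto intro!: continuous_intros\<close>)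
  then obtain e where e: "e > 0" "\<forall>t\<in>ball 0 e. (\<lambda>a. z a + t * v a) \<in> VV S b" unfolding ev_ball by blast
  have r: "real_smooth (ball 0 e) (\<lambda>t. z a + t * v a)" for a by (intro rs_add rs_const rs_mult rs_id)
  note pc = Phi_curve[OF assms(1,2) open_ball, of 0 e "\<lambda>t a. z a + t * v a"]
  have "smooth_at (ambient S k) \<gamma> t" if "t \<in> ball 0 e" for t
    unfolding \<gamma>_def by (rule pc(2)) (use e r that in auto)
  then show "\<exists>e>0. \<forall>t\<in>ball 0 e. (\<lambda>a. z a + t * v a) \<in> VV S b \<and> smooth_at (ambient S k) \<gamma> t" using e by blast
  have d: "deriv (\<lambda>s. z a + s * v a) 0 = v a" for a
    by (rule DERIV_imp_deriv) (auto intro!: derivative_eq_intros)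
  have "velocity (ambient S k) (\<lambda>t. Phi S b w k (\<lambda>a. z a + t * v a)) 0
     = tvP S b w k (\<lambda>a. z a + 0 * v a) (\<lambda>a. deriv (\<lambda>s. z a + s * v a) 0)"
    by (rule pc(3)) (use e r in auto)
  then show "velocity (ambient S k) \<gamma> 0 = tvP S b w k z v" by (simp add: \<gamma>_def d)
qed

lemma differential_curve:
  assumes "e > 0" "\<And>t. t \<in> ball 0 e \<Longrightarrow> smooth_at (ambient S (Suc k)) \<gamma> t"
  shows "differential (ambient S (Suc k)) (ambient S k) foot (\<gamma> 0) (velocity (ambient S (Suc k)) \<gamma> 0)
    = velocity (ambient S k) (foot \<circ> \<gamma>) 0"
  using A.differential_foot[of e k \<gamma>] assms unfolding PTf by blast

text \<open>In coordinates \<open>foot\<close> forgets the last coordinate and maps a straight line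
  to the straight line with the same direction.\<close>

lemma differential_tvP:
  assumes b: "b \<in> charts S" and stage_coords: "stage_coords b w k" "stage_coords b w (Suc k)" and z: "z \<in> VV S b"
  shows "differential (ambient S (Suc k)) (ambient S k) foot (Phi S b w (Suc k) z) (tvP S b w (Suc k) z v) = tvP S b w k z v"
proof -
  let ?\<gamma> = "\<lambda>t. Phi S b w (Suc k) (\<lambda>a. z a + t * v a)"
  obtain e where e: "e > 0" "\<forall>t\<in>ball 0 e. smooth_at (ambient S (Suc k)) ?\<gamma> t" using straight(1)[OF b stage_coords(2) z, of v] by blast
  have g0: "?\<gamma> 0 = Phi S b w (Suc k) z" by simp
  have f: "foot \<circ> ?\<gamma> = (\<lambda>t. Phi S b w k (\<lambda>a. z a + t * v a))" by (simp add: o_def foot_Phi)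
  show ?thesis
    using differential_curve[OF e(1), of k ?\<gamma>] e(2) unfolding straight(2)[OF b stage_coords(2) z] f straight(2)[OF b stage_coords(1) z] g0 by blast
qed

lemma rho_lt: "rho w (Suc k) < k + 2" "other w k < k + 2"
  using rho_le[of w "Suc k"] rho_le[of w k] by (auto simp: other_def)

lemma tvP_not_zero:
  assumes "b \<in> charts S" "stage_coords b w k" "z \<in> VV S b"
  shows "tvP S b w k z (ev w (Suc k) z) \<noteq> (\<lambda>_ _. 0)"
  using tvP_zero_iff[OF assms, of "ev w (Suc k) z"] ev_rho[of w "Suc k" z] rho_lt(1)[of w k] by fastforce

text \<open>A focal direction with nonzero component along the coordinate retained by the word is the one
  of \<open>ev w (Suc k)\<close> for exactly one value of the new coordinate.\<close>

lemma focal_line: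
  assumes b: "b \<in> charts S" and stage_coords: "stage_coords b w k" and z: "z \<in> VV S b"
    and ne: "Eframe w k z \<alpha> \<beta> (rho w (Suc k)) \<noteq> 0"
  shows "\<exists>x. Line (Phi S b w k z) (line_of (tvP S b w k z (Eframe w k z \<alpha> \<beta>))) = Phi S b w (Suc k) (z(k + 2 := x)) \<and>
     z(k + 2 := x) \<in> VV S b \<and> (w (Suc k) \<longrightarrow> \<alpha> = 0 \<longrightarrow> x = 0)"
proof -
  define g x where "g = Eframe w k z \<alpha> \<beta> (rho w (Suc k))" and "x = (if w (Suc k) then \<alpha> / \<beta> else \<beta> / \<alpha>)"
  let ?z = "z(k + 2 := x)"
  have agree: "z a = ?z a" if "a < k + 2" for a using that by simp
  have evk: "ev w k ?z = ev w k z" by (rule ev_cong) simp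
  have zV: "?z \<in> VV S b" by (rule VV_cong[OF z]) auto
  have g: "g = (if w (Suc k) then \<beta> else \<alpha>)" unfolding g_def using Eframe_rho[of w k z \<alpha> \<beta>] Eframe_last[of w k z \<alpha> \<beta>] by simp
  have gne: "g \<noteq> 0" using ne by (simp add: g_def)
  have E: "Eframe w k z \<alpha> \<beta> = (\<lambda>a. g * ev w (Suc k) ?z a)"
    using gne unfolding Eframe_def ev.simps(2) evk
    using g by (cases "w (Suc k)") (auto simp: x_def fun_eq_iff distrib_left)
  have "line_of (tvP S b w k z (Eframe w k z \<alpha> \<beta>)) = line_of (tvP S b w k z (ev w (Suc k) ?z))"
    unfolding E tvP_scale by (rule line_of_scale) (use ne in \<open>simp add: g_def\<close>)
  also have "tvP S b w k z (ev w (Suc k) ?z) = tvP S b w k ?z (ev w (Suc k) ?z)" by (rule tvP_cong) (use agree in auto)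
  finally have l: "line_of (tvP S b w k z (Eframe w k z \<alpha> \<beta>)) = line_of (tvP S b w k ?z (ev w (Suc k) ?z))" .
  have "Phi S b w k z = Phi S b w k ?z" by (rule Phi_cong[OF agree])
  with l have "Line (Phi S b w k z) (line_of (tvP S b w k z (Eframe w k z \<alpha> \<beta>))) = Phi S b w (Suc k) ?z"
    unfolding Phi_Suc by (rule arg_cong2[where f = Line, rotated])
  then show ?thesis using zV by (intro exI[of _ x]) (simp add: x_def)
qed

text \<open>The field \<open>ev w (Suc k)\<close> has entry 1 along the retained coordinate, so its
  push-forward \<open>\<xi>\<close> is already normalized for the affine chart. Conversely, a focal
  line lies in that chart only if its retained component is nonzero, which is the hypothesis of
  \<open>focal_line\<close>.\<close>

lemma stage_coords_Suc:
  assumes b: "b \<in> charts S" and stage_coords: "stage_coords b w k" and stage_focal: "stage_focal b w k"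
  shows "stage_coords b w (Suc k)"
proof -
  let ?M = "ambient S k" and ?c = "ch S b w k" and ?i = "sg S w k (rho w (Suc k))"
  let ?N = "mdim ?M"
  define \<xi> where "\<xi> z = dir_deriv (FF S b w k) (k + 2) z (ev w (Suc k) z)" for z
  note L = stage_coords[unfolded stage_coords_def]
  note c = ch_charts[OF b, of w k]
  have i: "?i < ?N" by (rule sg_less[OF dimS rho_lt(1)])
  have q: "Phi S b w k z \<in> cdom ?M ?c" if "z \<in> VV S b" for z using L that by blast
  have \<xi>nth: "\<xi> z (sg S w k a) = ev w (Suc k) z a" if "z \<in> VV S b" "a < k + 2" for z a
    unfolding \<xi>_def by (rule DF_nth[OF b stage_coords that])
  have \<xi>i: "\<xi> z ?i = 1" if "z \<in> VV S b" for z using \<xi>nth[OF that rho_lt(1)] ev_rho[of w "Suc k" z] by simp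
  have Ph: "Phi S b w (Suc k) z = Line (Phi S b w k z) (line_of (tv ?M (Phi S b w k z) ?c (\<xi> z)))" for z
    unfolding Phi_Suc tvP_def \<xi>_def ..
  have dom: "Phi S b w (Suc k) z \<in> proj_dom ?M ?c ?i" if "z \<in> VV S b" for z
    unfolding Ph by (rule A.proj_domI[OF c q[OF that] i]) (use \<xi>i[OF that] in simp)
  have F: "FF S b w (Suc k) z = pcoord ?N ?i (FF S b w k z) (\<xi> z)" if "z \<in> VV S b" for z
    unfolding FF_def ch.simps coord_Suc Ph using A.proj_coord_eq[OF c i q[OF that], of "\<xi> z"] \<xi>i[OF that] by simp
  have lo: "line_open (Suc k + 2) (VV S b)" by (rule VV_line_open[OF b])
  have lo': "line_open (k + 2) (VV S b)" by (rule VV_line_open[OF b])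
  have smF: "smooth_along (open_plots (Suc k + 2) (VV S b)) (Suc k + 2) (\<lambda>z. FF S b w k z m)" if "m < ?N" for m
    by (rule sm_more_vars[OF _ _ lo]) (use L that in auto)
  have smooth_along\<xi>: "smooth_along (open_plots (Suc k + 2) (VV S b)) (Suc k + 2) (\<lambda>z. \<xi> z m)" if "m < ?N" for m
    unfolding \<xi>_def dir_deriv_def
  proof (intro sm_sum sm_mult)
    fix a assume a: "a < k + 2"
    have "smooth_along (open_plots (k + 2) (VV S b)) (k + 2) (partial_deriv a (\<lambda>z. FF S b w k z m))"
      by (rule sm_partial_deriv[OF _ lo' a]) (use L that in blast)
    then show "smooth_along (open_plots (Suc k + 2) (VV S b)) (Suc k + 2) (partial_deriv a (\<lambda>z. FF S b w k z m))"
      by (rule sm_more_vars[OF _ _ lo]) simp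
    show "smooth_along (open_plots (Suc k + 2) (VV S b)) (Suc k + 2) (\<lambda>z. ev w (Suc k) z a)" by (rule sm_ev) simp
  qed
  have 1: "\<forall>z\<in>VV S b. Phi S b w (Suc k) z \<in> cdom (ambient S (Suc k)) (ch S b w (Suc k))"
    unfolding ch.simps cdom_Suc using dom by blast
  have 2: "smooth_along (open_plots (Suc k + 2) (VV S b)) (Suc k + 2) (\<lambda>z. FF S b w (Suc k) z m)" if m: "m < mdim (ambient S (Suc k))" for m
  proof (cases "m < ?N")
    case True
    show ?thesis by (rule sm_PW_cong[OF smF[OF True]]) (use F True in \<open>simp add: pcoord_def\<close>)
  next
    case False
    then have "skip ?i (m - ?N) < ?N" using skip_bounds[OF i, of "m - ?N"] m unfolding mdim_Suc by linarith
    from smooth_along\<xi>[OF this] show ?thesis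
      by (rule sm_PW_cong) (use F False m in \<open>simp add: pcoord_def mdim_Suc\<close>)
  qed
  have 3: "FF S b w (Suc k) z (sg S w (Suc k) a) = z a" if z: "z \<in> VV S b" and a: "a < Suc k + 2" for z a
  proof (cases "a < k + 2")
    case True
    then have "sg S w k a < ?N" by (rule sg_less[OF dimS])
    then show ?thesis using F[OF z] True L z by (simp add: pcoord_def)
  next
    case False
    then have ak: "a = k + 2" using a by simp
    let ?m = "sg S w k (other w k)"
    have m: "?m < ?N" by (rule sg_less[OF dimS rho_lt(2)])
    have "rho w (Suc k) \<noteq> other w k" using rho_le[of w k] by (auto simp: other_def)
    then have ne: "?m \<noteq> ?i" using inj_onD[OF sg_inj[OF dimS, of w k], of "rho w (Suc k)" "other w k"] rho_lt[of w k] by auto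
    have u: "unskip ?i ?m < ?N - 1" by (rule unskip_less[OF i m ne])
    have "FF S b w (Suc k) z (?N + unskip ?i ?m) = \<xi> z (skip ?i (unskip ?i ?m))"
      using F[OF z] u by (simp add: pcoord_def)
    also have "\<dots> = \<xi> z ?m" by (rule arg_cong[OF unskip_skip[OF ne]])
    also have "\<dots> = z (k + 2)" using \<xi>nth[OF z rho_lt(2)] ev_other[of w k z] by simp
    finally show ?thesis using ak by simp
  qed
  have 4: "monster S (Suc k) \<inter> cdom (ambient S (Suc k)) (ch S b w (Suc k)) = Phi S b w (Suc k) ` VV S b"
  proof (intro set_eqI iffI)
    fix P assume "P \<in> monster S (Suc k) \<inter> cdom (ambient S (Suc k)) (ch S b w (Suc k))"
    then obtain p l where P: "P = Line p l" "p \<in> monster S k" "l \<in> lines (focal_bundle S k p)" "P \<in> proj_dom ?M ?c ?i"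
      unfolding monster_Suc ch.simps cdom_Suc by blast
    then obtain v' where v': "p \<in> cdom ?M ?c" "v' \<in> l" "v' ?c ?i \<noteq> 0" unfolding proj_dom_def by blast
    then obtain z where z: "z \<in> VV S b" "p = Phi S b w k z" using L P(2) by blast
    obtain v where v: "l = line_of v" "v \<in> focal_bundle S k p" using P(3) unfolding lines_def by blast
    then obtain \<alpha> \<beta> where \<alpha>: "v = tvP S b w k z (Eframe w k z \<alpha> \<beta>)" using stage_focal z unfolding stage_focal_def by blast
    have "v ?c ?i \<noteq> 0" using v' v(1) by (auto simp: line_of_def)
    then have "Eframe w k z \<alpha> \<beta> (rho w (Suc k)) \<noteq> 0" unfolding \<alpha> tvP_nth[OF b stage_coords z(1) rho_lt(1)] .
    from focal_line[OF b stage_coords z(1) this] show "P \<in> Phi S b w (Suc k) ` VV S b"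
      unfolding P(1) v(1) z(2) \<alpha> by blast
  next
    fix P assume "P \<in> Phi S b w (Suc k) ` VV S b"
    then obtain z where z: "z \<in> VV S b" "P = Phi S b w (Suc k) z" by blast
    have "\<exists>\<alpha> \<beta>. ev w (Suc k) z = Eframe w k z \<alpha> \<beta>"
      unfolding ev_Suc_Eframe by (cases "w (Suc k)") (simp_all only: if_True if_False, blast+)
    then obtain \<alpha> \<beta> where E: "ev w (Suc k) z = Eframe w k z \<alpha> \<beta>" by blast
    have "tvP S b w k z (Eframe w k z \<alpha> \<beta>) \<in> focal_bundle S k (Phi S b w k z)"
      unfolding bspec[OF stage_focal[unfolded stage_focal_def] z(1)] by blast
    then have "tvP S b w k z (ev w (Suc k) z) \<in> focal_bundle S k (Phi S b w k z)" unfolding E .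
    moreover have "Phi S b w k z \<in> monster S k" using L z(1) by blast
    ultimately have "P \<in> monster S (Suc k)"
      unfolding z(2) Phi_Suc monster_Suc lines_def using tvP_not_zero[OF b stage_coords z(1)] by blast
    then show "P \<in> monster S (Suc k) \<inter> cdom (ambient S (Suc k)) (ch S b w (Suc k))"
      using 1 z by blast
  qed
  show ?thesis unfolding stage_coords_def using 1 2 3 4 by blast
qed

lemma Phi_inj:
  assumes "stage_coords b w k" "z \<in> VV S b" "z' \<in> VV S b" "Phi S b w k z = Phi S b w k z'" "a < k + 2"
  shows "z a = z' a"
proof -
  have "FF S b w k z (sg S w k a) = z a" "FF S b w k z' (sg S w k a) = z' a" using assms unfolding stage_coords_def by blast+
  then show ?thesis using assms(4) by (simp add: FF_def)
qed

text \<open>Besides the components of \<open>v\<close> this gives a coordinate curve inside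
  \<open>N\<close>. For a prolonged divisor, a coordinate that vanishes on \<open>N\<close> then
  also has derivative 0.\<close>

lemma tangents_coords:
  assumes b: "b \<in> charts S" and stage_coords: "stage_coords b w k" and z: "z \<in> VV S b" and N: "N \<subseteq> monster S k"
    and v: "v \<in> tangents (ambient S k) N (Phi S b w k z)"
  shows "\<exists>\<zeta> e. e > 0 \<and> (\<forall>a. real_smooth (ball 0 e) (\<lambda>s. \<zeta> s a)) \<and> (\<forall>s\<in>ball 0 e. \<zeta> s \<in> VV S b \<and> Phi S b w k (\<zeta> s) \<in> N) \<and>
    (\<forall>a<k + 2. \<zeta> 0 a = z a) \<and> v = tvP S b w k z (\<lambda>a. deriv (\<lambda>s. \<zeta> s a) 0)"
proof -
  obtain \<gamma> e1 where g: "e1 > 0" "\<gamma> 0 = Phi S b w k z" "v = velocity (ambient S k) \<gamma> 0"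
    "\<forall>t\<in>ball 0 e1. smooth_at (ambient S k) \<gamma> t \<and> \<gamma> t \<in> N" using v unfolding A.tangents_iff by blast
  have "\<forall>\<^sub>F s in nhds 0. \<gamma> s \<in> monster S k" unfolding ev_ball using g(1,4) N by blast
  moreover have "smooth_at (ambient S k) \<gamma> 0" using g(1,4) by simp
  moreover have "\<gamma> 0 \<in> cdom (ambient S k) (ch S b w k)" using g(2) stage_coords z unfolding stage_coords_def by simp
  ultimately obtain e2 \<zeta> where \<zeta>: "e2 > 0" "\<forall>a. real_smooth (ball 0 e2) (\<lambda>s. \<zeta> s a)"
    "\<forall>s\<in>ball 0 e2. \<zeta> s \<in> VV S b \<and> \<gamma> s = Phi S b w k (\<zeta> s)" using monster_coords[OF b stage_coords] by blast
  define e where "e = min e1 e2"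
  have e: "e > 0" "ball 0 e \<subseteq> ball (0::real) e1" "ball 0 e \<subseteq> ball (0::real) e2" using g(1) \<zeta>(1) by (auto simp: e_def)
  have r: "real_smooth (ball 0 e) (\<lambda>s. \<zeta> s a)" for a using rs_mono[OF _ e(3)] \<zeta>(2) by blast
  have V: "\<zeta> s \<in> VV S b" "\<gamma> s = Phi S b w k (\<zeta> s)" "\<gamma> s \<in> N" if "s \<in> ball 0 e" for s
    using \<zeta>(3) g(4) that e(2,3) by blast+
  have 0: "0 \<in> ball 0 e" using e(1) by simp
  have eq0: "\<zeta> 0 a = z a" if "a < k + 2" for a
    by (rule Phi_inj[OF stage_coords V(1)[OF 0] z _ that]) (use V(2)[OF 0] g(2) in simp)
  have "\<forall>\<^sub>F s in nhds 0. \<gamma> s = Phi S b w k (\<zeta> s)" unfolding ev_ball using e(1) V(2) by blast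
  from velocity_cong[OF this, of "ambient S k"] have "v = tvP S b w k (\<zeta> 0) (\<lambda>a. deriv (\<lambda>s. \<zeta> s a) 0)"
    unfolding g(3) by (rule trans) (rule Phi_curve(3)[OF b stage_coords open_ball r V(1) 0])
  also have "\<dots> = tvP S b w k z (\<lambda>a. deriv (\<lambda>s. \<zeta> s a) 0)" by (rule tvP_cong) (use eq0 in auto)
  finally have "v = tvP S b w k z (\<lambda>a. deriv (\<lambda>s. \<zeta> s a) 0)" .
  then show ?thesis using e(1) r V eq0 by (intro exI[of _ \<zeta>] exI[of _ e]) auto
qed

text \<open>Being mapped into the line fixes the old components up to a factor and leaves the
  component of the new coordinate free.\<close>

lemma stage_focal_Suc:
  assumes b: "b \<in> charts S" and stage_coords: "stage_coords b w k" "stage_coords b w (Suc k)"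
  shows "stage_focal b w (Suc k)"
  unfolding stage_focal_def
proof
  fix z assume z: "z \<in> VV S b"
  let ?P = "Phi S b w (Suc k) z"
  have in_dir: "differential (ambient S (Suc k)) (ambient S k) foot ?P (tvP S b w (Suc k) z v) \<in> dir ?P \<longleftrightarrow>
      (\<exists>r. \<forall>a<k + 2. v a = r * ev w (Suc k) z a)" for v
    unfolding differential_tvP[OF b stage_coords z] dir_Phi tvP_in_line[OF b stage_coords(1) z] ..
  show "focal_bundle S (Suc k) ?P = {tvP S b w (Suc k) z (Eframe w (Suc k) z \<alpha> \<beta>) | \<alpha> \<beta>. True}"
  proof (intro set_eqI iffI)
    fix v assume "v \<in> focal_bundle S (Suc k) ?P"
    then have v: "v \<in> tangents (ambient S (Suc k)) (monster S (Suc k)) ?P"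
      "differential (ambient S (Suc k)) (ambient S k) foot ?P v \<in> dir ?P" unfolding focal_Suc by auto
    from tangents_coords[OF b stage_coords(2) z order_refl v(1)] obtain v0 where v0: "v = tvP S b w (Suc k) z v0" by blast
    obtain r where r: "\<forall>a<k + 2. v0 a = r * ev w (Suc k) z a" using v(2) unfolding v0 in_dir by blast
    have "v = tvP S b w (Suc k) z (Eframe w (Suc k) z r (v0 (k + 2)))"
      unfolding v0
    proof (rule tvP_cong)
      fix a assume "a < Suc k + 2"
      then consider "a < k + 2" | "a = k + 2" by linarith
      then show "v0 a = Eframe w (Suc k) z r (v0 (k + 2)) a"
      proof cases
        case 1
        then show ?thesis using r by (simp add: Eframe_def unitv_def del: ev.simps)
      next
        case 2
        then show ?thesis using Eframe_last[of w "Suc k" z r "v0 (k + 2)"] by simp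
      qed
    qed simp
    then show "v \<in> {tvP S b w (Suc k) z (Eframe w (Suc k) z \<alpha> \<beta>) | \<alpha> \<beta>. True}" by blast
  next
    fix v assume "v \<in> {tvP S b w (Suc k) z (Eframe w (Suc k) z \<alpha> \<beta>) | \<alpha> \<beta>. True}"
    then obtain \<alpha> \<beta> where v: "v = tvP S b w (Suc k) z (Eframe w (Suc k) z \<alpha> \<beta>)" by blast
    let ?v = "Eframe w (Suc k) z \<alpha> \<beta>"
    let ?\<gamma> = "\<lambda>t. Phi S b w (Suc k) (\<lambda>a. z a + t * ?v a)"
    obtain e where e: "e > 0" "\<forall>t\<in>ball 0 e. (\<lambda>a. z a + t * ?v a) \<in> VV S b \<and> smooth_at (ambient S (Suc k)) ?\<gamma> t"
      using straight(1)[OF b stage_coords(2) z, of ?v] by blast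
    have "?\<gamma> t \<in> monster S (Suc k)" if "t \<in> ball 0 e" for t using stage_coords(2) e(2) that unfolding stage_coords_def by blast
    then have "v \<in> tangents (ambient S (Suc k)) (monster S (Suc k)) ?P"
      unfolding A.tangents_iff v using e straight(2)[OF b stage_coords(2) z, of ?v] by (intro exI[of _ ?\<gamma>] exI[of _ e]) auto
    moreover have "\<exists>r. \<forall>a<k + 2. ?v a = r * ev w (Suc k) z a"
      by (intro exI[of _ \<alpha>]) (simp add: Eframe_def unitv_def del: ev.simps)
    ultimately show "v \<in> focal_bundle S (Suc k) ?P" unfolding focal_Suc v using in_dir by blast
  qed
qed

lemma stage_coords_focal: "b \<in> charts S \<Longrightarrow> stage_coords b w k \<and> stage_focal b w k"
proof (induction k)
  case 0
  then show ?case using stage_coords_0 stage_focal_0 by blast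
next
  case (Suc k)
  then have 1: "stage_coords b w k" "stage_focal b w k" by auto
  have 2: "stage_coords b w (Suc k)" by (rule stage_coords_Suc[OF Suc.prems 1])
  show ?case using 2 stage_focal_Suc[OF Suc.prems 1(1) 2] by blast
qed

lemmas stage_coords_Phi = stage_coords_focal[THEN conjunct1] and stage_focal_Phi = stage_coords_focal[THEN conjunct2]

lemma Phi_monster: "b \<in> charts S \<Longrightarrow> z \<in> VV S b \<Longrightarrow> Phi S b w k z \<in> monster S k"
  and Phi_cdom: "b \<in> charts S \<Longrightarrow> z \<in> VV S b \<Longrightarrow> Phi S b w k z \<in> cdom (ambient S k) (ch S b w k)"
  using stage_coords_Phi[of b w k] unfolding stage_coords_def by blast+

lemma focal_Phi: "b \<in> charts S \<Longrightarrow> z \<in> VV S b \<Longrightarrow>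
    focal_bundle S k (Phi S b w k z) = {tvP S b w k z (Eframe w k z \<alpha> \<beta>) | \<alpha> \<beta>. True}"
  using stage_focal_Phi unfolding stage_focal_def by blast

text \<open>Most points lie in charts for several words. The extra condition selects one in which a
  step is inverted only for a vertical line, so that the inverted coordinate vanishes at the
  point.\<close>

lemma monster_surj:
  "P \<in> monster S k \<Longrightarrow> \<exists>b\<in>charts S. \<exists>w. \<exists>z\<in>VV S b. P = Phi S b w k z \<and> (\<forall>s. 1 \<le> s \<and> s \<le> k \<and> w s \<longrightarrow> z (Suc s) = 0)"
proof (induction k arbitrary: P)
  case 0
  then obtain b where b: "b \<in> charts S" "P \<in> cdom (ambient S 0) (Base b)"
    unfolding monster_0 points_def by auto
  have "P \<in> monster S 0 \<inter> cdom (ambient S 0) (ch S b (\<lambda>_. False) 0)" using 0 b by simp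
  then have "P \<in> Phi S b (\<lambda>_. False) 0 ` VV S b" using stage_coords_Phi[OF b(1)] unfolding stage_coords_def by blast
  then show ?case using b(1) by blast
next
  case (Suc k)
  then obtain q l where P: "P = Line q l" "q \<in> monster S k" "l \<in> lines (focal_bundle S k q)" unfolding monster_Suc by blast
  from Suc.IH[OF P(2)] obtain b w z where q: "b \<in> charts S" "z \<in> VV S b" "q = Phi S b w k z"
    and norm: "\<forall>s. 1 \<le> s \<and> s \<le> k \<and> w s \<longrightarrow> z (Suc s) = 0" by blast
  obtain v where v: "l = line_of v" "v \<in> focal_bundle S k q" "v \<noteq> (\<lambda>_ _. 0)" using P(3) unfolding lines_def by blast
  obtain \<alpha> \<beta> where \<alpha>: "v = tvP S b w k z (Eframe w k z \<alpha> \<beta>)" using v(2) unfolding q(3) focal_Phi[OF q(1,2)] by blast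
  \<comment> \<open>\<open>\<alpha> = 0\<close> says that the line is vertical; only then is the
    quotient inverted.\<close>
  define w' where "w' = w(Suc k := (\<alpha> = 0))"
  have w': "w' s = w s" if "s \<le> k" for s using that by (simp add: w'_def)
  have cw: "Phi S b w' k = Phi S b w k" "ch S b w' k = ch S b w k" "ev w' k = ev w k"
    by ((rule Phi_cong_word; erule w')+)
  have tv': "tvP S b w' k = tvP S b w k" unfolding tvP_def FF_def[abs_def] cw ..
  have E': "Eframe w' k z \<alpha> \<beta> = Eframe w k z \<alpha> \<beta>" unfolding Eframe_def cw ..
  have ne: "Eframe w' k z \<alpha> \<beta> (rho w' (Suc k)) \<noteq> 0"
  proof (cases "\<alpha> = 0")
    case True
    have "\<beta> \<noteq> 0"
    proof
      assume "\<beta> = 0"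
      then have "\<forall>a<k + 2. Eframe w k z \<alpha> \<beta> a = 0" using True by (simp add: Eframe_def)
      then show False using tvP_zero_iff[OF q(1) stage_coords_Phi[OF q(1)] q(2), of w k "Eframe w k z \<alpha> \<beta>"] v(3) \<alpha> by blast
    qed
    then show ?thesis using True Eframe_last[of w' k z \<alpha> \<beta>] by (simp add: w'_def)
  next
    case False
    then show ?thesis using Eframe_rho[of w' k z \<alpha> \<beta>] by (simp add: w'_def)
  qed
  from focal_line[OF q(1) stage_coords_Phi[OF q(1)] q(2) ne] obtain x where
    x: "Line (Phi S b w' k z) (line_of (tvP S b w' k z (Eframe w' k z \<alpha> \<beta>))) = Phi S b w' (Suc k) (z(k + 2 := x))"
      "z(k + 2 := x) \<in> VV S b" "w' (Suc k) \<longrightarrow> \<alpha> = 0 \<longrightarrow> x = 0" by blast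
  have "P = Phi S b w' (Suc k) (z(k + 2 := x))" using x(1) unfolding P(1) v(1) \<alpha> q(3) E' tv' cw .
  moreover have "\<forall>s. 1 \<le> s \<and> s \<le> Suc k \<and> w' s \<longrightarrow> (z(k + 2 := x)) (Suc s) = 0"
  proof (intro allI impI)
    fix s assume s: "1 \<le> s \<and> s \<le> Suc k \<and> w' s"
    show "(z(k + 2 := x)) (Suc s) = 0"
    proof (cases "s = Suc k")
      case True
      then have "\<alpha> = 0" using s by (simp add: w'_def)
      then show ?thesis using x(3) s True by simp
    next
      case False
      then show ?thesis using s norm w'[of s] by auto
    qed
  qed
  ultimately show ?case using q(1) x(2) by blast
qed

end

subsection \<open>The divisors at infinity in coordinates\<close>

text \<open>The coordinates of the points of \<open>I\<^sub>j\<^sub>+\<^sub>2[s - 1]\<close> on \<open>S(j + 1 + s)\<close>: step \<open>j + 2\<close> is inverted, the later steps are not, and the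
  coordinates created from then on vanish.\<close>

definition infinity_conds :: "(nat \<Rightarrow> bool) \<Rightarrow> (nat \<Rightarrow> real) \<Rightarrow> nat \<Rightarrow> nat \<Rightarrow> bool" where
  "infinity_conds w z j s \<longleftrightarrow> (1 \<le> s \<longrightarrow> w (j + 2)) \<and> (\<forall>a. j + 2 < a \<and> a \<le> j + 1 + s \<longrightarrow> \<not> w a) \<and>
     (\<forall>a. j + 2 \<le> a \<and> a \<le> j + 1 + s \<longrightarrow> z (Suc a) = 0)"

lemma conds_0 [simp]: "infinity_conds w z j 0"
  unfolding infinity_conds_def by auto

lemma conds_Suc: "infinity_conds w z j (Suc s) \<longleftrightarrow> infinity_conds w z j s \<and> (w (j + 2 + s) \<longleftrightarrow> s = 0) \<and> z (j + 3 + s) = 0"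
proof -
  have eq: "(\<forall>a. x < a \<and> a \<le> Suc y \<longrightarrow> P a) \<longleftrightarrow> (\<forall>a. x < a \<and> a \<le> y \<longrightarrow> P a) \<and> (x < Suc y \<longrightarrow> P (Suc y))"
    for x y :: nat and P by (auto simp: le_Suc_eq)
  have eq': "(\<forall>a. x \<le> a \<and> a \<le> Suc y \<longrightarrow> P a) \<longleftrightarrow> (\<forall>a. x \<le> a \<and> a \<le> y \<longrightarrow> P a) \<and> (x \<le> Suc y \<longrightarrow> P (Suc y))"
    for x y :: nat and P by (auto simp: le_Suc_eq)
  have s: "j + 1 + Suc s = Suc (j + 1 + s)" by simp
  show ?thesis unfolding infinity_conds_def s eq eq' by (cases "s = 0") (auto simp: numeral_3_eq_3)
qed

lemma conds_cong: "infinity_conds w z j s \<Longrightarrow> (\<And>a. j + 3 \<le> a \<Longrightarrow> a \<le> j + 2 + s \<Longrightarrow> z' a = z a) \<Longrightarrow> infinity_conds w z' j s"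
  by (auto simp: infinity_conds_def)

text \<open>An inverted step with new coordinate 0 discards the old field and leaves the unit vector
  along \<open>z (j + 2)\<close>; an uninverted step with new coordinate 0 changes nothing.\<close>

lemma ev_conds: "1 \<le> s \<Longrightarrow> infinity_conds w z j s \<Longrightarrow> ev w (j + 1 + s) z = unitv (j + 2)"
proof (induction s)
  case (Suc s)
  have c: "infinity_conds w z j s" "w (j + 2 + s) \<longleftrightarrow> s = 0" "z (j + 3 + s) = 0" using Suc.prems(2) unfolding conds_Suc by auto
  have e: "j + 1 + Suc s = Suc (j + 1 + s)" "Suc (j + 1 + s) = j + 2 + s" "j + 1 + s + 2 = j + 3 + s" by auto
  show ?case
  proof (cases "s = 0")
    case True
    have w1: "w (Suc (j + 1 + s))" and z1: "z (j + 1 + s + 2) = 0" using c True unfolding e by auto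
    show ?thesis unfolding e(1) ev.simps(2) z1 using w1 True by (auto simp: fun_eq_iff)
  next
    case False
    then have IH: "ev w (j + 1 + s) z = unitv (j + 2)" using Suc.IH c(1) by simp
    have w1: "\<not> w (Suc (j + 1 + s))" and z1: "z (j + 1 + s + 2) = 0" using c False unfolding e by auto
    show ?thesis unfolding e(1) ev.simps(2) z1 IH using w1 by (simp only: if_False mult_zero_left add_0_right)
  qed
qed simp

context surf begin

abbreviation "vt j s \<equiv> vert_tower S (j + 2) s"

lemma vert_tower_0: "fst (vt j 0) = monster S (j + 1)"
  "snd (vt j 0) q = {v \<in> focal_bundle S (j + 1) q. differential (ambient S (j + 1)) (ambient S j) foot q v = (\<lambda>_ _. 0)}"
  by simp_all

lemma vert_tower_Suc: "fst (vt j (Suc s)) = {Line q l | q l. q \<in> fst (vt j s) \<and> l \<in> lines (snd (vt j s) q)}"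
  "snd (vt j (Suc s)) P = {v \<in> tangents (ambient S (Suc (j + 1 + s))) (fst (vt j (Suc s))) P.
     differential (ambient S (Suc (j + 1 + s))) (ambient S (j + 1 + s)) foot P v \<in> dir P}"
  by (simp_all add: prolong_def proj_dist_def PTf)

declare vert_tower.simps [simp del]

lemma tangents_mono: "N \<subseteq> N' \<Longrightarrow> tangents M N q \<subseteq> tangents M N' q"
  unfolding tangents_def by blast

lemma vert_tower_sub: "fst (vt j s) \<subseteq> monster S (j + 1 + s) \<and> (\<forall>q. snd (vt j s) q \<subseteq> focal_bundle S (j + 1 + s) q)"
proof (induction s)
  case 0
  then show ?case using vert_tower_0 by auto
next
  case (Suc s)
  have e: "j + 1 + Suc s = Suc (j + 1 + s)" by simp
  have 1: "fst (vt j (Suc s)) \<subseteq> monster S (Suc (j + 1 + s))"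
    unfolding vert_tower_Suc monster_Suc lines_def using Suc by blast
  show ?case unfolding e vert_tower_Suc(2) focal_Suc using 1 tangents_mono[OF 1] by blast
qed

lemma unit_lines: "lines {tvP S b w k z (\<lambda>a. r * unitv j a) | r. True} \<subseteq> {line_of (tvP S b w k z (unitv j))}"
proof
  fix l assume "l \<in> lines {tvP S b w k z (\<lambda>a. r * unitv j a) | r. True}"
  then obtain v where v: "l = line_of v" "v \<in> {tvP S b w k z (\<lambda>a. r * unitv j a) | r. True}" "v \<noteq> (\<lambda>_ _. 0)"
    unfolding lines_def by blast
  then obtain r where r: "v = (\<lambda>c i. r * tvP S b w k z (unitv j) c i)" unfolding tvP_scale by blast
  then have "r \<noteq> 0" using v(3) by auto
  then have "l = line_of (tvP S b w k z (unitv j))" unfolding v(1) r by (rule line_of_scale)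
  then show "l \<in> {line_of (tvP S b w k z (unitv j))}" by (rule iffD2[OF singleton_iff])
qed

text \<open>The points and the line bundle have to be treated in one induction. The bundle
  \<open>E\<^sub>0\<close> is spanned by the direction of the fibre coordinate
  \<open>z (j + 2)\<close>, and every prolongation keeps this direction.\<close>

lemma vert_tower_coords:
  assumes b: "b \<in> charts S"
  shows "z \<in> VV S b \<Longrightarrow> Phi S b w (j + 1 + s) z \<in> fst (vt j s) \<longleftrightarrow> infinity_conds w z j s"
    and "z \<in> VV S b \<Longrightarrow> infinity_conds w z j s \<Longrightarrow>
      snd (vt j s) (Phi S b w (j + 1 + s) z) = {tvP S b w (j + 1 + s) z (\<lambda>a. r * unitv (j + 2) a) | r. True}"
proof -
  note stage_coords = stage_coords_Phi[OF b]
  have "(\<forall>z\<in>VV S b. Phi S b w (j + 1 + s) z \<in> fst (vt j s) \<longleftrightarrow> infinity_conds w z j s) \<and>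
     (\<forall>z\<in>VV S b. infinity_conds w z j s \<longrightarrow> snd (vt j s) (Phi S b w (j + 1 + s) z) = {tvP S b w (j + 1 + s) z (\<lambda>a. r * unitv (j + 2) a) | r. True})"
  proof (induction s)
    case 0
    have "snd (vt j 0) (Phi S b w (Suc j) z) = {tvP S b w (Suc j) z (\<lambda>a. r * unitv (j + 2) a) | r. True}" if z: "z \<in> VV S b" for z
    proof -
      have zero: "differential (ambient S (Suc j)) (ambient S j) foot (Phi S b w (Suc j) z) (tvP S b w (Suc j) z (Eframe w (Suc j) z \<alpha> \<beta>)) = (\<lambda>_ _. 0)
         \<longleftrightarrow> \<alpha> = 0" for \<alpha> \<beta>
        unfolding differential_tvP[OF b stage_coords stage_coords z] tvP_zero_iff[OF b stage_coords z]
      proof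
        assume "\<forall>a<j + 2. Eframe w (Suc j) z \<alpha> \<beta> a = 0"
        then show "\<alpha> = 0" using Eframe_rho[of w "Suc j" z \<alpha> \<beta>] rho_lt(1)[of w j] by auto
      next
        assume "\<alpha> = 0"
        then show "\<forall>a<j + 2. Eframe w (Suc j) z \<alpha> \<beta> a = 0" by (simp add: Eframe_def unitv_def)
      qed
      have E0: "Eframe w (Suc j) z 0 \<beta> = (\<lambda>a. \<beta> * unitv (j + 2) a)" for \<beta> by (auto simp: Eframe_def)
      have mem: "v \<in> snd (vt j 0) (Phi S b w (Suc j) z) \<longleftrightarrow> v \<in> focal_bundle S (Suc j) (Phi S b w (Suc j) z) \<and>
          differential (ambient S (Suc j)) (ambient S j) foot (Phi S b w (Suc j) z) v = (\<lambda>_ _. 0)" for v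
        unfolding vert_tower_0(2) Suc_eq_plus1 by (simp only: mem_Collect_eq)
      show ?thesis
      proof (intro set_eqI iffI)
        fix v assume "v \<in> snd (vt j 0) (Phi S b w (Suc j) z)"
        then have v: "v \<in> focal_bundle S (Suc j) (Phi S b w (Suc j) z)"
          "differential (ambient S (Suc j)) (ambient S j) foot (Phi S b w (Suc j) z) v = (\<lambda>_ _. 0)" unfolding mem by blast+
        obtain \<alpha> \<beta> where \<alpha>: "v = tvP S b w (Suc j) z (Eframe w (Suc j) z \<alpha> \<beta>)" using v(1) unfolding focal_Phi[OF b z] by blast
        have "\<alpha> = 0" using v(2) unfolding \<alpha> zero .
        then show "v \<in> {tvP S b w (Suc j) z (\<lambda>a. r * unitv (j + 2) a) | r. True}" unfolding \<alpha> by (auto simp only: E0)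
      next
        fix v assume "v \<in> {tvP S b w (Suc j) z (\<lambda>a. r * unitv (j + 2) a) | r. True}"
        then obtain r where v: "v = tvP S b w (Suc j) z (Eframe w (Suc j) z 0 r)" unfolding E0 by blast
        have "v \<in> focal_bundle S (Suc j) (Phi S b w (Suc j) z)" unfolding v focal_Phi[OF b z] by blast
        then show "v \<in> snd (vt j 0) (Phi S b w (Suc j) z)" unfolding mem using zero[of 0 r] v by blast
      qed
    qed
    note B = this
    have e: "j + 1 + 0 = Suc j" "j + 1 = Suc j" by simp_all
    have A: "Phi S b w (Suc j) z \<in> fst (vt j 0)" if "z \<in> VV S b" for z
      unfolding vert_tower_0(1) e(2) using Phi_monster[OF b that] .
    show ?case unfolding e(1) using A B conds_0 by blast
  next
    case (Suc s)
    define k where "k = j + 1 + s"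
    have ek: "j + 1 + Suc s = Suc k" "j + 2 + s = Suc k" "j + 3 + s = k + 2" by (auto simp: k_def)
    note IH1 = bspec[OF conjunct1[OF Suc[folded k_def]]] and IH2 = bspec[OF conjunct2[OF Suc[folded k_def]], rule_format]
    have jk: "j + 2 < Suc k + 2" "s \<noteq> 0 \<Longrightarrow> j + 2 < k + 2 \<and> j + 2 \<noteq> Suc k" by (auto simp: k_def)
    \<comment> \<open>The field \<open>ev w (Suc k)\<close> has entries 1 and
      \<open>z (k + 2)\<close> at its two active indices. Proportionality to a unit vector forces
      the index with entry 1 to be \<open>j + 2\<close> and the other entry to be 0.\<close>
    have par: "(\<exists>r. \<forall>a<k + 2. ev w (Suc k) z a = r * unitv (j + 2) a) \<longleftrightarrow> (w (Suc k) \<longleftrightarrow> s = 0) \<and> z (k + 2) = 0"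
      if c: "infinity_conds w z j s" for z
    proof
      assume "\<exists>r. \<forall>a<k + 2. ev w (Suc k) z a = r * unitv (j + 2) a"
      then obtain r where r: "\<And>a. a < k + 2 \<Longrightarrow> ev w (Suc k) z a = r * unitv (j + 2) a" by blast
      have "rho w (Suc k) = j + 2" using r[OF rho_lt(1)] ev_rho[of w "Suc k" z] by (auto simp: unitv_def split: if_splits)
      moreover have "other w k \<noteq> rho w (Suc k)" using rho_le[of w k] by (auto simp: other_def)
      moreover have "s \<noteq> 0 \<Longrightarrow> j + 2 \<noteq> Suc k" "s = 0 \<Longrightarrow> j + 2 = Suc k" by (auto simp: k_def)
      ultimately show "(w (Suc k) \<longleftrightarrow> s = 0) \<and> z (k + 2) = 0"
        using r[OF rho_lt(2)] ev_other[of w k z] rho_le[of w k] by (auto simp: unitv_def split: if_splits)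
    next
      assume a: "(w (Suc k) \<longleftrightarrow> s = 0) \<and> z (k + 2) = 0"
      then have "infinity_conds w z j (Suc s)" using c unfolding conds_Suc ek by simp
      then have "ev w (Suc k) z = unitv (j + 2)" using ev_conds[of "Suc s" w z j] unfolding ek by simp
      then show "\<exists>r. \<forall>a<k + 2. ev w (Suc k) z a = r * unitv (j + 2) a" by (intro exI[of _ 1]) simp
    qed
    have A: "Phi S b w (Suc k) z \<in> fst (vt j (Suc s)) \<longleftrightarrow> infinity_conds w z j (Suc s)" if z: "z \<in> VV S b" for z
    proof
      assume "Phi S b w (Suc k) z \<in> fst (vt j (Suc s))"
      then have 1: "Phi S b w k z \<in> fst (vt j s)" "line_of (tvP S b w k z (ev w (Suc k) z)) \<in> lines (snd (vt j s) (Phi S b w k z))"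
        unfolding vert_tower_Suc Phi_Suc by auto
      then have c: "infinity_conds w z j s" using IH1[OF z] by blast
      have "line_of (tvP S b w k z (ev w (Suc k) z)) = line_of (tvP S b w k z (unitv (j + 2)))"
        using 1(2) unit_lines unfolding IH2[OF z c] by blast
      then have "tvP S b w k z (ev w (Suc k) z) \<in> line_of (tvP S b w k z (unitv (j + 2)))" using line_of_self by blast
      then show "infinity_conds w z j (Suc s)" using par[OF c] c unfolding tvP_in_line[OF b stage_coords z] conds_Suc ek by blast
    next
      assume c': "infinity_conds w z j (Suc s)"
      then have c: "infinity_conds w z j s" by (simp add: conds_Suc)
      have ev: "ev w (Suc k) z = (\<lambda>a. 1 * unitv (j + 2) a)" using ev_conds[OF _ c'] unfolding ek by simp
      have "tvP S b w k z (ev w (Suc k) z) \<in> snd (vt j s) (Phi S b w k z)" unfolding IH2[OF z c] ev by blast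
      then show "Phi S b w (Suc k) z \<in> fst (vt j (Suc s))"
        unfolding vert_tower_Suc Phi_Suc lines_def using IH1[OF z] c tvP_not_zero[OF b stage_coords z, of w k] by blast
    qed
    have B: "snd (vt j (Suc s)) (Phi S b w (Suc k) z) = {tvP S b w (Suc k) z (\<lambda>a. r * unitv (j + 2) a) | r. True}"
      if z: "z \<in> VV S b" and c: "infinity_conds w z j (Suc s)" for z
    proof -
      let ?P = "Phi S b w (Suc k) z"
      have ev: "ev w (Suc k) z = unitv (j + 2)" using ev_conds[OF _ c] unfolding ek by simp
      have in_dir: "differential (ambient S (Suc k)) (ambient S k) foot ?P (tvP S b w (Suc k) z v) \<in> dir ?P \<longleftrightarrow>
          (\<exists>r. \<forall>a<k + 2. v a = r * unitv (j + 2) a)" for v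
        unfolding differential_tvP[OF b stage_coords stage_coords z] dir_Phi tvP_in_line[OF b stage_coords z] ev ..
      have sub: "fst (vt j (Suc s)) \<subseteq> monster S (Suc k)" using vert_tower_sub[of j "Suc s"] unfolding ek by blast
      show ?thesis
      proof (intro set_eqI iffI)
        fix v assume "v \<in> snd (vt j (Suc s)) ?P"
        then have v: "v \<in> tangents (ambient S (Suc k)) (fst (vt j (Suc s))) ?P"
          "differential (ambient S (Suc k)) (ambient S k) foot ?P v \<in> dir ?P" unfolding vert_tower_Suc(2) k_def by auto
        from tangents_coords[OF b stage_coords z sub v(1)] obtain \<zeta> e where \<zeta>: "e > 0" "\<forall>s'\<in>ball 0 e. \<zeta> s' \<in> VV S b \<and> Phi S b w (Suc k) (\<zeta> s') \<in> fst (vt j (Suc s))"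
          "v = tvP S b w (Suc k) z (\<lambda>a. deriv (\<lambda>s. \<zeta> s a) 0)" by blast
        obtain r where r: "\<forall>a<k + 2. deriv (\<lambda>s. \<zeta> s a) 0 = r * unitv (j + 2) a" using v(2) unfolding \<zeta>(3) in_dir by blast
        have "\<zeta> t (k + 2) = 0" if "t \<in> ball 0 e" for t
        proof -
          have "infinity_conds w (\<zeta> t) j (Suc s)" using A \<zeta>(2) that by blast
          then show ?thesis by (simp add: conds_Suc ek)
        qed
        then have "\<forall>\<^sub>F t in nhds 0. \<zeta> t (k + 2) = 0" unfolding ev_ball using \<zeta>(1) by blast
        then have "deriv (\<lambda>s. \<zeta> s (k + 2)) 0 = deriv (\<lambda>s. 0) 0" by (intro deriv_cong_ev) auto
        then have d0: "deriv (\<lambda>s. \<zeta> s (k + 2)) 0 = 0" by simp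
        have "v = tvP S b w (Suc k) z (\<lambda>a. r * unitv (j + 2) a)"
          unfolding \<zeta>(3)
        proof (rule tvP_cong)
          fix a assume "a < Suc k + 2"
          then consider "a < k + 2" | "a = k + 2" by linarith
          then show "deriv (\<lambda>s. \<zeta> s a) 0 = r * unitv (j + 2) a"
            using r d0 by cases (auto simp: unitv_def k_def)
        qed simp
        then show "v \<in> {tvP S b w (Suc k) z (\<lambda>a. r * unitv (j + 2) a) | r. True}" by blast
      next
        fix v assume "v \<in> {tvP S b w (Suc k) z (\<lambda>a. r * unitv (j + 2) a) | r. True}"
        then obtain r where v: "v = tvP S b w (Suc k) z (\<lambda>a. r * unitv (j + 2) a)" by blast
        let ?v = "\<lambda>a. r * unitv (j + 2) a"
        let ?\<gamma> = "\<lambda>t. Phi S b w (Suc k) (\<lambda>a. z a + t * ?v a)"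
        obtain e where e: "e > 0" "\<forall>t\<in>ball 0 e. (\<lambda>a. z a + t * ?v a) \<in> VV S b \<and> smooth_at (ambient S (Suc k)) ?\<gamma> t"
          using straight(1)[OF b stage_coords z, where v = ?v] by blast
        have "?\<gamma> t \<in> fst (vt j (Suc s))" if "t \<in> ball 0 e" for t
        proof -
          have "infinity_conds w (\<lambda>a. z a + t * ?v a) j (Suc s)" by (rule conds_cong[OF c]) (auto simp: unitv_def)
          then show ?thesis using A e(2) that by blast
        qed
        then have "v \<in> tangents (ambient S (Suc k)) (fst (vt j (Suc s))) ?P"
          unfolding A.tangents_iff v
        proof (intro exI[of _ ?\<gamma>] exI[of _ e] conjI)
          show "tvP S b w (Suc k) z ?v = velocity (ambient S (Suc k)) ?\<gamma> 0" by (rule straight(2)[OF b stage_coords z, where v = ?v, symmetric])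
        qed (use e in auto)
        then show "v \<in> snd (vt j (Suc s)) ?P" unfolding vert_tower_Suc(2) v using in_dir[of ?v] unfolding k_def by blast
      qed
    qed
    show ?case unfolding ek using A B by blast
  qed
  then show "z \<in> VV S b \<Longrightarrow> Phi S b w (j + 1 + s) z \<in> fst (vt j s) \<longleftrightarrow> infinity_conds w z j s"
    "z \<in> VV S b \<Longrightarrow> infinity_conds w z j s \<Longrightarrow>
      snd (vt j s) (Phi S b w (j + 1 + s) z) = {tvP S b w (j + 1 + s) z (\<lambda>a. r * unitv (j + 2) a) | r. True}" by blast+
qed

text \<open>The shift to \<open>Suc s\<close> occurs because \<open>I\<^sub>j[l]\<close> is the
  member \<open>l + 1\<close> of the tower over \<open>E\<^sub>0\<close>.\<close>

lemma div_inf_coords: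
  assumes "b \<in> charts S" "z \<in> VV S b"
  shows "Phi S b w (i + 2 + s) z \<in> div_inf S (i + 2) s \<longleftrightarrow> infinity_conds w z i (Suc s)"
proof -
  have "i + 1 + Suc s = i + 2 + s" by simp
  then show ?thesis using vert_tower_coords(1)[OF assms, of w i "Suc s"] by (simp only: div_inf_def)
qed


subsection \<open>Focal curves in coordinates\<close>

text \<open>The Pfaffian equations of the focal bundle: apart from the free last coordinate, the
  velocity is a multiple of \<open>ev w k\<close>. The factor is the derivative of
  \<open>z (rho w k)\<close>, where \<open>ev w k\<close> has entry 1.\<close>

definition focal_eqs :: "(nat \<Rightarrow> bool) \<Rightarrow> nat \<Rightarrow> (real \<Rightarrow> nat \<Rightarrow> real) \<Rightarrow> real \<Rightarrow> bool" where
  "focal_eqs w k \<zeta> e \<longleftrightarrow> (\<forall>t\<in>ball 0 e. \<forall>a\<le>k. deriv (\<lambda>s. \<zeta> s a) t = ev w k (\<zeta> t) a * deriv (\<lambda>s. \<zeta> s (rho w k)) t)"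

text \<open>The system on stage \<open>k + 1\<close> consists of the one on stage \<open>k\<close>
  and a single new relation, which exhibits \<open>z (k + 2)\<close> as a quotient of
  derivatives.\<close>

lemma rel_pred:
  assumes "focal_eqs w (Suc k) \<zeta> e"
  shows "focal_eqs w k \<zeta> e"
    and "t \<in> ball 0 e \<Longrightarrow> deriv (\<lambda>s. \<zeta> s (other w k)) t = \<zeta> t (k + 2) * deriv (\<lambda>s. \<zeta> s (rho w (Suc k))) t"
proof -
  have R: "deriv (\<lambda>s. \<zeta> s a) t = ev w (Suc k) (\<zeta> t) a * deriv (\<lambda>s. \<zeta> s (rho w (Suc k))) t"
    if "t \<in> ball 0 e" "a \<le> Suc k" for a t using assms that unfolding focal_eqs_def by blast
  show 2: "deriv (\<lambda>s. \<zeta> s (other w k)) t = \<zeta> t (k + 2) * deriv (\<lambda>s. \<zeta> s (rho w (Suc k))) t" if "t \<in> ball 0 e" for t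
    using R[OF that, of "other w k"] rho_lt(2)[of w k] unfolding ev_other by simp
  show "focal_eqs w k \<zeta> e" unfolding focal_eqs_def
  proof (intro ballI allI impI)
    fix t a assume t: "t \<in> ball (0::real) e" and a: "a \<le> k"
    have u: "unitv (Suc k) a = 0" using a by (simp add: unitv_def)
    show "deriv (\<lambda>s. \<zeta> s a) t = ev w k (\<zeta> t) a * deriv (\<lambda>s. \<zeta> s (rho w k)) t"
    proof (cases "w (Suc k)")
      case True
      then have o: "other w k = rho w k" by (simp add: other_def)
      have "deriv (\<lambda>s. \<zeta> s a) t = (\<zeta> t (k + 2) * ev w k (\<zeta> t) a) * deriv (\<lambda>s. \<zeta> s (rho w (Suc k))) t"
        using R[OF t, of a] a True u by (simp del: rho.simps)
      then show ?thesis using 2[OF t] unfolding o by simp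
    next
      case False
      then show ?thesis using R[OF t, of a] a u by simp
    qed
  qed
qed

lemma rs_ev: "(\<And>a. real_smooth T (\<lambda>s. \<zeta> s a)) \<Longrightarrow> real_smooth T (\<lambda>s. ev w k (\<zeta> s) a)"
proof (induction k arbitrary: a)
  case 0
  then show ?case by (simp add: rs_const)
next
  case (Suc k)
  then have "real_smooth T (\<lambda>s. ev w k (\<zeta> s) a)" "real_smooth T (\<lambda>s. \<zeta> s (k + 2))" by blast+
  then show ?case unfolding ev.simps by (cases "w (Suc k)") (simp_all del: add_2_eq_Suc' add: rs_add rs_mult rs_const)
qed

lemma velocity_Phi:
  assumes b: "b \<in> charts S" and r: "\<And>a. real_smooth (ball 0 e) (\<lambda>s. \<zeta> s a)"
    and V: "\<And>s. s \<in> ball 0 e \<Longrightarrow> \<zeta> s \<in> VV S b \<and> \<gamma> s = Phi S b w k (\<zeta> s)" and t: "t \<in> ball 0 e"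
  shows "smooth_at (ambient S k) \<gamma> t" "velocity (ambient S k) \<gamma> t = tvP S b w k (\<zeta> t) (\<lambda>a. deriv (\<lambda>s. \<zeta> s a) t)"
proof -
  have V': "\<And>s. s \<in> ball 0 e \<Longrightarrow> \<zeta> s \<in> VV S b" using V by blast
  have sc: "curve_in_chart (ambient S k) (ch S b w k) \<gamma> (ball 0 e)"
    by (rule scurve_cong[OF Phi_curve(1)[OF b stage_coords_Phi[OF b] open_ball r V']]) (use V in auto)
  show "smooth_at (ambient S k) \<gamma> t" by (rule scurve_csm[OF sc open_ball t ch_charts[OF b]])
  have "\<forall>\<^sub>F s in nhds t. \<gamma> s = Phi S b w k (\<zeta> s)"
    using eventually_nhds_in_open[OF open_ball t] by eventually_elim (use V in blast)
  from velocity_cong[OF this, of "ambient S k"]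
  show "velocity (ambient S k) \<gamma> t = tvP S b w k (\<zeta> t) (\<lambda>a. deriv (\<lambda>s. \<zeta> s a) t)"
    by (rule trans) (rule Phi_curve(3)[OF b stage_coords_Phi[OF b] open_ball r V' t])
qed

lemma velocity_ev_nonzero:
  assumes "smooth_at (ambient S k) \<gamma> 0" "vanishing_order (ambient S k) \<gamma> m"
  shows "\<forall>\<^sub>F t in nhds 0. t \<noteq> 0 \<longrightarrow> velocity (ambient S k) \<gamma> t \<noteq> (\<lambda>_ _. 0)"
proof -
  obtain c where c: "c \<in> charts (ambient S k)" "\<gamma> 0 \<in> cdom (ambient S k) c" using A.csm_points[OF assms(1)] by (auto simp: points_def)
  from A.order_factor[OF assms c] obtain i h k1 where i: "i < mdim (ambient S k)" and h: "smooth_near_0 (h i)" "h i 0 \<noteq> 0"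
    and dh: "\<forall>\<^sub>F t in nhds 0. deriv (\<lambda>t. coord (ambient S k) c (\<gamma> t) i) t = t ^ k1 * h i t" by blast
  have "\<forall>\<^sub>F t in nhds 0. h i t \<noteq> 0"
    by (rule tendsto_imp_eventually_ne[OF isCont_nhds[OF rsn_isCont[OF h(1)]] h(2)])
  then show ?thesis using dh A.csm_open_ev[OF assms(1) A.openin_cdom[OF c(1)] c(2)]
  proof eventually_elim
    case (elim t)
    show ?case
    proof
      assume "t \<noteq> 0"
      then have "velocity (ambient S k) \<gamma> t c i \<noteq> 0" using elim c(1) i by (simp add: velocity_def)
      then show "velocity (ambient S k) \<gamma> t \<noteq> (\<lambda>_ _. 0)" by auto
    qed
  qed
qed

text \<open>A focal germ is controlled at nonsingular points only. By finiteness of the order all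
  times near 0, except possibly 0 itself, give such points.\<close>

lemma focal_coords:
  assumes foc: "focal_curve_germ S k C p" and \<gamma>: "parametrizes (ambient S k) \<gamma> C p"
    and vo: "vanishing_order (ambient S k) \<gamma> m" and b: "b \<in> charts S" and pc: "p \<in> cdom (ambient S k) (ch S b w k)"
  shows "\<exists>e>0. \<exists>\<zeta>. (\<forall>a. real_smooth (ball 0 e) (\<lambda>s. \<zeta> s a)) \<and> (\<forall>s\<in>ball 0 e. \<zeta> s \<in> VV S b \<and> \<gamma> s = Phi S b w k (\<zeta> s)) \<and> focal_eqs w k \<zeta> e"
proof -
  let ?M = "ambient S k"
  have cs0: "smooth_at ?M \<gamma> 0" by (rule A.param_csm[OF \<gamma>])
  have \<gamma>0: "\<gamma> 0 = p" by (rule A.param_0[OF \<gamma>])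
  have "\<exists>U. openin (mtopology ?M) U \<and> p \<in> U \<and> C \<inter> U \<subseteq> monster S k \<and>
      (\<forall>q\<in>C \<inter> U. \<forall>l. nonsingular_tangent ?M C q l \<longrightarrow> l \<subseteq> focal_bundle S k q)"
    using foc unfolding focal_curve_germ_def by (rule conjunct2)
  then obtain U where U: "openin (mtopology ?M) U" "p \<in> U" "C \<inter> U \<subseteq> monster S k"
    "\<forall>q\<in>C \<inter> U. \<forall>l. nonsingular_tangent ?M C q l \<longrightarrow> l \<subseteq> focal_bundle S k q"
    by (elim exE conjE) (rule that)
  from A.param_nbhd[OF \<gamma> zero_less_one] obtain d W where d: "0 < d" and csd: "\<forall>t\<in>{-d..d}. smooth_at ?M \<gamma> t" and inj: "inj_on \<gamma> {-d..d}"
    and W: "openin (mtopology ?M) W" "p \<in> W" "C \<inter> W = \<gamma> ` {-d<..<d} \<inter> W"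
    by (elim exE conjE) (rule that)
  have csd': "\<And>t. t \<in> {-d..d} \<Longrightarrow> smooth_at ?M \<gamma> t" using csd by blast
  have evU: "\<forall>\<^sub>F s in nhds 0. \<gamma> s \<in> U" using A.csm_open_ev[OF cs0 U(1)] \<gamma>0 U(2) by simp
  have evW: "\<forall>\<^sub>F s in nhds 0. \<gamma> s \<in> W" using A.csm_open_ev[OF cs0 W(1)] \<gamma>0 W(2) by simp
  have evd: "\<forall>\<^sub>F s in nhds 0. s \<in> {-d<..<d}" using d by (intro eventually_nhds_in_open) auto
  have evC: "\<forall>\<^sub>F s in nhds 0. \<gamma> s \<in> C \<inter> U" using evU evW evd by eventually_elim (use W(3) in blast)
  then have "\<forall>\<^sub>F s in nhds 0. \<gamma> s \<in> monster S k" by eventually_elim (use U(3) in blast)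
  from monster_coords[OF b stage_coords_Phi[OF b] cs0 this] pc obtain e1 \<zeta> where \<zeta>: "e1 > 0" "\<forall>a. real_smooth (ball 0 e1) (\<lambda>s. \<zeta> s a)"
    "\<forall>s\<in>ball 0 e1. \<zeta> s \<in> VV S b \<and> \<gamma> s = Phi S b w k (\<zeta> s)" unfolding \<gamma>0 by blast
  from eventually_conj[OF velocity_ev_nonzero[OF cs0 vo] eventually_conj[OF evC eventually_conj[OF evW evd]]]
  obtain e2 where e2: "e2 > 0" "\<forall>t\<in>ball 0 e2. (t \<noteq> 0 \<longrightarrow> velocity ?M \<gamma> t \<noteq> (\<lambda>_ _. 0)) \<and> \<gamma> t \<in> C \<inter> U \<and> \<gamma> t \<in> W \<and> t \<in> {-d<..<d}"
    unfolding ev_ball by blast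
  define e where "e = min e1 e2"
  have e: "e > 0" "ball 0 e \<subseteq> ball (0::real) e1" "ball 0 e \<subseteq> ball (0::real) e2" using \<zeta>(1) e2(1) by (auto simp: e_def)
  have r: "real_smooth (ball 0 e) (\<lambda>s. \<zeta> s a)" for a using rs_mono[OF _ e(2)] \<zeta>(2) by blast
  have V: "\<zeta> s \<in> VV S b \<and> \<gamma> s = Phi S b w k (\<zeta> s)" if "s \<in> ball 0 e" for s using \<zeta>(3) e(2) that by blast
  have R: "deriv (\<lambda>s. \<zeta> s a) t = ev w k (\<zeta> t) a * deriv (\<lambda>s. \<zeta> s (rho w k)) t"
    if t: "t \<in> ball 0 e" "t \<noteq> 0" and a: "a \<le> k" for t a
  proof -
    have P: "velocity ?M \<gamma> t \<noteq> (\<lambda>_ _. 0)" "\<gamma> t \<in> C \<inter> U" "\<gamma> t \<in> W" "t \<in> {-d<..<d}" using e2(2) e(3) t by blast+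
    have pr: "parametrizes ?M (\<lambda>s. \<gamma> (s + t)) C (\<gamma> t)" by (rule A.recenter[OF d csd' inj W(1,3) P(4,3)])
    have vs: "velocity ?M (\<lambda>s. \<gamma> (s + t)) 0 = velocity ?M \<gamma> t" using A.velocity_shift[of k \<gamma> t 0] by simp
    have "nonsingular_tangent ?M C (\<gamma> t) (line_of (velocity ?M \<gamma> t))"
      using A.nonsingular_tangent_iff[OF pr] P(1) unfolding vs by blast
    then have "velocity ?M \<gamma> t \<in> focal_bundle S k (\<gamma> t)" using U(4) P(2) line_of_self by blast
    then obtain \<alpha> \<beta> where ab: "velocity ?M \<gamma> t = tvP S b w k (\<zeta> t) (Eframe w k (\<zeta> t) \<alpha> \<beta>)"
      using focal_Phi[OF b, of "\<zeta> t" k w] V[OF t(1)] by auto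
    have "velocity ?M \<gamma> t = tvP S b w k (\<zeta> t) (\<lambda>a. deriv (\<lambda>s. \<zeta> s a) t)"
      by (rule velocity_Phi(2)[OF b r V t(1)])
    then have T: "tvP S b w k (\<zeta> t) (\<lambda>a. deriv (\<lambda>s. \<zeta> s a) t) = tvP S b w k (\<zeta> t) (Eframe w k (\<zeta> t) \<alpha> \<beta>)"
      using ab by (rule HOL.trans[OF sym])
    have Vt: "\<zeta> t \<in> VV S b" using V[OF t(1)] by (rule conjunct1)
    note E = iffD1[OF tvP_eq_iff[OF b stage_coords_Phi[OF b] Vt] T, rule_format]
    have "deriv (\<lambda>s. \<zeta> s (rho w k)) t = \<alpha>" using E[of "rho w k"] rho_le[of w k] unfolding Eframe_rho by simp
    moreover have "Eframe w k (\<zeta> t) \<alpha> \<beta> a = \<alpha> * ev w k (\<zeta> t) a" using a by (simp add: Eframe_def unitv_def)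
    ultimately show ?thesis using E[of a] a by simp
  qed
  have n\<zeta>: "smooth_near_0 (\<lambda>s. \<zeta> s a)" for a using r e(1) unfolding smooth_near_0_def by blast
  \<comment> \<open>At time 0 the equation follows from the other times by continuity.\<close>
  have "deriv (\<lambda>s. \<zeta> s a) 0 = ev w k (\<zeta> 0) a * deriv (\<lambda>s. \<zeta> s (rho w k)) 0" if a: "a \<le> k" for a
  proof (rule rsn_eq_at_0[of "deriv (\<lambda>s. \<zeta> s a)" "\<lambda>t. ev w k (\<zeta> t) a * deriv (\<lambda>s. \<zeta> s (rho w k)) t"])
    show "smooth_near_0 (deriv (\<lambda>s. \<zeta> s a))" by (rule rsn_deriv[OF n\<zeta>])
    have "smooth_near_0 (\<lambda>t. ev w k (\<zeta> t) a)" unfolding smooth_near_0_def using rs_ev[where \<zeta> = \<zeta>, OF r] e(1) by blast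
    then show "smooth_near_0 (\<lambda>t. ev w k (\<zeta> t) a * deriv (\<lambda>s. \<zeta> s (rho w k)) t)" by (rule rsn_mult[OF _ rsn_deriv[OF n\<zeta>]])
    have "\<forall>\<^sub>F t in nhds 0. t \<noteq> 0 \<longrightarrow> deriv (\<lambda>s. \<zeta> s a) t = ev w k (\<zeta> t) a * deriv (\<lambda>s. \<zeta> s (rho w k)) t"
      unfolding ev_ball using R a e(1) by blast
    then show "\<forall>\<^sub>F t in at 0. deriv (\<lambda>s. \<zeta> s a) t = ev w k (\<zeta> t) a * deriv (\<lambda>s. \<zeta> s (rho w k)) t"
      unfolding eventually_at_filter by simp
  qed
  then have "focal_eqs w k \<zeta> e" unfolding focal_eqs_def using R by blast
  then show ?thesis using e(1) r V by blast
qed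

definition val :: "(real \<Rightarrow> nat \<Rightarrow> real) \<Rightarrow> nat \<Rightarrow> enat" where
  "val \<zeta> a = order_of_change (\<lambda>s. \<zeta> s a)"

text \<open>By the focal equations no \<open>z a\<close> with \<open>a \<le> k\<close> has smaller
  order than \<open>z (rho w k)\<close>. The remaining ambient coordinates are smooth functions of
  the tower coordinates and cannot lower the minimum.\<close>

lemma mord_Phi:
  assumes b: "b \<in> charts S" and e: "e > 0" and r: "\<And>a. real_smooth (ball 0 e) (\<lambda>s. \<zeta> s a)"
    and V: "\<And>s. s \<in> ball 0 e \<Longrightarrow> \<zeta> s \<in> VV S b \<and> \<gamma> s = Phi S b w k (\<zeta> s)" and focal_eqs: "focal_eqs w k \<zeta> e"
  shows "curve_order (ambient S k) (ch S b w k) \<gamma> = min (val \<zeta> (rho w k)) (val \<zeta> (Suc k))"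
proof (rule enat_eqI)
  fix m
  note stage_coords = stage_coords_Phi[OF b, of w k, unfolded stage_coords_def]
  have n\<zeta>: "smooth_near_0 (\<lambda>s. \<zeta> s a)" for a using r e unfolding smooth_near_0_def by blast
  have ge: "val \<zeta> (rho w k) \<le> val \<zeta> a" if a: "a \<le> k" for a
  proof -
    have "\<forall>\<^sub>F t in nhds 0. deriv (\<lambda>s. \<zeta> s a) t = ev w k (\<zeta> t) a * deriv (\<lambda>s. \<zeta> s (rho w k)) t"
      unfolding ev_ball using focal_eqs a e unfolding focal_eqs_def by blast
    moreover have "smooth_near_0 (\<lambda>t. ev w k (\<zeta> t) a)" unfolding smooth_near_0_def using rs_ev[where \<zeta> = \<zeta>, OF r] e by blast
    ultimately have "val \<zeta> a = order_at_0 (\<lambda>t. ev w k (\<zeta> t) a) + val \<zeta> (rho w k)"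
      unfolding val_def by (intro vord_rel n\<zeta>)
    then show ?thesis by simp
  qed
  have cong: "order_of_change (\<lambda>s. coord (ambient S k) (ch S b w k) (\<gamma> s) i) = order_of_change (\<lambda>s. FF S b w k (\<zeta> s) i)" for i
    by (rule vord_cong) (unfold ev_ball, use V e in \<open>auto simp: FF_def\<close>)
  have evV: "\<forall>\<^sub>F t in nhds 0. \<zeta> t \<in> VV S b" unfolding ev_ball using V e by blast
  show "enat m \<le> curve_order (ambient S k) (ch S b w k) \<gamma> \<longleftrightarrow> enat m \<le> min (val \<zeta> (rho w k)) (val \<zeta> (Suc k))"
  proof
    assume m: "enat m \<le> curve_order (ambient S k) (ch S b w k) \<gamma>"
    have "enat m \<le> val \<zeta> a" if a: "a < k + 2" for a
    proof -
      have "enat m \<le> order_of_change (\<lambda>s. FF S b w k (\<zeta> s) (sg S w k a))"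
        using m sg_less[OF dimS a, of w] unfolding mord_ge_iff cong by blast
      also have "\<dots> = val \<zeta> a" unfolding val_def
        by (rule vord_cong) (use evV in eventually_elim, use stage_coords a in blast)
      finally show ?thesis .
    qed
    from this[of "rho w k"] this[of "Suc k"] show "enat m \<le> min (val \<zeta> (rho w k)) (val \<zeta> (Suc k))"
      using rho_le[of w k] by simp
  next
    assume m: "enat m \<le> min (val \<zeta> (rho w k)) (val \<zeta> (Suc k))"
    have all: "enat m \<le> order_of_change (\<lambda>s. \<zeta> s a)" if "a < k + 2" for a
    proof (cases "a = Suc k")
      case True
      then show ?thesis using m by (simp add: val_def)
    next
      case False
      then have "a \<le> k" using that by simp
      then have "val \<zeta> (rho w k) \<le> val \<zeta> a" by (rule ge)
      then show ?thesis using m unfolding val_def by (meson min.boundedE order_trans)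
    qed
    show "enat m \<le> curve_order (ambient S k) (ch S b w k) \<gamma>"
      unfolding mord_ge_iff cong
    proof (intro allI impI)
      fix i assume "i < mdim (ambient S k)"
      then have "smooth_along (open_plots (k + 2) (VV S b)) (k + 2) (\<lambda>z. FF S b w k z i)" using stage_coords by blast
      from vord_multi(2)[OF this VV_line_open[OF b] n\<zeta> evV all] show "enat m \<le> order_of_change (\<lambda>s. FF S b w k (\<zeta> s) i)" .
    qed
  qed
qed

end

lemma vord_1_iff: "order_of_change f = 1 \<longleftrightarrow> deriv f 0 \<noteq> 0"
  unfolding order_of_change_def one_eSuc eSuc_inject by (rule ordz_0_iff)

lemma ordz_infinity_0: "order_at_0 f = \<infinity> \<Longrightarrow> f 0 = 0"
  using ordz_0_iff[of f] by auto

lemma vord_infinity_deriv: "order_of_change f = \<infinity> \<Longrightarrow> deriv f 0 = 0"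
  using vord_1_iff[of f] by auto

lemma ordz_le_vord: "order_at_0 f \<le> order_of_change f"
proof (rule enat_leI)
  fix n assume "enat n \<le> order_at_0 f"
  then show "enat n \<le> order_of_change f" unfolding vord_ge_iff ordz_ge_iff by blast
qed

text \<open>The retained index is that of the last inverted step; if there is none after step
  \<open>k\<close>, it is unchanged.\<close>

lemma rho_cases:
  "k \<le> r \<Longrightarrow> rho w r = rho w k \<or>
    (k < rho w r \<and> rho w r \<le> r \<and> w (rho w r) \<and> (\<forall>a. rho w r < a \<and> a \<le> r \<longrightarrow> \<not> w a))"
proof (induction r)
  case (Suc r)
  show ?case
  proof (cases "k = Suc r")
    case False
    then have "k \<le> r" using Suc.prems by simp
    then show ?thesis using Suc.IH Suc.prems by (auto simp: le_Suc_eq)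
  qed simp
qed simp

context hman begin

lemma nst_points: "tangent_lines M C \<subseteq> points (PT M)"
proof
  fix P assume "P \<in> tangent_lines M C"
  then obtain q \<gamma> where P: "P = Line q (line_of (velocity M \<gamma> 0))" "parametrizes M \<gamma> C q" "velocity M \<gamma> 0 \<noteq> (\<lambda>_ _. 0)"
    unfolding tangent_lines_def nonsingular_tangent_def by auto
  have cs: "smooth_at M \<gamma> 0" and q: "\<gamma> 0 = q" by (rule param_csm[OF P(2)], rule param_0[OF P(2)])
  obtain c where c: "c \<in> charts M" "\<gamma> 0 \<in> cdom M c" using csm_points[OF cs] unfolding points_def by blast
  obtain i where i: "i < n" "velocity M \<gamma> 0 c i \<noteq> 0" using velocity_nonzero[OF cs P(3) c] by blast
  have "P = Line q (line_of (tv M q c (velocity M \<gamma> 0 c)))" unfolding P(1) using velocity_tv[OF cs c] unfolding q by (rule arg_cong)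
  then show "P \<in> points (PT M)" unfolding points_PT using c i unfolding q by blast
qed

lemma immersed_order: "smooth_at M \<gamma> 0 \<Longrightarrow> velocity M \<gamma> 0 \<noteq> (\<lambda>_ _. 0) \<Longrightarrow> vanishing_order M \<gamma> 1"
proof -
  assume cs: "smooth_at M \<gamma> 0" and v: "velocity M \<gamma> 0 \<noteq> (\<lambda>_ _. 0)"
  obtain c where c: "c \<in> charts M" "\<gamma> 0 \<in> cdom M c" using csm_points[OF cs] unfolding points_def by blast
  obtain i where i: "i < n" "velocity M \<gamma> 0 c i \<noteq> 0" using velocity_nonzero[OF cs v c] by blast
  then have "(deriv ^^ 1) (\<lambda>t. coord M c (\<gamma> t) i) 0 \<noteq> 0" unfolding velocity_def using c by simp
  then show ?thesis unfolding vanishing_order_def using c i(1) by auto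
qed

text \<open>\<open>lift_germ\<close> makes the fibre over \<open>p\<close> a singleton, and the
  tangent line at \<open>p\<close> is one of its elements.\<close>

lemma immersed_lift:
  assumes "parametrizes M \<gamma> C p" "velocity M \<gamma> 0 \<noteq> (\<lambda>_ _. 0)"
  shows "{P \<in> mtopology (PT M) closure_of tangent_lines M C. foot P = p} = {Line p (line_of (velocity M \<gamma> 0))}"
proof -
  let ?l = "line_of (velocity M \<gamma> 0)"
  interpret PTM: hman "PT M" by (rule hman_PT[OF hman_axioms])
  have cs: "smooth_at M \<gamma> 0" by (rule param_csm[OF assms(1)])
  obtain d where d: "{P \<in> mtopology (PT M) closure_of tangent_lines M C. foot P = p} = {d}"
    using lift_germ[OF assms(1) immersed_order[OF cs assms(2)]] by blast
  have p: "p \<in> C" using assms(1) unfolding parametrizes_def by auto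
  have "nonsingular_tangent M C p ?l" unfolding nonsingular_tangent_iff[OF assms] ..
  then have "Line p ?l \<in> tangent_lines M C" unfolding tangent_lines_def using p by blast
  moreover have "tangent_lines M C \<subseteq> mtopology (PT M) closure_of tangent_lines M C"
    by (rule closure_of_subset) (unfold PTM.topspace_mt, rule nst_points)
  ultimately have "Line p ?l \<in> {P \<in> mtopology (PT M) closure_of tangent_lines M C. foot P = p}" by auto
  then show ?thesis unfolding d by auto
qed

end

lemma (in surf) lift_curve_nst: "lift_curve S k C = mtopology (PT (ambient S k)) closure_of tangent_lines (ambient S k) C"
  unfolding lift_curve_def tangent_lines_def PTf ..

lemma (in surf) tangent_direction_foot: "tangent_direction S k C p p' \<Longrightarrow> foot p' = p"
  unfolding tangent_direction_def by blast

subsection \<open>Critical directions\<close>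

context surf begin

lemma root_Phi: "root (Phi S b w k z) = root (Phi S b w 0 z)"
  by (induction k) (simp_all add: Phi_Suc del: Phi.simps)

text \<open>The straight line in the direction of \<open>z (j + 2)\<close> is focal: it is vertical
  if \<open>s = 0\<close> and follows the field \<open>ev\<close> otherwise. It leaves
  \<open>z 0\<close> and \<open>z 1\<close> fixed and so stays over one point of the
  surface.\<close>

lemma critical_unitv:
  assumes b: "b \<in> charts S" and z: "z \<in> VV S b" and c: "infinity_conds w z j s" and r: "r = j + 1 + s"
  shows "critical_direction S r (Phi S b w r z) (line_of (tvP S b w r z (unitv (j + 2))))"
proof -
  let ?M = "ambient S r"
  define \<zeta> where "\<zeta> = (\<lambda>t a. z a + t * unitv (j + 2) a)"
  define D where "D = (\<lambda>t. Phi S b w r (\<zeta> t))"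
  define C where "C = D ` {-1..1}"
  note stage_coords = stage_coords_Phi[OF b]
  have V: "\<zeta> t \<in> VV S b" for t by (rule VV_cong[OF z]) (simp_all add: \<zeta>_def unitv_def)
  have rz: "real_smooth UNIV (\<lambda>t. \<zeta> t a)" for a unfolding \<zeta>_def by (intro rs_add rs_const rs_mult rs_id)
  have dz: "deriv (\<lambda>s. \<zeta> s a) t = unitv (j + 2) a" for a t
    unfolding \<zeta>_def by (rule DERIV_imp_deriv) (auto intro!: derivative_eq_intros)
  have cs: "smooth_at ?M D t" for t unfolding D_def by (rule Phi_curve(2)[OF b stage_coords open_UNIV rz V UNIV_I])
  have vel: "velocity ?M D t = tvP S b w r (\<zeta> t) (unitv (j + 2))" for t
  proof -
    have "velocity ?M D t = tvP S b w r (\<zeta> t) (\<lambda>a. deriv (\<lambda>s. \<zeta> s a) t)"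
      unfolding D_def by (rule Phi_curve(3)[OF b stage_coords open_UNIV rz V UNIV_I])
    then show ?thesis unfolding dz .
  qed
  have nz: "velocity ?M D t \<noteq> (\<lambda>_ _. 0)" for t
    unfolding vel tvP_zero_iff[OF b stage_coords V] using r by (auto simp: unitv_def intro!: exI[of _ "j + 2"])
  have inj: "inj D"
  proof (rule injI)
    fix x y assume "D x = D y"
    then have "\<zeta> x (j + 2) = \<zeta> y (j + 2)" unfolding D_def using r by (intro Phi_inj[OF stage_coords V V]) auto
    then show "x = y" by (simp add: \<zeta>_def unitv_def)
  qed
  have D0: "D 0 = Phi S b w r z" by (simp add: D_def \<zeta>_def)
  have sub: "C \<subseteq> points ?M" unfolding C_def using A.csm_points[OF cs] by blast
  have p: "Phi S b w r z \<in> C" unfolding C_def D0[symmetric] by auto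
  have pm: "Phi S b w r z \<in> points ?M" using p sub by blast
  have par: "parametrizes ?M D C (Phi S b w r z)"
    unfolding parametrizes_def smooth_curve_iff
    using cs inj_on_subset[OF inj subset_UNIV] A.openin_topsp D0 pm
    by (intro conjI exI[of _ 1] exI[of _ "points ?M"]) (auto simp: C_def)
  \<comment> \<open>\<open>recenter\<close> computes tangent lines at interior times only, so the
    end points of the arc are cut off.\<close>
  define U where "U = points ?M - D ` {-1, 1}"
  have "closedin (mtopology ?M) (D ` {-1, 1})" by (rule A.curve_closedin) (use cs in auto)
  then have U: "openin (mtopology ?M) U" unfolding U_def by (rule openin_diff[OF A.openin_topsp])
  have CU: "C \<inter> U = D ` {-1<..<1} \<inter> U"
  proof -
    have "{-1..1} = {-1<..<1} \<union> {-1, 1::real}" by auto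
    then have "C = D ` {-1<..<1} \<union> D ` {-1, 1}" unfolding C_def by (metis image_Un)
    then show ?thesis unfolding U_def by blast
  qed
  have DU: "D t \<in> U" if "t \<in> {-1<..<1}" for t
    unfolding U_def using A.csm_points[OF cs] injD[OF inj] that by fastforce
  have foc: "focal_curve_germ S r C (Phi S b w r z)"
    unfolding focal_curve_germ_def
  proof (intro conjI exI[of _ U] ballI allI impI)
    show "\<exists>\<gamma>. parametrizes ?M \<gamma> C (Phi S b w r z)" by (rule exI[of _ D]) (rule par)
    show "Phi S b w r z \<in> U" using DU[of 0] D0 by simp
    show "C \<inter> U \<subseteq> monster S r" unfolding C_def D_def using Phi_monster[OF b V] by blast
    fix q l assume q: "q \<in> C \<inter> U" and l: "nonsingular_tangent ?M C q l"
    obtain t where t: "t \<in> {-1<..<1}" "q = D t" using q CU by blast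
    have pr: "parametrizes ?M (\<lambda>s. D (s + t)) C (D t)"
      by (rule A.recenter[OF zero_less_one cs inj_on_subset[OF inj subset_UNIV] U CU t(1) DU[OF t(1)]])
    have vs: "velocity ?M (\<lambda>s. D (s + t)) 0 = tvP S b w r (\<zeta> t) (unitv (j + 2))"
      using A.velocity_shift[of r D t 0] vel[of t] by simp
    have nz': "velocity ?M (\<lambda>s. D (s + t)) 0 \<noteq> (\<lambda>_ _. 0)" using nz[of t] vs vel by simp
    have l': "l = line_of (tvP S b w r (\<zeta> t) (unitv (j + 2)))"
      using l unfolding t(2) A.nonsingular_tangent_iff[OF pr nz'] vs .
    \<comment> \<open>For \<open>s = 0\<close> the index \<open>j + 2\<close> is the last
      coordinate, the second field of the frame; for larger \<open>s\<close> the unit vector is the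
      first field by \<open>ev_conds\<close>, as moving along the line preserves the
      conditions.\<close>
    have "\<exists>\<alpha> \<beta>. \<forall>x. (\<lambda>a. x * unitv (j + 2) a) = Eframe w r (\<zeta> t) (x * \<alpha>) (x * \<beta>)"
    proof (cases "s = 0")
      case True
      then show ?thesis by (intro exI[of _ 0] exI[of _ 1]) (simp add: Eframe_def r)
    next
      case False
      have "infinity_conds w (\<zeta> t) j s" by (rule conds_cong[OF c]) (auto simp: \<zeta>_def unitv_def)
      then have "ev w r (\<zeta> t) = unitv (j + 2)" unfolding r using ev_conds[of s w "\<zeta> t" j] False by simp
      then show ?thesis by (intro exI[of _ 1] exI[of _ 0]) (simp add: Eframe_def)
    qed
    then obtain \<alpha> \<beta> where ab: "\<And>x. (\<lambda>a. x * unitv (j + 2) a) = Eframe w r (\<zeta> t) (x * \<alpha>) (x * \<beta>)" by blast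
    show "l \<subseteq> focal_bundle S r q"
    proof
      fix v assume "v \<in> l"
      then obtain x where "v = (\<lambda>c i. x * tvP S b w r (\<zeta> t) (unitv (j + 2)) c i)" unfolding l' line_of_def by blast
      then have "v = tvP S b w r (\<zeta> t) (Eframe w r (\<zeta> t) (x * \<alpha>) (x * \<beta>))" unfolding tvP_scale[symmetric] ab .
      then show "v \<in> focal_bundle S r q" unfolding t(2) D_def focal_Phi[OF b V] by blast
    qed
  qed (rule U)
  have rt: "root (D t) = root (Phi S b w r z)" for t
  proof -
    have "Phi S b w 0 (\<zeta> t) = Phi S b w 0 z" by (rule Phi_cong) (simp add: \<zeta>_def unitv_def)
    then show ?thesis unfolding D_def using root_Phi[of b w r "\<zeta> t"] root_Phi[of b w r z] by simp
  qed
  have "critical_germ S r C (Phi S b w r z)"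
    unfolding critical_germ_def
  proof (intro conjI foc exI[of _ "points ?M"] exI[of _ "root (Phi S b w r z)"])
    show "root ` (C \<inter> points ?M) = {root (Phi S b w r z)}"
      using p pm rt unfolding C_def by auto
  qed (use A.openin_topsp pm in auto)
  moreover have "tangent_direction S r C (Phi S b w r z) (Line (Phi S b w r z) (line_of (tvP S b w r z (unitv (j + 2)))))"
  proof -
    have v: "velocity ?M D 0 = tvP S b w r z (unitv (j + 2))" unfolding vel by (simp add: \<zeta>_def)
    show ?thesis unfolding tangent_direction_def lift_curve_nst v[symmetric] by (rule A.immersed_lift[OF par nz])
  qed
  ultimately show ?thesis unfolding critical_direction_def by blast
qed

end

section \<open>Orders of the coordinates along focal curves\<close>

context surf begin

text \<open>The same word, coordinates and radius also serve all projections to lower stages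
  (\<open>focal_param_down\<close>), so a single \<open>\<zeta>\<close> carries the orders of all
  stages at once.\<close>

definition focal_param :: "'c \<Rightarrow> (nat \<Rightarrow> bool) \<Rightarrow> nat \<Rightarrow> (real \<Rightarrow> ('a, 'c) pt) \<Rightarrow> (real \<Rightarrow> nat \<Rightarrow> real) \<Rightarrow> real \<Rightarrow> bool" where
  "focal_param b w k \<gamma> \<zeta> e \<longleftrightarrow> b \<in> charts S \<and> e > 0 \<and> (\<forall>a. real_smooth (ball 0 e) (\<lambda>s. \<zeta> s a)) \<and>
     (\<forall>s\<in>ball 0 e. \<zeta> s \<in> VV S b \<and> \<gamma> s = Phi S b w k (\<zeta> s)) \<and> focal_eqs w k \<zeta> e"

lemma focal_paramD:
  assumes "focal_param b w k \<gamma> \<zeta> e"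
  shows "b \<in> charts S" "e > 0" "real_smooth (ball 0 e) (\<lambda>s. \<zeta> s a)"
    "s \<in> ball 0 e \<Longrightarrow> \<zeta> s \<in> VV S b" "s \<in> ball 0 e \<Longrightarrow> \<gamma> s = Phi S b w k (\<zeta> s)" "focal_eqs w k \<zeta> e"
    "smooth_near_0 (\<lambda>s. \<zeta> s a)" "\<zeta> 0 \<in> VV S b" "\<gamma> 0 = Phi S b w k (\<zeta> 0)"
  using assms unfolding focal_param_def smooth_near_0_def by auto

text \<open>The second statement is the additive relation for one step, obtained from the new
  Pfaffian equation by \<open>vord_rel\<close>; the third is the tangency hypothesis of
  \<open>project_germ\<close>.\<close>

lemma focal_param_pred:
  assumes "focal_param b w (Suc k) \<gamma> \<zeta> e"
  shows "focal_param b w k (foot \<circ> \<gamma>) \<zeta> e"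
    and "val \<zeta> (other w k) = order_at_0 (\<lambda>s. \<zeta> s (k + 2)) + val \<zeta> (rho w (Suc k))"
    and "\<forall>\<^sub>F t in at 0. velocity (ambient S k) (foot \<circ> \<gamma>) t \<in> dir (\<gamma> t)"
proof -
  note focal_param = focal_paramD[OF assms]
  have R: "focal_eqs w k \<zeta> e" by (rule rel_pred(1)[OF focal_param(6)])
  have eq: "(foot \<circ> \<gamma>) s = Phi S b w k (\<zeta> s)" if "s \<in> ball 0 e" for s
    using focal_param(5)[OF that] foot_Phi[of b w k "\<zeta> s"] by simp
  show "focal_param b w k (foot \<circ> \<gamma>) \<zeta> e" unfolding focal_param_def using focal_param(1-4) R eq by blast
  have "\<forall>\<^sub>F t in nhds 0. deriv (\<lambda>s. \<zeta> s (other w k)) t = \<zeta> t (k + 2) * deriv (\<lambda>s. \<zeta> s (rho w (Suc k))) t"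
    unfolding ev_ball using rel_pred(2)[OF focal_param(6)] focal_param(2) by blast
  then show "val \<zeta> (other w k) = order_at_0 (\<lambda>s. \<zeta> s (k + 2)) + val \<zeta> (rho w (Suc k))"
    unfolding val_def by (intro vord_rel focal_param(7))
  have "velocity (ambient S k) (foot \<circ> \<gamma>) t \<in> dir (\<gamma> t)" if t: "t \<in> ball 0 e" for t
  proof -
    have V: "\<zeta> s \<in> VV S b \<and> (foot \<circ> \<gamma>) s = Phi S b w k (\<zeta> s)" if "s \<in> ball 0 e" for s
      using focal_param(4) eq that by blast
    have v: "velocity (ambient S k) (foot \<circ> \<gamma>) t = tvP S b w k (\<zeta> t) (\<lambda>a. deriv (\<lambda>s. \<zeta> s a) t)"
      by (rule velocity_Phi(2)[OF focal_param(1,3) V t])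
    show ?thesis unfolding v focal_param(5)[OF t] dir_Phi tvP_in_line[OF focal_param(1) stage_coords_Phi[OF focal_param(1)] focal_param(4)[OF t]]
    proof (intro exI allI impI)
      fix a assume "a < k + 2"
      then have "a \<le> Suc k" by simp
      then show "deriv (\<lambda>s. \<zeta> s a) t = deriv (\<lambda>s. \<zeta> s (rho w (Suc k))) t * ev w (Suc k) (\<zeta> t) a"
        using focal_param(6) t unfolding focal_eqs_def by (simp only: mult.commute)
    qed
  qed
  then have "\<forall>\<^sub>F t in nhds 0. velocity (ambient S k) (foot \<circ> \<gamma>) t \<in> dir (\<gamma> t)" unfolding ev_ball using focal_param(2) by blast
  then show "\<forall>\<^sub>F t in at 0. velocity (ambient S k) (foot \<circ> \<gamma>) t \<in> dir (\<gamma> t)"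
    unfolding eventually_at_filter by (rule eventually_mono) blast
qed

lemma funpow_foot: "((foot ^^ Suc m) \<circ> \<gamma>) = foot \<circ> ((foot ^^ m) \<circ> \<gamma>)"
  by (simp add: comp_assoc)

lemma focal_param_down: "focal_param b w J \<gamma> \<zeta> e \<Longrightarrow> i \<le> J \<Longrightarrow> focal_param b w i ((foot ^^ (J - i)) \<circ> \<gamma>) \<zeta> e"
proof (induction "J - i" arbitrary: i)
  case 0
  then have "i = J" by simp
  then show ?case using 0 by simp
next
  case (Suc d)
  have "focal_param b w (Suc i) ((foot ^^ (J - Suc i)) \<circ> \<gamma>) \<zeta> e" using Suc.hyps(2) Suc.prems by (intro Suc.hyps(1)) auto
  from focal_param_pred(1)[OF this] have "focal_param b w i ((foot ^^ Suc (J - Suc i)) \<circ> \<gamma>) \<zeta> e" unfolding funpow_foot .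
  moreover have "Suc (J - Suc i) = J - i" using Suc.hyps(2) by simp
  ultimately show ?case by (simp only:)
qed

text \<open>The order of the projection to stage \<open>k\<close>, by \<open>mord_Phi\<close>;
  infinite if both active coordinates are flat.\<close>

definition mu :: "(nat \<Rightarrow> bool) \<Rightarrow> (real \<Rightarrow> nat \<Rightarrow> real) \<Rightarrow> nat \<Rightarrow> enat" where
  "mu w \<zeta> k = min (val \<zeta> (rho w k)) (val \<zeta> (Suc k))"

lemma mu_finite: "val \<zeta> (rho w k) \<noteq> \<infinity> \<or> val \<zeta> (Suc k) \<noteq> \<infinity> \<Longrightarrow> mu w \<zeta> k \<noteq> \<infinity>"
  unfolding mu_def by (cases "val \<zeta> (rho w k)"; cases "val \<zeta> (Suc k)") (simp_all only: min_enat_simps, auto)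

lemma focal_param_csm: "focal_param b w k \<gamma> \<zeta> e \<Longrightarrow> smooth_at (ambient S k) \<gamma> 0"
  and focal_param_velocity: "focal_param b w k \<gamma> \<zeta> e \<Longrightarrow> velocity (ambient S k) \<gamma> 0 = tvP S b w k (\<zeta> 0) (\<lambda>a. deriv (\<lambda>s. \<zeta> s a) 0)"
proof -
  assume a: "focal_param b w k \<gamma> \<zeta> e"
  note focal_param = focal_paramD[OF a]
  have V: "\<zeta> s \<in> VV S b \<and> \<gamma> s = Phi S b w k (\<zeta> s)" if "s \<in> ball 0 e" for s using focal_param(4,5) that by blast
  have t: "0 \<in> ball (0::real) e" using focal_param(2) by simp
  show "smooth_at (ambient S k) \<gamma> 0" by (rule velocity_Phi(1)[OF focal_param(1,3) V t])
  show "velocity (ambient S k) \<gamma> 0 = tvP S b w k (\<zeta> 0) (\<lambda>a. deriv (\<lambda>s. \<zeta> s a) 0)"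
    by (rule velocity_Phi(2)[OF focal_param(1,3) V t])
qed

lemma focal_param_order:
  assumes "focal_param b w k \<gamma> \<zeta> e"
  shows "vanishing_order (ambient S k) \<gamma> m \<longleftrightarrow> mu w \<zeta> k = enat m"
proof -
  note focal_param = focal_paramD[OF assms]
  have V: "\<zeta> s \<in> VV S b \<and> \<gamma> s = Phi S b w k (\<zeta> s)" if "s \<in> ball 0 e" for s using focal_param(4,5) that by blast
  have m: "curve_order (ambient S k) (ch S b w k) \<gamma> = mu w \<zeta> k" unfolding mu_def
    by (rule mord_Phi[OF focal_param(1,2,3) V focal_param(6)])
  have "\<gamma> 0 \<in> cdom (ambient S k) (ch S b w k)" unfolding focal_param(9) by (rule Phi_cdom[OF focal_param(1,8)])
  from A.vanishing_order_iff[OF focal_param_csm[OF assms] ch_charts[OF focal_param(1)] this] show ?thesis unfolding m .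
qed

lemma focal_at: "focal_curve_germ S k C p \<Longrightarrow> p \<in> monster S k"
proof -
  assume a: "focal_curve_germ S k C p"
  then obtain \<gamma> U where g: "parametrizes (ambient S k) \<gamma> C p" "p \<in> U" "C \<inter> U \<subseteq> monster S k"
    unfolding focal_curve_germ_def by (elim exE conjE) (rule that)
  have "p \<in> C" using g(1) unfolding parametrizes_def by auto
  then show ?thesis using g by blast
qed

text \<open>The word is chosen from the location alone, by \<open>monster_surj\<close>; through
  \<open>Phi_inj\<close> the coordinates of the curve at time 0 inherit its normalization.\<close>

lemma focal_fc:
  assumes "focal_curve_germ S k C p" "parametrizes (ambient S k) \<gamma> C p" "vanishing_order (ambient S k) \<gamma> m"
  shows "\<exists>b w \<zeta> e. focal_param b w k \<gamma> \<zeta> e \<and> (\<forall>s. 1 \<le> s \<and> s \<le> k \<and> w s \<longrightarrow> \<zeta> 0 (Suc s) = 0)"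
proof -
  obtain b w z where b: "b \<in> charts S" and z: "z \<in> VV S b" and p: "p = Phi S b w k z"
    and n: "\<forall>s. 1 \<le> s \<and> s \<le> k \<and> w s \<longrightarrow> z (Suc s) = 0"
    using monster_surj[OF focal_at[OF assms(1)]] by (elim bexE exE conjE) (rule that)
  have "p \<in> cdom (ambient S k) (ch S b w k)" unfolding p by (rule Phi_cdom[OF b z])
  from focal_coords[OF assms b this] obtain e \<zeta> where "e > 0" "\<forall>a. real_smooth (ball 0 e) (\<lambda>s. \<zeta> s a)"
    "\<forall>s\<in>ball 0 e. \<zeta> s \<in> VV S b \<and> \<gamma> s = Phi S b w k (\<zeta> s)" "focal_eqs w k \<zeta> e" by (elim exE conjE) (rule that)
  then have focal_param: "focal_param b w k \<gamma> \<zeta> e" unfolding focal_param_def using b by blast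
  have "Phi S b w k (\<zeta> 0) = Phi S b w k z" using focal_paramD(9)[OF focal_param] A.param_0[OF assms(2)] p by simp
  then have eq: "\<zeta> 0 a = z a" if "a < k + 2" for a
    by (rule Phi_inj[OF stage_coords_Phi[OF b] focal_paramD(8)[OF focal_param] z _ that])
  have "\<zeta> 0 (Suc s) = 0" if "1 \<le> s \<and> s \<le> k \<and> w s" for s
    using eq[of "Suc s"] n that by simp
  then show ?thesis using focal_param by blast
qed

subsection \<open>Regular germs\<close>

lemma regular_not_parallel:
  assumes focal_param: "focal_param b w r \<gamma> \<zeta> e" and nc: "\<not> critical_direction S r (\<gamma> 0) (line_of (velocity (ambient S r) \<gamma> 0))"
    and nz: "velocity (ambient S r) \<gamma> 0 \<noteq> (\<lambda>_ _. 0)"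
    and c: "infinity_conds w (\<zeta> 0) j s" "r = j + 1 + s"
    and par: "\<And>a. a < r + 2 \<Longrightarrow> deriv (\<lambda>s. \<zeta> s a) 0 = x * unitv (j + 2) a"
  shows False
proof -
  note b = focal_paramD(1)[OF focal_param] and V = focal_paramD(8)[OF focal_param]
  have "tvP S b w r (\<zeta> 0) (\<lambda>a. deriv (\<lambda>s. \<zeta> s a) 0) = tvP S b w r (\<zeta> 0) (\<lambda>a. x * unitv (j + 2) a)"
    unfolding tvP_eq_iff[OF b stage_coords_Phi[OF b] V] using par by blast
  then have v: "velocity (ambient S r) \<gamma> 0 = (\<lambda>c i. x * tvP S b w r (\<zeta> 0) (unitv (j + 2)) c i)"
    unfolding focal_param_velocity[OF focal_param] tvP_scale .
  have "x \<noteq> 0" using nz unfolding v by auto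
  then have "line_of (velocity (ambient S r) \<gamma> 0) = line_of (tvP S b w r (\<zeta> 0) (unitv (j + 2)))"
    unfolding v by (rule line_of_scale)
  then show False using nc critical_unitv[OF b V c] unfolding focal_paramD(9)[OF focal_param] by simp
qed

text \<open>The retained coordinate of stage \<open>r\<close> has order 1. If its index is beyond
  \<open>k\<close>, it is the last inverted step \<open>j\<close>, and finiteness descends by the
  additive relations once both active coordinates of stage \<open>j - 1\<close> are known to have
  finite order.\<close>

lemma regular_finite:
  assumes focal_param: "focal_param b w r \<gamma> \<zeta> e" and nc: "\<not> critical_direction S r (\<gamma> 0) (line_of (velocity (ambient S r) \<gamma> 0))"
    and nz: "velocity (ambient S r) \<gamma> 0 \<noteq> (\<lambda>_ _. 0)" and k: "k \<le> r"
  shows "mu w \<zeta> k \<noteq> \<infinity>"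
proof (cases "k = r")
  case True
  then show ?thesis using focal_param_order[OF focal_param, of 1] A.immersed_order[OF focal_param_csm[OF focal_param] nz] by simp
next
  case False
  then have r: "r \<ge> 1" "k < r" using k by auto
  have R: "deriv (\<lambda>s. \<zeta> s a) 0 = ev w r (\<zeta> 0) a * deriv (\<lambda>s. \<zeta> s (rho w r)) 0" if "a \<le> r" for a
    using focal_paramD(6)[OF focal_param] focal_paramD(2)[OF focal_param] that unfolding focal_eqs_def by simp
  \<comment> \<open>Otherwise the focal equations leave only the last component of the velocity, a
    vertical and hence critical direction.\<close>
  have N1: "deriv (\<lambda>s. \<zeta> s (rho w r)) 0 \<noteq> 0"
  proof
    assume 0: "deriv (\<lambda>s. \<zeta> s (rho w r)) 0 = 0"
    have rj: "r = (r - 1) + 1 + 0" and r1: "r - 1 + 2 = r + 1" using r by auto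
    show False
      by (rule regular_not_parallel[OF focal_param nc nz conds_0 rj, where x = "deriv (\<lambda>s. \<zeta> s (r + 1)) 0"])
        (unfold r1, use R 0 in \<open>auto simp: unitv_def less_Suc_eq\<close>)
  qed
  then have v1: "val \<zeta> (rho w r) = 1" unfolding val_def vord_1_iff .
  let ?o = "\<lambda>a. order_at_0 (\<lambda>s. \<zeta> s a)"
  have ov: "?o a \<le> val \<zeta> a" for a unfolding val_def by (rule ordz_le_vord)
  have step: "val \<zeta> (other w i) = ?o (i + 2) + val \<zeta> (rho w (Suc i))" if "i < r" for i
    by (rule focal_param_pred(2)) (rule focal_param_down[OF focal_param], use that in simp)
  \<comment> \<open>Finiteness of the single order \<open>mu w \<zeta>\<close> is not inherited by lower stages; \<open>H\<close> is.\<close>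
  define H where "H i \<longleftrightarrow> val \<zeta> (rho w i) \<noteq> \<infinity> \<and> val \<zeta> (Suc i) \<noteq> \<infinity>" for i
  have H_pred: "H i" if "i < r" "H (Suc i)" for i
  proof -
    have "val \<zeta> (rho w (Suc i)) \<noteq> \<infinity>" "val \<zeta> (i + 2) \<noteq> \<infinity>" using that(2) unfolding H_def by simp_all
    moreover have "?o (i + 2) \<noteq> \<infinity>"
    proof
      assume "?o (i + 2) = \<infinity>"
      with ov[of "i + 2"] have "\<infinity> \<le> val \<zeta> (i + 2)" by (simp only:)
      then show False using calculation(2) by simp
    qed
    ultimately have "val \<zeta> (other w i) \<noteq> \<infinity>" "val \<zeta> (rho w (Suc i)) \<noteq> \<infinity>" using step[OF that(1)] by auto
    then show ?thesis unfolding H_def other_def by (cases "w (Suc i)") auto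
  qed
  define j where "j = rho w r"
  from rho_cases[OF k, of w] consider "rho w r = rho w k"
    | "k < j" "j \<le> r" "w j" "\<forall>a. j < a \<and> a \<le> r \<longrightarrow> \<not> w a" unfolding j_def by blast
  then show ?thesis
  proof cases
    case 1
    then have "val \<zeta> (rho w k) \<noteq> \<infinity>" using v1 by (simp add: one_enat_def)
    then show ?thesis by (intro mu_finite disjI1)
  next
    case 2
    have vj: "val \<zeta> j = 1" using v1 unfolding j_def .
    show ?thesis
    proof (cases "j = Suc k")
      case True
      then have "val \<zeta> (Suc k) \<noteq> \<infinity>" using vj by (simp add: one_enat_def)
      then show ?thesis by (intro mu_finite disjI2)
    next
      case False
      define i where "i = j - 2"
      have i: "j = i + 2" "k \<le> i" using 2 False by (auto simp: i_def)
      have rho_j: "rho w a = j" if "j \<le> a" "a \<le> r" for a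
        using rho_cases[OF that(2), of w] that 2 rho_le[of w a] unfolding j_def by auto
      \<comment> \<open>An infinite order of \<open>z (j + 1)\<close> would propagate upwards, each
        relation taking away only the order 1 of \<open>z j\<close>. All later coordinates would
        vanish at 0, the point would lie on a prolonged divisor or on the stage where
        \<open>z j\<close> is vertical, and the velocity along \<open>z j\<close> would be
        critical.\<close>
      have "?o (j + 1) \<noteq> \<infinity>"
      proof
        assume inf: "?o (j + 1) = \<infinity>"
        have all: "?o (j + 1 + s) = \<infinity>" if "j + s \<le> r" for s
          using that
        proof (induction s)
          case (Suc s)
          have e: "j + s < r" "Suc (j + s) = j + 1 + s" "j + s + 2 = j + 1 + Suc s" using Suc.prems by auto
          have nw: "\<not> w (Suc (j + s))" using 2(4) Suc.prems by auto
          have "val \<zeta> (j + 1 + s) = ?o (j + 1 + Suc s) + val \<zeta> j"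
            using step[OF e(1)] rho_j[of "Suc (j + s)"] Suc.prems nw unfolding other_def e(3) by simp
          moreover have "val \<zeta> (j + 1 + s) = \<infinity>" using ov[of "j + 1 + s"] Suc by simp
          ultimately show ?case using vj by (metis enat.distinct(2) one_enat_def plus_eq_infty_iff_enat)
        qed (use inf in simp)
        define s where "s = r - j + 1"
        have real_smooth: "r = i + 1 + s" using 2(2) i(1) by (simp add: s_def)
        have c: "infinity_conds w (\<zeta> 0) i s" unfolding infinity_conds_def
        proof (intro conjI allI impI)
          show "w (i + 2)" using 2(3) i(1) by simp
          fix a
          show "\<not> w a" if "i + 2 < a \<and> a \<le> i + 1 + s" using 2(4) that unfolding real_smooth i(1) by blast
          assume a: "i + 2 \<le> a \<and> a \<le> i + 1 + s"
          then have "?o (j + 1 + (a - j)) = \<infinity>" using i real_smooth by (intro all) auto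
          moreover have "j + 1 + (a - j) = Suc a" using a i by linarith
          ultimately show "\<zeta> 0 (Suc a) = 0" using ordz_infinity_0[of "\<lambda>s. \<zeta> s (Suc a)"] by simp
        qed
        have ev: "ev w r (\<zeta> 0) = unitv (i + 2)" unfolding real_smooth by (rule ev_conds[OF _ c]) (simp add: s_def)
        have "?o (r + 1) = \<infinity>" using all[of "r - j"] 2(2) by simp
        then have "val \<zeta> (r + 1) = \<infinity>" using ov[of "r + 1"] by simp
        then have last: "deriv (\<lambda>s. \<zeta> s (r + 1)) 0 = 0" unfolding val_def by (rule vord_infinity_deriv)
        show False
        proof (rule regular_not_parallel[OF focal_param nc nz c real_smooth, where x = "deriv (\<lambda>s. \<zeta> s (rho w r)) 0"])
          fix a assume "a < r + 2"
          then consider "a \<le> r" | "a = r + 1" by linarith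
          then show "deriv (\<lambda>s. \<zeta> s a) 0 = deriv (\<lambda>s. \<zeta> s (rho w r)) 0 * unitv (i + 2) a"
          proof cases
            case 1
            then show ?thesis using R ev by simp
          next
            case 2
            then have "unitv (i + 2) a = 0" using \<open>j \<le> r\<close> i(1) by (simp add: unitv_def)
            then show ?thesis using last 2 by simp
          qed
        qed
      qed
      moreover have "val \<zeta> (rho w (Suc i)) = ?o (j + 1) + val \<zeta> j"
      proof -
        have e: "Suc i < r" "Suc i + 2 = j + 1" "Suc (Suc i) = j" using 2(2) i(1) by auto
        have "other w (Suc i) = rho w (Suc i)" "rho w j = j" unfolding other_def e(3) using 2(2,3) rho_j[of j] by auto
        then show ?thesis using step[OF e(1)] unfolding e(2,3) by simp
      qed
      moreover have "Suc (Suc i) = j" using i by simp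
      moreover have "val \<zeta> j \<noteq> \<infinity>" using vj by (simp add: one_enat_def)
      ultimately have "H (Suc i)" unfolding H_def plus_eq_infty_iff_enat by (simp only: plus_eq_infty_iff_enat) blast
      then have "H (Suc i - d)" for d
      proof (induction d)
        case (Suc d)
        show ?case
        proof (cases "d \<le> i")
          case True
          have e: "Suc i - d = Suc (Suc i - Suc d)" using True by simp
          show ?thesis by (rule H_pred) (use Suc e 2(2) i in auto)
        next
          case False
          then have "Suc i - Suc d = Suc i - d" by simp
          then show ?thesis using Suc by simp
        qed
      qed simp
      from this[of "Suc i - k"] have "H k" using i(2) by simp
      then have "val \<zeta> (rho w k) \<noteq> \<infinity>" unfolding H_def by (rule conjunct1)
      then show ?thesis by (intro mu_finite disjI1)
    qed
  qed
qed

end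

lemma (in hman) order_le_reparam:
  assumes cs: "smooth_at M \<gamma> 0" "smooth_at M \<eta> 0" and \<phi>: "smooth_near_0 \<phi>" "\<phi> 0 = 0" and eq: "\<forall>\<^sub>F t in nhds 0. \<eta> t = \<gamma> (\<phi> t)"
    and vo: "vanishing_order M \<gamma> m" "vanishing_order M \<eta> k"
  shows "m \<le> k"
proof -
  have \<eta>0: "\<eta> 0 = \<gamma> 0" using eventually_nhds_x_imp_x[OF eq] \<phi>(2) by simp
  obtain c where c: "c \<in> charts M" "\<gamma> 0 \<in> cdom M c" using csm_points[OF cs(1)] unfolding points_def by blast
  have c': "\<eta> 0 \<in> cdom M c" unfolding \<eta>0 by (rule c(2))
  have m: "curve_order M c \<gamma> = enat m" using vo(1) unfolding vanishing_order_iff[OF cs(1) c] .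
  have k: "curve_order M c \<eta> = enat k" using vo(2) unfolding vanishing_order_iff[OF cs(2) c(1) c'] .
  have "enat m \<le> curve_order M c \<eta>" unfolding mord_ge_iff
  proof (intro allI impI)
    fix i assume i: "i < n"
    have "enat m \<le> order_of_change (\<lambda>t. coord M c (\<gamma> t) i)" using mord_ge_iff[of "enat m" M c \<gamma>] m i by simp
    also have "\<dots> \<le> order_of_change (\<lambda>t. coord M c (\<gamma> (\<phi> t)) i)" by (rule vord_le_comp[OF rsn_coord[OF cs(1) c i] \<phi>])
    also have "\<dots> = order_of_change (\<lambda>t. coord M c (\<eta> t) i)"
      by (rule vord_cong) (use eq in eventually_elim, simp)
    finally show "enat m \<le> order_of_change (\<lambda>t. coord M c (\<eta> t) i)" .
  qed
  then show ?thesis unfolding k by simp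
qed

lemma rho_conds: "infinity_conds w z j (Suc s) \<Longrightarrow> rho w (j + 2 + s) = j + 2"
proof (induction s)
  case 0
  then have "w (j + 2)" unfolding conds_Suc by simp
  then show ?case by simp
next
  case (Suc s)
  have "infinity_conds w z j (Suc s)" "\<not> w (j + 2 + Suc s)" using Suc.prems unfolding conds_Suc[of w z j "Suc s"] by auto
  then show ?case using Suc.IH by simp
qed

lemma conds_mono: "infinity_conds w z j s \<Longrightarrow> s' \<le> s \<Longrightarrow> infinity_conds w z j s'"
  unfolding infinity_conds_def by auto

section \<open>Division with remainder, multiplicities and proximity\<close>

context surf begin

text \<open>If step \<open>i + 2\<close> is inverted, \<open>A\<close> is divided by
  \<open>b\<close>, the order on stage \<open>i + 1\<close>: \<open>A = b + c 0\<close> and, while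
  the points remain on the divisor, \<open>c s = c (Suc s) + b\<close>. On each stage the smaller of
  \<open>b\<close> and the current remainder is the order. The room up to \<open>J\<close> suffices
  because \<open>b \<ge> 1\<close>.\<close>

lemma euclid:
  assumes F: "\<And>l. l < J \<Longrightarrow> val \<zeta> (other w l) = order_at_0 (\<lambda>s. \<zeta> s (l + 2)) + val \<zeta> (rho w (Suc l))"
    and smooth_near_0: "\<And>a. smooth_near_0 (\<lambda>s. \<zeta> s a)" and norm: "\<And>s. 1 \<le> s \<and> s \<le> J \<and> w s \<Longrightarrow> \<zeta> 0 (Suc s) = 0"
    and mi: "mu w \<zeta> i = enat a" and J: "i + 3 + a \<le> J"
  shows "\<exists>m\<le>a. (\<forall>s. i + 2 + s \<le> J \<longrightarrow> infinity_conds w (\<zeta> 0) i (Suc s) \<longleftrightarrow> s < m) \<and>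
    mu w \<zeta> i = mu w \<zeta> (i + 1) + (\<Sum>s<m. mu w \<zeta> (i + 2 + s))"
proof -
  \<comment> \<open>The quotient of the derivatives has nonnegative order, so the minimum is
    attained by the denominator.\<close>
  have mu_rho: "mu w \<zeta> l = val \<zeta> (rho w (Suc l))" if "l < J" for l
  proof -
    have "val \<zeta> (rho w (Suc l)) \<le> val \<zeta> (other w l)" unfolding F[OF that] by simp
    then show ?thesis unfolding mu_def other_def by (cases "w (Suc l)") (auto simp: min_def)
  qed
  have pos: "1 \<le> val \<zeta> x" for x unfolding val_def order_of_change_def one_eSuc by simp
  define A where "A = val \<zeta> (rho w (Suc i))"
  have A: "mu w \<zeta> i = A" "A = enat a" using mu_rho[of i] mi J by (auto simp: A_def)
  show ?thesis
  proof (cases "w (i + 2)")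
    case False
    have "mu w \<zeta> (i + 1) = A" using mu_rho[of "i + 1"] J False by (simp add: A_def)
    moreover have "\<not> infinity_conds w (\<zeta> 0) i (Suc s)" for s using False unfolding infinity_conds_def by simp
    ultimately show ?thesis unfolding A(1) by (intro exI[of _ 0]) simp
  next
    case True
    define b where "b = val \<zeta> (i + 2)"
    define c where "c s = val \<zeta> (i + 3 + s)" for s
    have r2: "rho w (i + 2) = i + 2" using True by simp
    have mu1: "mu w \<zeta> (i + 1) = b" using mu_rho[of "i + 1"] J True by (simp add: b_def)
    \<comment> \<open>Here the normalization of the word enters: the inverted coordinate vanishes at
      0, so its order as a quotient is also its order of change.\<close>
    have z3: "\<zeta> 0 (i + 3) = 0" using norm[of "i + 2"] True J by (simp add: eval_nat_numeral)
    have A1: "A = b + c 0"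
    proof -
      have e: "i + 1 < J" "i + 1 + 2 = i + 3" "Suc (i + 1) = i + 2" using J by auto
      have "other w (i + 1) = rho w (Suc i)" using True by (simp add: other_def)
      then have "A = order_at_0 (\<lambda>s. \<zeta> s (i + 3)) + b" using F[OF e(1)] unfolding e(2,3) r2 A_def b_def by simp
      moreover have "c 0 = order_at_0 (\<lambda>s. \<zeta> s (i + 3))" unfolding c_def val_def using vord_eq_ordz0[OF smooth_near_0[of "i + 3"] z3] by simp
      ultimately show ?thesis by (simp add: add.commute)
    qed
    have min_mu: "mu w \<zeta> (i + 2 + s) = min b (c s)" if "infinity_conds w (\<zeta> 0) i (Suc s)" for s
      unfolding mu_def rho_conds[OF that] b_def c_def by (simp add: eval_nat_numeral)
    have next_c: "c s = c (Suc s) + b" if "infinity_conds w (\<zeta> 0) i (Suc (Suc s))" "i + 2 + s < J" for s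
    proof -
      have e: "i + 2 + s + 2 = i + 3 + Suc s" "Suc (i + 2 + s) = i + 2 + Suc s" by auto
      have cc: "\<not> w (i + 2 + Suc s)" "\<zeta> 0 (i + 3 + Suc s) = 0" using that(1) unfolding conds_Suc[of w _ i "Suc s"] by auto
      have "other w (i + 2 + s) = i + 3 + s" using cc(1) by (simp add: other_def eval_nat_numeral)
      then have "c s = order_at_0 (\<lambda>s'. \<zeta> s' (i + 3 + Suc s)) + b"
        using F[OF that(2)] unfolding e rho_conds[OF that(1)] c_def b_def by simp
      moreover have "c (Suc s) = order_at_0 (\<lambda>s'. \<zeta> s' (i + 3 + Suc s))"
        unfolding c_def val_def by (rule vord_eq_ordz0[OF smooth_near_0 cc(2)])
      ultimately show ?thesis by simp
    qed
    \<comment> \<open>The second half counts the summands, each being at least 1. Together with the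
      first half it bounds the number of points on the divisor by \<open>a\<close>.\<close>
    have inv: "A = b + (\<Sum>t<s. mu w \<zeta> (i + 2 + t)) + c s \<and> enat (Suc s) \<le> b + (\<Sum>t<s. mu w \<zeta> (i + 2 + t))"
      if "infinity_conds w (\<zeta> 0) i (Suc s)" "i + 2 + s \<le> J" for s
      using that
    proof (induction s)
      case 0
      then show ?case using A1 pos[of "i + 2"] by (simp add: b_def one_enat_def)
    next
      case (Suc s)
      have cs: "infinity_conds w (\<zeta> 0) i (Suc s)" "i + 2 + s < J" using conds_mono[OF Suc.prems(1)] Suc.prems(2) by auto
      have IH: "A = b + (\<Sum>t<s. mu w \<zeta> (i + 2 + t)) + c s" "enat (Suc s) \<le> b + (\<Sum>t<s. mu w \<zeta> (i + 2 + t))"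
        using Suc.IH[OF cs(1)] cs(2) by simp_all
      have nc: "c s = c (Suc s) + b" by (rule next_c[OF Suc.prems(1) cs(2)])
      have mb: "mu w \<zeta> (i + 2 + s) = b" unfolding min_mu[OF cs(1)] nc by (simp add: min_def)
      have "enat (Suc s) + enat 1 \<le> b + (\<Sum>t<s. mu w \<zeta> (i + 2 + t)) + b"
        by (rule add_mono[OF IH(2)]) (use pos[of "i + 2"] in \<open>simp add: b_def one_enat_def\<close>)
      moreover have "enat (Suc (Suc s)) = enat (Suc s) + enat 1" by simp
      moreover have "A = b + ((\<Sum>t<s. mu w \<zeta> (i + 2 + t)) + b) + c (Suc s)"
        unfolding IH(1) nc by (simp only: ac_simps)
      ultimately show ?case unfolding sum.lessThan_Suc mb by (simp only: add.assoc simp_thms)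
    qed
    have bound: "s < a" if "infinity_conds w (\<zeta> 0) i (Suc s)" "i + 2 + s \<le> J" for s
    proof -
      define X where "X = b + (\<Sum>t<s. mu w \<zeta> (i + 2 + t))"
      have X: "A = X + c s" "enat (Suc s) \<le> X" using inv[OF that] unfolding X_def by (rule conjunct1, rule conjunct2)
      have "enat (Suc s) \<le> A" unfolding X(1) by (rule order_trans[OF X(2)]) simp
      then show ?thesis unfolding A(2) by simp
    qed
    have na: "\<not> infinity_conds w (\<zeta> 0) i (Suc a)" using bound[of a] J by auto
    define m where "m = (LEAST m. \<not> infinity_conds w (\<zeta> 0) i (Suc m))"
    have nm: "\<not> infinity_conds w (\<zeta> 0) i (Suc m)" unfolding m_def by (rule LeastI[of _ a]) (rule na)
    have m: "m \<le> a" unfolding m_def by (rule Least_le) (rule na)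
    have below: "infinity_conds w (\<zeta> 0) i (Suc s)" if "s < m" for s using not_less_Least[OF that[unfolded m_def]] by blast
    have above: "\<not> infinity_conds w (\<zeta> 0) i (Suc s)" if "m \<le> s" for s using nm conds_mono[of w "\<zeta> 0" i "Suc s" "Suc m"] that by auto
    have "infinity_conds w (\<zeta> 0) i (Suc 0)" unfolding conds_Suc using True z3 by simp
    then have "m \<noteq> 0" using nm by (cases m) auto
    then obtain s where s: "m = Suc s" by (cases m) auto
    have cs: "infinity_conds w (\<zeta> 0) i (Suc s)" by (rule below) (simp add: s)
    have sJ: "i + 2 + s < J" using m s J by simp
    \<comment> \<open>The curve leaves the divisor when the next step is inverted or the next
      quotient is nonzero at 0. In the first case the remainder is the denominator, in the second
      both orders agree; either way \<open>c s \<le> b\<close>, and the last stage uses up the whole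
      remainder.\<close>
    have last: "mu w \<zeta> (i + 2 + s) = c s"
    proof -
      have e: "i + 2 + s + 2 = i + 3 + Suc s" "Suc (i + 2 + s) = i + 2 + Suc s" by auto
      note Fs = F[OF sJ, unfolded e]
      have o: "other w (i + 2 + s) = (if w (i + 2 + Suc s) then i + 2 else i + 3 + s)"
        unfolding other_def e rho_conds[OF cs] by (simp add: eval_nat_numeral)
      have r: "rho w (i + 2 + Suc s) = (if w (i + 2 + Suc s) then i + 3 + s else i + 2)"
        using rho_conds[OF cs] by (simp add: eval_nat_numeral)
      have "w (i + 2 + Suc s) \<or> \<zeta> 0 (i + 3 + Suc s) \<noteq> 0" using nm cs unfolding s conds_Suc[of w _ i "Suc s"] by auto
      then have "c s \<le> b"
      proof (cases "w (i + 2 + Suc s)")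
        case True
        then have "b = order_at_0 (\<lambda>s'. \<zeta> s' (i + 3 + Suc s)) + c s" using Fs unfolding o r b_def c_def by simp
        then show ?thesis by simp
      next
        case False
        assume "w (i + 2 + Suc s) \<or> \<zeta> 0 (i + 3 + Suc s) \<noteq> 0"
        then have "order_at_0 (\<lambda>s'. \<zeta> s' (i + 3 + Suc s)) = 0" using False unfolding ordz_0_iff by blast
        then show ?thesis using Fs False unfolding o r b_def c_def by simp
      qed
      then show ?thesis unfolding min_mu[OF cs] by (simp add: min_def)
    qed
    have "A = b + (\<Sum>t<m. mu w \<zeta> (i + 2 + t))" unfolding s sum.lessThan_Suc last
      using inv[OF cs] sJ by (simp add: add.assoc)
    moreover have "infinity_conds w (\<zeta> 0) i (Suc s) \<longleftrightarrow> s < m" for s using below above not_less by blast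
    ultimately show ?thesis unfolding A(1) mu1 using m by blast
  qed
qed

subsection \<open>Iterated lifts\<close>

lemma lift_step:
  assumes "parametrizes (ambient S k) \<delta> C p" "vanishing_order (ambient S k) \<delta> n" "tangent_direction S k C p p'"
  shows "\<exists>\<delta>'. foot \<circ> \<delta>' = \<delta> \<and> parametrizes (ambient S (Suc k)) \<delta>' (lift_curve S k C) p' \<and>
    (\<exists>n'\<le>n. vanishing_order (ambient S (Suc k)) \<delta>' n')"
proof -
  obtain \<delta>' where d: "\<forall>t. foot (\<delta>' t) = \<delta> t" "parametrizes (ambient S (Suc k)) \<delta>' (lift_curve S k C) (\<delta>' 0)"
    "{P \<in> lift_curve S k C. foot P = p} = {\<delta>' 0}" "\<exists>n'\<le>n. vanishing_order (ambient S (Suc k)) \<delta>' n'"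
    using A.lift_germ[OF assms(1,2)] unfolding lift_curve_nst[unfolded PTf, symmetric] PTf by - (erule exE, (erule conjE)+, rule that)
  have "p' = \<delta>' 0" using assms(3) d(3) unfolding tangent_direction_def by simp
  moreover have "foot \<circ> \<delta>' = \<delta>" using d(1) by (simp add: fun_eq_iff)
  ultimately show ?thesis using d(2,4) by blast
qed

lemma iterated_liftsD:
  assumes "iterated_lifts S k C p" "k \<le> j"
  shows "focal_curve_germ S j (C j) (p j)" "C (Suc j) = lift_curve S j (C j)"
    "tangent_direction S j (C j) (p j) (p (Suc j))"
  using assms unfolding iterated_lifts_def by simp_all

text \<open>A single curve on the top stage represents all intermediate lifts through iterates of
  \<open>foot\<close>, and orders do not increase on the way up.\<close>

lemma lift_iter:
  assumes it: "iterated_lifts S k C p" and i: "k \<le> i"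
    and \<delta>: "parametrizes (ambient S i) \<delta> (C i) (p i)" "vanishing_order (ambient S i) \<delta> n"
  shows "\<exists>\<delta>'. (foot ^^ d) \<circ> \<delta>' = \<delta> \<and> (\<forall>d'\<le>d. parametrizes (ambient S (i + d')) ((foot ^^ (d - d')) \<circ> \<delta>') (C (i + d')) (p (i + d')) \<and>
    (\<exists>n'\<le>n. vanishing_order (ambient S (i + d')) ((foot ^^ (d - d')) \<circ> \<delta>') n'))"
proof (induction d)
  case 0
  then show ?case using \<delta> by auto
next
  case (Suc d)
  then obtain \<delta>1 where d1: "(foot ^^ d) \<circ> \<delta>1 = \<delta>"
    and d2: "\<forall>d'\<le>d. parametrizes (ambient S (i + d')) ((foot ^^ (d - d')) \<circ> \<delta>1) (C (i + d')) (p (i + d')) \<and>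
      (\<exists>n'\<le>n. vanishing_order (ambient S (i + d')) ((foot ^^ (d - d')) \<circ> \<delta>1) n')" by - (erule exE, (erule conjE)+, rule that)
  have ki: "k \<le> i + d" using i by simp
  from d2[rule_format, OF order_refl] obtain n1 where n1: "n1 \<le> n" and p1: "parametrizes (ambient S (i + d)) \<delta>1 (C (i + d)) (p (i + d))"
    and v1: "vanishing_order (ambient S (i + d)) \<delta>1 n1" by auto
  from lift_step[OF p1 v1 iterated_liftsD(3)[OF it ki], folded iterated_liftsD(2)[OF it ki]] obtain \<delta>2 where f: "foot \<circ> \<delta>2 = \<delta>1"
    and p2: "parametrizes (ambient S (Suc (i + d))) \<delta>2 (C (Suc (i + d))) (p (Suc (i + d)))"
    and v2: "\<exists>n'\<le>n1. vanishing_order (ambient S (Suc (i + d))) \<delta>2 n'" by - (erule exE, (erule conjE)+, rule that)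
  have comp: "(foot ^^ Suc m) \<circ> \<delta>2 = (foot ^^ m) \<circ> \<delta>1" for m
    unfolding funpow_Suc_right f[symmetric] comp_assoc ..
  show ?case
  proof (intro exI[of _ \<delta>2] conjI allI impI)
    show "(foot ^^ Suc d) \<circ> \<delta>2 = \<delta>" unfolding comp by (rule d1)
    fix d' assume d': "d' \<le> Suc d"
    have "parametrizes (ambient S (i + d')) ((foot ^^ (Suc d - d')) \<circ> \<delta>2) (C (i + d')) (p (i + d')) \<and>
      (\<exists>n'\<le>n. vanishing_order (ambient S (i + d')) ((foot ^^ (Suc d - d')) \<circ> \<delta>2) n')"
    proof (cases "d' = Suc d")
      case True
      have e: "i + d' = Suc (i + d)" "(foot ^^ (Suc d - d')) \<circ> \<delta>2 = \<delta>2" using True by simp_all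
      show ?thesis unfolding e using p2 v2 n1 order_trans by blast
    next
      case False
      then have e: "Suc d - d' = Suc (d - d')" and le: "d' \<le> d" using d' by auto
      show ?thesis unfolding e comp using d2[rule_format, OF le] .
    qed
    then show "parametrizes (ambient S (i + d')) ((foot ^^ (Suc d - d')) \<circ> \<delta>2) (C (i + d')) (p (i + d'))"
      "\<exists>n'\<le>n. vanishing_order (ambient S (i + d')) ((foot ^^ (Suc d - d')) \<circ> \<delta>2) n'" by (rule conjunct1, rule conjunct2)
  qed
qed

text \<open>Finiteness of \<open>mu w \<zeta> i\<close> is exactly the finite order of the
  projection that \<open>project_germ\<close> asks for at each step down.\<close>

lemma descend:
  assumes it: "iterated_lifts S k C p" and focal_param: "focal_param b w r \<gamma> \<zeta> e" and fin: "\<And>i. i \<le> r \<Longrightarrow> mu w \<zeta> i \<noteq> \<infinity>"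
    and par: "parametrizes (ambient S r) \<gamma> (C r) (p r)"
  shows "k \<le> i \<Longrightarrow> i \<le> r \<Longrightarrow> parametrizes (ambient S i) ((foot ^^ (r - i)) \<circ> \<gamma>) (C i) (p i)"
proof (induction "r - i" arbitrary: i)
  case 0
  then have "i = r" by simp
  then show ?case using par by simp
next
  case (Suc d)
  define \<gamma>' where "\<gamma>' = (foot ^^ (r - Suc i)) \<circ> \<gamma>"
  have e: "r - i = Suc (r - Suc i)" and le: "Suc i \<le> r" using Suc.hyps(2) by auto
  have g: "(foot ^^ (r - i)) \<circ> \<gamma> = foot \<circ> \<gamma>'" unfolding e \<gamma>'_def by (rule funpow_foot)
  have "parametrizes (ambient S (Suc i)) \<gamma>' (C (Suc i)) (p (Suc i))"
    unfolding \<gamma>'_def by (rule Suc.hyps(1)) (use Suc.hyps(2) Suc.prems(1) in auto)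
  then have p': "parametrizes (PT (ambient S i)) \<gamma>' (mtopology (PT (ambient S i)) closure_of tangent_lines (ambient S i) (C i)) (p (Suc i))"
    unfolding iterated_liftsD(2)[OF it Suc.prems(1)] lift_curve_nst PTf .
  have fc': "focal_param b w (Suc i) \<gamma>' \<zeta> e" unfolding \<gamma>'_def by (rule focal_param_down[OF focal_param le])
  obtain m where m: "mu w \<zeta> i = enat m" using fin[OF Suc.prems(2)] by auto
  have vo: "vanishing_order (ambient S i) (foot \<circ> \<gamma>') m" using m unfolding focal_param_order[OF focal_param_pred(1)[OF fc']] .
  obtain \<delta> where \<delta>: "parametrizes (ambient S i) \<delta> (C i) (p i)"
    using iterated_liftsD(1)[OF it Suc.prems(1)] unfolding focal_curve_germ_def by (elim exE conjE) (rule that)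
  show ?case unfolding g
    by (rule A.project_germ[OF \<delta> p' tangent_direction_foot[OF iterated_liftsD(3)[OF it Suc.prems(1)]] vo focal_param_pred(3)[OF fc']])
qed

lemma multiplicity_atI:
  assumes "parametrizes M \<gamma> C p" "vanishing_order M \<gamma> m"
    "\<And>\<eta> n. parametrizes M \<eta> C p \<Longrightarrow> vanishing_order M \<eta> n \<Longrightarrow> m \<le> n"
  shows "multiplicity_at M C p = m"
  unfolding multiplicity_at_def by (rule Least_equality) (use assms in blast)+

lemma regular_param:
  assumes it: "iterated_lifts S k C p" and r: "k \<le> r" and reg: "regular_germ S r (C r) (p r)"
  shows "\<exists>\<gamma>. parametrizes (ambient S r) \<gamma> (C r) (p r) \<and> vanishing_order (ambient S r) \<gamma> 1 \<and>
    (\<forall>i. k \<le> i \<and> i \<le> r \<longrightarrow> parametrizes (ambient S i) ((foot ^^ (r - i)) \<circ> \<gamma>) (C i) (p i) \<and>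
      vanishing_order (ambient S i) ((foot ^^ (r - i)) \<circ> \<gamma>) (multiplicity_at (ambient S i) (C i) (p i)))"
proof -
  obtain l where l: "nonsingular_tangent (ambient S r) (C r) (p r) l" "\<not> critical_direction S r (p r) l"
    using reg unfolding regular_germ_def by (elim exE conjE) (rule that)
  obtain \<gamma> where par: "parametrizes (ambient S r) \<gamma> (C r) (p r)" and nz: "velocity (ambient S r) \<gamma> 0 \<noteq> (\<lambda>_ _. 0)"
    and l': "l = line_of (velocity (ambient S r) \<gamma> 0)" using l(1) unfolding nonsingular_tangent_def by (elim exE conjE) (rule that)
  have vo: "vanishing_order (ambient S r) \<gamma> 1" by (rule A.immersed_order[OF A.param_csm[OF par] nz])
  from focal_fc[OF iterated_liftsD(1)[OF it r] par vo] obtain b w \<zeta> e where focal_param: "focal_param b w r \<gamma> \<zeta> e" by (elim exE conjE) (rule that)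
  have nc: "\<not> critical_direction S r (\<gamma> 0) (line_of (velocity (ambient S r) \<gamma> 0))" using l(2) unfolding l' A.param_0[OF par] .
  have fin: "mu w \<zeta> i \<noteq> \<infinity>" if "i \<le> r" for i by (rule regular_finite[OF focal_param nc nz that])
  have "parametrizes (ambient S i) ((foot ^^ (r - i)) \<circ> \<gamma>) (C i) (p i) \<and>
      vanishing_order (ambient S i) ((foot ^^ (r - i)) \<circ> \<gamma>) (multiplicity_at (ambient S i) (C i) (p i))" if i: "k \<le> i" "i \<le> r" for i
  proof -
    let ?g = "(foot ^^ (r - i)) \<circ> \<gamma>"
    have pi: "parametrizes (ambient S i) ?g (C i) (p i)" by (rule descend[OF it focal_param fin par i])
    obtain m where m: "mu w \<zeta> i = enat m" using fin[OF i(2)] by auto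
    have vi: "vanishing_order (ambient S i) ?g m" using m unfolding focal_param_order[OF focal_param_down[OF focal_param i(2)]] .
    have "multiplicity_at (ambient S i) (C i) (p i) = m"
    proof (rule multiplicity_atI[OF pi vi])
      fix \<eta> n assume \<eta>: "parametrizes (ambient S i) \<eta> (C i) (p i)" "vanishing_order (ambient S i) \<eta> n"
      obtain \<eta>' where f: "(foot ^^ (r - i)) \<circ> \<eta>' = \<eta>" and p0: "\<forall>d'\<le>r - i. parametrizes (ambient S (i + d')) ((foot ^^ (r - i - d')) \<circ> \<eta>') (C (i + d')) (p (i + d')) \<and>
         (\<exists>n'\<le>n. vanishing_order (ambient S (i + d')) ((foot ^^ (r - i - d')) \<circ> \<eta>') n')"
        using lift_iter[OF it i(1) \<eta>, of "r - i"] by - (erule exE, (erule conjE)+, rule that)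
      have p': "parametrizes (ambient S r) \<eta>' (C r) (p r)" using p0[rule_format, OF order_refl] i(2) by simp
      obtain \<phi> where \<phi>: "smooth_near_0 \<phi>" "\<phi> 0 = 0" "\<forall>\<^sub>F t in nhds 0. \<eta>' t = \<gamma> (\<phi> t)" by (rule A.reparam[OF par nz p'])
      have "\<forall>\<^sub>F t in nhds 0. \<eta> t = ?g (\<phi> t)" using \<phi>(3) by eventually_elim (simp add: f[symmetric])
      from A.order_le_reparam[OF A.param_csm[OF pi] A.param_csm[OF \<eta>(1)] \<phi>(1,2) this vi \<eta>(2)] show "m \<le> n" .
    qed
    then show ?thesis using pi vi by simp
  qed
  then show ?thesis using par vo by blast
qed

text \<open>Above stage \<open>r\<close> the order stays at most 1 under lifting; as orders are
  positive it equals 1, the least possible value.\<close>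

lemma germ_sequence:
  assumes it: "iterated_lifts S k C p" and r: "k \<le> r" and reg: "regular_germ S r (C r) (p r)" and J: "r \<le> J"
  shows "\<exists>\<gamma>. \<forall>i. k \<le> i \<and> i \<le> J \<longrightarrow> parametrizes (ambient S i) ((foot ^^ (J - i)) \<circ> \<gamma>) (C i) (p i) \<and>
      vanishing_order (ambient S i) ((foot ^^ (J - i)) \<circ> \<gamma>) (multiplicity_at (ambient S i) (C i) (p i))"
proof -
  obtain \<gamma>r where par: "parametrizes (ambient S r) \<gamma>r (C r) (p r)" "vanishing_order (ambient S r) \<gamma>r 1"
    and low: "\<forall>i. k \<le> i \<and> i \<le> r \<longrightarrow> parametrizes (ambient S i) ((foot ^^ (r - i)) \<circ> \<gamma>r) (C i) (p i) \<and>
      vanishing_order (ambient S i) ((foot ^^ (r - i)) \<circ> \<gamma>r) (multiplicity_at (ambient S i) (C i) (p i))"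
    using regular_param[OF it r reg] by (elim exE conjE) (rule that)
  obtain \<gamma> where f: "(foot ^^ (J - r)) \<circ> \<gamma> = \<gamma>r" and up: "\<forall>d'\<le>J - r. parametrizes (ambient S (r + d')) ((foot ^^ (J - r - d')) \<circ> \<gamma>) (C (r + d')) (p (r + d')) \<and>
     (\<exists>n'\<le>1. vanishing_order (ambient S (r + d')) ((foot ^^ (J - r - d')) \<circ> \<gamma>) n')"
    using lift_iter[OF it r par, of "J - r"] by - (erule exE, (erule conjE)+, rule that)
  have "parametrizes (ambient S i) ((foot ^^ (J - i)) \<circ> \<gamma>) (C i) (p i) \<and>
      vanishing_order (ambient S i) ((foot ^^ (J - i)) \<circ> \<gamma>) (multiplicity_at (ambient S i) (C i) (p i))" if i: "k \<le> i" "i \<le> J" for i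
  proof (cases "i \<le> r")
    case True
    have "J - i = (r - i) + (J - r)" using True J by simp
    then have "(foot ^^ (J - i)) \<circ> \<gamma> = (foot ^^ (r - i)) \<circ> \<gamma>r" unfolding f[symmetric] by (simp only: funpow_add comp_assoc)
    then show ?thesis using low i True by (simp only:)
  next
    case False
    have e: "r + (i - r) = i" "J - r - (i - r) = J - i" using False i by auto
    have le: "i - r \<le> J - r" using i by simp
    from up[rule_format, OF le] have pi: "parametrizes (ambient S i) ((foot ^^ (J - i)) \<circ> \<gamma>) (C i) (p i)"
      and "\<exists>n'\<le>1. vanishing_order (ambient S i) ((foot ^^ (J - i)) \<circ> \<gamma>) n'" unfolding e by blast+
    then obtain n' where n': "n' \<le> 1" "vanishing_order (ambient S i) ((foot ^^ (J - i)) \<circ> \<gamma>) n'" by blast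
    have "n' \<noteq> 0" using n'(2) unfolding vanishing_order_def by simp
    then have "n' = 1" using n'(1) by simp
    have "multiplicity_at (ambient S i) (C i) (p i) = n'"
    proof (rule multiplicity_atI[OF pi n'(2)])
      fix \<eta> n assume "vanishing_order (ambient S i) \<eta> n"
      then have "0 < n" unfolding vanishing_order_def by (rule conjunct1)
      then show "n' \<le> n" using \<open>n' = 1\<close> by simp
    qed
    then show ?thesis using pi n'(2) by simp
  qed
  then show ?thesis by blast
qed

text \<open>Regularizability speaks of some sequence of lifts; this identifies it with the given
  one.\<close>

lemma iterated_lifts_unique:
  assumes "iterated_lifts S k C p" "iterated_lifts S k C' p'" "C' k = C k" "p' k = p k"
  shows "k \<le> j \<Longrightarrow> C' j = C j \<and> p' j = p j"
proof (induction j rule: dec_induct)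
  case base
  then show ?case using assms(3,4) by simp
next
  case (step j)
  have "C' (Suc j) = C (Suc j)" using iterated_liftsD(2)[OF assms(1) step(1)] iterated_liftsD(2)[OF assms(2) step(1)] step(3) by simp
  moreover have "p' (Suc j) = p (Suc j)"
    using iterated_liftsD(3)[OF assms(1) step(1)] iterated_liftsD(3)[OF assms(2) step(1)] step(3) unfolding tangent_direction_def by simp
  ultimately show ?case ..
qed

text \<open>By construction a prolongation lies over the previous one, so a sequence of points that
  has left the divisor cannot return to it.\<close>

lemma div_inf_nested:
  assumes it: "iterated_lifts S k C p" and i: "k \<le> i"
  shows "s' \<le> s \<Longrightarrow> p (i + 2 + s) \<in> div_inf S (i + 2) s \<Longrightarrow> p (i + 2 + s') \<in> div_inf S (i + 2) s'"
proof (induction s rule: dec_induct)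
  case (step s)
  have f: "foot (p (i + 2 + Suc s)) = p (i + 2 + s)"
    using tangent_direction_foot[OF iterated_liftsD(3)[OF it, of "i + 2 + s"]] i by simp
  have "p (i + 2 + Suc s) \<in> fst (vt i (Suc (Suc s)))" using step.prems unfolding div_inf_def .
  then obtain q l where "p (i + 2 + Suc s) = Line q l" "q \<in> fst (vt i (Suc s))" unfolding vert_tower_Suc(1)[of i "Suc s"] by blast
  then have "p (i + 2 + s) \<in> div_inf S (i + 2) s" unfolding f[symmetric] div_inf_def by simp
  then show ?case by (rule step.IH)
qed

lemma proximity:
  assumes it: "iterated_lifts S k C p" and r: "k \<le> r" and reg: "regular_germ S r (C r) (p r)" and i: "k \<le> i"
  defines "m \<equiv> \<lambda>j. multiplicity_at (ambient S j) (C j) (p j)"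
  shows "finite {j. proximate S p j i} \<and> m i = (\<Sum>j | proximate S p j i. m j)"
proof -
  have m_eq: "m l = multiplicity_at (ambient S l) (C l) (p l)" for l by (simp only: m_def)
  \<comment> \<open>At least \<open>r\<close>, for \<open>germ_sequence\<close>, and at least
    \<open>i + 3 + m i\<close>, the room \<open>euclid\<close> needs to see the points leave the
    divisor.\<close>
  define J where "J = max r (i + 3 + m i)"
  have J: "r \<le> J" "i + 3 + m i \<le> J" "k \<le> J" using r by (auto simp: J_def)
  obtain \<gamma> where g: "\<forall>i. k \<le> i \<and> i \<le> J \<longrightarrow> parametrizes (ambient S i) ((foot ^^ (J - i)) \<circ> \<gamma>) (C i) (p i) \<and>
      vanishing_order (ambient S i) ((foot ^^ (J - i)) \<circ> \<gamma>) (m i)"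
    using germ_sequence[OF it r reg J(1), folded m_eq] by (elim exE) (rule that)
  have gJ: "parametrizes (ambient S J) \<gamma> (C J) (p J)" "vanishing_order (ambient S J) \<gamma> (m J)" using g[rule_format, of J] J(3) by simp_all
  from focal_fc[OF iterated_liftsD(1)[OF it J(3)] gJ] obtain b w \<zeta> e where focal_param: "focal_param b w J \<gamma> \<zeta> e"
    and norm: "\<forall>s. 1 \<le> s \<and> s \<le> J \<and> w s \<longrightarrow> \<zeta> 0 (Suc s) = 0" by (elim exE conjE) (rule that)
  have mu: "mu w \<zeta> l = enat (m l)" if "k \<le> l" "l \<le> J" for l
    using g[rule_format, of l] that unfolding focal_param_order[OF focal_param_down[OF focal_param that(2)]] by blast
  have F: "val \<zeta> (other w l) = order_at_0 (\<lambda>s. \<zeta> s (l + 2)) + val \<zeta> (rho w (Suc l))" if "l < J" for l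
    by (rule focal_param_pred(2)) (rule focal_param_down[OF focal_param], use that in simp)
  have iJ: "i \<le> J" "i + 1 \<le> J" using J(2) by auto
  have "\<exists>M\<le>m i. (\<forall>s. i + 2 + s \<le> J \<longrightarrow> infinity_conds w (\<zeta> 0) i (Suc s) \<longleftrightarrow> s < M) \<and>
    mu w \<zeta> i = mu w \<zeta> (i + 1) + (\<Sum>s<M. mu w \<zeta> (i + 2 + s))"
    by (rule euclid[OF _ focal_paramD(7)[OF focal_param] _ mu[OF i iJ(1)] J(2)]) (rule F, assumption, rule norm[rule_format])
  then obtain M where M: "M \<le> m i" and cM: "\<forall>s. i + 2 + s \<le> J \<longrightarrow> infinity_conds w (\<zeta> 0) i (Suc s) \<longleftrightarrow> s < M"
    and sum: "mu w \<zeta> i = mu w \<zeta> (i + 1) + (\<Sum>s<M. mu w \<zeta> (i + 2 + s))"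
    by (elim exE conjE) (rule that)
  have d: "p (i + 2 + s) \<in> div_inf S (i + 2) s \<longleftrightarrow> s < M" if s: "i + 2 + s \<le> J" for s
  proof -
    have ks: "k \<le> i + 2 + s" using i by simp
    have "p (i + 2 + s) = ((foot ^^ (J - (i + 2 + s))) \<circ> \<gamma>) 0" using A.param_0 g ks s by metis
    also have "\<dots> = Phi S b w (i + 2 + s) (\<zeta> 0)" by (rule focal_paramD(9)[OF focal_param_down[OF focal_param s]])
    finally show ?thesis using div_inf_coords[OF focal_paramD(1,8)[OF focal_param], of w i s] cM s by simp
  qed
  \<comment> \<open>The coordinates reach only up to stage \<open>J\<close>. Beyond it nesting
    decides, since the point on stage \<open>i + 3 + m i\<close> is already off the divisor.\<close>
  have dd: "p (i + 2 + s) \<in> div_inf S (i + 2) s \<longleftrightarrow> s < M" for s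
  proof (cases "i + 2 + s \<le> J")
    case False
    then have s: "Suc (m i) \<le> s" using J(2) by simp
    have "\<not> p (i + 2 + Suc (m i)) \<in> div_inf S (i + 2) (Suc (m i))" using d[of "Suc (m i)"] J(2) M by simp
    then have "\<not> p (i + 2 + s) \<in> div_inf S (i + 2) s" using div_inf_nested[OF it i s] by blast
    then show ?thesis using s M by simp
  qed (rule d)
  have prox: "{j. proximate S p j i} = insert (i + 1) ((\<lambda>s. i + 2 + s) ` {..<M})"
  proof (intro set_eqI iffI)
    fix j assume "j \<in> {j. proximate S p j i}"
    then consider "j = i + 1" | "j \<ge> i + 2" "p j \<in> div_inf S (i + 2) (j - i - 2)" unfolding proximate_def by blast
    then show "j \<in> insert (i + 1) ((\<lambda>s. i + 2 + s) ` {..<M})"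
    proof cases
      case 2
      have e: "i + 2 + (j - i - 2) = j" using 2(1) by simp
      have "j - i - 2 < M" using dd[of "j - i - 2"] 2(2) unfolding e by blast
      then show ?thesis using e by (metis imageI insertI2 lessThan_iff)
    qed simp
  next
    fix j assume "j \<in> insert (i + 1) ((\<lambda>s. i + 2 + s) ` {..<M})"
    then consider "j = i + 1" | s where "j = i + 2 + s" "s < M" by blast
    then show "j \<in> {j. proximate S p j i}"
    proof cases
      case 2
      have e: "i + 2 + s - i - 2 = s" "i + 2 + s \<ge> i + 2" by simp_all
      show ?thesis unfolding mem_Collect_eq proximate_def 2(1) e(1) using dd[of s] 2(2) e(2) by blast
    qed (simp add: proximate_def)
  qed
  have "enat (m i) = enat (m (i + 1)) + (\<Sum>s<M. enat (m (i + 2 + s)))"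
  proof -
    have "(\<Sum>s<M. mu w \<zeta> (i + 2 + s)) = (\<Sum>s<M. enat (m (i + 2 + s)))"
      by (rule sum.cong[OF refl], rule mu) (use i J(2) M in auto)
    moreover have "mu w \<zeta> (i + 1) = enat (m (i + 1))" by (rule mu) (use i iJ in auto)
    ultimately show ?thesis using sum mu[OF i iJ(1)] by simp
  qed
  also have "\<dots> = enat (m (i + 1) + (\<Sum>s<M. m (i + 2 + s)))"
    unfolding of_nat_eq_enat[symmetric] of_nat_add of_nat_sum ..
  finally have "m i = m (i + 1) + (\<Sum>s<M. m (i + 2 + s))" by simp
  also have "\<dots> = m (i + 1) + (\<Sum>j\<in>(\<lambda>s. i + 2 + s) ` {..<M}. m j)"
    by (subst sum.reindex) (auto simp: inj_on_def)
  also have "\<dots> = (\<Sum>j\<in>insert (i + 1) ((\<lambda>s. i + 2 + s) ` {..<M}). m j)"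
    by (rule sum.insert[symmetric]) auto
  finally show ?thesis unfolding prox by simp
qed

end

theorem theorem30:
  fixes S :: "('a, 'c) manifold" and k :: nat
    and C :: "nat \<Rightarrow> ('a, 'c) pt set" and p :: "nat \<Rightarrow> ('a, 'c) pt"
  assumes "smooth_surface S"
    and "iterated_lifts S k C p"
    and "regularizable S k (C k) (p k)"
  defines "m \<equiv> \<lambda>j. multiplicity_at (ambient S j) (C j) (p j)"
  shows "\<forall>i\<ge>k. finite {j. proximate S p j i} \<and> m i = (\<Sum>j | proximate S p j i. m j)"
proof (intro allI impI)
  fix i assume i: "k \<le> i"
  interpret surf S by unfold_locales (rule assms(1))
  obtain C' p' r where C': "C' k = C k" "p' k = p k" "iterated_lifts S k C' p'"
    and r: "k \<le> r" "regular_germ S r (C' r) (p' r)"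
    using assms(3) unfolding regularizable_def by (elim exE conjE) (rule that)
  have "C' r = C r \<and> p' r = p r" by (rule iterated_lifts_unique[OF assms(2) C'(3,1,2) r(1)])
  then have reg: "regular_germ S r (C r) (p r)" using r(2) by simp
  show "finite {j. proximate S p j i} \<and> m i = (\<Sum>j | proximate S p j i. m j)"
    unfolding m_def by (rule proximity[OF assms(2) r(1) reg i])
qed

end
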